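(* Let $W=G_{28}$ (the Weyl group of type $F_4$, acting on $\mathbb C^4$). Up to type equivalence there is exactly one nice $4$-tuple in $W$. It produces, after middle convolution, exactly one MCG-finite rank $2$ $5$-tuple up to equivalence: that is, nice $4$-tuples exist, they all have the same type, and all $5$-tuples in $\mathrm{SL}_2(\mathbb C)^5$ induced by $MC_\lambda(\mathbf A)$, for $\mathbf A$ a nice $4$-tuple in $W$ and $\lambda\ne1$ an eigenvalue of multiplicity $2$ of the inverse product of $\mathbf A$, are equivalent and MCG-finite. There are no nice $5$-tuples in $W$.
   Context: A reflection is an invertible matrix of finite order having exactly one eigenvalue different from $1$, of multiplicity $1$. A $T$-tuple $[A_1,\dots,A_T]$ in a finite complex reflection group $W$ is nice if all $A_i$ are reflections in $W$, $W=\langle A_1,\dots,A_T\rangle$, and the inverse product $(A_1\cdots A_T)^{-1}$ has an eigenvalue $\lambda\ne 1$ of multiplicity $T-2$ (exactly). The type of a tuple is the multiset of eigenvalues of its inverse product; the inverse tuple of $[A_1,\dots,A_T]$ is $[A_T^{-1},\dots,A_1^{-1}]$. Two nice tuples are type equivalent if they have the same type or the type of one is the type of the inverse tuple of the other. Middle convolution: for $\mathbf A=[A_1,\dots,A_T]\in\mathrm{GL}(V)^T$ and $\lambda\in\mathbb C^\times$, $\lambda\ne1$, let $B_k\in \mathrm{GL}(V^T)$ be the block matrix equal to the identity outside its $k$-th block row, which is $(\lambda(A_1-1),\dots,\lambda(A_{k-1}-1),\lambda A_k,A_{k+1}-1,\dots,A_T-1)$. Let $\mathcal K=\bigoplus_k\ker(A_k-1)$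 (the $k$-th summand in the $k$-th copy of $V$) and $\mathcal L=\bigcap_k\ker(B_k-1)$. Then $MC_\lambda(\mathbf A)=[\tilde A_1,\dots,\tilde A_T]$ is the tuple induced by $(B_1,\dots,B_T)$ on $V^T/(\mathcal K+\mathcal L)$, defined up to simultaneous conjugation. For a nice $T$-tuple and $\lambda\neq 1$ an eigenvalue of multiplicity $T-2$ of its inverse product, it consists of $2\times2$ matrices. A tuple induced by $MC_\lambda(\mathbf A)$ is a tuple $[c_1\tilde A_1,\dots,c_T\tilde A_T,c_{T+1}(\tilde A_1\cdots\tilde A_T)^{-1}]\in\mathrm{SL}_2(\mathbb C)^{T+1}$ with $c_i\in\mathbb C^\times$ and $\prod_{i=1}^{T+1}c_i=1$. The braid group on $T+1$ strands acts on $(T+1)$-tuples up to simultaneous conjugation by $\sigma_i[M_1,\dots,M_{T+1}]=[M_1,\dots,M_{i-1},M_iM_{i+1}M_i^{-1},M_i,M_{i+2},\dots,M_{T+1}]$, $1\le i\le T$; a tuple with product $I$ is MCG-finite if its orbit (on simultaneous conjugacy classes) is finite. Two induced tuples are equivalent if they are related by simultaneous conjugation, the braid group action, and changing the choice of the scalars $(c_i)$ (i.e. replacing $M_i$ by $\pm M_i$ with an even number of minus signs). *)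

theory Defs
  imports
    "HOL-Algebra.Generated_Groups"
    "Jordan_Normal_Form.Char_Poly"
    "Jordan_Normal_Form.Matrix_Kernel"
begin

section \<open>Tuples of invertible matrices\<close>

abbreviation GL :: "nat \<Rightarrow> complex mat monoid" where
  "GL n \<equiv> units_of (ring_mat TYPE(complex) n ())"

text \<open>Tuples are lists; the \<open>k\<close>-th entry (counted from 1) is the list element with index \<open>k - 1\<close>.\<close>

definition tuple_prod :: "nat \<Rightarrow> complex mat list \<Rightarrow> complex mat" where
  "tuple_prod n As = foldr (*) As (1\<^sub>m n)"

definition inv_prod :: "nat \<Rightarrow> complex mat list \<Rightarrow> complex mat" where
  "inv_prod n As = inv\<^bsub>GL n\<^esub> (tuple_prod n As)"

definition inverse_tuple :: "nat \<Rightarrow> complex mat list \<Rightarrow> complex mat list" where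
  "inverse_tuple n As = rev (map (\<lambda>A. inv\<^bsub>GL n\<^esub> A) As)"


section \<open>Reflections and nice tuples\<close>

definition reflection :: "nat \<Rightarrow> complex mat \<Rightarrow> bool" where
  "reflection n A \<longleftrightarrow>
     A \<in> carrier (GL n) \<and> (\<exists>k>0. A ^\<^sub>m k = 1\<^sub>m n) \<and>
     (\<exists>\<mu>. {\<nu>. eigenvalue A \<nu> \<and> \<nu> \<noteq> 1} = {\<mu>} \<and> Polynomial.order \<mu> (char_poly A) = 1)"

definition nice_eigenvalue :: "nat \<Rightarrow> complex mat list \<Rightarrow> complex \<Rightarrow> bool" where
  "nice_eigenvalue n As lam \<longleftrightarrow>
     lam \<noteq> 1 \<and> eigenvalue (inv_prod n As) lam \<and>
     Polynomial.order lam (char_poly (inv_prod n As)) + 2 = length As"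

definition nice_tuple :: "nat \<Rightarrow> complex mat set \<Rightarrow> complex mat list \<Rightarrow> bool" where
  "nice_tuple n W As \<longleftrightarrow>
     (\<forall>A\<in>set As. A \<in> W \<and> reflection n A) \<and>
     W = generate (GL n) (set As) \<and>
     (\<exists>lam. nice_eigenvalue n As lam)"

definition tuple_type :: "nat \<Rightarrow> complex mat list \<Rightarrow> complex multiset" where
  "tuple_type n As = proots (char_poly (inv_prod n As))"

definition type_equivalent :: "nat \<Rightarrow> complex mat list \<Rightarrow> complex mat list \<Rightarrow> bool" where
  "type_equivalent n As Bs \<longleftrightarrow>
     tuple_type n As = tuple_type n Bs \<or>
     tuple_type n As = tuple_type n (inverse_tuple n Bs) \<or>
     tuple_type n Bs = tuple_type n (inverse_tuple n As)"


section \<open>Middle convolution\<close>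

text \<open>
  For \<open>V = \<complex>\<^sup>n\<close> and a tuple of length \<open>T\<close>, the space \<open>V\<^sup>T\<close> is \<open>carrier_vec (T * n)\<close>; the copy of
  \<open>V\<close> with index \<open>k\<close> occupies the coordinates \<open>k * n, \<dots>, k * n + n - 1\<close>.
\<close>

definition conv_mat :: "nat \<Rightarrow> complex \<Rightarrow> complex mat list \<Rightarrow> nat \<Rightarrow> complex mat" where
  "conv_mat n lam As k = mat (length As * n) (length As * n) (\<lambda>(i, j).
     if i div n = k then
       (let l = j div n;
            block = (if l < k then lam \<cdot>\<^sub>m (As ! l - 1\<^sub>m n)
                     else if l = k then lam \<cdot>\<^sub>m (As ! k)
                     else As ! l - 1\<^sub>m n)
        in block $$ (i mod n, j mod n))
     else (if i = j then 1 else 0))"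

definition component :: "nat \<Rightarrow> nat \<Rightarrow> complex vec \<Rightarrow> complex vec" where
  "component n k v = vec n (\<lambda>i. v $ (k * n + i))"

definition conv_K :: "nat \<Rightarrow> complex mat list \<Rightarrow> complex vec set" where
  "conv_K n As = {v \<in> carrier_vec (length As * n).
     \<forall>k<length As. component n k v \<in> mat_kernel (As ! k - 1\<^sub>m n)}"

definition conv_L :: "nat \<Rightarrow> complex \<Rightarrow> complex mat list \<Rightarrow> complex vec set" where
  "conv_L n lam As = {v \<in> carrier_vec (length As * n).
     \<forall>k<length As. v \<in> mat_kernel (conv_mat n lam As k - 1\<^sub>m (length As * n))}"

text \<open>
  The middle convolution is only defined up to simultaneous conjugation, so it is rendered as a
  relation: \<open>P\<close> identifies the quotient of \<open>V\<^sup>T\<close> by \<open>K + L\<close> with \<open>\<complex>\<^sup>m\<close>, that is, \<open>P\<close> is the matrix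
  of the quotient map with respect to some basis of the quotient, and \<open>Ms\<close> are the matrices, in
  that basis, of the maps induced by the convolution matrices.
\<close>

definition middle_convolution ::
    "nat \<Rightarrow> complex \<Rightarrow> complex mat list \<Rightarrow> complex mat list \<Rightarrow> bool" where
  "middle_convolution n lam As Ms \<longleftrightarrow> length Ms = length As \<and>
     (\<exists>m. \<exists>P \<in> carrier_mat m (length As * n).
        (\<lambda>v. P *\<^sub>v v) ` carrier_vec (length As * n) = carrier_vec m \<and>
        mat_kernel P = {u + w | u w. u \<in> conv_K n As \<and> w \<in> conv_L n lam As} \<and>
        (\<forall>k<length As. Ms ! k \<in> carrier_mat m m \<and> Ms ! k * P = P * conv_mat n lam As k))"


section \<open>Induced tuples, braid group action and equivalence\<close>

definition SL2 :: "complex mat set" where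
  "SL2 = {M \<in> carrier_mat 2 2. det M = 1}"

definition induced_tuple ::
    "nat \<Rightarrow> complex \<Rightarrow> complex mat list \<Rightarrow> complex mat list \<Rightarrow> bool" where
  "induced_tuple n lam As Ns \<longleftrightarrow>
     (\<exists>Ms cs. middle_convolution n lam As Ms \<and>
        length cs = length As + 1 \<and> 0 \<notin> set cs \<and> prod_list cs = 1 \<and>
        Ns = map2 (\<cdot>\<^sub>m) cs (Ms @ [inv_prod 2 Ms]) \<and> set Ns \<subseteq> SL2)"

definition simult_conj :: "(complex mat list \<times> complex mat list) set" where
  "simult_conj = {(Ms, map (\<lambda>M. P * M * inv\<^bsub>GL 2\<^esub> P) Ms) | Ms P.
     set Ms \<subseteq> SL2 \<and> P \<in> carrier (GL 2)}"

text \<open>The generator \<open>\<sigma>\<^sub>i\<^sub>+\<^sub>1\<close>, as list positions are counted from 0.\<close>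

definition braid_gen :: "nat \<Rightarrow> complex mat list \<Rightarrow> complex mat list" where
  "braid_gen i Ms = take i Ms @
     [Ms ! i * Ms ! Suc i * inv\<^bsub>GL 2\<^esub> (Ms ! i), Ms ! i] @ drop (i + 2) Ms"

definition braid_step :: "(complex mat list \<times> complex mat list) set" where
  "braid_step = {(Ms, braid_gen i Ms) | Ms i. set Ms \<subseteq> SL2 \<and> Suc i < length Ms}"

text \<open>
  Each generator is a bijection on the tuples in \<open>SL2\<close> of a fixed length, so the converse relation
  consists of the actions of the inverse generators.
\<close>

definition braid_orbit :: "complex mat list \<Rightarrow> complex mat list set" where
  "braid_orbit Ms = (braid_step \<union> braid_step\<inverse>)\<^sup>* `` {Ms}"

definition MCG_finite :: "complex mat list \<Rightarrow> bool" where
  "MCG_finite Ms \<longleftrightarrow> tuple_prod 2 Ms = 1\<^sub>m 2 \<and>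
     finite ((\<lambda>Ns. simult_conj `` {Ns}) ` braid_orbit Ms)"

definition sign_change :: "(complex mat list \<times> complex mat list) set" where
  "sign_change = {(Ms, map2 (\<cdot>\<^sub>m) ss Ms) | Ms ss.
     set Ms \<subseteq> SL2 \<and> length ss = length Ms \<and> set ss \<subseteq> {1, -1} \<and> prod_list ss = 1}"

text \<open>Conjugation and sign changes are already symmetric relations.\<close>

definition tuple_equivalent :: "complex mat list \<Rightarrow> complex mat list \<Rightarrow> bool" where
  "tuple_equivalent Ms Ns \<longleftrightarrow>
     (Ms, Ns) \<in> (simult_conj \<union> braid_step \<union> braid_step\<inverse> \<union> sign_change)\<^sup>*"


section \<open>The Weyl group of type \<open>F\<^sub>4\<close>\<close>

definition F4_roots :: "complex vec set" where
  "F4_roots =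
     {s \<cdot>\<^sub>v unit_vec 4 i | s i. s \<in> {1, -1} \<and> i < 4} \<union>
     {s \<cdot>\<^sub>v unit_vec 4 i + t \<cdot>\<^sub>v unit_vec 4 j | s t i j. s \<in> {1, -1} \<and> t \<in> {1, -1} \<and> i < j \<and> j < 4} \<union>
     {vec_of_list [a, b, c, d] | a b c d. {a, b, c, d} \<subseteq> {1/2, -1/2}}"

text \<open>
  The reflection \<open>v \<mapsto> v - (2 (v, \<alpha>) / (\<alpha>, \<alpha>)) \<alpha>\<close>. All roots have real coordinates, so the bilinear
  scalar product can be used.
\<close>

definition root_reflection :: "complex vec \<Rightarrow> complex mat" where
  "root_reflection \<alpha> = mat 4 4 (\<lambda>(i, j).
     (if i = j then 1 else 0) - 2 * \<alpha> $ i * \<alpha> $ j / (\<alpha> \<bullet> \<alpha>))"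

definition G28 :: "complex mat set" where
  "G28 = generate (GL 4) (root_reflection ` F4_roots)"

end

theory Submission
imports Defs
  "Jordan_Normal_Form.Jordan_Normal_Form_Uniqueness"
  "Jordan_Normal_Form.Jordan_Normal_Form_Existence"
  "HOL-Algebra.Multiplicative_Group"
begin

text \<open>
  \<open>G28\<close> preserves the Hurwitz lattice, hence is finite and its reflections are the root reflections,
  so a nice tuple is given by roots \<open>\<alpha>\<^sub>1, \<dots>, \<alpha>\<^sub>T\<close>. If \<open>C\<close> is their Cartan matrix, the
  eigenvectors of the inverse product for \<open>lam\<close> embed into the kernel of the matrix \<open>F\<close> with entries
  \<open>lam * C\<^sub>k\<^sub>l\<close> below, \<open>1 + lam\<close> on and \<open>C\<^sub>k\<^sub>l\<close> above the diagonal. Since the reflections generate,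
  \<open>C\<close> induces a unimodular pairing between the lattice of coroots and the lattice of roots. As
  \<open>F\<close> is congruent to \<open>C\<close> modulo \<open>lam - 1\<close> and has a two-dimensional kernel,
  \<open>1 / (1 - lam)\<close> is an algebraic integer. Together with the symmetry of the spectrum
  under conjugation this excludes \<open>T = 5\<close>, where \<open>lam\<close> would be \<open>-1\<close>, and forces \<open>lam\<close> to be a
  primitive sixth root of unity if \<open>T = 4\<close>.

  For \<open>T = 4\<close> the matrix \<open>F\<close> has rank two, which leaves finitely many Gram matrices of normalized roots.
  They form one orbit under Hurwitz moves and sign changes. The space \<open>V\<^sup>T / (K + L)\<close> is the
  image of \<open>F\<close>, so the middle convolution consists of the complex reflections \<open>1 - q\<^sub>k x\<^sub>k\<close> with
  \<open>x\<^sub>k q\<^sub>l = F\<^sub>k\<^sub>l\<close>. It is determined by \<open>lam\<close> and the Gram matrix up to conjugation, and dualizing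
  exchanges \<open>lam\<close> and \<open>1 / lam\<close>. Hence all induced tuples are equivalent to a single one, whose
  entries generate a finite group.
\<close>

section \<open>Matrices of finite order\<close>

text \<open>Generation of the group enters only through the unimodular pairing. It is exploited by
  testing lattices: a lattice stable under the given reflections is stable under all root
  reflections, and this forces enough roots into it. Integrality of \<open>1 / (1 - lam)\<close>
  decides \<open>lam\<close> as follows. For \<open>lam = -1\<close> it would make
  \<open>1/2\<close> an algebraic integer. For \<open>T = 4\<close> a vanishing 3 x 3 minor of
  \<open>F\<close> gives \<open>(1 + lam)^2 = m * lam\<close> with an integer \<open>m\<close>, so
  \<open>1 - lam\<close> has norm \<open>4 - m\<close>; being a unit, it needs \<open>m = 3\<close>,
  which is the equation \<open>lam * lam = lam - 1\<close> of the primitive sixth roots of unity.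
  Roots of two lengths are normalized, so the Gram entries are 0, 1, -1, 2, -2 and plus or minus the
  square root of 2. The leading 2 x 2 block of \<open>F\<close> has determinant
  \<open>lam * (3 - a * a)\<close> for an entry \<open>a\<close>, which is therefore never zero.
  This is what allows a tuple of reflections in dimension two to be recovered from
  \<open>lam\<close> and the Gram matrix, and it reduces the equivalence of induced tuples to a
  finite question on Gram matrices.\<close>

lemma GL_simps: "x \<otimes>\<^bsub>GL n\<^esub> y = x * y" "\<one>\<^bsub>GL n\<^esub> = 1\<^sub>m n"
  by (simp_all add: units_of_def ring_mat_simps)

lemma GL_group: "group (GL n)"
  by (rule monoid.units_group[OF ring.is_monoid[OF ring_mat]])

lemma GL_I:
  assumes "A \<in> carrier_mat n n" "B \<in> carrier_mat n n" "A * B = 1\<^sub>m n"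
  shows "A \<in> carrier (GL n)"
  using assms mat_mult_left_right_inverse[OF assms]
  by (auto simp: units_of_def Units_def ring_mat_simps)

lemma GL_D:
  assumes "A \<in> carrier (GL n)"
  shows "A \<in> carrier_mat n n" "inv\<^bsub>GL n\<^esub> A \<in> carrier_mat n n"
    "A * inv\<^bsub>GL n\<^esub> A = 1\<^sub>m n" "inv\<^bsub>GL n\<^esub> A * A = 1\<^sub>m n"
proof -
  interpret group "GL n" by (rule GL_group)
  have c: "X \<in> carrier (GL n) \<Longrightarrow> X \<in> carrier_mat n n" for X
    by (auto simp: units_of_def Units_def ring_mat_simps)
  show "A \<in> carrier_mat n n" "inv\<^bsub>GL n\<^esub> A \<in> carrier_mat n n"
    using c assms by auto
  show "A * inv\<^bsub>GL n\<^esub> A = 1\<^sub>m n" "inv\<^bsub>GL n\<^esub> A * A = 1\<^sub>m n"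
    using r_inv[OF assms] l_inv[OF assms] by (simp_all add: GL_simps)
qed

lemma GL_inv_eq:
  assumes "A \<in> carrier_mat n n" "B \<in> carrier_mat n n" "A * B = 1\<^sub>m n"
  shows "inv\<^bsub>GL n\<^esub> A = B"
proof -
  have A: "A \<in> carrier (GL n)" by (rule GL_I[OF assms])
  have "inv\<^bsub>GL n\<^esub> A = inv\<^bsub>GL n\<^esub> A * (A * B)"
    using GL_D(2)[OF A] assms by simp
  also have "\<dots> = (inv\<^bsub>GL n\<^esub> A * A) * B"
    using GL_D(2)[OF A] assms by (simp add: assoc_mult_mat[of _ n n _ n _ n])
  finally show ?thesis using GL_D(4)[OF A] assms by simp
qed

lemma tuple_prod_Nil: "tuple_prod n [] = 1\<^sub>m n"
  and tuple_prod_Cons: "tuple_prod n (A # As) = A * tuple_prod n As"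
  by (simp_all add: tuple_prod_def)

lemma tuple_prod_GL: "set As \<subseteq> carrier (GL n) \<Longrightarrow> tuple_prod n As \<in> carrier (GL n)"
proof (induction As)
  case Nil
  show ?case using group.is_monoid[OF GL_group] by (metis tuple_prod_Nil GL_simps(2) monoid.one_closed)
next
  case (Cons A As)
  then show ?case
    using monoid.m_closed[OF group.is_monoid[OF GL_group[of n]], of A "tuple_prod n As"]
    by (simp add: GL_simps tuple_prod_Cons)
qed

lemma nonzero_vec_index:
  fixes v :: "'a :: zero vec"
  assumes "v \<in> carrier_vec n" "v \<noteq> 0\<^sub>v n"
  obtains i where "i < n" "v $ i \<noteq> 0"
proof -
  have "\<exists>i<n. v $ i \<noteq> 0"
  proof (rule ccontr)
    assume "\<not> (\<exists>i<n. v $ i \<noteq> 0)"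
    then have "v = 0\<^sub>v n" using assms(1) by (intro eq_vecI) auto
    then show False using assms(2) by blast
  qed
  then show thesis using that by blast
qed

text \<open>If \<open>A v = a v + w\<close> and \<open>A w = a w\<close>, then \<open>A\<^sup>k v = a\<^sup>k v + k a\<^sup>k\<^sup>-\<^sup>1 w\<close>.\<close>

lemma finite_order_gen_eigenvector:
  fixes A :: "complex mat"
  assumes A: "A \<in> carrier_mat n n" and k: "k > 0" "A ^\<^sub>m k = 1\<^sub>m n"
    and v: "v \<in> carrier_vec n" and w: "w \<in> carrier_vec n"
    and Av: "A *\<^sub>v v = a \<cdot>\<^sub>v v + w" and Aw: "A *\<^sub>v w = a \<cdot>\<^sub>v w"
  shows "w = 0\<^sub>v n"
proof -
  have pow: "A ^\<^sub>m j *\<^sub>v w = a ^ j \<cdot>\<^sub>v w \<and>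
      a \<cdot>\<^sub>v (A ^\<^sub>m j *\<^sub>v v) = a ^ (Suc j) \<cdot>\<^sub>v v + (of_nat j * a ^ j) \<cdot>\<^sub>v w" for j
  proof (induction j)
    case 0
    then show ?case using A v w by auto
  next
    case (Suc j)
    have P: "A ^\<^sub>m j \<in> carrier_mat n n" using A by simp
    have 1: "A ^\<^sub>m Suc j *\<^sub>v w = a ^ Suc j \<cdot>\<^sub>v w"
      using Suc A w P Aw
      by (simp add: mult_mat_vec[OF P] smult_smult_assoc assoc_mult_mat_vec[OF P A w])
    have "a \<cdot>\<^sub>v (A ^\<^sub>m Suc j *\<^sub>v v) = a \<cdot>\<^sub>v (A ^\<^sub>m j *\<^sub>v (a \<cdot>\<^sub>v v + w))"
      using A v P Av by (simp add: assoc_mult_mat_vec[OF P A v])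
    also have "\<dots> = a \<cdot>\<^sub>v (a \<cdot>\<^sub>v (A ^\<^sub>m j *\<^sub>v v)) + a \<cdot>\<^sub>v (A ^\<^sub>m j *\<^sub>v w)"
      using A v w P
      using smult_add_distrib_vec[of "a \<cdot>\<^sub>v (A ^\<^sub>m j *\<^sub>v v)" n "A ^\<^sub>m j *\<^sub>v w" a]
        mult_mat_vec_carrier[OF P v] mult_mat_vec_carrier[OF P w]
      by (simp add: mult_add_distrib_mat_vec[OF P] mult_mat_vec[OF P])
    also have "\<dots> = a ^ Suc (Suc j) \<cdot>\<^sub>v v + (of_nat (Suc j) * a ^ Suc j) \<cdot>\<^sub>v w"
      unfolding conjunct2[OF Suc] conjunct1[OF Suc]
      using v w by (intro eq_vecI) (auto simp: algebra_simps)
    finally show ?case using 1 by blast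
  qed
  show ?thesis
  proof (rule ccontr)
    assume nz: "w \<noteq> 0\<^sub>v n"
    obtain i where i: "i < n" "w $ i \<noteq> 0" using w nz by (rule nonzero_vec_index)
    have "w = a ^ k \<cdot>\<^sub>v w" using pow[of k] k w by simp
    then have "w $ i = (a ^ k \<cdot>\<^sub>v w) $ i" by simp
    then have "w $ i = a ^ k * w $ i" using i w by simp
    then have ak: "a ^ k = 1" using i by simp
    have "a \<cdot>\<^sub>v v = a ^ (Suc k) \<cdot>\<^sub>v v + (of_nat k * a ^ k) \<cdot>\<^sub>v w"
      using pow[of k] k v by simp
    then have "(a \<cdot>\<^sub>v v) $ i = (a ^ (Suc k) \<cdot>\<^sub>v v + (of_nat k * a ^ k) \<cdot>\<^sub>v w) $ i"
      by simp
    then have "a * v $ i = a ^ (Suc k) * v $ i + of_nat k * a ^ k * w $ i"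
      using i v w by simp
    then show False using ak i k by simp
  qed
qed

lemma jordan_matrix_sizes_1:
  assumes "\<forall>x\<in>set n_as. fst x = 1"
  shows "jordan_matrix n_as = mat_diag (length n_as) (\<lambda>i. snd (n_as ! i))"
  using assms
proof (induction n_as)
  case Nil
  then show ?case by (intro eq_matI) (auto simp: jordan_matrix_def mat_diag_def)
next
  case (Cons x xs)
  obtain a where x: "x = (1, a)" using Cons.prems by (cases x) auto
  have s: "sum_list (map fst xs) = length xs"
    using Cons.prems by (induction xs) auto
  show ?case
    unfolding x jordan_matrix_Cons s using Cons
    by (intro eq_matI) (auto simp: mat_diag_def nth_Cons split: nat.splits)
qed

text \<open>A Jordan block of size at least two would make the kernel of \<open>(A - a)^2\<close>
  larger than that of \<open>A - a\<close>, which the preceding lemmas exclude. The characteristic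
  polynomial is listed by the same \<open>d\<close>, so that algebraic multiplicities become
  cardinalities of index sets.\<close>

lemma finite_order_diagonalizable:
  fixes A :: "complex mat"
  assumes A: "A \<in> carrier_mat n n" and k: "k > 0" "A ^\<^sub>m k = 1\<^sub>m n"
  obtains P R d where "P \<in> carrier_mat n n" "R \<in> carrier_mat n n" "P * R = 1\<^sub>m n" "R * P = 1\<^sub>m n"
    "A = P * mat_diag n d * R" "char_poly A = (\<Prod>i<n. [:- d i, 1:])"
proof -
  obtain as where "char_poly A = (\<Prod>a\<leftarrow>as. [:- a, 1:])"
    using char_poly_factorized[OF A] by blast
  then obtain n_as where jnf: "jordan_nf A n_as" using jordan_nf_exists[OF A] by blast
  have one: "fst x = 1" if x: "x \<in> set n_as" for x
  proof -
    obtain m a where xm: "x = (m, a)" by force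
    define B where "B = char_matrix A a"
    have B: "B \<in> carrier_mat n n" using A by (simp add: B_def)
    have Bv: "B *\<^sub>v v = A *\<^sub>v v - a \<cdot>\<^sub>v v" if "v \<in> carrier_vec n" for v
    proof -
      have "((- a) \<cdot>\<^sub>m 1\<^sub>m n) *\<^sub>v v = (- a) \<cdot>\<^sub>v v"
        using that by (intro eq_vecI) auto
      then have "B *\<^sub>v v = A *\<^sub>v v + (- a) \<cdot>\<^sub>v v"
        using that A unfolding B_def char_matrix_def
        by (simp add: add_mult_distrib_mat_vec[of _ n n])
      then show ?thesis using that A by (intro eq_vecI) auto
    qed
    have ker: "mat_kernel (B ^\<^sub>m 2) = mat_kernel (B ^\<^sub>m 1)"
    proof (intro equalityI subsetI)
      fix v assume "v \<in> mat_kernel (B ^\<^sub>m 2)"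
      then have v: "v \<in> carrier_vec n" and "B ^\<^sub>m 2 *\<^sub>v v = 0\<^sub>v n"
        using mat_kernelD[of "B ^\<^sub>m 2" n n] B by auto
      then have BB: "B *\<^sub>v (B *\<^sub>v v) = 0\<^sub>v n" using B by (simp add: numeral_2_eq_2)
      define w where "w = B *\<^sub>v v"
      have w: "w \<in> carrier_vec n" using B v by (simp add: w_def)
      have "w = 0\<^sub>v n"
      proof (rule finite_order_gen_eigenvector[OF A k v w])
        have *: "A *\<^sub>v u = a \<cdot>\<^sub>v u + B *\<^sub>v u" if "u \<in> carrier_vec n" for u
          using Bv[OF that] that A by (intro eq_vecI) auto
        show "A *\<^sub>v v = a \<cdot>\<^sub>v v + w" using *[OF v] by (simp add: w_def)
        show "A *\<^sub>v w = a \<cdot>\<^sub>v w" using *[OF w] BB w by (simp add: w_def)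
      qed
      then show "v \<in> mat_kernel (B ^\<^sub>m 1)"
        using B v by (intro mat_kernelI[of _ n n]) (auto simp: w_def)
    next
      fix v assume "v \<in> mat_kernel (B ^\<^sub>m 1)"
      then have v: "v \<in> carrier_vec n" and "B *\<^sub>v v = 0\<^sub>v n"
        using mat_kernelD[of "B ^\<^sub>m 1" n n] B by auto
      then show "v \<in> mat_kernel (B ^\<^sub>m 2)"
        using B by (intro mat_kernelI[of _ n n]) (auto simp: numeral_2_eq_2)
    qed
    have "kernel_dim (B ^\<^sub>m 2) = kernel_dim (B ^\<^sub>m 1)"
      using ker B by (simp add: kernel_dim_def)
    then have "dim_gen_eigenspace A a 2 = dim_gen_eigenspace A a 1"
      by (simp add: dim_gen_eigenspace_def B_def)
    \<comment> \<open>The kernel of \<open>(A - a)^k\<close> has as dimension the sum of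
      \<open>min k m\<close> over the sizes \<open>m\<close> of the Jordan blocks for
      \<open>a\<close>; equality for \<open>k = 1\<close> and \<open>k = 2\<close> leaves only
      blocks of size one.\<close>
    then have eq: "(\<Sum>m\<leftarrow>map fst [(m, e)\<leftarrow>n_as. e = a]. min 2 m) = (\<Sum>m\<leftarrow>map fst [(m, e)\<leftarrow>n_as. e = a]. min 1 m)"
      unfolding dim_gen_eigenspace[OF jnf] by simp
    define ms where "ms = map fst [(m, e)\<leftarrow>n_as. e = a]"
    have m: "m \<in> set ms" using x xm by (force simp: ms_def)
    have "\<forall>m\<in>set xs. m \<le> 1"
      if "(\<Sum>m\<leftarrow>xs. min 2 m) = (\<Sum>m\<leftarrow>xs. min (1::nat) m)" for xs
      using that
    proof (induction xs)
      case (Cons y ys)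
      have "(\<Sum>m\<leftarrow>ys. min 1 m) \<le> (\<Sum>m\<leftarrow>ys. min (2::nat) m)"
        by (intro sum_list_mono) auto
      then show ?case using Cons by (auto simp: min_def split: if_splits)
    qed simp
    then have "m \<le> 1" using eq m unfolding ms_def by blast
    moreover have "m \<noteq> 0" using jnf x xm unfolding jordan_nf_def by force
    ultimately show ?thesis using xm by simp
  qed
  define d where "d = (\<lambda>i. snd (n_as ! i))"
  obtain P R where wit: "similar_mat_wit A (jordan_matrix n_as) P R"
    using jnf unfolding jordan_nf_def similar_mat_def by blast
  have len: "length n_as = n"
  proof -
    have "dim_row (jordan_matrix n_as) = n"
      using similar_mat_witD2(5)[OF A wit] by (rule carrier_matD)
    moreover have "sum_list (map fst n_as) = length n_as"
      using one by (induction n_as) auto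
    ultimately show ?thesis by simp
  qed
  have J: "jordan_matrix n_as = mat_diag n d"
    using jordan_matrix_sizes_1[of n_as] one len by (auto simp: d_def)
  have "char_poly A = (\<Prod>(m, a)\<leftarrow>n_as. [:- a, 1:] ^ m)" by (rule jordan_nf_char_poly[OF jnf])
  also have "\<dots> = (\<Prod>x\<leftarrow>n_as. [:- snd x, 1:])"
    using one by (intro arg_cong[of _ _ prod_list] map_cong) (auto simp: case_prod_beta)
  also have "\<dots> = (\<Prod>i<n. [:- d i, 1:])"
    using len by (simp add: prod.list_conv_set_nth d_def atLeast0LessThan)
  finally have cp: "char_poly A = (\<Prod>i<n. [:- d i, 1:])" .
  show thesis
    by (rule that[OF _ _ _ _ _ cp]) (use similar_mat_witD2[OF A wit] J in simp_all)
qed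

lemma eigenvalue_of_linear_factors:
  fixes A :: "complex mat"
  assumes "A \<in> carrier_mat n n" "char_poly A = (\<Prod>i<n. [:- d i, 1:])" "i < n"
  shows "eigenvalue A (d i)"
  using assms by (auto simp: eigenvalue_root_char_poly poly_prod)

section \<open>The Weyl group of type \<open>F\<^sub>4\<close>\<close>

lemma all_less_4: "(\<forall>i<4. P i) \<longleftrightarrow> P 0 \<and> P 1 \<and> P 2 \<and> P (3::nat)"
  by (auto simp: less_Suc_eq numeral_eq_Suc)

lemma less_4_cases: "i < 4 \<Longrightarrow> i = 0 \<or> i = 1 \<or> i = 2 \<or> i = (3::nat)"
  by auto

lemma sum_less_4: "(\<Sum>i<4. f i) = f 0 + f 1 + f 2 + f (3::nat)"
  by (simp add: eval_nat_numeral)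

lemma scalar_prod_4:
  "v \<in> carrier_vec 4 \<Longrightarrow> w \<in> carrier_vec 4 \<Longrightarrow>
     v \<bullet> w = v $ 0 * w $ 0 + v $ 1 * w $ 1 + v $ 2 * w $ 2 + v $ 3 * w $ (3::nat)"
  by (simp add: scalar_prod_def eval_nat_numeral)

section \<open>The root lattice, the coroot lattice and their pairing\<close>

definition Q_lattice :: "complex vec set" where
  "Q_lattice = {x \<in> carrier_vec 4. (\<forall>i<4. x $ i \<in> \<int>) \<or> (\<forall>i<4. x $ i - 1/2 \<in> \<int>)}"

text \<open>The lattice of type D4. It is dual to \<open>Q_lattice\<close> and is spanned by the
  coroots, as \<open>Q_lattice\<close> is spanned by the roots.\<close>

definition D_lattice :: "complex vec set" where
  "D_lattice = {x \<in> carrier_vec 4. (\<forall>i<4. x $ i \<in> \<int>) \<and> (x $ 0 + x $ 1 + x $ 2 + x $ 3) / 2 \<in> \<int>}"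

definition coroot :: "complex vec \<Rightarrow> complex vec" where
  "coroot \<alpha> = (2 / (\<alpha> \<bullet> \<alpha>)) \<cdot>\<^sub>v \<alpha>"

lemma Q_carrier: "x \<in> Q_lattice \<Longrightarrow> x \<in> carrier_vec 4"
  and D_carrier: "x \<in> D_lattice \<Longrightarrow> x \<in> carrier_vec 4"
  by (auto simp: Q_lattice_def D_lattice_def)

lemma D_Q_int:
  assumes "x \<in> D_lattice" "y \<in> Q_lattice"
  shows "x \<bullet> y \<in> \<int>"
proof -
  have x: "x \<in> carrier_vec 4" and y: "y \<in> carrier_vec 4"
    using assms by (auto intro: Q_carrier D_carrier)
  have xi: "x $ 0 \<in> \<int>" "x $ 1 \<in> \<int>" "x $ 2 \<in> \<int>" "x $ 3 \<in> \<int>"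
    and xs: "(x $ 0 + x $ 1 + x $ 2 + x $ 3) / 2 \<in> \<int>"
    using assms(1) by (auto simp: D_lattice_def)
  from assms(2) consider "\<forall>i<4. y $ i \<in> \<int>" | "\<forall>i<4. y $ i - 1/2 \<in> \<int>"
    by (auto simp: Q_lattice_def)
  then show ?thesis
  proof cases
    case 1
    then show ?thesis using x y xi by (simp add: scalar_prod_4 all_less_4)
  next
    case 2
    \<comment> \<open>A half-integral \<open>y\<close> is (1/2, 1/2, 1/2, 1/2) plus an integral
      vector; the first part contributes half the coordinate sum of \<open>x\<close>, which is where
      the parity condition of \<open>D_lattice\<close> enters.\<close>
    have "x \<bullet> y = (x $ 0 + x $ 1 + x $ 2 + x $ 3) / 2 + x $ 0 * (y $ 0 - 1/2) + x $ 1 * (y $ 1 - 1/2)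
        + x $ 2 * (y $ 2 - 1/2) + x $ 3 * (y $ 3 - 1/2)"
      using x y by (simp add: scalar_prod_4 field_simps)
    then show ?thesis using 2 xi xs by (simp only: all_less_4) (intro Ints_add Ints_mult; blast)
  qed
qed

lemma Q_diff:
  assumes "x \<in> Q_lattice" "y \<in> Q_lattice" shows "x - y \<in> Q_lattice"
proof -
  have c: "x \<in> carrier_vec 4" "y \<in> carrier_vec 4" using assms by (auto intro: Q_carrier)
  have *: "a - b \<in> \<int>" if "a - 1/2 \<in> \<int>" "b - 1/2 \<in> \<int>" for a b :: complex
    using Ints_diff[OF that] by simp
  have **: "a - b - 1/2 \<in> \<int>" if "a - 1/2 \<in> \<int>" "b \<in> \<int>" for a b :: complex
    using Ints_diff[OF that] by (simp add: algebra_simps)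
  have ***: "a - b - 1/2 \<in> \<int>" if "a \<in> \<int>" "b - 1/2 \<in> \<int>" for a b :: complex
    using Ints_diff[OF Ints_diff[OF that] Ints_1] by (simp add: algebra_simps)
  show ?thesis
    using assms c unfolding Q_lattice_def
    by (auto intro: * ** ***)
qed

lemma Q_zero: "0\<^sub>v 4 \<in> Q_lattice"
  by (auto simp: Q_lattice_def)

lemma Q_uminus: assumes "x \<in> Q_lattice" shows "- x \<in> Q_lattice"
  using Q_diff[OF Q_zero assms] Q_carrier[OF assms] by simp

lemma Q_smult:
  assumes "x \<in> Q_lattice" "c \<in> \<int>" shows "c \<cdot>\<^sub>v x \<in> Q_lattice"
proof -
  have c: "x \<in> carrier_vec 4" using assms by (auto intro: Q_carrier)
  have nat: "of_nat n \<cdot>\<^sub>v x \<in> Q_lattice" for n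
  proof (induction n)
    case 0
    have "of_nat 0 \<cdot>\<^sub>v x = 0\<^sub>v 4" using c by auto
    then show ?case by (simp add: Q_zero)
  next
    case (Suc n)
    have "of_nat (Suc n) \<cdot>\<^sub>v x = of_nat n \<cdot>\<^sub>v x - (- x)"
      using c by (intro eq_vecI) (auto simp: algebra_simps)
    then show ?case using Suc Q_uminus[OF assms(1)] Q_diff by metis
  qed
  from assms(2) obtain k where k: "c = of_int k" by (auto elim: Ints_cases)
  show ?thesis
  proof (cases "k \<ge> 0")
    case True
    then show ?thesis using nat[of "nat k"] k by simp
  next
    case False
    then have "c \<cdot>\<^sub>v x = - (of_nat (nat (-k)) \<cdot>\<^sub>v x)"
      using c k by (intro eq_vecI) auto
    then show ?thesis using nat Q_uminus by metis
  qed
qed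

lemma F4_rootsE:
  assumes "\<alpha> \<in> F4_roots"
  obtains (axis) s i where "s \<in> {1,-1}" "i < 4" "\<alpha> = s \<cdot>\<^sub>v unit_vec 4 i"
  | (long) s t i j where "s \<in> {1,-1}" "t \<in> {1,-1}" "i < j" "j < 4"
      "\<alpha> = s \<cdot>\<^sub>v unit_vec 4 i + t \<cdot>\<^sub>v unit_vec 4 j"
  | (half) a b c d where "{a, b, c, d} \<subseteq> {1/2, -1/2}" "\<alpha> = vec_of_list [a, b, c, d]"
proof -
  show thesis
    using assms unfolding F4_roots_def
    apply (elim UnE CollectE exE conjE)
    subgoal for s i by (rule axis)
    subgoal for s t i j by (rule long)
    subgoal for a b c d by (rule half)
    done
qed

lemma vec_of_list_4:
  "vec_of_list [a,b,c,d] \<in> carrier_vec 4" "vec_of_list [a,b,c,d] $ 0 = a"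
  "vec_of_list [a,b,c,d] $ 1 = b" "vec_of_list [a,b,c,d] $ 2 = c" "vec_of_list [a,b,c,d] $ 3 = d"
  by (simp_all only: carrier_vec_def vec_of_list_index dim_vec_of_list, simp_all)

lemma vec_of_list_4_eqI:
  assumes "v \<in> carrier_vec 4" "v $ 0 = a" "v $ 1 = b" "v $ 2 = c" "v $ 3 = d"
  shows "v = vec_of_list [a, b, c, d]"
proof (rule eq_vecI)
  show "dim_vec v = dim_vec (vec_of_list [a, b, c, d])"
    using carrier_vecD[OF assms(1)] carrier_vecD[OF vec_of_list_4(1)] by metis
  fix i assume "i < dim_vec (vec_of_list [a, b, c, d])"
  then have "i < 4" unfolding carrier_vecD[OF vec_of_list_4(1)] .
  then show "v $ i = vec_of_list [a, b, c, d] $ i"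
    by (elim less_4_cases[elim_format] disjE; hypsubst; simp only: assms vec_of_list_4)
qed

lemma F4_root_lattice:
  assumes "\<alpha> \<in> F4_roots"
  shows "\<alpha> \<in> Q_lattice" "\<alpha> \<bullet> \<alpha> = 1 \<or> \<alpha> \<bullet> \<alpha> = 2 \<and> \<alpha> \<in> D_lattice" "coroot \<alpha> \<in> D_lattice"
proof -
  have "\<alpha> \<in> Q_lattice \<and> (\<alpha> \<bullet> \<alpha> = 1 \<or> \<alpha> \<bullet> \<alpha> = 2 \<and> \<alpha> \<in> D_lattice) \<and> coroot \<alpha> \<in> D_lattice"
    using assms
  proof (cases rule: F4_rootsE)
    case (axis s i)
    have c: "\<alpha> \<in> carrier_vec 4" using axis by simp
    from axis(2) have "i = 0 \<or> i = 1 \<or> i = 2 \<or> i = 3" by (rule less_4_cases)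
    moreover have "\<alpha> $ l = (if l = i then s else 0)" if "l < 4" for l
      using axis that by simp
    ultimately have e: "(\<alpha> $ 0, \<alpha> $ 1, \<alpha> $ 2, \<alpha> $ 3) \<in> {(s,0,0,0), (0,s,0,0), (0,0,s,0), (0,0,0,s)}"
      by auto
    have s: "s \<in> \<int>" "s * s = 1" using axis(1) by auto
    have "\<alpha> $ 0 * \<alpha> $ 0 + \<alpha> $ 1 * \<alpha> $ 1 + \<alpha> $ 2 * \<alpha> $ 2 + \<alpha> $ 3 * \<alpha> $ 3 = 1"
      using e by (elim insertE emptyE) (simp_all add: s(2))
    then have n: "\<alpha> \<bullet> \<alpha> = 1" by (simp only: scalar_prod_4[OF c c])
    have "\<alpha> \<in> Q_lattice" using c e s(1) by (elim insertE emptyE) (simp_all add: Q_lattice_def all_less_4)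
    moreover have "coroot \<alpha> \<in> D_lattice"
      using c e s(1) by (elim insertE emptyE) (simp_all add: D_lattice_def all_less_4 coroot_def n)
    ultimately show ?thesis using n by simp
  next
    case (long s t i j)
    have c: "\<alpha> \<in> carrier_vec 4" using long by simp
    have "i = 0 \<and> j = 1 \<or> i = 0 \<and> j = 2 \<or> i = 0 \<and> j = 3 \<or> i = 1 \<and> j = 2 \<or> i = 1 \<and> j = 3 \<or> i = 2 \<and> j = 3"
      using long(3,4) by linarith
    moreover have co: "\<alpha> $ l = (if l = i then s else 0) + (if l = j then t else 0)" if "l < 4" for l
      using long that by simp
    have "\<alpha> $ 0 = (if 0 = i then s else 0) + (if 0 = j then t else 0)"
      "\<alpha> $ 1 = (if 1 = i then s else 0) + (if 1 = j then t else 0)"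
      "\<alpha> $ 2 = (if 2 = i then s else 0) + (if 2 = j then t else 0)"
      "\<alpha> $ 3 = (if 3 = i then s else 0) + (if 3 = j then t else 0)"
      by (rule co; simp)+
    ultimately have e: "(\<alpha> $ 0, \<alpha> $ 1, \<alpha> $ 2, \<alpha> $ 3) \<in>
        {(s,t,0,0), (s,0,t,0), (s,0,0,t), (0,s,t,0), (0,s,0,t), (0,0,s,t)}"
      by (elim disjE conjE) simp_all
    have s: "s \<in> \<int>" "t \<in> \<int>" and ss: "s * s = 1" "t * t = 1" using long(1,2) by auto
    have st: "(s + t) / 2 \<in> \<int>" using long(1,2) by auto
    have "\<alpha> $ 0 * \<alpha> $ 0 + \<alpha> $ 1 * \<alpha> $ 1 + \<alpha> $ 2 * \<alpha> $ 2 + \<alpha> $ 3 * \<alpha> $ 3 = 2"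
      using e by (elim insertE emptyE) (simp_all add: ss)
    then have n: "\<alpha> \<bullet> \<alpha> = 2" by (simp only: scalar_prod_4[OF c c])
    have "\<alpha> \<in> Q_lattice" using c e s by (elim insertE emptyE) (simp_all add: Q_lattice_def all_less_4)
    moreover have "\<alpha> \<in> D_lattice"
      using c e s st by (elim insertE emptyE) (simp_all add: D_lattice_def all_less_4)
    ultimately show ?thesis using n by (simp add: coroot_def)
  next
    case (half a b c d)
    have c: "\<alpha> \<in> carrier_vec 4" and e: "\<alpha> $ 0 = a" "\<alpha> $ 1 = b" "\<alpha> $ 2 = c" "\<alpha> $ 3 = d"
      unfolding half(2) by (rule vec_of_list_4)+
    have sq: "x * x = 1/4" if "x \<in> {1/2, -1/2}" for x :: complex
    proof -
      have "x = 1/2 \<or> x = -1/2" using that by blast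
      then show ?thesis by (elim disjE; hypsubst; simp)
    qed
    have "a * a = 1/4" "b * b = 1/4" "c * c = 1/4" "d * d = 1/4" using half(1) sq by blast+
    then have "\<alpha> \<bullet> \<alpha> = 1/4 + 1/4 + 1/4 + 1/4" by (simp only: scalar_prod_4[OF c c] e)
    then have n: "\<alpha> \<bullet> \<alpha> = 1" by simp
    have "x - 1/2 \<in> \<int>" if "x \<in> {1/2, -1/2}" for x :: complex
    proof -
      have "x = 1/2 \<or> x = -1/2" using that by blast
      then show ?thesis by (elim disjE; hypsubst; simp)
    qed
    then have h: "a - 1/2 \<in> \<int>" "b - 1/2 \<in> \<int>" "c - 1/2 \<in> \<int>" "d - 1/2 \<in> \<int>"
      using half(1) by blast+
    then have "\<alpha> \<in> Q_lattice" using c e by (simp add: Q_lattice_def all_less_4)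
    moreover have "2 * x \<in> \<int>" if "x \<in> {1/2, -1/2}" for x :: complex
    proof -
      have "x = 1/2 \<or> x = -1/2" using that by blast
      then show ?thesis by (elim disjE; hypsubst; simp)
    qed
    then have h2: "2 * a \<in> \<int>" "2 * b \<in> \<int>" "2 * c \<in> \<int>" "2 * d \<in> \<int>"
      using half(1) by blast+
    have "(2 * a + 2 * b + 2 * c + 2 * d) / 2 =
        (a - 1/2) + (b - 1/2) + (c - 1/2) + (d - 1/2) + 2"
      by (simp add: field_simps)
    then have "(2 * a + 2 * b + 2 * c + 2 * d) / 2 \<in> \<int>"
      using h by (metis Ints_add Ints_numeral)
    then have "coroot \<alpha> \<in> D_lattice"
      using c e h2 by (simp add: D_lattice_def all_less_4 coroot_def n)
    ultimately show ?thesis using n by simp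
  qed
  then show "\<alpha> \<in> Q_lattice" "\<alpha> \<bullet> \<alpha> = 1 \<or> \<alpha> \<bullet> \<alpha> = 2 \<and> \<alpha> \<in> D_lattice" "coroot \<alpha> \<in> D_lattice"
    by auto
qed

lemma root_reflection_carrier: "root_reflection \<alpha> \<in> carrier_mat 4 4"
  by (simp add: root_reflection_def)

lemma root_reflection_mult_vec:
  assumes "\<alpha> \<in> carrier_vec 4" "x \<in> carrier_vec 4"
  shows "root_reflection \<alpha> *\<^sub>v x = x - (coroot \<alpha> \<bullet> x) \<cdot>\<^sub>v \<alpha>"
proof (rule eq_vecI)
  fix i assume "i < dim_vec (x - (coroot \<alpha> \<bullet> x) \<cdot>\<^sub>v \<alpha>)"
  then have i: "i < 4" using assms by simp
  then have "i = 0 \<or> i = 1 \<or> i = 2 \<or> i = 3" by (rule less_4_cases)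
  then show "(root_reflection \<alpha> *\<^sub>v x) $ i = (x - (coroot \<alpha> \<bullet> x) \<cdot>\<^sub>v \<alpha>) $ i"
    using assms i
    by (elim disjE; simp add: root_reflection_def scalar_prod_4 coroot_def; simp add: algebra_simps)
qed (use assms in \<open>simp add: root_reflection_def\<close>)

lemma mat_eq_vecI:
  assumes "A \<in> carrier_mat m n" "B \<in> carrier_mat m n" "\<And>v. v \<in> carrier_vec n \<Longrightarrow> A *\<^sub>v v = B *\<^sub>v v"
  shows "(A :: 'a :: comm_ring_1 mat) = B"
proof (rule mat_col_eqI)
  fix j assume j: "j < dim_col B"
  have "col A j = A *\<^sub>v unit_vec n j" "col B j = B *\<^sub>v unit_vec n j"
    using assms(1,2) j by (auto intro!: eq_vecI)
  then show "col A j = col B j" using assms(3) by simp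
qed (use assms in auto)

lemma root_reflection_involution:
  assumes "\<alpha> \<in> carrier_vec 4" "\<alpha> \<bullet> \<alpha> \<noteq> 0"
  shows "root_reflection \<alpha> * root_reflection \<alpha> = 1\<^sub>m 4"
proof (rule mat_eq_vecI[of _ 4 4])
  fix v :: "complex vec" assume v: "v \<in> carrier_vec 4"
  have c: "coroot \<alpha> \<in> carrier_vec 4" using assms by (simp add: coroot_def)
  have ca: "coroot \<alpha> \<bullet> \<alpha> = 2" using assms by (simp add: coroot_def)
  define k where "k = coroot \<alpha> \<bullet> v"
  have "coroot \<alpha> \<bullet> (v - k \<cdot>\<^sub>v \<alpha>) = k - k * 2"
    using v c assms ca by (simp add: scalar_prod_minus_distrib[of _ 4] k_def)
  then show "root_reflection \<alpha> * root_reflection \<alpha> *\<^sub>v v = 1\<^sub>m 4 *\<^sub>v v"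
    using v assms
    by (simp add: assoc_mult_mat_vec[OF root_reflection_carrier root_reflection_carrier v]
        root_reflection_mult_vec k_def[symmetric]) (intro eq_vecI, auto)
qed (auto simp: root_reflection_def)

section \<open>Orthogonality, integrality and finiteness of the group\<close>

lemma F4_root_carrier: "\<alpha> \<in> F4_roots \<Longrightarrow> \<alpha> \<in> carrier_vec 4"
  using F4_root_lattice(1) Q_carrier by blast

lemma F4_root_nonzero: "\<alpha> \<in> F4_roots \<Longrightarrow> \<alpha> \<bullet> \<alpha> \<noteq> 0"
  using F4_root_lattice(2) by fastforce

text \<open>The generators are their own inverses, so the case of an inverse generator reduces to
  that of a generator.\<close>

lemma generate_involutions_induct:
  assumes X: "X \<in> generate (GL n) H"
    and H: "\<And>h. h \<in> H \<Longrightarrow> h \<in> carrier_mat n n \<and> h * h = 1\<^sub>m n"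
    and P: "P (1\<^sub>m n)" "\<And>h. h \<in> H \<Longrightarrow> P h"
      "\<And>A B. A \<in> carrier_mat n n \<Longrightarrow> B \<in> carrier_mat n n \<Longrightarrow> P A \<Longrightarrow> P B \<Longrightarrow> P (A * B)"
  shows "X \<in> carrier_mat n n \<and> P X"
  using X
proof induction
  case (inv h)
  then show ?case using GL_inv_eq[of h n h] H[OF inv] P by simp
qed (use H P in \<open>auto simp: GL_simps\<close>)

lemmas G28_induct = generate_involutions_induct[of _ 4 "root_reflection ` F4_roots", folded G28_def]

lemma root_reflection_F4_involution:
  "h \<in> root_reflection ` F4_roots \<Longrightarrow> h \<in> carrier_mat 4 4 \<and> h * h = 1\<^sub>m 4"
  by (auto intro!: root_reflection_involution root_reflection_carrier F4_root_carrier dest: F4_root_nonzero)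

lemma transpose_root_reflection: "transpose_mat (root_reflection \<alpha>) = root_reflection \<alpha>"
  by (intro eq_matI) (auto simp: root_reflection_def)

lemma root_reflection_Q:
  assumes "\<alpha> \<in> F4_roots" "x \<in> Q_lattice" shows "root_reflection \<alpha> *\<^sub>v x \<in> Q_lattice"
  using assms F4_root_lattice[OF assms(1)]
  by (auto simp: root_reflection_mult_vec Q_carrier intro!: Q_diff Q_smult D_Q_int)

text \<open>Orthogonality and stability of the Hurwitz lattice are the two facts behind finiteness:
  the first bounds the entries, the second makes them halves of integers.\<close>

lemma G28_props:
  assumes "A \<in> G28"
  shows "A \<in> carrier_mat 4 4" "transpose_mat A * A = 1\<^sub>m 4" "x \<in> Q_lattice \<Longrightarrow> A *\<^sub>v x \<in> Q_lattice"
proof -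
  have "A \<in> carrier_mat 4 4 \<and> (transpose_mat A * A = 1\<^sub>m 4 \<and> (\<forall>x\<in>Q_lattice. A *\<^sub>v x \<in> Q_lattice))"
    using assms
  proof (rule G28_induct)
    show "(1\<^sub>m 4)\<^sup>T * 1\<^sub>m 4 = (1\<^sub>m 4 :: complex mat) \<and> (\<forall>x\<in>Q_lattice. 1\<^sub>m 4 *\<^sub>v x \<in> Q_lattice)"
      using Q_carrier by auto
    fix h assume "h \<in> root_reflection ` F4_roots"
    then show "h\<^sup>T * h = 1\<^sub>m 4 \<and> (\<forall>x\<in>Q_lattice. h *\<^sub>v x \<in> Q_lattice)"
      using root_reflection_F4_involution root_reflection_Q by (auto simp: transpose_root_reflection)
  next
    fix A B :: "complex mat" assume c: "A \<in> carrier_mat 4 4" "B \<in> carrier_mat 4 4"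
      and A: "A\<^sup>T * A = 1\<^sub>m 4 \<and> (\<forall>x\<in>Q_lattice. A *\<^sub>v x \<in> Q_lattice)"
      and B: "B\<^sup>T * B = 1\<^sub>m 4 \<and> (\<forall>x\<in>Q_lattice. B *\<^sub>v x \<in> Q_lattice)"
    have "(A * B)\<^sup>T * (A * B) = (B\<^sup>T * A\<^sup>T) * (A * B)" using c by (simp add: transpose_mult)
    also have "\<dots> = B\<^sup>T * ((A\<^sup>T * A) * B)"
      using c by (simp add: assoc_mult_mat[of _ 4 4 _ 4 _ 4])
    finally have "(A * B)\<^sup>T * (A * B) = 1\<^sub>m 4" using A B c by simp
    moreover have "A * B *\<^sub>v x \<in> Q_lattice" if "x \<in> Q_lattice" for x
      using that A B c Q_carrier[OF that] by (simp add: assoc_mult_mat_vec[OF c(1,2)])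
    ultimately show "(A * B)\<^sup>T * (A * B) = 1\<^sub>m 4 \<and> (\<forall>x\<in>Q_lattice. A * B *\<^sub>v x \<in> Q_lattice)" by blast
  qed (rule root_reflection_F4_involution)
  then show "A \<in> carrier_mat 4 4" "transpose_mat A * A = 1\<^sub>m 4" "x \<in> Q_lattice \<Longrightarrow> A *\<^sub>v x \<in> Q_lattice"
    by auto
qed

lemma G28_entry:
  assumes "A \<in> G28" "i < 4" "j < 4"
  shows "2 * A $$ (i,j) \<in> \<int>"
proof -
  have "unit_vec 4 j \<in> Q_lattice" by (simp add: Q_lattice_def unit_vec_def)
  then have "A *\<^sub>v unit_vec 4 j \<in> Q_lattice" by (rule G28_props(3)[OF assms(1)])
  then have "A $$ (i,j) \<in> \<int> \<or> A $$ (i,j) - 1/2 \<in> \<int>"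
    using G28_props(1)[OF assms(1)] assms(2,3) by (auto simp: Q_lattice_def)
  moreover have "2 * x \<in> \<int>" if "x - 1/2 \<in> \<int>" for x :: complex
  proof -
    have "2 * x = 2 * (x - 1/2) + 1" by simp
    then show ?thesis using that by (metis Ints_1 Ints_add Ints_mult Ints_numeral)
  qed
  ultimately show ?thesis by auto
qed

lemma G28_sub_GL: "G28 \<subseteq> carrier (GL 4)" "subgroup G28 (GL 4)"
proof -
  have sub: "root_reflection ` F4_roots \<subseteq> carrier (GL 4)"
    using root_reflection_F4_involution GL_I by blast
  show "G28 \<subseteq> carrier (GL 4)" "subgroup G28 (GL 4)"
    unfolding G28_def using group.generate_incl[OF GL_group sub] group.generate_is_subgroup[OF GL_group sub]
    by auto
qed

lemma finite_mat_entries: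
  assumes "finite S"
  shows "finite {A \<in> carrier_mat m n. \<forall>i<m. \<forall>j<n. A $$ (i,j) \<in> S}" (is "finite ?X")
proof -
  have "?X \<subseteq> (\<lambda>f. mat m n f) ` (PiE ({0..<m} \<times> {0..<n}) (\<lambda>_. S))"
  proof
    fix A assume A: "A \<in> ?X"
    then have "A = mat m n (\<lambda>x\<in>{0..<m} \<times> {0..<n}. A $$ x)" by (intro eq_matI) auto
    moreover have "(\<lambda>x\<in>{0..<m} \<times> {0..<n}. A $$ x) \<in> PiE ({0..<m} \<times> {0..<n}) (\<lambda>_. S)"
      using A by auto
    ultimately show "A \<in> (\<lambda>f. mat m n f) ` (PiE ({0..<m} \<times> {0..<n}) (\<lambda>_. S))" by blast
  qed
  moreover have "finite (PiE ({0..<m} \<times> {0..<n}) (\<lambda>_. S))" using assms by (intro finite_PiE) auto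
  ultimately show ?thesis by (meson finite_imageI finite_subset)
qed

text \<open>The doubled entries of a column are integers whose squares add up to 4, so each lies
  between -2 and 2.\<close>

lemma G28_finite: "finite G28"
proof -
  let ?S = "(\<lambda>k::int. complex_of_int k / 2) ` {-2..2}"
  have "G28 \<subseteq> {A \<in> carrier_mat 4 4. \<forall>i<4. \<forall>j<4. A $$ (i,j) \<in> ?S}"
  proof (intro subsetI CollectI conjI allI impI)
    fix A assume A: "A \<in> G28"
    show c: "A \<in> carrier_mat 4 4" by (rule G28_props(1)[OF A])
    fix i j :: nat assume ij: "i < 4" "j < 4"
    have "\<exists>k. 2 * A $$ (l,j) = of_int k" if "l < 4" for l
      using G28_entry[OF A that ij(2)] by (auto elim: Ints_cases)
    then obtain k where k: "\<And>l. l < 4 \<Longrightarrow> 2 * A $$ (l,j) = of_int (k l)" by metis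
    have "(A\<^sup>T * A) $$ (j,j) = 1" using G28_props(2)[OF A] ij by simp
    then have "(\<Sum>l<4. A $$ (l,j) * A $$ (l,j)) = 1"
      using c ij by (simp add: scalar_prod_def atLeast0LessThan)
    then have four: "4 * (\<Sum>l<4. A $$ (l,j) * A $$ (l,j)) = 4" by simp
    have "(\<Sum>l<4. (2 * A $$ (l,j)) * (2 * A $$ (l,j))) = 4"
    proof -
      have *: "(2 * x) * (2 * x) = 4 * (x * x)" for x :: complex by simp
      show ?thesis using four unfolding * sum_distrib_left[symmetric] .
    qed
    then have "(\<Sum>l<4. of_int (k l) * of_int (k l)) = (4 :: complex)" using k by simp
    then have "of_int (\<Sum>l<4. k l * k l) = (of_int 4 :: complex)" by simp
    then have s: "(\<Sum>l<4. k l * k l) = 4" using of_int_eq_iff by blast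
    have "k i * k i \<le> (\<Sum>l<4. k l * k l)" using ij by (intro member_le_sum) auto
    then have "(k i)\<^sup>2 \<le> 2\<^sup>2" using s by (simp add: power2_eq_square)
    then have "\<bar>k i\<bar> \<le> 2" using abs_le_square_iff[of "k i" 2] by simp
    then have "k i \<in> {-2..2}" by auto
    moreover have "A $$ (i,j) = of_int (k i) / 2" using k[OF ij(1)] by (simp add: field_simps)
    ultimately show "A $$ (i,j) \<in> ?S" by blast
  qed
  then show ?thesis by (rule finite_subset) (intro finite_mat_entries, simp)
qed

lemma G28_finite_order:
  assumes "A \<in> G28"
  shows "\<exists>k>0. A ^\<^sub>m k = 1\<^sub>m 4"
proof -
  let ?G = "GL 4\<lparr>carrier := G28\<rparr>"
  interpret G: group ?G by (rule subgroup.subgroup_is_group[OF G28_sub_GL(2) GL_group])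
  have "A [^]\<^bsub>?G\<^esub> k = A ^\<^sub>m k" for k :: nat
    using G28_props(1)[OF assms] by (induction k) (auto simp: GL_simps)
  moreover have "A [^]\<^bsub>?G\<^esub> Coset.order ?G = \<one>\<^bsub>?G\<^esub>"
    using assms by (intro G.pow_order_eq_1) auto
  moreover have "Coset.order ?G > 0" using G28_finite G.order_gt_0_iff_finite by simp
  ultimately show ?thesis by (auto simp: GL_simps)
qed

section \<open>Reflections in the Weyl group\<close>

lemma order_prod_linear:
  fixes d :: "nat \<Rightarrow> 'a :: idom"
  shows "Polynomial.order x (\<Prod>i<n. [:- d i, 1:]) = card {i. i < n \<and> d i = x}"
proof (induction n)
  case (Suc n)
  have nz: "(\<Prod>i<m. [:- d i, 1:]) \<noteq> 0" for m by (simp add: prod_zero_iff)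
  have "Polynomial.order x (\<Prod>i<Suc n. [:- d i, 1:]) =
      Polynomial.order x (\<Prod>i<n. [:- d i, 1:]) + Polynomial.order x [:- d n, 1:]"
    unfolding prod.lessThan_Suc by (rule order_mult) (use nz[of "Suc n"] in \<open>simp add: prod.lessThan_Suc\<close>)
  moreover have "Polynomial.order x [:- d n, 1:] = (if d n = x then 1 else 0)"
    using order_power_n_n[of x 1] by (auto simp: order_0I)
  moreover have "card {i. i < n \<and> d i = x} + (if d n = x then 1 else 0) = card {i. i < Suc n \<and> d i = x}"
  proof -
    have "{i. i < Suc n \<and> d i = x} = {i. i < n \<and> d i = x} \<union> (if d n = x then {n} else {})"
      by (auto simp: less_Suc_eq)
    then show ?thesis by (auto simp: card_insert_if)
  qed
  ultimately show ?case using Suc by simp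
qed simp

lemma mat_diag_sandwich_index:
  assumes "P \<in> carrier_mat n n" "R \<in> carrier_mat n n" "i < n" "j < n"
  shows "(P * mat_diag n d * R) $$ (i,j) = (\<Sum>l<n. P $$ (i,l) * d l * R $$ (l,j))"
  using assms
  by (subst mat_diag_mult_right[of _ n]) (auto simp: scalar_prod_def atLeast0LessThan)

lemma root_reflection_scale:
  assumes "c \<noteq> 0" "\<alpha> \<in> carrier_vec 4"
  shows "root_reflection (c \<cdot>\<^sub>v \<alpha>) = root_reflection \<alpha>"
  using assms by (intro eq_matI) (auto simp: root_reflection_def field_simps)

lemma F4_rootsI:
  assumes c: "\<alpha> \<in> carrier_vec 4"
    and "(\<forall>i<4. \<alpha> $ i = 1/2 \<or> \<alpha> $ i = -1/2) \<or>
      (\<exists>i<4. (\<alpha> $ i = 1 \<or> \<alpha> $ i = -1) \<and> (\<forall>k<4. k \<noteq> i \<longrightarrow> \<alpha> $ k = 0)) \<or>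
      (\<exists>i<4. \<exists>j<4. i \<noteq> j \<and> (\<alpha> $ i = 1 \<or> \<alpha> $ i = -1) \<and> (\<alpha> $ j = 1 \<or> \<alpha> $ j = -1) \<and>
        (\<forall>k<4. k \<noteq> i \<longrightarrow> k \<noteq> j \<longrightarrow> \<alpha> $ k = 0))"
  shows "\<alpha> \<in> F4_roots"
proof -
  from assms(2) consider "\<forall>i<4. \<alpha> $ i = 1/2 \<or> \<alpha> $ i = -1/2"
    | i where "i < 4" "\<alpha> $ i = 1 \<or> \<alpha> $ i = -1" "\<forall>k<4. k \<noteq> i \<longrightarrow> \<alpha> $ k = 0"
    | i j where "i < 4" "j < 4" "i \<noteq> j" "\<alpha> $ i = 1 \<or> \<alpha> $ i = -1" "\<alpha> $ j = 1 \<or> \<alpha> $ j = -1"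
      "\<forall>k<4. k \<noteq> i \<longrightarrow> k \<noteq> j \<longrightarrow> \<alpha> $ k = 0"
    by (elim disjE[where R = thesis] exE[where Q = thesis] conjE) blast+
  then show ?thesis
  proof cases
    case 1
    have "\<alpha> = vec_of_list [\<alpha> $ 0, \<alpha> $ 1, \<alpha> $ 2, \<alpha> $ 3]"
      using c by (rule vec_of_list_4_eqI) (rule refl)+
    moreover have "{\<alpha> $ 0, \<alpha> $ 1, \<alpha> $ 2, \<alpha> $ 3} \<subseteq> {1/2, -1/2}" using 1 by auto
    ultimately show ?thesis unfolding F4_roots_def by blast
  next
    case (2 i)
    then have "\<alpha> = \<alpha> $ i \<cdot>\<^sub>v unit_vec 4 i" using c by (intro eq_vecI) auto
    then show ?thesis using 2 unfolding F4_roots_def by blast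
  next
    case (3 i j)
    have "\<alpha> = \<alpha> $ i \<cdot>\<^sub>v unit_vec 4 i + \<alpha> $ j \<cdot>\<^sub>v unit_vec 4 j"
      "\<alpha> = \<alpha> $ j \<cdot>\<^sub>v unit_vec 4 j + \<alpha> $ i \<cdot>\<^sub>v unit_vec 4 i"
      using 3 c by (auto intro!: eq_vecI)
    moreover have "i < j \<or> j < i" using 3(3) by linarith
    ultimately show ?thesis using 3(1,2,4,5) unfolding F4_roots_def by blast
  qed
qed

text \<open>The matrix \<open>n\<close> stands for twice \<open>1 - A\<close>, where
  \<open>A\<close> is the reflection along a vector \<open>w\<close>; its entries are
  \<open>4 * w i * w j / (w, w)\<close>. The diagonal entries are nonnegative integers with sum 4,
  and the product of any two of them is a square. This leaves the patterns 4; 2, 2; 1, 1, 1, 1,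
  which belong to the axis roots, the long roots and the half-integral roots.\<close>

lemma root_of_gram_matrix:
  fixes n :: "nat \<Rightarrow> nat \<Rightarrow> int"
  assumes rank1: "\<And>a b. a < 4 \<Longrightarrow> b < 4 \<Longrightarrow> n a b * n a b = n a a * n b b"
    and tr: "n 0 0 + n 1 1 + n 2 2 + n 3 3 = 4"
    and r: "r < 4" "n r r > 0"
  obtains c \<alpha> where "c \<noteq> 0" "\<alpha> \<in> F4_roots" "vec 4 (\<lambda>i. of_int (n i r)) = (c :: complex) \<cdot>\<^sub>v \<alpha>"
proof -
  define N where "N = (\<lambda>i. n i i)"
  define x where "x = (\<lambda>i. n i r)"
  have xr: "x r = N r" by (simp add: x_def N_def)
  have sq: "x i * x i = N i * N r" if "i < 4" for i using rank1[OF that r(1)] by (simp add: x_def N_def)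
  have Nr: "N r > 0" using r by (simp add: N_def)
  have nonneg: "N i \<ge> 0" if "i < 4" for i
    using sq[OF that] Nr by (metis zero_le_mult_iff zero_le_square not_less order.strict_iff_not)
  have sum: "(\<Sum>i<4. N i) = 4" using tr by (simp add: sum_less_4 N_def)
  have le2: "N i + N j \<le> 4" if "i < 4" "j < 4" "i \<noteq> j" for i j
  proof -
    have "(\<Sum>l\<in>{i,j}. N l) \<le> (\<Sum>l<4. N l)" using nonneg that by (intro sum_mono2) auto
    then show ?thesis using that sum by simp
  qed
  have le3: "N i + N j + N k \<le> 4" if "i < 4" "j < 4" "k < 4" "i \<noteq> j" "i \<noteq> k" "j \<noteq> k" for i j k
  proof -
    have "(\<Sum>l\<in>{i,j,k}. N l) \<le> (\<Sum>l<4. N l)" using nonneg that by (intro sum_mono2) auto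
    then show ?thesis using that sum by simp
  qed
  \<comment> \<open>As products of diagonal entries are squares, an entry 1 cannot occur together
    with 2 or 3.\<close>
  have nsq: "y * y \<noteq> 2 \<and> y * y \<noteq> 3" for y :: int
  proof -
    have "y * y \<ge> 4" if "\<bar>y\<bar> \<ge> 2" using mult_mono[OF that that] by (simp add: abs_mult_self_eq)
    moreover have "y * y \<le> 1" if "\<bar>y\<bar> \<le> 1"
    proof -
      have "y = 0 \<or> y = 1 \<or> y = -1" using that by linarith
      then show ?thesis by auto
    qed
    ultimately show ?thesis by (cases "\<bar>y\<bar> \<ge> 2") auto
  qed
  have sq4: "y = 2 \<or> y = -2" if "y * y = 4" for y :: int
    using that by (metis mult_2_right numeral_Bit0 power2_eq_iff power2_eq_square mult_numeral_left_semiring_numeral semiring_norm(80) numeral_times_numeral semiring_norm(13) semiring_norm(11))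
  have sq1: "y = 1 \<or> y = -1" if "y * y = 1" for y :: int
    using that by (metis pos_zmult_eq_1_iff_lemma zmult_eq_1_iff)
  have Nr4: "N r \<le> 4"
  proof -
    have "(\<Sum>l\<in>{r}. N l) \<le> (\<Sum>l<4. N l)" using nonneg r by (intro sum_mono2) auto
    then show ?thesis using sum by simp
  qed
  have root: "\<exists>c \<alpha>. c \<noteq> 0 \<and> \<alpha> \<in> F4_roots \<and> vec 4 (\<lambda>i. of_int (x i)) = (c :: complex) \<cdot>\<^sub>v \<alpha>"
    if "c \<noteq> 0" "vec 4 (\<lambda>i. of_int (x i) / c) \<in> F4_roots" for c
  proof (intro exI conjI)
    show "vec 4 (\<lambda>i. of_int (x i)) = c \<cdot>\<^sub>v vec 4 (\<lambda>i. of_int (x i) / c)"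
      using that by (intro eq_vecI) auto
  qed (use that in auto)
  consider "N r = 4" | "N r = 3" | "N r = 2" | "N r = 1" using Nr Nr4 by linarith
  then have "\<exists>c \<alpha>. c \<noteq> 0 \<and> \<alpha> \<in> F4_roots \<and> vec 4 (\<lambda>i. of_int (x i)) = (c :: complex) \<cdot>\<^sub>v \<alpha>"
  proof cases
    case 1
    have "x i = 0" if "i < 4" "i \<noteq> r" for i
    proof -
      have "N i = 0" using le2[OF that(1) r(1) that(2)] nonneg[OF that(1)] 1 by simp
      then show ?thesis using sq[OF that(1)] by simp
    qed
    then have "vec 4 (\<lambda>i. of_int (x i) / 4) \<in> F4_roots"
      using r(1) 1 xr by (intro F4_rootsI) auto
    then show ?thesis using root[of 4] by simp
  next
    case 2
    have "N i = 0" if "i < 4" "i \<noteq> r" for i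
    proof -
      have "N i \<le> 1" using le2[OF that(1) r(1) that(2)] 2 by simp
      moreover have "N i \<noteq> 1" using sq[OF that(1)] 2 nsq[of "x i"] by auto
      ultimately show ?thesis using nonneg[OF that(1)] by linarith
    qed
    then have "(\<Sum>i<4. N i) = N r" using r(1) by (subst sum.remove[of _ r]) auto
    then show ?thesis using sum 2 by simp
  next
    case 3
    have N02: "N i = 0 \<or> N i = 2" if "i < 4" "i \<noteq> r" for i
    proof -
      have "N i \<le> 2" using le2[OF that(1) r(1) that(2)] 3 by simp
      moreover have "N i \<noteq> 1" using sq[OF that(1)] 3 nsq[of "x i"] by auto
      ultimately show ?thesis using nonneg[OF that(1)] by linarith
    qed
    have "\<exists>j<4. j \<noteq> r \<and> N j = 2"
    proof (rule ccontr)
      assume "\<not> ?thesis"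
      then have "N i = 0" if "i < 4" "i \<noteq> r" for i using N02 that by blast
      then have "(\<Sum>i<4. N i) = N r" using r(1) by (subst sum.remove[of _ r]) auto
      then show False using sum 3 by simp
    qed
    then obtain j where j: "j < 4" "j \<noteq> r" "N j = 2" by blast
    have "x j * x j = 4" using sq[OF j(1)] j 3 by simp
    then have xj: "x j = 2 \<or> x j = -2" by (rule sq4)
    have x0: "x k = 0" if "k < 4" "k \<noteq> r" "k \<noteq> j" for k
    proof -
      have "N k = 0" using le3[OF that(1) r(1) j(1)] that j 3 nonneg[OF that(1)] by auto
      then show ?thesis using sq[OF that(1)] by simp
    qed
    have "vec 4 (\<lambda>i. of_int (x i) / 2) \<in> F4_roots"
      by (rule F4_rootsI, simp, rule disjI2, rule disjI2, rule exI[of _ r], rule conjI[OF r(1)],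
          rule exI[of _ j]) (use r j xj x0 xr 3 in auto)
    then show ?thesis using root[of 2] by simp
  next
    case 4
    have N1: "N i \<le> 1" if "i < 4" for i
    proof (cases "i = r")
      case False
      have "N i \<le> 3" using le2[OF that r(1) False] 4 by simp
      moreover have "N i \<noteq> 2" "N i \<noteq> 3" using sq[OF that] 4 nsq[of "x i"] by auto
      ultimately show ?thesis by linarith
    qed (use 4 in simp)
    have "N 0 \<le> 1" "N 1 \<le> 1" "N 2 \<le> 1" "N 3 \<le> 1" using N1 by auto
    then have "\<forall>i<4. N i = 1" using sum unfolding sum_less_4 all_less_4 by linarith
    then have "\<forall>i<4. x i = 1 \<or> x i = -1" using sq sq1 4 by simp
    then have "vec 4 (\<lambda>i. of_int (x i) / 2) \<in> F4_roots"
      by (intro F4_rootsI disjI1) auto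
    then show ?thesis using root[of 2] by simp
  qed
  then show thesis using that unfolding x_def by blast
qed

text \<open>Diagonalizability makes \<open>A - 1\<close> a matrix \<open>u w^T\<close> of rank one.
  Orthogonality forces \<open>u\<close> to be a multiple of \<open>w\<close>, hence
  \<open>A = 1 - 2 w w^T / (w, w)\<close>; since the entries are halves of integers, only roots are
  left for the direction of \<open>w\<close>.\<close>

lemma reflection_in_G28:
  assumes A: "A \<in> G28" and refl: "reflection 4 A"
  obtains \<alpha> where "\<alpha> \<in> F4_roots" "A = root_reflection \<alpha>"
proof -
  have c: "A \<in> carrier_mat 4 4" by (rule G28_props(1)[OF A])
  obtain k where "k > 0" "A ^\<^sub>m k = 1\<^sub>m 4" using refl unfolding reflection_def by blast
  from finite_order_diagonalizable[OF c this]
  obtain P R d where P: "P \<in> carrier_mat 4 4" and R: "R \<in> carrier_mat 4 4"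
    and PR: "P * R = 1\<^sub>m 4" and RP: "R * P = 1\<^sub>m 4"
    and APR: "A = P * mat_diag 4 d * R" and cp: "char_poly A = (\<Prod>i<4. [:- d i, 1:])"
    by blast
  obtain \<mu> where mu: "{\<nu>. eigenvalue A \<nu> \<and> \<nu> \<noteq> 1} = {\<mu>}" and ord: "Polynomial.order \<mu> (char_poly A) = 1"
    using refl unfolding reflection_def by blast
  have ev: "eigenvalue A (d i)" if "i < 4" for i
    by (rule eigenvalue_of_linear_factors[OF c cp that])
  have mu1: "\<mu> \<noteq> 1" using mu by blast
  have d: "d i = 1 \<or> d i = \<mu>" if "i < 4" for i using ev[OF that] mu by blast
  have "card {i. i < 4 \<and> d i = \<mu>} = 1" using ord unfolding cp order_prod_linear .
  then obtain j where j: "{i. i < 4 \<and> d i = \<mu>} = {j}" by (rule card_1_singletonE)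
  then have j4: "j < 4" "d j = \<mu>" by auto
  have dj: "d i = 1" if "i < 4" "i \<noteq> j" for i using d[OF that(1)] j that by blast
  define u where "u = (\<lambda>a. (\<mu> - 1) * P $$ (a,j))"
  define w where "w = (\<lambda>b. R $$ (j,b))"
  define h where "h = (\<lambda>a b. A $$ (a,b) - (if a = b then 1 else 0))"
  have huw: "h a b = u a * w b" if ab: "a < 4" "b < 4" for a b
  proof -
    have "(1\<^sub>m 4 :: complex mat) $$ (a,b) = (P * R) $$ (a,b)" using PR by simp
    then have "(if a = b then 1 else 0) = (\<Sum>l<4. P $$ (a,l) * R $$ (l,b))"
      using ab P R by (simp add: scalar_prod_def atLeast0LessThan)
    moreover have "A $$ (a,b) = (\<Sum>l<4. P $$ (a,l) * d l * R $$ (l,b))"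
      unfolding APR by (rule mat_diag_sandwich_index[OF P R ab])
    ultimately have "h a b = (\<Sum>l<4. P $$ (a,l) * (d l - 1) * R $$ (l,b))"
      by (simp add: h_def sum_subtractf[symmetric] algebra_simps)
    also have "\<dots> = (\<Sum>l<4. if l = j then u a * w b else 0)"
      using j4 dj by (intro sum.cong) (auto simp: u_def w_def)
    finally show ?thesis using j4 by simp
  qed
  have wP: "(\<Sum>b<4. w b * P $$ (b,j)) = 1"
  proof -
    have "(R * P) $$ (j,j) = 1" using RP j4 by simp
    then show ?thesis using P R j4 by (simp add: scalar_prod_def atLeast0LessThan w_def)
  qed
  then obtain r where r: "r < 4" "w r \<noteq> 0" by (metis (no_types, lifting) lessThan_iff mult_zero_left sum.neutral zero_neq_one)
  obtain s where s: "s < 4" "P $$ (s,j) \<noteq> 0" using wP by (metis (no_types, lifting) lessThan_iff mult_zero_right sum.neutral zero_neq_one)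
  have us: "u s \<noteq> 0" using s mu1 by (simp add: u_def)
  define N where "N = u 0 * u 0 + u 1 * u 1 + u 2 * u 2 + u 3 * u 3"
  \<comment> \<open>Entry (a, b) of \<open>A^T A = 1\<close> after inserting
    \<open>A = 1 + u w^T\<close>.\<close>
  have orth: "u a * w b + u b * w a + N * w a * w b = 0" if ab: "a < 4" "b < 4" for a b
  proof -
    have "(A\<^sup>T * A) $$ (a,b) = (if a = b then 1 else 0)" using G28_props(2)[OF A] ab by simp
    then have "(\<Sum>l<4. A $$ (l,a) * A $$ (l,b)) = (if a = b then 1 else 0)"
      using c ab by (simp add: scalar_prod_def atLeast0LessThan)
    moreover have "A $$ (l,a) = u l * w a + (if l = a then 1 else 0)" if "l < 4" for l
      using huw[OF that ab(1)] by (simp add: h_def algebra_simps)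
    moreover have "A $$ (l,b) = u l * w b + (if l = b then 1 else 0)" if "l < 4" for l
      using huw[OF that ab(2)] by (simp add: h_def algebra_simps)
    ultimately have "(\<Sum>l<4. (u l * w a + (if l = a then 1 else 0)) * (u l * w b + (if l = b then 1 else 0)))
        = (if a = b then 1 else 0)" by simp
    then have "(\<Sum>l<4. u l * u l * w a * w b + (if l = b then u b * w a else 0) + (if l = a then u a * w b else 0)
        + (if l = a then if a = b then 1 else 0 else 0)) = (if a = b then 1 else 0)"
      by (elim trans[rotated]) (intro sum.cong, auto simp: algebra_simps)
    then have "(\<Sum>l<4. u l * u l * w a * w b) + u b * w a + u a * w b + (if a = b then 1 else 0) = (if a = b then 1 else 0)"
      using ab by (simp add: sum.distrib)
    then show ?thesis by (simp add: sum_less_4 N_def algebra_simps)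
  qed
  define \<kappa> where "\<kappa> = - (u r + N * w r) / w r"
  have u: "u a = \<kappa> * w a" if "a < 4" for a
  proof -
    have "u a * w r = - (u r + N * w r) * w a" using orth[OF that r(1)]
      unfolding minus_mult_left[symmetric] eq_neg_iff_add_eq_0 by (simp add: algebra_simps)
    then show ?thesis using r(2) unfolding \<kappa>_def by (simp add: field_simps)
  qed
  have k0: "\<kappa> \<noteq> 0" using u[OF s(1)] us by auto
  have "(2 * u r + N * w r) * w r = 0" using orth[OF r(1) r(1)] by (simp add: algebra_simps)
  then have "2 * u r + N * w r = 0" using r(2) by simp
  moreover have "N = \<kappa> * \<kappa> * (w 0 * w 0 + w 1 * w 1 + w 2 * w 2 + w 3 * w 3)"
    unfolding N_def using u[of 0] u[of 1] u[of 2] u[of 3] by (simp add: algebra_simps)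
  ultimately have "\<kappa> * w r * (2 + \<kappa> * (w 0 * w 0 + w 1 * w 1 + w 2 * w 2 + w 3 * w 3)) = 0"
    using u[OF r(1)] by (simp add: algebra_simps)
  then have "2 + \<kappa> * (w 0 * w 0 + w 1 * w 1 + w 2 * w 2 + w 3 * w 3) = 0"
    using k0 r(2) by simp
  then have kw: "\<kappa> * (w 0 * w 0 + w 1 * w 1 + w 2 * w 2 + w 3 * w 3) = -2"
    by (metis add_eq_0_iff)
  \<comment> \<open>The factor -2 clears the denominators of \<open>A - 1\<close> and makes the
    trace 4, because by \<open>kw\<close> the trace of \<open>A - 1\<close> is -2.\<close>
  have "\<exists>n. of_int n = -2 * h a b" if "a < 4" "b < 4" for a b
  proof -
    have "- (2 * A $$ (a,b)) + (if a = b then 2 else 0) \<in> \<int>"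
      using G28_entry[OF A that] by auto
    then obtain z where "- (2 * A $$ (a,b)) + (if a = b then 2 else 0) = of_int z" by (rule Ints_cases)
    then have "of_int z = -2 * h a b" by (auto simp: h_def algebra_simps)
    then show ?thesis by blast
  qed
  then obtain n where n: "\<And>a b. a < 4 \<Longrightarrow> b < 4 \<Longrightarrow> of_int (n a b) = -2 * h a b" by metis
  have nw: "of_int (n a b) = -2 * \<kappa> * w a * w b" if "a < 4" "b < 4" for a b
    using n[OF that] huw[OF that] u[OF that(1)] by simp
  have rank1: "n a b * n c e = n a e * n c b" if "a < 4" "b < 4" "c < 4" "e < 4" for a b c e
  proof -
    have "complex_of_int (n a b * n c e) = of_int (n a e * n c b)" using nw that by simp
    then show ?thesis by (simp only: of_int_eq_iff)
  qed
  have sym: "n a b = n b a" if "a < 4" "b < 4" for a b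
  proof -
    have "complex_of_int (n a b) = of_int (n b a)" using nw that by simp
    then show ?thesis by (simp only: of_int_eq_iff)
  qed
  have tr: "n 0 0 + n 1 1 + n 2 2 + n 3 3 = 4"
  proof -
    have "complex_of_int (n 0 0 + n 1 1 + n 2 2 + n 3 3) =
        -2 * (\<kappa> * (w 0 * w 0 + w 1 * w 1 + w 2 * w 2 + w 3 * w 3))"
      using nw by (simp add: algebra_simps)
    also have "\<dots> = of_int 4" unfolding kw by simp
    finally have "complex_of_int (n 0 0 + n 1 1 + n 2 2 + n 3 3) = of_int 4" .
    then show ?thesis by (simp only: of_int_eq_iff)
  qed
  have nrr0: "n r r \<noteq> 0" using nw[OF r(1) r(1)] k0 r(2) by auto
  \<comment> \<open>Since \<open>w\<close> is a complex vector, positivity is not automatic. By rank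
    one no diagonal entry has the sign opposite to that of \<open>n r r\<close>, and their sum is
    4.\<close>
  have nrr: "n r r > 0"
  proof (rule ccontr)
    assume "\<not> n r r > 0"
    then have neg: "n r r < 0" using nrr0 by simp
    have "n a a \<le> 0" if "a < 4" for a
    proof -
      have "n a a * n r r = n a r * n a r" using rank1[OF that that r(1) r(1)] sym[OF that r(1)] by simp
      then have "n a a * n r r \<ge> 0" by simp
      then show ?thesis using neg by (simp add: zero_le_mult_iff)
    qed
    then have "n 0 0 \<le> 0" "n 1 1 \<le> 0" "n 2 2 \<le> 0" "n 3 3 \<le> 0" by auto
    then show False using tr by linarith
  qed
  have sqn: "n a b * n a b = n a a * n b b" if "a < 4" "b < 4" for a b
    using rank1[OF that(1) that(1) that(2) that(2)] sym[OF that] by simp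
  obtain c' \<alpha> where \<alpha>: "c' \<noteq> 0" "\<alpha> \<in> F4_roots" "vec 4 (\<lambda>i. of_int (n i r)) = c' \<cdot>\<^sub>v \<alpha>"
    using root_of_gram_matrix[OF sqn tr r(1) nrr] by blast
  have "A = root_reflection (vec 4 (\<lambda>i. of_int (n i r)))"
  proof (rule eq_matI)
    fix a b assume "a < dim_row (root_reflection (vec 4 (\<lambda>i. of_int (n i r))))"
      "b < dim_col (root_reflection (vec 4 (\<lambda>i. of_int (n i r))))"
    then have ab: "a < 4" "b < 4" by (auto simp: root_reflection_def)
    have "complex_of_int (n a r * n b r) = of_int (n a b * n r r)"
      using rank1[OF ab(1) r(1) ab(2) r(1)] rank1[OF ab r(1) r(1)] sym[OF ab(2) r(1)] by simp
    moreover have "n 0 r * n 0 r + n 1 r * n 1 r + n 2 r * n 2 r + n 3 r * n 3 r = 4 * n r r"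
      using sqn[OF _ r(1)] tr by (simp add: distrib_right[symmetric])
    then have "complex_of_int (n 0 r * n 0 r + n 1 r * n 1 r + n 2 r * n 2 r + n 3 r * n 3 r) = of_int (4 * n r r)"
      by (simp only:)
    ultimately have "root_reflection (vec 4 (\<lambda>i. of_int (n i r))) $$ (a,b) =
        (if a = b then 1 else 0) - 2 * (of_int (n a b) * of_int (n r r)) / (4 * of_int (n r r))"
      using ab by (simp add: root_reflection_def scalar_prod_4 mult.assoc)
    also have "\<dots> = (if a = b then 1 else 0) - of_int (n a b) / 2" using nrr by (simp add: field_simps)
    also have "\<dots> = A $$ (a,b)" using n[OF ab] by (simp add: h_def field_simps)
    finally show "A $$ (a,b) = root_reflection (vec 4 (\<lambda>i. of_int (n i r))) $$ (a,b)" by simp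
  qed (use c in \<open>auto simp: root_reflection_def\<close>)
  then have "A = root_reflection \<alpha>"
    using \<alpha> root_reflection_scale F4_root_carrier by metis
  then show thesis using that \<alpha>(2) by blast
qed

section \<open>Lattices spanned by generating roots\<close>

definition lat :: "nat \<Rightarrow> (nat \<Rightarrow> complex vec) \<Rightarrow> complex vec set" where
  "lat T v = {x \<in> carrier_vec 4. \<exists>z :: nat \<Rightarrow> int. \<forall>i<4. x $ i = (\<Sum>k<T. of_int (z k) * v k $ i)}"

lemma lat_diff:
  assumes "x \<in> lat T v" "y \<in> lat T v" shows "x - y \<in> lat T v"
proof -
  from assms obtain z z' :: "nat \<Rightarrow> int" where z: "x \<in> carrier_vec 4" "y \<in> carrier_vec 4"
    "\<And>i. i < 4 \<Longrightarrow> x $ i = (\<Sum>k<T. of_int (z k) * v k $ i)"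
    "\<And>i. i < 4 \<Longrightarrow> y $ i = (\<Sum>k<T. of_int (z' k) * v k $ i)"
    by (auto simp: lat_def)
  have "\<forall>i<4. (x - y) $ i = (\<Sum>k<T. of_int (z k - z' k) * v k $ i)"
    using z by (simp add: sum_subtractf left_diff_distrib)
  moreover have "x - y \<in> carrier_vec 4" using z(1,2) by simp
  ultimately show ?thesis unfolding lat_def mem_Collect_eq by (intro conjI exI)
qed

lemma lat_smult:
  assumes "x \<in> lat T v" "c \<in> \<int>" shows "c \<cdot>\<^sub>v x \<in> lat T v"
proof -
  from assms obtain z :: "nat \<Rightarrow> int" and n where z: "x \<in> carrier_vec 4" "c = of_int n"
    "\<And>i. i < 4 \<Longrightarrow> x $ i = (\<Sum>k<T. of_int (z k) * v k $ i)"
    by (auto simp: lat_def elim!: Ints_cases)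
  have "\<forall>i<4. (c \<cdot>\<^sub>v x) $ i = (\<Sum>k<T. of_int (n * z k) * v k $ i)"
    using z by (simp add: sum_distrib_left mult.assoc)
  moreover have "c \<cdot>\<^sub>v x \<in> carrier_vec 4" using z(1) by simp
  ultimately show ?thesis unfolding lat_def mem_Collect_eq by (intro conjI exI)
qed

lemma lat_base:
  assumes "j < T" "v j \<in> carrier_vec 4" shows "v j \<in> lat T v"
proof -
  define z where "z = (\<lambda>k. if k = j then 1 else 0 :: int)"
  have "(\<Sum>k<T. of_int (z k) * v k $ i) = v j $ i" for i
  proof -
    have "(\<Sum>k<T. of_int (z k) * v k $ i) = (\<Sum>k<T. if k = j then v j $ i else 0)"
      by (intro sum.cong) (auto simp: z_def)
    then show ?thesis using assms by simp
  qed
  then show ?thesis using assms(2) unfolding lat_def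
    by (intro CollectI conjI exI[of _ z]) simp_all
qed

lemma lat_scalar_prod:
  fixes c :: "complex vec"
  assumes "c \<in> carrier_vec 4" "\<And>k. k < T \<Longrightarrow> v k \<in> carrier_vec 4" "x \<in> carrier_vec 4"
    "\<And>i. i < 4 \<Longrightarrow> x $ i = (\<Sum>k<T. z k * v k $ i)"
  shows "c \<bullet> x = (\<Sum>k<T. z k * (c \<bullet> v k))"
proof -
  have "c \<bullet> x = (\<Sum>i<4. c $ i * (\<Sum>k<T. z k * v k $ i))"
    using assms by (simp add: scalar_prod_def atLeast0LessThan)
  also have "\<dots> = (\<Sum>i<4. \<Sum>k<T. z k * (c $ i * v k $ i))"
  proof (rule sum.cong[OF refl])
    fix i assume "i \<in> {..<4::nat}"
    show "c $ i * (\<Sum>k<T. z k * v k $ i) = (\<Sum>k<T. z k * (c $ i * v k $ i))"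
      unfolding sum_distrib_left by (rule sum.cong[OF refl], rule mult.left_commute)
  qed
  also have "\<dots> = (\<Sum>k<T. \<Sum>i<4. z k * (c $ i * v k $ i))" by (rule sum.swap)
  also have "\<dots> = (\<Sum>k<T. z k * (c \<bullet> v k))"
    using carrier_vecD[OF assms(2)]
    by (intro sum.cong) (auto simp: scalar_prod_def atLeast0LessThan sum_distrib_left)
  finally show ?thesis .
qed

lemma lat_int:
  assumes "c \<in> carrier_vec 4" "\<And>k. k < T \<Longrightarrow> v k \<in> carrier_vec 4" "x \<in> lat T v"
    "\<And>k. k < T \<Longrightarrow> c \<bullet> v k \<in> \<int>"
  shows "c \<bullet> x \<in> \<int>"
proof -
  from assms(3) obtain z :: "nat \<Rightarrow> int" where z: "x \<in> carrier_vec 4"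
    "\<And>i. i < 4 \<Longrightarrow> x $ i = (\<Sum>k<T. of_int (z k) * v k $ i)"
    by (auto simp: lat_def)
  have "c \<bullet> x = (\<Sum>k<T. of_int (z k) * (c \<bullet> v k))"
    using assms(1,2) z by (rule lat_scalar_prod)
  then show ?thesis using assms(4) by (simp only:) (intro Ints_sum Ints_mult, auto)
qed

lemma lat_carrier: "x \<in> lat T v \<Longrightarrow> x \<in> carrier_vec 4" by (auto simp: lat_def)

lemma coroot_carrier: "\<alpha> \<in> carrier_vec 4 \<Longrightarrow> coroot \<alpha> \<in> carrier_vec 4"
  by (simp add: coroot_def)

locale generating_roots =
  fixes T :: nat and \<alpha> :: "nat \<Rightarrow> complex vec"
  assumes roots: "\<And>k. k < T \<Longrightarrow> \<alpha> k \<in> F4_roots"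
    and gen: "G28 = generate (GL 4) ((\<lambda>k. root_reflection (\<alpha> k)) ` {..<T})"
begin

text \<open>The generation hypothesis is used in this form: stability passes from the given
  reflections to their products, hence to the whole group, which contains every root
  reflection.\<close>

lemma inv_set:
  assumes S: "S \<subseteq> carrier_vec 4"
    and inv: "\<And>k x. k < T \<Longrightarrow> x \<in> S \<Longrightarrow> root_reflection (\<alpha> k) *\<^sub>v x \<in> S"
    and b: "\<beta> \<in> F4_roots" and x: "x \<in> S"
  shows "root_reflection \<beta> *\<^sub>v x \<in> S"
proof -
  have "root_reflection \<beta> \<in> G28" unfolding G28_def using b by (intro generate.incl) auto
  then have "root_reflection \<beta> \<in> generate (GL 4) ((\<lambda>k. root_reflection (\<alpha> k)) ` {..<T})"
    using gen by simp
  then have "root_reflection \<beta> \<in> carrier_mat 4 4 \<and> (\<forall>x\<in>S. root_reflection \<beta> *\<^sub>v x \<in> S)"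
  proof (rule generate_involutions_induct)
    fix h assume "h \<in> (\<lambda>k. root_reflection (\<alpha> k)) ` {..<T}"
    then show "h \<in> carrier_mat 4 4 \<and> h * h = 1\<^sub>m 4" "\<forall>x\<in>S. h *\<^sub>v x \<in> S"
      using roots inv by (auto intro!: root_reflection_F4_involution[THEN conjunct1] root_reflection_F4_involution[THEN conjunct2])
  next
    fix A B :: "complex mat"
    assume c: "A \<in> carrier_mat 4 4" "B \<in> carrier_mat 4 4" "\<forall>x\<in>S. A *\<^sub>v x \<in> S" "\<forall>x\<in>S. B *\<^sub>v x \<in> S"
    show "\<forall>x\<in>S. A * B *\<^sub>v x \<in> S"
    proof
      fix x assume x: "x \<in> S"
      then have "A * B *\<^sub>v x = A *\<^sub>v (B *\<^sub>v x)" using S c by (intro assoc_mult_mat_vec) auto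
      then show "A * B *\<^sub>v x \<in> S" using c x by simp
    qed
  qed (use S in \<open>simp add: subset_iff\<close>)
  then show ?thesis using x by blast
qed

text \<open>Turns stability into membership: if \<open>x\<close> lies in a stable lattice and pairs
  to 1 or -1 with the coroot of \<beta>, then \<beta> itself lies in the lattice.\<close>

lemma refl_diff:
  assumes "\<beta> \<in> F4_roots" "x \<in> carrier_vec 4"
  shows "x - root_reflection \<beta> *\<^sub>v x = (coroot \<beta> \<bullet> x) \<cdot>\<^sub>v \<beta>"
  using assms F4_root_carrier[OF assms(1)]
  by (intro eq_vecI) (auto simp: root_reflection_mult_vec)

lemma half_root: "vec 4 (\<lambda>_. 1/2) \<in> F4_roots"
  by (intro F4_rootsI) auto

lemma axis_root: "i < 4 \<Longrightarrow> unit_vec 4 i \<in> F4_roots"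
  by (intro F4_rootsI disjI2 disjI1) auto

lemma plus_root: "i < 4 \<Longrightarrow> j < 4 \<Longrightarrow> i \<noteq> j \<Longrightarrow> unit_vec 4 i + unit_vec 4 j \<in> F4_roots"
  by (rule F4_rootsI, simp, rule disjI2, rule disjI2, rule exI[of _ i], rule conjI, assumption, rule exI[of _ j]) auto

lemma minus_root: "i < 4 \<Longrightarrow> j < 4 \<Longrightarrow> i \<noteq> j \<Longrightarrow> unit_vec 4 i - unit_vec 4 j \<in> F4_roots"
  by (rule F4_rootsI, simp, rule disjI2, rule disjI2, rule exI[of _ i], rule conjI, assumption, rule exI[of _ j]) auto

text \<open>The long roots alone preserve \<open>\<int>\<^sup>4\<close>, which the reflection in \<open>(1/2, 1/2, 1/2, 1/2)\<close> does not.\<close>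

lemma short_root_exists: "\<exists>k<T. \<alpha> k \<bullet> \<alpha> k = 1"
proof (rule ccontr)
  assume "\<not> ?thesis"
  then have long: "\<alpha> k \<bullet> \<alpha> k = 2 \<and> \<alpha> k \<in> D_lattice" if "k < T" for k
    using F4_root_lattice(2)[OF roots[OF that]] that by blast
  define S where "S = {x \<in> carrier_vec 4. \<forall>i<4. x $ i \<in> (\<int> :: complex set)}"
  have inv: "root_reflection (\<alpha> k) *\<^sub>v x \<in> S" if k: "k < T" and x: "x \<in> S" for k x
  proof -
    have c: "\<alpha> k \<in> carrier_vec 4" using F4_root_carrier[OF roots[OF k]] .
    have co: "coroot (\<alpha> k) = \<alpha> k" using long[OF k] c by (simp add: coroot_def)
    have i: "\<forall>i<4. \<alpha> k $ i \<in> \<int>" using long[OF k] by (simp add: D_lattice_def)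
    have "\<alpha> k \<bullet> x \<in> \<int>" using x c i unfolding S_def by (auto simp: scalar_prod_4 all_less_4)
    then show ?thesis using x c i co unfolding S_def by (auto simp: root_reflection_mult_vec)
  qed
  \<comment> \<open>The image of the first unit vector is (1/2, -1/2, -1/2, -1/2).\<close>
  have "root_reflection (vec 4 (\<lambda>_. 1/2)) *\<^sub>v unit_vec 4 0 \<in> S"
    by (rule inv_set[OF _ inv half_root]) (auto simp: S_def unit_vec_def)
  then have "(root_reflection (vec 4 (\<lambda>_. 1/2)) *\<^sub>v unit_vec 4 0) $ 1 \<in> \<int>" by (simp add: S_def)
  then have "- (1/2 :: complex) \<in> \<int>"
    by (simp add: root_reflection_mult_vec coroot_def scalar_prod_4)
  then show False by auto
qed

text \<open>The short roots alone preserve the lattice spanned by \<open>e\<^sub>0 \<plusminus> e\<^sub>1, e\<^sub>2 \<plusminus> e\<^sub>3\<close>, which the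
  reflection in \<open>e\<^sub>1 - e\<^sub>2\<close> does not.\<close>

lemma long_root_exists: "\<exists>k<T. \<alpha> k \<bullet> \<alpha> k = 2 \<and> \<alpha> k \<in> D_lattice"
proof (rule ccontr)
  assume "\<not> ?thesis"
  then have short: "\<alpha> k \<bullet> \<alpha> k = 1" if "k < T" for k
    using F4_root_lattice(2)[OF roots[OF that]] that by blast
  define S where "S = {x \<in> carrier_vec 4. (\<forall>i<4. x $ i \<in> (\<int> :: complex set)) \<and>
      (x $ 0 + x $ 1) / 2 \<in> \<int> \<and> (x $ 2 + x $ 3) / 2 \<in> \<int>}"
  have inv: "root_reflection (\<alpha> k) *\<^sub>v x \<in> S" if k: "k < T" and x: "x \<in> S" for k x
  proof -
    have c: "\<alpha> k \<in> carrier_vec 4" using F4_root_carrier[OF roots[OF k]] .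
    have xc: "x \<in> carrier_vec 4" and xi: "x $ 0 \<in> \<int>" "x $ 1 \<in> \<int>" "x $ 2 \<in> \<int>" "x $ 3 \<in> \<int>"
      and xs: "(x $ 0 + x $ 1) / 2 \<in> \<int>" "(x $ 2 + x $ 3) / 2 \<in> \<int>"
      using x by (auto simp: S_def)
    have co: "coroot (\<alpha> k) = 2 \<cdot>\<^sub>v \<alpha> k" using short[OF k] c by (simp add: coroot_def)
    \<comment> \<open>On \<open>S\<close> the pairing with the coroot of a short root is an even
      integer \<open>2 * m\<close>. Reflecting therefore subtracts \<open>m\<close> times the
      integral vector \<open>2 \<alpha>\<close>, and the half sums of the two coordinate pairs
      change by integers.\<close>
    have "\<exists>m\<in>\<int>. coroot (\<alpha> k) \<bullet> x = 2 * m \<and> (\<forall>i<4. m * (2 * \<alpha> k $ i) \<in> \<int>) \<and>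
        m * (\<alpha> k $ 0 + \<alpha> k $ 1) \<in> \<int> \<and> m * (\<alpha> k $ 2 + \<alpha> k $ 3) \<in> \<int>"
      using roots[OF k]
    proof (cases rule: F4_rootsE)
      case (axis s i)
      have s: "s \<in> \<int>" using axis by auto
      have "x $ i \<in> \<int>" using x axis by (auto simp: S_def)
      then have m: "s * x $ i \<in> \<int>" using s by simp
      have "coroot (\<alpha> k) \<bullet> x = 2 * (s * x $ i)" unfolding co using axis xc by simp
      moreover have e: "\<alpha> k $ l \<in> \<int>" if "l < 4" for l using axis s that by simp
      have "\<forall>l<4. s * x $ i * (2 * \<alpha> k $ l) \<in> \<int>" using m e by simp
      moreover have "s * x $ i * (\<alpha> k $ 0 + \<alpha> k $ 1) \<in> \<int>" "s * x $ i * (\<alpha> k $ 2 + \<alpha> k $ 3) \<in> \<int>"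
        using m e[of 0] e[of 1] e[of 2] e[of 3] by simp_all
      ultimately show ?thesis using m by blast
    next
      case (long s t i j)
      have "\<alpha> k \<bullet> \<alpha> k = s * s + t * t"
        using long by (auto simp: scalar_prod_add_distrib[of _ 4] add_scalar_prod_distrib[of _ 4])
      then show ?thesis using short[OF k] long by auto
    next
      case (half a b c' d)
      have e: "\<alpha> k $ 0 = a" "\<alpha> k $ 1 = b" "\<alpha> k $ 2 = c'" "\<alpha> k $ 3 = d"
        unfolding half(2) by (rule vec_of_list_4)+
      have two: "2 * y \<in> \<int>" if "y \<in> {1/2, -1/2}" for y :: complex
      proof -
        have "y = 1/2 \<or> y = -1/2" using that by blast
        then show ?thesis by (elim disjE; hypsubst; simp)
      qed
      have pair: "y * u + z * v \<in> \<int> \<and> y + z \<in> \<int>"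
        if yz: "y \<in> {1/2, -1/2}" "z \<in> {1/2, -1/2}" and u: "u \<in> \<int>" "v \<in> \<int>" "(u + v) / 2 \<in> \<int>" for y z u v :: complex
      proof -
        have f: "(u - v) / 2 \<in> \<int>" using Ints_diff[OF u(3,2)] by (simp add: field_simps)
        have eqs: "1/2 * u + 1/2 * v = (u + v) / 2" "1/2 * u + -1/2 * v = (u - v) / 2"
          "-1/2 * u + 1/2 * v = - ((u - v) / 2)" "-1/2 * u + -1/2 * v = - ((u + v) / 2)"
          by (simp_all add: field_simps)
        have yz': "y = 1/2 \<or> y = -1/2" "z = 1/2 \<or> z = -1/2" using yz by blast+
        then have "y * u + z * v \<in> \<int>"
          by (elim disjE; hypsubst; simp only: eqs Ints_minus f u(3))
        moreover have "y + z \<in> \<int>" using yz' by (elim disjE; hypsubst; simp)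
        ultimately show ?thesis by blast
      qed
      define m where "m = (a * x $ 0 + b * x $ 1) + (c' * x $ 2 + d * x $ 3)"
      have in2: "a \<in> {1/2,-1/2}" "b \<in> {1/2,-1/2}" "c' \<in> {1/2,-1/2}" "d \<in> {1/2,-1/2}" using half(1) by auto
      have m: "m \<in> \<int>" unfolding m_def
        using pair[OF in2(1,2) xi(1,2) xs(1)] pair[OF in2(3,4) xi(3,4) xs(2)] by auto
      have "coroot (\<alpha> k) \<bullet> x = 2 * m"
        unfolding co m_def e[symmetric] using c xc by (simp add: scalar_prod_4 algebra_simps)
      moreover have "m * (2 * \<alpha> k $ i) \<in> \<int>" if "i < 4" for i
      proof -
        have "\<alpha> k $ i \<in> {a, b, c', d}" using less_4_cases[OF that] e by (elim disjE) blast+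
        then have "2 * \<alpha> k $ i \<in> \<int>" using two half(1) by blast
        then show ?thesis using m by simp
      qed
      moreover have "m * (a + b) \<in> \<int>" "m * (c' + d) \<in> \<int>"
        using m pair[OF in2(1,2) xi(1,2) xs(1)] pair[OF in2(3,4) xi(3,4) xs(2)] by auto
      ultimately show ?thesis using m unfolding e by blast
    qed
    then obtain m where m: "m \<in> \<int>" "coroot (\<alpha> k) \<bullet> x = 2 * m" "\<And>i. i < 4 \<Longrightarrow> m * (2 * \<alpha> k $ i) \<in> \<int>"
      "m * (\<alpha> k $ 0 + \<alpha> k $ 1) \<in> \<int>" "m * (\<alpha> k $ 2 + \<alpha> k $ 3) \<in> \<int>" by blast
    define y where "y = root_reflection (\<alpha> k) *\<^sub>v x"
    have y: "y = x - (2 * m) \<cdot>\<^sub>v \<alpha> k" using c xc m by (simp add: y_def root_reflection_mult_vec)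
    have yi: "y $ i = x $ i - m * (2 * \<alpha> k $ i)" if "i < 4" for i
      using that c xc by (simp add: y)
    have "y \<in> carrier_vec 4" using c xc by (simp add: y)
    moreover have "\<forall>i<4. y $ i \<in> \<int>" using yi m(3) x by (auto simp: S_def)
    moreover have "(y $ 0 + y $ 1) / 2 = (x $ 0 + x $ 1) / 2 - m * (\<alpha> k $ 0 + \<alpha> k $ 1)"
      "(y $ 2 + y $ 3) / 2 = (x $ 2 + x $ 3) / 2 - m * (\<alpha> k $ 2 + \<alpha> k $ 3)"
    proof -
      have "y $ 0 = x $ 0 - m * (2 * \<alpha> k $ 0)" "y $ 1 = x $ 1 - m * (2 * \<alpha> k $ 1)"
        "y $ 2 = x $ 2 - m * (2 * \<alpha> k $ 2)" "y $ 3 = x $ 3 - m * (2 * \<alpha> k $ 3)"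
        by (rule yi; simp)+
      note y' = this
      show "(y $ 0 + y $ 1) / 2 = (x $ 0 + x $ 1) / 2 - m * (\<alpha> k $ 0 + \<alpha> k $ 1)"
        "(y $ 2 + y $ 3) / 2 = (x $ 2 + x $ 3) / 2 - m * (\<alpha> k $ 2 + \<alpha> k $ 3)"
        unfolding y' by (simp_all add: field_simps)
    qed
    then have "(y $ 0 + y $ 1) / 2 \<in> \<int>" "(y $ 2 + y $ 3) / 2 \<in> \<int>"
      using Ints_diff[OF xs(1) m(4)] Ints_diff[OF xs(2) m(5)] by (simp_all only:)
    ultimately show ?thesis unfolding S_def y_def by blast
  qed
  \<comment> \<open>Reflecting e0 + e1 in e1 - e2 gives e0 + e2, whose first pair of coordinates has
    half sum 1/2.\<close>
  have "root_reflection (unit_vec 4 1 - unit_vec 4 2) *\<^sub>v (unit_vec 4 0 + unit_vec 4 1) \<in> S"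
    by (rule inv_set[OF _ inv minus_root]) (auto simp: S_def unit_vec_def)
  then have "((root_reflection (unit_vec 4 1 - unit_vec 4 2) *\<^sub>v (unit_vec 4 0 + unit_vec 4 1)) $ 0
     + (root_reflection (unit_vec 4 1 - unit_vec 4 2) *\<^sub>v (unit_vec 4 0 + unit_vec 4 1)) $ 1) / 2 \<in> \<int>"
    by (simp add: S_def)
  then have "(1/2 :: complex) \<in> \<int>"
    by (simp add: root_reflection_mult_vec coroot_def scalar_prod_4)
  then show False by auto
qed

text \<open>The span of the given roots is stable under all root reflections and contains a short
  root. Reflections lead from it to one unit vector, through the roots e_i + e_j to all unit
  vectors, and finally to the half-integral vector; these span \<open>Q_lattice\<close>.\<close>

lemma root_lattice_generated:
  shows "\<And>i. i < 4 \<Longrightarrow> unit_vec 4 i \<in> lat T \<alpha>"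
    and "vec 4 (\<lambda>_. 1/2) \<in> lat T \<alpha>"
proof -
  let ?S = "lat T \<alpha>"
  have c: "\<alpha> k \<in> carrier_vec 4" if "k < T" for k using F4_root_carrier[OF roots[OF that]] .
  have inv: "root_reflection (\<alpha> k) *\<^sub>v x \<in> ?S" if k: "k < T" and x: "x \<in> ?S" for k x
  proof -
    have "coroot (\<alpha> k) \<bullet> x \<in> \<int>"
      using coroot_carrier[OF c[OF k]] c x
      by (rule lat_int) (use F4_root_lattice(1,3)[OF roots] k in \<open>auto intro!: D_Q_int\<close>)
    then show ?thesis
      using x lat_carrier[OF x] c[OF k] lat_base[of k T \<alpha>, OF k c[OF k]]
      by (auto simp: root_reflection_mult_vec intro!: lat_diff lat_smult)
  qed
  note W = inv_set[of ?S, OF _ inv]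
  have sub: "?S \<subseteq> carrier_vec 4" using lat_carrier by blast
  have step: "\<beta> \<in> ?S" if b: "\<beta> \<in> F4_roots" "x \<in> ?S" and e: "e * (coroot \<beta> \<bullet> x) = 1" "e = 1 \<or> e = -1" for \<beta> x e
  proof -
    have "e \<cdot>\<^sub>v (x - root_reflection \<beta> *\<^sub>v x) \<in> ?S"
      using W[OF sub _ _ b] b e(2) by (intro lat_smult lat_diff) auto
    then show ?thesis
      using refl_diff[OF b(1) lat_carrier[OF b(2)]] e(1) F4_root_carrier[OF b(1)]
      by (simp add: smult_smult_assoc)
  qed
  have sgn: "s * s = 1 \<and> (s = 1 \<or> s = -1)" if "s \<in> {1,-1}" for s :: complex using that by auto
  obtain k where k: "k < T" "\<alpha> k \<bullet> \<alpha> k = 1" using short_root_exists by blast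
  have ak: "\<alpha> k \<in> ?S" using lat_base[of k T \<alpha>, OF k(1) c[OF k(1)]] .
  have "\<exists>i<4. unit_vec 4 i \<in> ?S"
    using roots[OF k(1)]
  proof (cases rule: F4_rootsE)
    case (axis s i)
    have "s \<cdot>\<^sub>v \<alpha> k \<in> ?S" using ak axis(1) by (intro lat_smult) auto
    moreover have "s \<cdot>\<^sub>v \<alpha> k = unit_vec 4 i" using axis sgn[OF axis(1)] by (simp add: smult_smult_assoc)
    ultimately show ?thesis using axis(2) by auto
  next
    case (long s t i j)
    have "\<alpha> k \<bullet> \<alpha> k = s * s + t * t"
      using long by (auto simp: scalar_prod_add_distrib[of _ 4] add_scalar_prod_distrib[of _ 4])
    then show ?thesis using k long by auto
  next
    case (half a b c' d)
    have a: "a = 1/2 \<or> a = -1/2" using half(1) by blast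
    have e: "coroot (unit_vec 4 0) \<bullet> \<alpha> k = 2 * a"
      using vec_of_list_4(1,2)[of a b c' d] unfolding half(2) by (simp add: coroot_def)
    have a2: "2 * a = 1 \<or> 2 * a = -1" using a by (elim disjE; hypsubst; simp)
    then have "(2 * a) * (coroot (unit_vec 4 0) \<bullet> \<alpha> k) = 1" unfolding e by (elim disjE) simp_all
    then have "unit_vec 4 0 \<in> ?S" using a2 by (intro step[OF axis_root ak, of _ "2 * a"]) auto
    then show ?thesis by (intro exI[of _ 0]) simp
  qed
  then obtain i0 where i0: "i0 < 4" "unit_vec 4 i0 \<in> ?S" by blast
  have units: "unit_vec 4 j \<in> ?S" if j: "j < 4" for j
  proof (cases "j = i0")
    case False
    have "coroot (unit_vec 4 i0 + unit_vec 4 j) \<bullet> unit_vec 4 i0 = 1"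
      using False j i0(1)
      by (simp add: coroot_def scalar_prod_add_distrib[of _ 4] add_scalar_prod_distrib[of _ 4])
    then have "unit_vec 4 i0 + unit_vec 4 j \<in> ?S"
      using step[OF plus_root i0(2), of i0 j 1] i0 j False by auto
    then have "(unit_vec 4 i0 + unit_vec 4 j) - unit_vec 4 i0 \<in> ?S" using i0(2) by (rule lat_diff)
    moreover have "(unit_vec 4 i0 + unit_vec 4 j) - unit_vec 4 i0 = (unit_vec 4 j :: complex vec)"
      by (intro eq_vecI) auto
    ultimately show ?thesis by simp
  qed (use i0 in simp)
  show "\<And>i. i < 4 \<Longrightarrow> unit_vec 4 i \<in> lat T \<alpha>" by (rule units)
  show "vec 4 (\<lambda>_. 1/2) \<in> lat T \<alpha>"
    by (rule step[OF half_root units[of 0], of 1]) (auto simp: coroot_def scalar_prod_4)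
qed

text \<open>The preceding argument with roots and coroots exchanged. It starts from a long root,
  which is its own coroot, and a coroot belongs to the span as soon as its root pairs to 1 or -1
  with some element.\<close>

lemma coroot_lattice_generated:
  shows "2 \<cdot>\<^sub>v unit_vec 4 3 \<in> lat T (\<lambda>k. coroot (\<alpha> k))"
    and "\<And>i. i < 3 \<Longrightarrow> unit_vec 4 i - unit_vec 4 3 \<in> lat T (\<lambda>k. coroot (\<alpha> k))"
proof -
  let ?v = "\<lambda>k. coroot (\<alpha> k)"
  let ?S = "lat T ?v"
  have c: "\<alpha> k \<in> carrier_vec 4" if "k < T" for k using F4_root_carrier[OF roots[OF that]] .
  have cc: "coroot (\<alpha> k) \<in> carrier_vec 4" if "k < T" for k using coroot_carrier[OF c[OF that]] .
  have eq: "(coroot \<beta> \<bullet> x) \<cdot>\<^sub>v \<beta> = (\<beta> \<bullet> x) \<cdot>\<^sub>v coroot \<beta>" if "\<beta> \<in> carrier_vec 4" "x \<in> carrier_vec 4" for \<beta> x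
    using that by (simp add: coroot_def smult_smult_assoc mult.commute)
  have inv: "root_reflection (\<alpha> k) *\<^sub>v x \<in> ?S" if k: "k < T" and x: "x \<in> ?S" for k x
  proof -
    have "\<alpha> k \<bullet> coroot (\<alpha> l) \<in> \<int>" if "l < T" for l
      using D_Q_int[OF F4_root_lattice(3)[OF roots[OF that]] F4_root_lattice(1)[OF roots[OF k]]]
        comm_scalar_prod[OF c[OF k] cc[OF that]] by simp
    then have "\<alpha> k \<bullet> x \<in> \<int>"
      using lat_int[of "\<alpha> k" T ?v x] c[OF k] cc x by blast
    then show ?thesis
      using x lat_carrier[OF x] c[OF k] lat_base[of k T ?v, OF k cc[OF k]]
      by (auto simp: root_reflection_mult_vec eq intro!: lat_diff lat_smult)
  qed
  note W = inv_set[of ?S, OF _ inv]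
  have sub: "?S \<subseteq> carrier_vec 4" using lat_carrier by blast
  have step: "coroot \<beta> \<in> ?S" if b: "\<beta> \<in> F4_roots" "x \<in> ?S" and e: "\<beta> \<bullet> x = 1 \<or> \<beta> \<bullet> x = -1" for \<beta> x
  proof -
    have "(\<beta> \<bullet> x) \<cdot>\<^sub>v (x - root_reflection \<beta> *\<^sub>v x) \<in> ?S"
      using W[OF sub _ _ b] b e by (intro lat_smult lat_diff) auto
    then show ?thesis
      using refl_diff[OF b(1) lat_carrier[OF b(2)]] e eq[OF F4_root_carrier[OF b(1)] lat_carrier[OF b(2)]]
      by (auto simp: smult_smult_assoc)
  qed
  obtain k where k: "k < T" "\<alpha> k \<bullet> \<alpha> k = 2" using long_root_exists by blast
  have ak: "\<alpha> k \<in> ?S" using lat_base[of k T ?v, OF k(1) cc[OF k(1)]] k c[OF k(1)] by (simp add: coroot_def)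
  obtain s t i j where st: "s \<in> {1,-1}" "t \<in> {1,-1::complex}" "i < j" "j < 4"
      "\<alpha> k = s \<cdot>\<^sub>v unit_vec 4 i + t \<cdot>\<^sub>v unit_vec 4 j"
    using roots[OF k(1)]
  proof (cases rule: F4_rootsE)
    case (axis s i)
    have "\<alpha> k \<bullet> \<alpha> k = s * s" using axis by simp
    then show ?thesis using k axis by auto
  next
    case (half a b c' d)
    have "\<alpha> k \<bullet> \<alpha> k = a * a + b * b + c' * c' + d * d"
      unfolding half(2) scalar_prod_4[OF vec_of_list_4(1) vec_of_list_4(1)] vec_of_list_4 ..
    moreover have sq: "x * x = 1/4" if "x \<in> {1/2, -1/2}" for x :: complex
    proof -
      have "x = 1/2 \<or> x = -1/2" using that by blast
      then show ?thesis by (elim disjE; hypsubst; simp)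
    qed
    have "a * a = 1/4" "b * b = 1/4" "c' * c' = 1/4" "d * d = 1/4" using half(1) sq by blast+
    ultimately have "\<alpha> k \<bullet> \<alpha> k = 1/4 + 1/4 + 1/4 + 1/4" by (simp only:)
    then show ?thesis using k(2) by simp
  qed blast
  have i4: "i < 4" and ij: "i \<noteq> j" using st by auto
  note dist = scalar_prod_add_distrib[of _ 4] add_scalar_prod_distrib[of _ 4]
    scalar_prod_minus_distrib[of _ 4] minus_scalar_prod_distrib[of _ 4]
  have long: "coroot (unit_vec 4 a - unit_vec 4 b) = unit_vec 4 a - unit_vec 4 b"
    if "a < 4" "b < 4" "a \<noteq> b" for a b
    using that by (simp add: coroot_def dist)
  have ik: "unit_vec 4 a - unit_vec 4 b \<in> ?S" if "a = i \<or> a = j" "b < 4" "b \<noteq> i" "b \<noteq> j" for a b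
  proof -
    have "(unit_vec 4 a - unit_vec 4 b) \<bullet> \<alpha> k = (if a = i then s else t)"
      using that st i4 ij by (auto simp: dist)
    then have "coroot (unit_vec 4 a - unit_vec 4 b) \<in> ?S"
      using that st(1,2,4) i4 by (intro step[OF minus_root ak]) auto
    moreover have "a < 4" using that st i4 by auto
    ultimately show ?thesis using long[of a b] that by auto
  qed
  \<comment> \<open>From the long root supported on \<open>i\<close> and \<open>j\<close>, one
    reflection reaches the differences to an index outside the support; e_i - e_j is then obtained
    by passing through \<open>b\<close>.\<close>
  obtain b where b: "b < 4" "b \<noteq> i" "b \<noteq> j"
  proof -
    have "\<exists>b\<in>{0,1,2}. b \<noteq> i \<and> b \<noteq> j" using ij by (cases "i = 0"; cases "j = 0"; cases "i = 1"; cases "j = 1") auto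
    then obtain b where "b \<in> {0,1,2}" "b \<noteq> i" "b \<noteq> j" by blast
    then show ?thesis using that[of b] by auto
  qed
  have 2: "2 \<cdot>\<^sub>v unit_vec 4 i \<in> ?S"
  proof -
    have "unit_vec 4 i \<bullet> \<alpha> k = s" using st i4 ij by (simp add: dist)
    then have "coroot (unit_vec 4 i) \<in> ?S" using st(1) by (intro step[OF axis_root[OF i4] ak]) auto
    then show ?thesis using i4 by (simp add: coroot_def)
  qed
  have from_i: "unit_vec 4 i - unit_vec 4 a \<in> ?S" if "a < 4" for a
  proof -
    consider "a = i" | "a = j" | "a \<noteq> i" "a \<noteq> j" by blast
    then show ?thesis
    proof cases
      case 1
      have "2 \<cdot>\<^sub>v unit_vec 4 i - 2 \<cdot>\<^sub>v unit_vec 4 i \<in> ?S" using 2 by (intro lat_diff)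
      moreover have "2 \<cdot>\<^sub>v unit_vec 4 i - 2 \<cdot>\<^sub>v unit_vec 4 i = unit_vec 4 i - (unit_vec 4 i :: complex vec)"
        by (intro eq_vecI) auto
      ultimately show ?thesis using 1 by simp
    next
      case 2
      have "(unit_vec 4 i - unit_vec 4 b) - (unit_vec 4 j - unit_vec 4 b) \<in> ?S"
        by (rule lat_diff[OF ik[of i b] ik[of j b]]) (use b in auto)
      moreover have "(unit_vec 4 i - unit_vec 4 b) - (unit_vec 4 j - unit_vec 4 b) = (unit_vec 4 i - unit_vec 4 j :: complex vec)"
        by (intro eq_vecI) auto
      ultimately show ?thesis using 2 by simp
    next
      case 3
      then show ?thesis using ik that by blast
    qed
  qed
  show "2 \<cdot>\<^sub>v unit_vec 4 3 \<in> ?S"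
  proof -
    have "2 \<cdot>\<^sub>v unit_vec 4 i - 2 \<cdot>\<^sub>v (unit_vec 4 i - unit_vec 4 3) \<in> ?S"
      by (rule lat_diff[OF 2 lat_smult[OF from_i]]) auto
    moreover have "2 \<cdot>\<^sub>v unit_vec 4 i - 2 \<cdot>\<^sub>v (unit_vec 4 i - unit_vec 4 3) = (2 \<cdot>\<^sub>v unit_vec 4 3 :: complex vec)"
      by (intro eq_vecI) auto
    ultimately show ?thesis by simp
  qed
  show "unit_vec 4 a - unit_vec 4 3 \<in> ?S" if "a < 3" for a
  proof -
    have "(unit_vec 4 i - unit_vec 4 3) - (unit_vec 4 i - unit_vec 4 a) \<in> ?S"
      by (rule lat_diff[OF from_i from_i]) (use that in auto)
    moreover have "(unit_vec 4 i - unit_vec 4 3) - (unit_vec 4 i - unit_vec 4 a) = (unit_vec 4 a - unit_vec 4 3 :: complex vec)"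
      by (intro eq_vecI) auto
    ultimately show ?thesis by simp
  qed
qed

lemma unimodular_pairing:
  obtains M N :: "nat \<Rightarrow> nat \<Rightarrow> int" where
    "\<forall>i<4. \<forall>j<4.
      (\<Sum>k<T. \<Sum>l<T. of_int (M i k) * (coroot (\<alpha> k) \<bullet> \<alpha> l) * of_int (N j l)) = (if i = j then 1 else 0 :: complex)"
proof -
  \<comment> \<open>The vectors \<open>p\<close> and \<open>q\<close> form dual bases of the coroot
    lattice and the root lattice. \<open>M\<close> and \<open>N\<close> will hold their coordinates
    with respect to the given coroots and roots, so that the double sum is the pairing of
    \<open>p i\<close> with \<open>q j\<close>.\<close>
  define q where "q = (\<lambda>j. if j = 3 then vec 4 (\<lambda>_. 1/2) else unit_vec 4 j :: complex vec)"
  define p where "p = (\<lambda>i. if i = 3 then 2 \<cdot>\<^sub>v unit_vec 4 3 else unit_vec 4 i - unit_vec 4 3 :: complex vec)"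
  have c: "\<alpha> k \<in> carrier_vec 4" if "k < T" for k using F4_root_carrier[OF roots[OF that]] .
  have cc: "coroot (\<alpha> k) \<in> carrier_vec 4" if "k < T" for k using coroot_carrier[OF c[OF that]] .
  have q: "q j \<in> lat T \<alpha>" if "j < 4" for j
    using root_lattice_generated that by (auto simp: q_def)
  have p: "p i \<in> lat T (\<lambda>k. coroot (\<alpha> k))" if "i < 4" for i
    using coroot_lattice_generated that by (auto simp: p_def)
  have "\<forall>j. \<exists>z :: nat \<Rightarrow> int. j < 4 \<longrightarrow> (\<forall>i<4. q j $ i = (\<Sum>k<T. of_int (z k) * \<alpha> k $ i))"
    using q by (auto simp: lat_def)
  then obtain N :: "nat \<Rightarrow> nat \<Rightarrow> int"
    where N: "\<And>j i. j < 4 \<Longrightarrow> i < 4 \<Longrightarrow> q j $ i = (\<Sum>k<T. of_int (N j k) * \<alpha> k $ i)" by metis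
  have "\<forall>j. \<exists>z :: nat \<Rightarrow> int. j < 4 \<longrightarrow> (\<forall>i<4. p j $ i = (\<Sum>k<T. of_int (z k) * coroot (\<alpha> k) $ i))"
    using p by (auto simp: lat_def)
  then obtain M :: "nat \<Rightarrow> nat \<Rightarrow> int"
    where M: "\<And>j i. j < 4 \<Longrightarrow> i < 4 \<Longrightarrow> p j $ i = (\<Sum>k<T. of_int (M j k) * coroot (\<alpha> k) $ i)" by metis
  have pc: "p i \<in> carrier_vec 4" and qc: "q i \<in> carrier_vec 4" if "i < 4" for i
    using that by (auto simp: p_def q_def)
  show thesis
  proof (rule that, intro allI impI)
    fix i j :: nat assume ij: "i < 4" "j < 4"
    have "q j \<bullet> p i = (\<Sum>k<T. of_int (M i k) * (q j \<bullet> coroot (\<alpha> k)))"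
      using qc[OF ij(2)] cc pc[OF ij(1)] M[OF ij(1)] by (rule lat_scalar_prod)
    also have "\<dots> = (\<Sum>k<T. of_int (M i k) * (\<Sum>l<T. of_int (N j l) * (coroot (\<alpha> k) \<bullet> \<alpha> l)))"
    proof (intro sum.cong refl)
      fix k assume "k \<in> {..<T}"
      then have k: "k < T" by simp
      have "coroot (\<alpha> k) \<bullet> q j = (\<Sum>l<T. of_int (N j l) * (coroot (\<alpha> k) \<bullet> \<alpha> l))"
        using cc[OF k] c qc[OF ij(2)] N[OF ij(2)] by (rule lat_scalar_prod)
      then show "of_int (M i k) * (q j \<bullet> coroot (\<alpha> k)) = of_int (M i k) * (\<Sum>l<T. of_int (N j l) * (coroot (\<alpha> k) \<bullet> \<alpha> l))"
        using comm_scalar_prod[OF qc[OF ij(2)] cc[OF k]] by simp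
    qed
    finally have "(\<Sum>k<T. \<Sum>l<T. of_int (M i k) * (coroot (\<alpha> k) \<bullet> \<alpha> l) * of_int (N j l)) = q j \<bullet> p i"
      by (simp add: sum_distrib_left mult_ac)
    also have "q j \<bullet> p i = (if i = j then 1 else 0)"
      using ij less_4_cases[OF ij(1)] less_4_cases[OF ij(2)]
      by (elim disjE) (simp_all add: q_def p_def scalar_prod_4)
    finally show "(\<Sum>k<T. \<Sum>l<T. of_int (M i k) * (coroot (\<alpha> k) \<bullet> \<alpha> l) * of_int (N j l)) = (if i = j then 1 else 0 :: complex)" .
  qed
qed

end

section \<open>Eigenvectors of products of reflections\<close>

definition cartan :: "(nat \<Rightarrow> complex vec) \<Rightarrow> nat \<Rightarrow> nat \<Rightarrow> complex" where
  "cartan \<alpha> k l = coroot (\<alpha> k) \<bullet> \<alpha> l"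

text \<open>For \<open>C\<close> with diagonal 2 this is \<open>U + lam * L\<close>, where
  \<open>C = U + L\<close> is the splitting into unipotent upper and lower triangular parts, in
  analogy to Seifert forms in knot theory. The diagonal is \<open>1 + lam\<close> whatever the
  diagonal of \<open>C\<close> is.\<close>

definition seifert :: "complex \<Rightarrow> (nat \<Rightarrow> nat \<Rightarrow> complex) \<Rightarrow> nat \<Rightarrow> nat \<Rightarrow> complex" where
  "seifert lam C k l = (if l < k then lam * C k l else if l = k then 1 + lam else C k l)"

lemma cartan_diag: "\<alpha> k \<in> F4_roots \<Longrightarrow> cartan \<alpha> k k = 2"
  using F4_root_nonzero F4_root_carrier by (simp add: cartan_def coroot_def)

lemma cartan_int: "\<alpha> k \<in> F4_roots \<Longrightarrow> \<alpha> l \<in> F4_roots \<Longrightarrow> cartan \<alpha> k l \<in> \<int>"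
  unfolding cartan_def by (intro D_Q_int F4_root_lattice)

text \<open>When the reflections are applied to \<open>v\<close> from right to left, the one with
  index \<open>k\<close> subtracts this multiple of \<open>\<alpha> k\<close>; the list is dropped
  up to \<open>Suc k\<close> because the pairing is taken just before that reflection acts.\<close>

definition eigen_coord :: "nat \<Rightarrow> (nat \<Rightarrow> complex vec) \<Rightarrow> complex vec \<Rightarrow> nat \<Rightarrow> complex" where
  "eigen_coord T \<alpha> v k =
     coroot (\<alpha> k) \<bullet> (tuple_prod 4 (drop (Suc k) (map (\<lambda>k. root_reflection (\<alpha> k)) [0..<T])) *\<^sub>v v)"

lemma tuple_prod_carrier:
  "set As \<subseteq> carrier_mat n n \<Longrightarrow> tuple_prod n As \<in> carrier_mat n n"
  by (induction As) (auto simp: tuple_prod_def)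

text \<open>Let \<open>w k\<close> be the result of the factors from index \<open>k\<close> on.
  Telescoping from \<open>w T = v\<close> to \<open>w 0 = v / lam\<close> gives the first equation,
  by which the coordinates determine \<open>v\<close>. Inserting it into the telescoped
  \<open>w (Suc k)\<close> and pairing with the coroot of index \<open>k\<close> gives row
  \<open>k\<close> of the kernel equation.\<close>

lemma eigen_coord:
  fixes T \<alpha>
  defines "As \<equiv> map (\<lambda>k. root_reflection (\<alpha> k)) [0..<T]"
  assumes roots: "\<And>k. k < T \<Longrightarrow> \<alpha> k \<in> F4_roots" and lam: "lam \<noteq> 0" "lam \<noteq> 1"
    and v: "v \<in> carrier_vec 4" "tuple_prod 4 As *\<^sub>v v = (1 / lam) \<cdot>\<^sub>v v"
  shows "\<And>i. i < 4 \<Longrightarrow> (\<Sum>l<T. eigen_coord T \<alpha> v l * \<alpha> l $ i) = (1 - 1 / lam) * v $ i"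
    and "\<And>k. k < T \<Longrightarrow> (\<Sum>l<T. seifert lam (cartan \<alpha>) k l * eigen_coord T \<alpha> v l) = 0"
proof -
  define y where "y = eigen_coord T \<alpha> v"
  define w where "w = (\<lambda>k. tuple_prod 4 (drop k As) *\<^sub>v v)"
  have len: "length As = T" by (simp add: As_def)
  have c: "\<alpha> k \<in> carrier_vec 4" if "k < T" for k using F4_root_carrier[OF roots[OF that]] .
  have tc: "tuple_prod 4 (drop k As) \<in> carrier_mat 4 4" for k
    by (rule tuple_prod_carrier) (auto simp: As_def root_reflection_carrier dest!: in_set_dropD)
  have wc: "w k \<in> carrier_vec 4" for k
    unfolding w_def by (rule mult_mat_vec_carrier[OF tc v(1)])
  have wT: "w T = v" using v by (simp add: w_def len tuple_prod_Nil)
  have w0: "w 0 = (1 / lam) \<cdot>\<^sub>v v" using v by (simp add: w_def)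
  have yw: "y k = coroot (\<alpha> k) \<bullet> w (Suc k)" for k
    by (simp add: y_def eigen_coord_def w_def As_def)
  have step: "w k $ i = w (Suc k) $ i - y k * \<alpha> k $ i" if k: "k < T" and i: "i < 4" for k i
  proof -
    have "drop k As = As ! k # drop (Suc k) As" using k len by (simp add: Cons_nth_drop_Suc)
    then have "w k = root_reflection (\<alpha> k) *\<^sub>v w (Suc k)"
      using k v(1) tc[of "Suc k"]
      by (simp add: w_def tuple_prod_Cons As_def assoc_mult_mat_vec[OF root_reflection_carrier _ v(1)])
    then show ?thesis
      using root_reflection_mult_vec[OF c[OF k] wc[of "Suc k"]] wc c[OF k] i by (simp add: yw)
  qed
  have tele: "w k $ i = v $ i - (\<Sum>l\<in>{k..<T}. y l * \<alpha> l $ i)" if "k \<le> T" "i < 4" for k i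
    using that(1)
  proof (induction rule: inc_induct)
    case base
    then show ?case by (simp add: wT)
  next
    case (step n)
    then have "{n..<T} = insert n {Suc n..<T}" by auto
    then show ?case using step \<open>n < T\<close> by (simp add: \<open>\<And>k i. k < T \<Longrightarrow> i < 4 \<Longrightarrow> w k $ i = w (Suc k) $ i - y k * \<alpha> k $ i\<close> that)
  qed
  have all: "(\<Sum>l<T. y l * \<alpha> l $ i) = (1 - 1 / lam) * v $ i" if "i < 4" for i
    using tele[of 0 i] that w0 v(1) by (simp add: atLeast0LessThan algebra_simps)
  then show "\<And>i. i < 4 \<Longrightarrow> (\<Sum>l<T. eigen_coord T \<alpha> v l * \<alpha> l $ i) = (1 - 1 / lam) * v $ i"
    by (simp add: y_def)
  fix k assume k: "k < T"
  \<comment> \<open>The first equation expresses \<open>v\<close> by the full sum; the terms up to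
    \<open>k\<close> thereby acquire the weight \<open>lam\<close>, the later ones the weight
    1.\<close>
  have *: "((lam - 1) \<cdot>\<^sub>v w (Suc k)) $ i = (\<Sum>l<T. ((if l \<le> k then lam else 1) * y l) * \<alpha> l $ i)" if i: "i < 4" for i
  proof -
    have "(lam - 1) * v $ i = lam * (\<Sum>l<T. y l * \<alpha> l $ i)"
      using all[OF i] lam by (simp add: field_simps)
    then have "((lam - 1) \<cdot>\<^sub>v w (Suc k)) $ i = lam * (\<Sum>l<T. y l * \<alpha> l $ i) - (lam - 1) * (\<Sum>l\<in>{Suc k..<T}. y l * \<alpha> l $ i)"
      using tele[of "Suc k" i] k i wc[of "Suc k"] by (simp add: right_diff_distrib)
    also have "(\<Sum>l\<in>{Suc k..<T}. y l * \<alpha> l $ i) = (\<Sum>l<T. if l \<le> k then 0 else y l * \<alpha> l $ i)"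
      by (rule sum.mono_neutral_cong_left) auto
    finally show ?thesis
      by (simp add: sum_distrib_left sum_subtractf[symmetric]) (intro sum.cong, auto simp: algebra_simps)
  qed
  have "coroot (\<alpha> k) \<bullet> ((lam - 1) \<cdot>\<^sub>v w (Suc k)) =
      (\<Sum>l<T. ((if l \<le> k then lam else 1) * y l) * (coroot (\<alpha> k) \<bullet> \<alpha> l))"
    using coroot_carrier[OF c[OF k]] c _ * by (rule lat_scalar_prod) (use wc in auto)
  then have "(lam - 1) * y k = (\<Sum>l<T. ((if l \<le> k then lam else 1) * y l) * cartan \<alpha> k l)"
    using coroot_carrier[OF c[OF k]] wc[of "Suc k"] by (simp add: yw cartan_def)
  also have "\<dots> = (\<Sum>l<T. seifert lam (cartan \<alpha>) k l * y l + (if l = k then (lam - 1) * y k else 0))"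
    using cartan_diag[of \<alpha> k, OF roots[OF k]] by (intro sum.cong) (auto simp: seifert_def algebra_simps)
  also have "\<dots> = (\<Sum>l<T. seifert lam (cartan \<alpha>) k l * y l) + (lam - 1) * y k"
    using k by (simp add: sum.distrib)
  finally show "(\<Sum>l<T. seifert lam (cartan \<alpha>) k l * eigen_coord T \<alpha> v l) = 0" by (simp add: y_def)
qed

lemma singular_zero_row:
  fixes Z :: "complex mat"
  assumes "Z \<in> carrier_mat n n" "r < n" "\<And>j. j < n \<Longrightarrow> Z $$ (r,j) = 0"
  shows "det Z = 0"
proof -
  have "transpose_mat Z *\<^sub>v unit_vec n r = 0\<^sub>v n"
    using assms by (intro eq_vecI) auto
  moreover have "unit_vec n r \<in> carrier_vec n" "unit_vec n r \<noteq> (0\<^sub>v n :: complex vec)"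
    using assms(2) by auto
  moreover have "transpose_mat Z \<in> carrier_mat n n" using assms by simp
  ultimately have "det (transpose_mat Z) = 0" using det_0_iff_vec_prod_zero by blast
  then show ?thesis using det_transpose[OF assms(1)] by simp
qed

lemma reciprocal_root:
  fixes x z :: complex
  assumes "p0 + p1 * z + p2 * z^2 + p3 * z^3 + z^4 = 0" "x * z = -1"
  shows "1 + - p3 * x + p2 * x^2 + - p1 * x^3 + p0 * x^4 = 0"
proof -
  have "x^4 * z = x^3 * (x * z)" "x^4 * z^2 = x^2 * (x * z)^2" "x^4 * z^3 = x * (x * z)^3" "x^4 * z^4 = (x * z)^4"
    by (simp_all add: power4_eq_xxxx power3_eq_cube power2_eq_square mult_ac)
  then have "x^4 * z = - (x^3)" "x^4 * z^2 = x^2" "x^4 * z^3 = - x" "x^4 * z^4 = 1"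
    unfolding assms(2) by simp_all
  moreover have "p0 * x^4 + p1 * (x^4 * z) + p2 * (x^4 * z^2) + p3 * (x^4 * z^3) + x^4 * z^4 =
      x^4 * (p0 + p1 * z + p2 * z^2 + p3 * z^3 + z^4)"
    by (simp add: algebra_simps)
  ultimately show ?thesis unfolding assms(1) by (simp add: algebra_simps)
qed

text \<open>Modulo \<open>lam - 1\<close> the matrix \<open>F\<close> is the Cartan matrix, which is unimodular on the lattice, while
  \<open>F\<close> has a kernel of dimension two. This makes \<open>1 / (1 - lam)\<close> an algebraic integer.\<close>

lemma kernel_integral_relation:
  fixes C :: "nat \<Rightarrow> nat \<Rightarrow> complex" and M N :: "nat \<Rightarrow> nat \<Rightarrow> int"
  assumes T: "T \<le> 5" and lam: "lam \<noteq> 1"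
    and Cint: "\<And>k l. k < T \<Longrightarrow> l < T \<Longrightarrow> C k l \<in> \<int>" and C2: "\<And>k. k < T \<Longrightarrow> C k k = 2"
    and MN: "\<And>i j. i < 4 \<Longrightarrow> j < 4 \<Longrightarrow>
      (\<Sum>k<T. \<Sum>l<T. of_int (M i k) * C k l * of_int (N j l)) = (if i = j then 1 else 0)"
    and y: "\<And>k. k < T \<Longrightarrow> (\<Sum>l<T. seifert lam C k l * y l) = 0"
    and y': "\<And>k. k < T \<Longrightarrow> (\<Sum>l<T. seifert lam C k l * y' l) = 0"
    and indep: "\<And>a b. (\<And>l. l < T \<Longrightarrow> a * y l + b * y' l = 0) \<Longrightarrow> a = 0 \<and> b = 0"
  obtains a b c d :: int where
    "1 + of_int a * (lam - 1) + of_int b * (lam - 1)^2 + of_int c * (lam - 1)^3 + of_int d * (lam - 1)^4 = 0"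
proof -
  \<comment> \<open>Four integral vectors from \<open>N\<close> and two kernel vectors are six
    vectors with at most five coordinates, hence dependent. Padding with zero rows turns this into a
    vanishing 6 x 6 determinant; the last row is zero because \<open>T \<le> 5\<close>.\<close>
  define Z where "Z = mat 6 6 (\<lambda>(l,j). if T \<le> l then 0 else if j < 4 then of_int (N j l) else if j = 4 then y l else y' l)"
  have Z: "Z \<in> carrier_mat 6 6" by (simp add: Z_def)
  have "det Z = 0" using T by (intro singular_zero_row[OF Z, of 5]) (auto simp: Z_def)
  then obtain v where v: "v \<in> carrier_vec 6" "v \<noteq> 0\<^sub>v 6" "Z *\<^sub>v v = 0\<^sub>v 6"
    using det_0_iff_vec_prod_zero[OF Z] by blast
  have dep: "(\<Sum>j<4. of_int (N j l) * v $ j) + y l * v $ 4 + y' l * v $ 5 = 0" if "l < T" for l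
  proof -
    have "(Z *\<^sub>v v) $ l = 0" using v(3) that T by simp
    then have "(\<Sum>j<6. Z $$ (l,j) * v $ j) = 0"
      using Z v(1) that T by (simp add: scalar_prod_def atLeast0LessThan)
    then show ?thesis using that T by (simp add: Z_def eval_nat_numeral)
  qed
  define x where "x = vec 4 (\<lambda>j. v $ j)"
  \<comment> \<open>A dependency among the two kernel vectors alone contradicts their
    independence.\<close>
  have xnz: "x \<noteq> 0\<^sub>v 4"
  proof
    assume "x = 0\<^sub>v 4"
    then have v0: "v $ j = 0" if "j < 4" for j using that by (metis index_vec index_zero_vec(1) x_def)
    have "v $ 4 * y l + v $ 5 * y' l = 0" if "l < T" for l
      using dep[OF that] v0 by (simp add: mult.commute)
    then have "v $ 4 = 0 \<and> v $ 5 = 0" by (rule indep)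
    moreover have "j < 4 \<or> j = 4 \<or> j = 5" if "j < 6" for j :: nat using that by linarith
    ultimately have vj: "v $ j = 0" if "j < 6" for j using v0 that by metis
    have "v = 0\<^sub>v 6"
    proof (rule eq_vecI)
      show "v $ i = 0\<^sub>v 6 $ i" if "i < dim_vec (0\<^sub>v 6)" for i using vj[of i] that by simp
      show "dim_vec v = dim_vec (0\<^sub>v 6)" using v(1) by simp
    qed
    then show False using v(2) by blast
  qed
  define Lw where "Lw = (\<lambda>k l. if l < k then C k l else if l = k then 1 else 0)"
  have FL: "seifert lam C k l = C k l + (lam - 1) * Lw k l" if "k < T" for k l
    using C2[OF that] by (simp add: seifert_def Lw_def algebra_simps)
  have Lint: "Lw k l \<in> \<int>" if "k < T" "l < T" for k l using Cint[OF that] by (simp add: Lw_def)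
  have "\<exists>z :: int. of_int z = (\<Sum>k<T. \<Sum>l<T. of_int (M i k) * Lw k l * of_int (N j l))" for i j
  proof -
    have "(\<Sum>k<T. \<Sum>l<T. of_int (M i k) * Lw k l * of_int (N j l)) \<in> \<int>"
      using Lint by (intro Ints_sum Ints_mult) auto
    then obtain z where "(\<Sum>k<T. \<Sum>l<T. of_int (M i k) * Lw k l * of_int (N j l)) = of_int z"
      by (rule Ints_cases)
    then show ?thesis by (intro exI[of _ z]) (rule sym)
  qed
  then obtain K :: "nat \<Rightarrow> nat \<Rightarrow> int" where
    K: "\<And>i j. of_int (K i j) = (\<Sum>k<T. \<Sum>l<T. of_int (M i k) * Lw k l * of_int (N j l))" by metis
  \<comment> \<open>The combination of the vectors of \<open>N\<close> with coefficients
    \<open>x\<close> lies in the kernel of \<open>F = C + (lam - 1) * Lw\<close>. Applying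
    \<open>M\<close> and using that \<open>M C N\<close> is the identity leaves
    \<open>x + (lam - 1) K x = 0\<close>.\<close>
  have rel: "x $ i + (lam - 1) * (\<Sum>j<4. of_int (K i j) * x $ j) = 0" if i: "i < 4" for i
  proof -
    have "(\<Sum>l<T. seifert lam C k l * (\<Sum>j<4. of_int (N j l) * v $ j)) = 0" if k: "k < T" for k
    proof -
      have "(\<Sum>l<T. seifert lam C k l * (\<Sum>j<4. of_int (N j l) * v $ j)) =
          (\<Sum>l<T. - v $ 4 * (seifert lam C k l * y l) - v $ 5 * (seifert lam C k l * y' l))"
      proof (intro sum.cong refl)
        fix l assume "l \<in> {..<T}"
        then have eq: "(\<Sum>j<4. of_int (N j l) * v $ j) = - v $ 4 * y l - v $ 5 * y' l"
          using dep[of l] by (simp add: add_eq_0_iff algebra_simps)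
        show "seifert lam C k l * (\<Sum>j<4. of_int (N j l) * v $ j) = - v $ 4 * (seifert lam C k l * y l) - v $ 5 * (seifert lam C k l * y' l)"
          unfolding eq by (simp add: algebra_simps)
      qed
      also have "\<dots> = - v $ 4 * (\<Sum>l<T. seifert lam C k l * y l) - v $ 5 * (\<Sum>l<T. seifert lam C k l * y' l)"
        by (simp add: sum_subtractf sum_distrib_left sum_negf)
      finally show ?thesis using y[OF k] y'[OF k] by simp
    qed
    then have "(\<Sum>k<T. of_int (M i k) * (\<Sum>l<T. seifert lam C k l * (\<Sum>j<4. of_int (N j l) * v $ j))) = 0"
      by simp
    also have "(\<Sum>k<T. of_int (M i k) * (\<Sum>l<T. seifert lam C k l * (\<Sum>j<4. of_int (N j l) * v $ j))) =
        (\<Sum>k<T. \<Sum>l<T. \<Sum>j<4. (of_int (M i k) * C k l * of_int (N j l) + (lam - 1) * (of_int (M i k) * Lw k l * of_int (N j l))) * v $ j)"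
      by (intro sum.cong refl) (auto simp: FL sum_distrib_left algebra_simps)
    also have "\<dots> = (\<Sum>j<4. \<Sum>k<T. \<Sum>l<T. (of_int (M i k) * C k l * of_int (N j l) + (lam - 1) * (of_int (M i k) * Lw k l * of_int (N j l))) * v $ j)"
      by (simp only: sum.swap[of _ "{..<4::nat}"])
    also have "\<dots> = (\<Sum>j<4. ((\<Sum>k<T. \<Sum>l<T. of_int (M i k) * C k l * of_int (N j l)) + (lam - 1) * of_int (K i j)) * v $ j)"
      unfolding K by (simp add: sum.distrib sum_distrib_left sum_distrib_right distrib_right)
    also have "\<dots> = (\<Sum>j<4. ((if i = j then 1 else 0) + (lam - 1) * of_int (K i j)) * v $ j)"
      using MN[OF i] by (intro sum.cong) auto
    also have "\<dots> = v $ i + (lam - 1) * (\<Sum>j<4. of_int (K i j) * v $ j)"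
      using i by (simp add: distrib_right sum.distrib sum_distrib_left if_distrib[of "\<lambda>z. z * _"] mult.assoc cong: if_cong)
    finally show ?thesis using i by (simp add: x_def)
  qed
  define Km where "Km = mat 4 4 (\<lambda>(i,j). K i j)"
  \<comment> \<open>By \<open>rel\<close> this is an eigenvalue of the integer matrix
    \<open>K\<close>, so it satisfies a monic integer equation of degree four.\<close>
  define z where "z = - 1 / (lam - 1)"
  have Kc: "Km \<in> carrier_mat 4 4" by (simp add: Km_def)
  define Kx where "Kx = map_mat complex_of_int Km"
  have Kxc: "Kx \<in> carrier_mat 4 4" using Kc by (simp add: Kx_def)
  have "Kx *\<^sub>v x = z \<cdot>\<^sub>v x"
  proof (rule eq_vecI)
    fix i assume "i < dim_vec (z \<cdot>\<^sub>v x)"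
    then have i: "i < 4" by (simp add: x_def)
    have "(Kx *\<^sub>v x) $ i = (\<Sum>j<4. of_int (K i j) * x $ j)"
      using i by (simp add: Kx_def Km_def scalar_prod_def atLeast0LessThan x_def)
    also have "\<dots> = z * x $ i" using rel[OF i] lam by (simp add: z_def field_simps add_eq_0_iff)
    finally show "(Kx *\<^sub>v x) $ i = (z \<cdot>\<^sub>v x) $ i" using i by (simp add: x_def)
  qed (use Kxc in \<open>simp add: x_def\<close>)
  then have "eigenvalue Kx z"
    unfolding eigenvalue_def eigenvector_def using xnz Kxc by (intro exI[of _ x]) (auto simp: x_def)
  then have root: "poly (char_poly Kx) z = 0" using eigenvalue_root_char_poly[OF Kxc] by blast
  have cp: "char_poly Kx = map_poly of_int (char_poly Km)"
    unfolding Kx_def by (rule of_int_hom.char_poly_hom[OF Kc])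
  have mon: "Polynomial.degree (char_poly Kx) = 4" "Polynomial.coeff (char_poly Kx) 4 = 1"
    using degree_monic_char_poly[OF Kxc] by auto
  define p where "p = Polynomial.coeff (char_poly Km)"
  have "(\<Sum>i\<le>4. Polynomial.coeff (char_poly Kx) i * z ^ i) = 0"
    using root unfolding poly_altdef mon(1) .
  moreover have "Polynomial.coeff (char_poly Kx) i = of_int (p i)" for i
    unfolding cp p_def by (simp add: coeff_map_poly)
  moreover have "of_int (p 4) = (1 :: complex)" using mon(2) calculation(2)[of 4] by simp
  ultimately have "of_int (p 0) + of_int (p 1) * z + of_int (p 2) * z^2 + of_int (p 3) * z^3 + z^4 = 0"
    by (simp add: eval_nat_numeral)
  moreover have "(lam - 1) * z = -1" using lam by (simp add: z_def)
  ultimately have "1 + - of_int (p 3) * (lam - 1) + of_int (p 2) * (lam - 1)^2 + - of_int (p 1) * (lam - 1)^3 + of_int (p 0) * (lam - 1)^4 = 0"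
    by (intro reciprocal_root)
  then have "1 + of_int (- p 3) * (lam - 1) + of_int (p 2) * (lam - 1)^2 + of_int (- p 1) * (lam - 1)^3 + of_int (p 0) * (lam - 1)^4 = 0"
    by simp
  then show thesis by (rule that)
qed

text \<open>For \<open>lam = -1\<close> the left-hand side is an odd integer.\<close>

lemma integral_relation_minus_one:
  fixes a b c d :: int
  assumes "1 + of_int a * (lam - 1) + of_int b * (lam - 1)^2 + of_int c * (lam - 1)^3 + of_int d * (lam - 1)^4 = 0"
  shows "lam \<noteq> (-1 :: complex)"
proof
  assume "lam = -1"
  then have "complex_of_int (1 - 2 * a + 4 * b - 8 * c + 16 * d) = of_int 0"
    using assms by (simp add: algebra_simps)
  then have "1 - 2 * a + 4 * b - 8 * c + 16 * d = 0" by (simp only: of_int_eq_iff)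
  then show False by presburger
qed

text \<open>For \<open>x = lam - 1\<close> and \<open>k = 4 - m\<close> the quadratic equation reads
  \<open>x^2 = - k x - k\<close>. After reduction of the powers of \<open>x\<close>, every term
  except the initial 1 contributes a multiple of \<open>k\<close> to the constant coefficient. As 1
  and the nonreal \<open>x\<close> are independent over the reals, this coefficient is zero and
  \<open>k\<close> divides 1.\<close>

lemma integral_relation_nonreal:
  fixes a b c d m :: int and lam :: complex
  assumes rel: "1 + of_int a * (lam - 1) + of_int b * (lam - 1)^2 + of_int c * (lam - 1)^3 + of_int d * (lam - 1)^4 = 0"
    and quad: "lam^2 + (2 - of_int m) * lam + 1 = 0" and nr: "Im lam \<noteq> 0" and m: "0 < m" "m < 4"
  shows "m = 3"
proof -
  define x where "x = lam - 1"
  define k where "k = 4 - m"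
  have x2: "x^2 = - (of_int k * x) - of_int k"
    using quad unfolding x_def k_def by (simp add: algebra_simps power2_eq_square add_eq_0_iff) algebra
  have x3: "x^3 = of_int (k * k - k) * x + of_int (k * k)"
  proof -
    have "x^3 = x * (- (of_int k * x) - of_int k)" unfolding x2[symmetric] by (simp add: eval_nat_numeral)
    also have "\<dots> = - of_int k * x^2 - of_int k * x" by (simp add: algebra_simps power2_eq_square)
    finally show ?thesis unfolding x2 by (simp add: algebra_simps)
  qed
  have x4: "x^4 = of_int (2 * k * k - k * k * k) * x + of_int (k * k - k * k * k)"
  proof -
    have "x^4 = x * (of_int (k * k - k) * x + of_int (k * k))"
      unfolding x3[symmetric] by (simp add: eval_nat_numeral)
    also have "\<dots> = of_int (k * k - k) * x^2 + of_int (k * k) * x" by (simp add: algebra_simps power2_eq_square)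
    finally show ?thesis unfolding x2 by (simp add: algebra_simps)
  qed
  define A where "A = 1 - b * k + c * (k * k) + d * (k * k - k * k * k)"
  define B where "B = a - b * k + c * (k * k - k) + d * (2 * k * k - k * k * k)"
  have "of_int A + of_int B * x = 0"
    using rel unfolding x_def[symmetric] x2 x3 x4 A_def B_def by (simp add: algebra_simps)
  then have "Im (of_int A + of_int B * x) = 0" "Re (of_int A + of_int B * x) = 0" by simp_all
  moreover have "Im x \<noteq> 0" using nr by (simp add: x_def)
  ultimately have "of_int A = (0 :: real)" by auto
  then have "A = 0" by simp
  then have "1 = k * (b - c * k - d * (k - k * k))" by (simp add: A_def algebra_simps)
  then have "k dvd 1" by (rule dvdI)
  then have "k = 1" using m by (auto simp: k_def)
  then show ?thesis by (simp add: k_def)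
qed

section \<open>Types of nice tuples\<close>

lemma G28_closed: "A \<in> G28 \<Longrightarrow> B \<in> G28 \<Longrightarrow> A * B \<in> G28" "1\<^sub>m 4 \<in> G28" "A \<in> G28 \<Longrightarrow> inv\<^bsub>GL 4\<^esub> A \<in> G28"
  using subgroup.m_closed[OF G28_sub_GL(2)] subgroup.one_closed[OF G28_sub_GL(2)]
    subgroup.m_inv_closed[OF G28_sub_GL(2)] by (auto simp: GL_simps)

lemma tuple_prod_G28: "set As \<subseteq> G28 \<Longrightarrow> tuple_prod 4 As \<in> G28"
  by (induction As) (auto simp: tuple_prod_Nil tuple_prod_Cons G28_closed)

lemma inv_prod_G28: "set As \<subseteq> G28 \<Longrightarrow> inv_prod 4 As \<in> G28"
  unfolding inv_prod_def by (intro G28_closed tuple_prod_G28)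

lemma nice_tuple_roots:
  assumes "nice_tuple 4 G28 As" and T: "length As = T"
  obtains \<alpha> where "As = map (\<lambda>k. root_reflection (\<alpha> k)) [0..<T]" "generating_roots T \<alpha>"
proof -
  have "\<exists>\<alpha>. \<alpha> \<in> F4_roots \<and> As ! k = root_reflection \<alpha>" if "k < T" for k
  proof -
    have "As ! k \<in> G28" "reflection 4 (As ! k)" using assms that by (auto simp: nice_tuple_def)
    then show ?thesis using reflection_in_G28 by metis
  qed
  then obtain \<alpha> where \<alpha>: "\<And>k. k < T \<Longrightarrow> \<alpha> k \<in> F4_roots \<and> As ! k = root_reflection (\<alpha> k)" by metis
  have As: "As = map (\<lambda>k. root_reflection (\<alpha> k)) [0..<T]"
    using \<alpha> T by (intro nth_equalityI) auto
  have "set As = (\<lambda>k. root_reflection (\<alpha> k)) ` {..<T}" unfolding As by (auto simp: atLeast0LessThan)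
  then have "generating_roots T \<alpha>"
    using assms(1) \<alpha> unfolding nice_tuple_def generating_roots_def by simp
  then show thesis using As that by blast
qed

lemma eigenvalue_norm_1:
  fixes A :: "complex mat"
  assumes A: "A \<in> carrier_mat n n" and k: "k > 0" "A ^\<^sub>m k = 1\<^sub>m n" and ev: "eigenvalue A lam"
  shows "norm lam = 1"
proof -
  obtain v where v: "v \<in> carrier_vec n" "v \<noteq> 0\<^sub>v n" "A *\<^sub>v v = lam \<cdot>\<^sub>v v"
    using ev A unfolding eigenvalue_def eigenvector_def by auto
  have pow: "A ^\<^sub>m j *\<^sub>v v = lam ^ j \<cdot>\<^sub>v v" for j
  proof (induction j)
    case (Suc j)
    have P: "A ^\<^sub>m j \<in> carrier_mat n n" using A by simp
    show ?case using Suc v A by (simp add: assoc_mult_mat_vec[OF P A v(1)] mult_mat_vec[OF P v(1)] smult_smult_assoc)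
  qed (use A v in auto)
  obtain i where i: "i < n" "v $ i \<noteq> 0" using v(1,2) by (rule nonzero_vec_index)
  have "v = lam ^ k \<cdot>\<^sub>v v" using pow[of k] k(2) v(1) by simp
  then have "v $ i = (lam ^ k \<cdot>\<^sub>v v) $ i" by simp
  then have "lam ^ k = 1" using i v(1) by simp
  then have "norm lam ^ k = 1" by (metis norm_one norm_power)
  then show ?thesis using k(1) power_eq_imp_eq_base[of "norm lam" k 1] by simp
qed

text \<open>The entries are halves of integers, hence real, so conjugation preserves the eigenvalues
  with their multiplicities; finite order puts them on the unit circle.\<close>

lemma G28_spectrum:
  assumes h: "h \<in> G28"
  obtains P R d where "P \<in> carrier_mat 4 4" "R \<in> carrier_mat 4 4" "R * P = 1\<^sub>m 4" "h * P = P * mat_diag 4 d"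
    "char_poly h = (\<Prod>i<4. [:- d i, 1:])"
    "\<forall>x. card {i. i < 4 \<and> d i = cnj x} = card {i. i < (4::nat) \<and> d i = x}"
    "\<forall>i<4. norm (d i) = 1"
proof -
  have c: "h \<in> carrier_mat 4 4" by (rule G28_props(1)[OF h])
  obtain k where k: "k > 0" "h ^\<^sub>m k = 1\<^sub>m 4" using G28_finite_order[OF h] by blast
  from finite_order_diagonalizable[OF c k]
  obtain P R d where P: "P \<in> carrier_mat 4 4" and R: "R \<in> carrier_mat 4 4"
    and PR: "P * R = 1\<^sub>m 4" and RP: "R * P = 1\<^sub>m 4"
    and hPR: "h = P * mat_diag 4 d * R" and cp: "char_poly h = (\<Prod>i<4. [:- d i, 1:])" by blast
  have D: "mat_diag 4 d \<in> carrier_mat 4 4" by simp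
  have "h * P = P * mat_diag 4 d * (R * P)"
    unfolding hPR using P R D by (intro assoc_mult_mat[of _ 4 4 _ 4 _ 4]) auto
  then have hP: "h * P = P * mat_diag 4 d" using RP P D by simp
  have real: "map_mat cnj h = h"
  proof (rule eq_matI)
    fix i j assume "i < dim_row h" "j < dim_col h"
    then have ij: "i < 4" "j < 4" using c by auto
    obtain z where "2 * h $$ (i,j) = of_int z" using G28_entry[OF h ij] by (rule Ints_cases)
    then have eq: "h $$ (i,j) = of_int z / 2" by (simp add: field_simps)
    show "map_mat cnj h $$ (i,j) = h $$ (i,j)" using c ij by (simp add: eq)
  qed auto
  interpret cnj: comm_ring_hom cnj by unfold_locales auto
  interpret mp: map_poly_comm_ring_hom cnj ..
  have "char_poly h = map_poly cnj (char_poly h)" using cnj.char_poly_hom[OF c] real by simp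
  also have "\<dots> = (\<Prod>i<4. map_poly cnj [:- d i, 1:])"
    unfolding cp by (rule mp.hom_prod)
  also have "\<dots> = (\<Prod>i<4. [:- cnj (d i), 1:])" by simp
  finally have cp': "char_poly h = (\<Prod>i<4. [:- cnj (d i), 1:])" .
  have conj: "card {i. i < 4 \<and> d i = cnj x} = card {i. i < (4::nat) \<and> d i = x}" for x
  proof -
    have "card {i. i < (4::nat) \<and> d i = x} = Polynomial.order x (char_poly h)"
      unfolding cp by (rule order_prod_linear[symmetric])
    also have "\<dots> = card {i. i < (4::nat) \<and> cnj (d i) = x}"
      unfolding cp' by (rule order_prod_linear)
    also have "{i. i < (4::nat) \<and> cnj (d i) = x} = {i. i < 4 \<and> d i = cnj x}" by auto
    finally show ?thesis by simp
  qed
  have "norm (d i) = 1" if "i < 4" for i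
  proof (rule eigenvalue_norm_1[OF c k])
    show "eigenvalue h (d i)"
      unfolding eigenvalue_root_char_poly[OF c] cp using that by (auto simp: poly_prod prod_zero_iff)
  qed
  then show thesis using that[OF P R RP hP cp] conj by blast
qed

text \<open>By diagonalizability, multiplicity at least two yields two columns of \<open>P\<close>
  as eigenvectors. Their coordinates \<open>eigen_coord\<close> are independent because they recover
  the vectors up to the nonzero factor \<open>1 - 1 / lam\<close>.\<close>

lemma G28_kernel:
  assumes roots: "\<And>k. k < T \<Longrightarrow> \<alpha> k \<in> F4_roots"
    and As: "As = map (\<lambda>k. root_reflection (\<alpha> k)) [0..<T]"
    and ord: "Polynomial.order lam (char_poly (inv_prod 4 As)) \<ge> 2" and lam1: "lam \<noteq> 1"
  obtains y y' where
    "\<forall>k<T. (\<Sum>l<T. seifert lam (cartan \<alpha>) k l * y l) = 0"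
    "\<forall>k<T. (\<Sum>l<T. seifert lam (cartan \<alpha>) k l * y' l) = 0"
    "\<forall>a b. (\<forall>l<T. a * y l + b * y' l = 0) \<longrightarrow> a = 0 \<and> b = 0"
proof -
  have sub: "set As \<subseteq> G28" unfolding As G28_def using roots by (auto intro!: generate.incl)
  define g where "g = tuple_prod 4 As"
  define h where "h = inv_prod 4 As"
  have g: "g \<in> G28" unfolding g_def by (rule tuple_prod_G28[OF sub])
  have h: "h \<in> G28" unfolding h_def by (rule inv_prod_G28[OF sub])
  have gc: "g \<in> carrier_mat 4 4" and hc: "h \<in> carrier_mat 4 4" using g h G28_props(1) by auto
  have gh: "g * h = 1\<^sub>m 4"
    unfolding h_def inv_prod_def g_def[symmetric] using GL_D(3) G28_sub_GL(1) g by blast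
  obtain P R d where P: "P \<in> carrier_mat 4 4" and R: "R \<in> carrier_mat 4 4"
    and RP: "R * P = 1\<^sub>m 4" and hP: "h * P = P * mat_diag 4 d"
    and cp: "char_poly h = (\<Prod>i<4. [:- d i, 1:])"
    and "\<forall>x. card {i. i < 4 \<and> d i = cnj x} = card {i. i < (4::nat) \<and> d i = x}"
    and nm: "\<forall>i<4. norm (d i) = 1"
    by (rule G28_spectrum[OF h])
  have "card {i. i < 4 \<and> d i = lam} \<ge> 2"
    using ord unfolding h_def[symmetric] cp order_prod_linear .
  then obtain i j where ij: "i < 4" "d i = lam" "j < 4" "d j = lam" "i \<noteq> j"
  proof -
    assume "card {i. i < 4 \<and> d i = lam} \<ge> 2"
    then have "\<not> card {i. i < 4 \<and> d i = lam} \<le> Suc 0" by simp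
    then have "\<exists>i j. i < 4 \<and> d i = lam \<and> j < 4 \<and> d j = lam \<and> i \<noteq> j"
      by (subst (asm) card_le_Suc0_iff_eq) auto
    then show ?thesis using that by blast
  qed
  have lam0: "lam \<noteq> 0" using nm ij by auto
  \<comment> \<open>As \<open>h\<close> is the inverse of the product \<open>g\<close>, the
    eigenvalue \<open>lam\<close> of \<open>h\<close> becomes \<open>1 / lam\<close>.\<close>
  have ev: "col P i \<in> carrier_vec 4 \<and> g *\<^sub>v col P i = (1 / lam) \<cdot>\<^sub>v col P i" if i: "i < 4" "d i = lam" for i
  proof -
    have v: "col P i \<in> carrier_vec 4" using P i by simp
    have "col (h * P) i = h *\<^sub>v col P i" using hc P i by (intro col_mult2) auto
    moreover have "col (P * mat_diag 4 d) i = lam \<cdot>\<^sub>v col P i"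
      using P i by (intro eq_vecI) (auto simp: mat_diag_mult_right[of P 4 4])
    ultimately have hv: "h *\<^sub>v col P i = lam \<cdot>\<^sub>v col P i" using hP by simp
    have "col P i = g * h *\<^sub>v col P i" using gh v by simp
    also have "\<dots> = lam \<cdot>\<^sub>v (g *\<^sub>v col P i)"
      using hv v gc hc by (simp add: assoc_mult_mat_vec[OF gc hc v] mult_mat_vec[OF gc v])
    finally have "(1 / lam) \<cdot>\<^sub>v col P i = (1 / lam) \<cdot>\<^sub>v (lam \<cdot>\<^sub>v (g *\<^sub>v col P i))" by simp
    then show ?thesis using v lam0 by (simp add: smult_smult_assoc)
  qed
  note evi = ev[OF ij(1,2)] and evj = ev[OF ij(3,4)]
  have coord: "\<And>m. m < 4 \<Longrightarrow> (\<Sum>l<T. eigen_coord T \<alpha> v l * \<alpha> l $ m) = (1 - 1 / lam) * v $ m"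
    "\<And>k. k < T \<Longrightarrow> (\<Sum>l<T. seifert lam (cartan \<alpha>) k l * eigen_coord T \<alpha> v l) = 0"
    if "v \<in> carrier_vec 4 \<and> g *\<^sub>v v = (1 / lam) \<cdot>\<^sub>v v" for v
    using eigen_coord[of T \<alpha> lam v] roots lam0 lam1 that by (simp_all add: As g_def)
  note ci = coord[OF evi] and cj = coord[OF evj]
  show thesis
  proof (rule that)
    show "\<forall>k<T. (\<Sum>l<T. seifert lam (cartan \<alpha>) k l * eigen_coord T \<alpha> (col P i) l) = 0"
      using ci(2) by simp
    show "\<forall>k<T. (\<Sum>l<T. seifert lam (cartan \<alpha>) k l * eigen_coord T \<alpha> (col P j) l) = 0"
      using cj(2) by simp
    show "\<forall>a b. (\<forall>l<T. a * eigen_coord T \<alpha> (col P i) l + b * eigen_coord T \<alpha> (col P j) l = 0) \<longrightarrow> a = 0 \<and> b = 0"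
    proof (intro allI impI)
    fix a b assume ab: "\<forall>l<T. a * eigen_coord T \<alpha> (col P i) l + b * eigen_coord T \<alpha> (col P j) l = 0"
    have zero: "a * P $$ (m,i) + b * P $$ (m,j) = 0" if m: "m < 4" for m
    proof -
      have "(1 - 1 / lam) * (a * P $$ (m,i) + b * P $$ (m,j)) =
          a * ((1 - 1 / lam) * col P i $ m) + b * ((1 - 1 / lam) * col P j $ m)"
        using m ij P by (simp add: algebra_simps)
      also have "\<dots> = a * (\<Sum>l<T. eigen_coord T \<alpha> (col P i) l * \<alpha> l $ m) + b * (\<Sum>l<T. eigen_coord T \<alpha> (col P j) l * \<alpha> l $ m)"
        using ci(1)[of m] cj(1)[of m] m by simp
      also have "\<dots> = (\<Sum>l<T. (a * eigen_coord T \<alpha> (col P i) l + b * eigen_coord T \<alpha> (col P j) l) * \<alpha> l $ m)"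
        by (simp add: sum_distrib_left sum.distrib distrib_right mult.assoc)
      also have "\<dots> = 0" using ab by simp
      finally have "(1 - 1 / lam) * (a * P $$ (m,i) + b * P $$ (m,j)) = 0" .
      moreover have "1 - 1 / lam \<noteq> 0" using lam0 lam1 by (simp add: field_simps)
      ultimately show ?thesis by (simp only: mult_eq_0_iff) simp
    qed
    have RPij: "(\<Sum>m<4. R $$ (p,m) * P $$ (m,q)) = (if p = q then 1 else 0)" if "p < 4" "q < 4" for p q
    proof -
      have "(R * P) $$ (p,q) = (if p = q then 1 else 0)" using RP that by simp
      then show ?thesis using R P that by (simp add: scalar_prod_def atLeast0LessThan)
    qed
    have comb: "a * (if p = i then 1 else 0) + b * (if p = j then 1 else 0) = 0" if "p < 4" for p
    proof -
      have "a * (if p = i then 1 else 0) + b * (if p = j then 1 else 0) =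
        a * (\<Sum>m<4. R $$ (p,m) * P $$ (m,i)) + b * (\<Sum>m<4. R $$ (p,m) * P $$ (m,j))"
        using RPij[OF that ij(1)] RPij[OF that ij(3)] by simp
      also have "\<dots> = (\<Sum>m<4. R $$ (p,m) * (a * P $$ (m,i) + b * P $$ (m,j)))"
        by (simp add: sum_distrib_left sum.distrib algebra_simps)
      also have "\<dots> = 0" using zero by simp
      finally show ?thesis .
    qed
    show "a = 0 \<and> b = 0" using comb[OF ij(1)] comb[OF ij(3)] ij(5) by simp
    qed
  qed
qed

lemma (in generating_roots) integral_relation:
  assumes T: "T \<le> 5" and lam: "lam \<noteq> 1"
    and ord: "Polynomial.order lam (char_poly (inv_prod 4 (map (\<lambda>k. root_reflection (\<alpha> k)) [0..<T]))) \<ge> 2"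
  obtains a b c d :: int where
    "1 + of_int a * (lam - 1) + of_int b * (lam - 1)^2 + of_int c * (lam - 1)^3 + of_int d * (lam - 1)^4 = 0"
proof -
  obtain y y' where y: "\<forall>k<T. (\<Sum>l<T. seifert lam (cartan \<alpha>) k l * y l) = 0"
    "\<forall>k<T. (\<Sum>l<T. seifert lam (cartan \<alpha>) k l * y' l) = 0"
    "\<forall>a b. (\<forall>l<T. a * y l + b * y' l = 0) \<longrightarrow> a = 0 \<and> b = 0"
    by (rule G28_kernel[OF roots refl ord lam]) assumption
  obtain M N :: "nat \<Rightarrow> nat \<Rightarrow> int" where MN: "\<forall>i<4. \<forall>j<4.
      (\<Sum>k<T. \<Sum>l<T. of_int (M i k) * cartan \<alpha> k l * of_int (N j l)) = (if i = j then 1 else 0)"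
    unfolding cartan_def by (rule unimodular_pairing)
  show thesis
  proof (rule kernel_integral_relation[OF T lam, of "cartan \<alpha>" M N y y'])
    show "cartan \<alpha> k l \<in> \<int>" if "k < T" "l < T" for k l using that roots by (intro cartan_int)
    show "cartan \<alpha> k k = 2" if "k < T" for k using that roots by (intro cartan_diag)
  qed (use MN y that in blast)+
qed

lemma real_unit_complex:
  assumes "norm (lam :: complex) = 1" "Im lam = 0" "lam \<noteq> 1"
  shows "lam = -1"
proof -
  have "\<bar>Re lam\<bar> = 1" using assms(1,2) by (simp add: cmod_def)
  then have "Re lam = 1 \<or> Re lam = -1" by linarith
  then show ?thesis using assms(2,3) by (auto simp: complex_eq_iff)
qed

text \<open>A threefold eigenvalue in dimension four equals its conjugate, as the two would
  otherwise fill six dimensions. Having norm one and being different from 1, it is -1, against the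
  integral relation.\<close>

lemma no_nice_5_tuple: "\<not> (length As = 5 \<and> nice_tuple 4 G28 As)"
proof
  assume A: "length As = 5 \<and> nice_tuple 4 G28 As"
  then obtain \<alpha> where As: "As = map (\<lambda>k. root_reflection (\<alpha> k)) [0..<5]" and g: "generating_roots 5 \<alpha>"
    using nice_tuple_roots by metis
  interpret generating_roots 5 \<alpha> by (rule g)
  obtain lam where lam: "nice_eigenvalue 4 As lam" using A unfolding nice_tuple_def by blast
  then have lam1: "lam \<noteq> 1" and ord: "Polynomial.order lam (char_poly (inv_prod 4 As)) = 3"
    using A unfolding nice_eigenvalue_def by auto
  have sub: "set As \<subseteq> G28" using A unfolding nice_tuple_def by blast
  obtain P R d where "P \<in> carrier_mat 4 4" "R \<in> carrier_mat 4 4" "R * P = 1\<^sub>m 4"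
    "inv_prod 4 As * P = P * mat_diag 4 d"
    and cp: "char_poly (inv_prod 4 As) = (\<Prod>i<4. [:- d i, 1:])"
    and conj: "\<forall>x. card {i. i < 4 \<and> d i = cnj x} = card {i. i < (4::nat) \<and> d i = x}"
    and nm: "\<forall>i<4. norm (d i) = 1"
    by (rule G28_spectrum[OF inv_prod_G28[OF sub]])
  have card: "card {i. i < (4::nat) \<and> d i = lam} = 3" using ord unfolding cp order_prod_linear .
  have "cnj lam = lam"
  proof (rule ccontr)
    assume "cnj lam \<noteq> lam"
    then have "card ({i. i < (4::nat) \<and> d i = lam} \<union> {i. i < 4 \<and> d i = cnj lam}) = 3 + 3"
      using card conj[rule_format, of lam] by (subst card_Un_disjoint) auto
    moreover have "card ({i. i < (4::nat) \<and> d i = lam} \<union> {i. i < 4 \<and> d i = cnj lam}) \<le> card {..<4::nat}"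
      by (intro card_mono) auto
    ultimately show False by simp
  qed
  then have im: "Im lam = 0" by (metis complex_cnj_cancel_iff complex_In_mult_cnj_zero Reals_cnj_iff complex_is_Real_iff)
  have "{i. i < (4::nat) \<and> d i = lam} \<noteq> {}" using card by (metis card.empty zero_neq_numeral)
  then have "norm lam = 1" using nm by auto
  then have "lam = -1" using im lam1 real_unit_complex by blast
  moreover obtain a b c d :: int where
    "1 + of_int a * (lam - 1) + of_int b * (lam - 1)^2 + of_int c * (lam - 1)^3 + of_int d * (lam - 1)^4 = 0"
    using integral_relation[OF _ lam1] ord unfolding As by force
  ultimately show False using integral_relation_minus_one by blast
qed

text \<open>The auxiliary identities multiply the system by the adjugate matrix.\<close>

lemma singular_3:
  fixes w0 w1 w2 :: complex
  assumes "f00 * w0 + f01 * w1 + f02 * w2 = 0" "f10 * w0 + f11 * w1 + f12 * w2 = 0"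
    "f20 * w0 + f21 * w1 + f22 * w2 = 0" "w0 \<noteq> 0 \<or> w1 \<noteq> 0 \<or> w2 \<noteq> 0"
  shows "f00 * (f11 * f22 - f12 * f21) - f01 * (f10 * f22 - f12 * f20) + f02 * (f10 * f21 - f11 * f20) = 0"
    (is "?D = 0")
proof -
  let ?E0 = "f00 * w0 + f01 * w1 + f02 * w2" and ?E1 = "f10 * w0 + f11 * w1 + f12 * w2"
    and ?E2 = "f20 * w0 + f21 * w1 + f22 * w2"
  have "?D * w0 = (f11 * f22 - f12 * f21) * ?E0 - (f01 * f22 - f02 * f21) * ?E1 + (f01 * f12 - f02 * f11) * ?E2"
    "?D * w1 = - (f10 * f22 - f12 * f20) * ?E0 + (f00 * f22 - f02 * f20) * ?E1 - (f00 * f12 - f02 * f10) * ?E2"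
    "?D * w2 = (f10 * f21 - f11 * f20) * ?E0 - (f00 * f21 - f01 * f20) * ?E1 + (f00 * f11 - f01 * f10) * ?E2"
    by (simp_all add: algebra_simps)
  then have "?D * w0 = 0" "?D * w1 = 0" "?D * w2 = 0" unfolding assms(1-3) by simp_all
  then show ?thesis using assms(4) by auto
qed

text \<open>A combination of the kernel vectors with last coordinate zero makes the leading 3 x 3
  minor of \<open>F\<close> vanish. The two cyclic products of Cartan entries agree, so the minor is
  \<open>(1 + lam) * ((1 + lam)^2 - lam * m)\<close> with an integer \<open>m\<close>. Once
  \<open>lam\<close> is known to be nonreal, it and its conjugate, each of multiplicity two, exhaust
  the spectrum.\<close>

lemma nice_4_tuple_eigenvalue:
  assumes len: "length As = 4" and nice: "nice_tuple 4 G28 As" and ev: "nice_eigenvalue 4 As lam"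
  obtains \<alpha> y y' where "As = map (\<lambda>k. root_reflection (\<alpha> k)) [0..<4]" "\<forall>k<4. \<alpha> k \<in> F4_roots"
    "lam * lam = lam - 1" "cnj lam = 1 - lam" "cnj lam \<noteq> lam"
    "\<forall>k<4. (\<Sum>l<4. seifert lam (cartan \<alpha>) k l * y l) = 0"
    "\<forall>k<4. (\<Sum>l<4. seifert lam (cartan \<alpha>) k l * y' l) = 0"
    "\<forall>a b. (\<forall>l<4. a * y l + b * y' l = 0) \<longrightarrow> a = 0 \<and> b = 0"
    "\<forall>x. count (tuple_type 4 As) x = (if x = lam \<or> x = cnj lam then 2 else 0)"
proof -
  obtain \<alpha> where As: "As = map (\<lambda>k. root_reflection (\<alpha> k)) [0..<4]" and g: "generating_roots 4 \<alpha>"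
    using nice_tuple_roots[OF nice len] by metis
  interpret generating_roots 4 \<alpha> by (rule g)
  have lam1: "lam \<noteq> 1" and ord: "Polynomial.order lam (char_poly (inv_prod 4 As)) = 2"
    using ev len unfolding nice_eigenvalue_def by auto
  have sub: "set As \<subseteq> G28" using nice unfolding nice_tuple_def by blast
  obtain P R d where "P \<in> carrier_mat 4 4" "R \<in> carrier_mat 4 4" "R * P = 1\<^sub>m 4"
    "inv_prod 4 As * P = P * mat_diag 4 d"
    and cp: "char_poly (inv_prod 4 As) = (\<Prod>i<4. [:- d i, 1:])"
    and conj: "\<forall>x. card {i. i < 4 \<and> d i = cnj x} = card {i. i < (4::nat) \<and> d i = x}"
    and nm: "\<forall>i<4. norm (d i) = 1"
    by (rule G28_spectrum[OF inv_prod_G28[OF sub]])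
  have card: "card {i. i < (4::nat) \<and> d i = lam} = 2" using ord unfolding cp order_prod_linear .
  have "{i. i < (4::nat) \<and> d i = lam} \<noteq> {}" using card by (metis card.empty zero_neq_numeral)
  then have nlam: "norm lam = 1" using nm by auto
  obtain a b c e :: int where rel:
    "1 + of_int a * (lam - 1) + of_int b * (lam - 1)^2 + of_int c * (lam - 1)^3 + of_int e * (lam - 1)^4 = 0"
    using integral_relation[OF _ lam1] ord unfolding As by force
  have lamm1: "lam \<noteq> -1" by (rule integral_relation_minus_one[OF rel])
  have nr: "Im lam \<noteq> 0" using real_unit_complex[OF nlam _ lam1] lamm1 by blast
  have lcl: "lam * cnj lam = 1" using nlam by (metis complex_norm_square of_real_1 power_one)
  have lam0: "lam \<noteq> 0" using nlam by auto
  have ord2: "2 \<le> Polynomial.order lam (char_poly (inv_prod 4 As))" using ord by simp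
  obtain y y' where y: "\<forall>k<4. (\<Sum>l<4. seifert lam (cartan \<alpha>) k l * y l) = 0"
    and y': "\<forall>k<4. (\<Sum>l<4. seifert lam (cartan \<alpha>) k l * y' l) = 0"
    and ind: "\<forall>a b. (\<forall>l<4. a * y l + b * y' l = 0) \<longrightarrow> a = 0 \<and> b = 0"
    by (rule G28_kernel[OF roots As ord2 lam1]) assumption
  define C where "C = cartan \<alpha>"
  \<comment> \<open>If \<open>y 3\<close> vanishes, \<open>y\<close> itself serves; otherwise the
    combination cancels the last coordinates. In both cases one of the coefficients is
    nonzero.\<close>
  define p where "p = (if y 3 = 0 then 1 else - y' 3)"
  define q where "q = (if y 3 = 0 then 0 else y 3)"
  define w where "w = (\<lambda>l. p * y l + q * y' l)"
  have w3: "w 3 = 0" by (auto simp: w_def p_def q_def)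
  have "p \<noteq> 0 \<or> q \<noteq> 0" by (auto simp: p_def q_def)
  then have "\<exists>l<4. w l \<noteq> 0" using ind unfolding w_def by blast
  then have wnz: "w 0 \<noteq> 0 \<or> w 1 \<noteq> 0 \<or> w 2 \<noteq> 0" using w3 by (auto dest!: less_4_cases)
  have Fw: "seifert lam C k 0 * w 0 + seifert lam C k 1 * w 1 + seifert lam C k 2 * w 2 = 0" if "k < 4" for k
  proof -
    have "(\<Sum>l<4. seifert lam C k l * w l) = p * (\<Sum>l<4. seifert lam C k l * y l) + q * (\<Sum>l<4. seifert lam C k l * y' l)"
      by (simp add: w_def sum_distrib_left sum.distrib algebra_simps)
    also have "\<dots> = 0" using y y' that by (simp add: C_def)
    finally show ?thesis using w3 by (simp add: sum_less_4)
  qed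
  \<comment> \<open>Both sides are 8 times the product of the three mutual scalar products, divided
    by the product of the three squared lengths.\<close>
  have "C 0 1 * C 1 2 * C 2 0 = C 0 2 * C 2 1 * C 1 0"
  proof -
    have c: "\<alpha> 0 \<in> carrier_vec 4" "\<alpha> 1 \<in> carrier_vec 4" "\<alpha> 2 \<in> carrier_vec 4"
      using F4_root_carrier[OF roots] by auto
    define u v w where "u = \<alpha> 0" and "v = \<alpha> 1" and "w = \<alpha> 2"
    note c = c[folded u_def v_def w_def]
    have "v \<bullet> u = u \<bullet> v" "w \<bullet> u = u \<bullet> w" "w \<bullet> v = v \<bullet> w"
      using c by (auto intro: comm_scalar_prod)
    then show ?thesis unfolding C_def cartan_def coroot_def u_def[symmetric] v_def[symmetric] w_def[symmetric]
      using c by (simp add: mult_ac)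
  qed
  note sym = this
  define mm where "mm = C 0 1 * C 1 0 + C 1 2 * C 2 1 + C 0 2 * C 2 0 - C 0 1 * C 1 2 * C 2 0"
  have "mm \<in> \<int>" unfolding mm_def C_def using roots by (intro Ints_diff Ints_add Ints_mult cartan_int) auto
  then obtain m where m: "mm = of_int m" by (rule Ints_cases)
  have "(1 + lam) * ((1 + lam)^2 - lam * mm) = 0"
  proof -
    have f: "seifert lam C 0 0 = 1 + lam" "seifert lam C 1 1 = 1 + lam" "seifert lam C 2 2 = 1 + lam"
      "seifert lam C 0 1 = C 0 1" "seifert lam C 0 2 = C 0 2" "seifert lam C 1 2 = C 1 2"
      "seifert lam C 1 0 = lam * C 1 0" "seifert lam C 2 0 = lam * C 2 0" "seifert lam C 2 1 = lam * C 2 1"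
      by (simp_all add: seifert_def)
    have "0 < (4::nat)" "1 < (4::nat)" "2 < (4::nat)" by simp_all
    note D = singular_3[OF Fw[OF this(1)] Fw[OF this(2)] Fw[OF this(3)] wnz, unfolded f]
    define x y z x' y' z' where "x = C 0 1" and "y = C 1 2" and "z = C 2 0" and "x' = C 1 0" and "y' = C 2 1" and "z' = C 0 2"
    note D = D[folded x_def y_def z_def x'_def y'_def z'_def]
    have s: "x * y * z - z' * y' * x' = 0" using sym unfolding x_def y_def z_def x'_def y'_def z'_def by simp
    have "(1 + lam) * ((1 + lam)^2 - lam * (x * x' + y * y' + z' * z - x * y * z)) =
      ((1 + lam) * ((1 + lam) * (1 + lam) - y * (lam * y')) - x * (lam * x' * (1 + lam) - y * (lam * z)) +
      z' * (lam * x' * (lam * y') - (1 + lam) * (lam * z))) + lam * lam * (x * y * z - z' * y' * x')"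
      by (simp add: algebra_simps power2_eq_square)
    then show ?thesis
      unfolding D s mm_def x_def[symmetric] y_def[symmetric] z_def[symmetric] x'_def[symmetric] y'_def[symmetric] z'_def[symmetric]
      by simp
  qed
  moreover have "1 + lam \<noteq> 0" using lamm1 by (simp add: add_eq_0_iff)
  ultimately have quad0: "(1 + lam)^2 = lam * mm" by simp
  then have quad: "lam^2 + (2 - of_int m) * lam + 1 = 0" unfolding m by (simp add: power2_eq_square algebra_simps)
  have "lam * (lam + (2 - of_int m) + cnj lam) = 0" using quad lcl by (simp add: power2_eq_square algebra_simps)
  then have "lam + (2 - of_int m) + cnj lam = 0" using lam0 by (simp only: mult_eq_0_iff) simp
  then have "lam + cnj lam - (of_int m - 2) = 0" by (simp add: algebra_simps)
  then have "lam + cnj lam = of_int m - 2" by simp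
  then have "complex_of_real (2 * Re lam) = of_int m - 2" by (simp add: complex_add_cnj)
  then have "Re (complex_of_real (2 * Re lam)) = Re (of_int m - 2)" by simp
  \<comment> \<open>For a nonreal \<open>lam\<close> of norm one this value lies strictly between -2
    and 2, which leaves 1, 2 and 3 for \<open>m\<close>.\<close>
  then have re: "2 * Re lam = of_int m - 2" by simp
  have "(Re lam)^2 + (Im lam)^2 = 1" using nlam by (simp add: cmod_def)
  moreover have "(Im lam)^2 > 0" using nr by simp
  ultimately have "(Re lam)^2 < 1" by linarith
  then have "\<bar>Re lam\<bar> < 1" by (simp add: abs_square_less_1)
  then have "0 < m" "m < 4" using re by auto
  then have m3: "m = 3" by (rule integral_relation_nonreal[OF rel quad nr])
  have l2: "lam * lam = lam - 1" using quad unfolding m3 by (simp add: power2_eq_square add_eq_0_iff algebra_simps)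
  have cl: "cnj lam = 1 - lam" using \<open>lam + cnj lam = of_int m - 2\<close> unfolding m3 by (simp add: algebra_simps)
  have ne: "cnj lam \<noteq> lam" using nr by (auto simp: complex_eq_iff)
  have cnt: "count (tuple_type 4 As) x = (if x = lam \<or> x = cnj lam then 2 else 0)" for x
  proof -
    have nz: "char_poly (inv_prod 4 As) \<noteq> 0" unfolding cp by (simp add: prod_zero_iff)
    have "count (tuple_type 4 As) x = card {i. i < (4::nat) \<and> d i = x}"
      unfolding tuple_type_def count_proots[OF nz] unfolding cp by (rule order_prod_linear)
    also have "\<dots> = (if x = lam \<or> x = cnj lam then 2 else 0)"
    proof (cases "x = lam \<or> x = cnj lam")
      case True
      then show ?thesis using card conj[rule_format, of lam] by auto
    next
      case False
      let ?U = "{i. i < (4::nat) \<and> d i = lam} \<union> {i. i < 4 \<and> d i = cnj lam}"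
      have "card ?U = 2 + 2" using card conj[rule_format, of lam] ne by (subst card_Un_disjoint) auto
      then have "?U = {..<4}" by (intro card_subset_eq) auto
      then have "{i. i < (4::nat) \<and> d i = x} = {}" using False by auto
      then show ?thesis using False by simp
    qed
    finally show ?thesis .
  qed
  show thesis using that[OF As _ l2 cl ne y y' ind] roots cnt by blast
qed

text \<open>Both eigenvalues are roots of \<open>x^2 - x + 1\<close>; conjugation exchanges the two
  roots, and each of them occurs twice in either spectrum.\<close>

lemma nice_4_tuple_types:
  assumes "length As = 4" "nice_tuple 4 G28 As" "length Bs = 4" "nice_tuple 4 G28 Bs"
  shows "tuple_type 4 As = tuple_type 4 Bs"
proof -
  obtain lam where l: "nice_eigenvalue 4 As lam" using assms unfolding nice_tuple_def by blast
  obtain mu where m: "nice_eigenvalue 4 Bs mu" using assms unfolding nice_tuple_def by blast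
  have L: "lam * lam = lam - 1 \<and> cnj lam = 1 - lam \<and> (\<forall>x. count (tuple_type 4 As) x = (if x = lam \<or> x = cnj lam then 2 else 0))"
    by (rule nice_4_tuple_eigenvalue[OF assms(1,2) l]) blast
  have M: "mu * mu = mu - 1 \<and> cnj mu = 1 - mu \<and> (\<forall>x. count (tuple_type 4 Bs) x = (if x = mu \<or> x = cnj mu then 2 else 0))"
    by (rule nice_4_tuple_eigenvalue[OF assms(3,4) m]) blast
  have "(mu - lam) * (mu - (1 - lam)) = (mu * mu - mu) - (lam * lam - lam)" by (simp add: algebra_simps)
  also have "\<dots> = 0" using L M by simp
  finally have "(mu - lam) * (mu - (1 - lam)) = 0" .
  then have "mu = lam \<or> mu = 1 - lam" by auto
  then show ?thesis using L M by (intro multiset_eqI) auto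
qed

section \<open>Gram matrices\<close>

text \<open>A Gram matrix \<open>(2 (u\<^sub>k, u\<^sub>l))\<close> of four unit vectors is encoded by its six entries
  \<open>01, 02, 03, 12, 13, 23\<close>. The rules \<open>braid0\<close> and \<open>braid1\<close> describe the effect of the first two
  Hurwitz moves, the others the effect of replacing a vector by its negative.\<close>

inductive gram_orbit :: "real \<Rightarrow> real \<Rightarrow> real \<Rightarrow> real \<Rightarrow> real \<Rightarrow> real \<Rightarrow> bool" where
  base: "gram_orbit 1 (sqrt 2) 0 0 (sqrt 2) (-1)"
| braid0: "gram_orbit (-a) (d - a * b) (e - a * c) b c f \<Longrightarrow> gram_orbit a b c d e f"
| braid1: "gram_orbit (b - d * a) a c (-d) (f - d * e) e \<Longrightarrow> gram_orbit a b c d e f"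
| neg0: "gram_orbit (-a) (-b) (-c) d e f \<Longrightarrow> gram_orbit a b c d e f"
| neg1: "gram_orbit (-a) b c (-d) (-e) f \<Longrightarrow> gram_orbit a b c d e f"
| neg2: "gram_orbit a (-b) c (-d) e (-f) \<Longrightarrow> gram_orbit a b c d e f"
| neg3: "gram_orbit a b (-c) d (-e) (-f) \<Longrightarrow> gram_orbit a b c d e f"

text \<open>Each matrix is linked by one Hurwitz move and sign changes to one derived before, with
  \<open>base\<close> as the starting point. Up to one further sign change these are all the
  solutions with nonnegative first row.\<close>

lemma gram_orbit_representatives:
  defines "r \<equiv> sqrt 2"
  shows "gram_orbit r 1 0 0 1 (-r)" "gram_orbit r 0 1 1 r r" "gram_orbit 1 0 r r r 1"
    "gram_orbit r 1 r r 1 r" "gram_orbit 1 r r r 0 1" "gram_orbit 0 r 1 1 (-r) 0"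
    "gram_orbit 0 1 r r (-1) 0" "gram_orbit r r 1 1 0 r" "gram_orbit 1 r 0 0 r (-1)"
proof -
  have rr: "r * r = 2" by (simp add: r_def)
  show A: "gram_orbit 1 r 0 0 r (-1)" unfolding r_def by (rule base)
  show B: "gram_orbit r 1 0 0 1 (-r)" by (rule braid1, rule neg3) (simp add: A)
  show E: "gram_orbit r 0 1 1 r r" by (rule braid0, rule neg0, rule neg2) (simp add: B)
  show I: "gram_orbit 1 0 r r r 1" by (rule braid0, rule neg0, rule neg2) (simp add: A)
  show F: "gram_orbit r 1 r r 1 r" by (rule braid0, rule neg0) (simp add: E rr)
  show H: "gram_orbit 1 r r r 0 1" by (rule braid0, rule neg0) (simp add: I)
  show D: "gram_orbit 0 r 1 1 (-r) 0" by (rule braid1, rule neg2) (simp add: E)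
  show G: "gram_orbit 0 1 r r (-1) 0" by (rule braid1, rule neg2) (simp add: I)
  show C: "gram_orbit r r 1 1 0 r" by (rule braid0, rule neg0) (simp add: F rr)
qed

text \<open>The square of a normalized entry is the product of two opposite Cartan integers, which
  is 0, 1, 2 or 4 in type F4.\<close>

definition gram_values :: "real set" where
  "gram_values = {0, 1, -1, sqrt 2, - sqrt 2, 2, -2}"

text \<open>The equation says that a principal 3 x 3 minor of \<open>F\<close> vanishes. Normalizing
  the signs of \<open>a\<close> and \<open>b\<close> keeps the enumeration small, and rational
  bounds for the square root of 2 refute the wrong cases.\<close>

lemma gram_triple:
  fixes a b d :: real
  defines "r \<equiv> sqrt 2"
  assumes v: "a \<in> {0, 1, r, 2}" "b \<in> {0, 1, r, 2}" "d \<in> {0, 1, -1, r, -r, 2, -2}"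
    and eq: "a * a + b * b + d * d - a * b * d = 3"
  shows "(a, b, d) \<in> {(0,1,r), (0,1,-r), (0,r,1), (0,r,-1), (1,0,r), (1,0,-r), (1,r,0), (1,r,r),
    (r,0,1), (r,0,-1), (r,1,0), (r,1,r), (r,r,1)}"
proof -
  have rr: "r * r = 2" "\<And>x. r * (r * x) = 2 * x" by (simp_all add: r_def mult.assoc[symmetric])
  have "7/5 < r" unfolding r_def by (rule real_less_rsqrt) (simp add: power2_eq_square)
  moreover have "r < 3/2" unfolding r_def by (rule real_less_lsqrt) (simp_all add: power2_eq_square)
  ultimately have bd: "5 * r > 7" "2 * r < 3" by simp_all
  show ?thesis using v eq by (elim insertE emptyE; hypsubst; use rr bd in simp; fail)
qed

text \<open>The triples (a, b, d) and (a, c, e) share \<open>a\<close>; joining the two lists and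
  filtering by \<open>s1\<close> leaves fifteen cases, and \<open>f\<close> is determined since
  \<open>3 - a * a\<close> is nonzero. Nine cases are the representatives, the other six differ from
  one of them by a sign change.\<close>

lemma gram_solutions_nonneg:
  fixes a b c d e f :: real
  assumes nn: "a \<ge> 0" "b \<ge> 0" "c \<ge> 0" and v: "{a, b, c, d, e} \<subseteq> gram_values"
    and t1: "a * a + b * b + d * d - a * b * d = 3" and t2: "a * a + c * c + e * e - a * c * e = 3"
    and s1: "b * c + d * e = a * c * d" and s2: "f * (3 - a * a) = a * (c * d - b * e)"
  shows "gram_orbit a b c d e f"
proof -
  define r where "r = sqrt 2"
  have rr: "r * r = 2" "\<And>x. r * (r * x) = 2 * x" by (simp_all add: r_def mult.assoc[symmetric])
  have "7/5 < r" unfolding r_def by (rule real_less_rsqrt) (simp add: power2_eq_square)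
  moreover have "r < 3/2" unfolding r_def by (rule real_less_lsqrt) (simp_all add: power2_eq_square)
  ultimately have bd: "5 * r > 7" "2 * r < 3" by simp_all
  have v': "a \<in> {0, 1, r, 2}" "b \<in> {0, 1, r, 2}" "c \<in> {0, 1, r, 2}"
    "d \<in> {0, 1, -1, r, -r, 2, -2}" "e \<in> {0, 1, -1, r, -r, 2, -2}"
    using nn v bd unfolding gram_values_def r_def by auto
  have 1: "(a, b, d) \<in> {(0,1,r), (0,1,-r), (0,r,1), (0,r,-1), (1,0,r), (1,0,-r), (1,r,0), (1,r,r),
    (r,0,1), (r,0,-1), (r,1,0), (r,1,r), (r,r,1)}"
    using gram_triple[of a b d] v' t1 unfolding r_def by simp
  have ace: "(a, c, e) \<in> {(0,1,r), (0,1,-r), (0,r,1), (0,r,-1), (1,0,r), (1,0,-r), (1,r,0), (1,r,r),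
    (r,0,1), (r,0,-1), (r,1,0), (r,1,r), (r,r,1)}"
    using gram_triple[of a c e] v' t2 unfolding r_def by simp
  have f: "f = a * (c * d - b * e) / (3 - a * a)"
  proof -
    have "a * a \<noteq> 3" using v'(1) rr by auto
    then show ?thesis using s2 by (simp add: field_simps)
  qed
  have r0: "r \<noteq> 0" "r \<noteq> 1" "1 \<noteq> r" using bd by simp_all
  have 3: "(a, b, c, d, e) \<in> {(0,1,r,r,-1), (0,1,r,-r,1), (0,r,1,1,-r), (0,r,1,-1,r),
      (1,0,r,r,r), (1,0,r,-r,r), (1,r,0,0,r), (1,r,0,0,-r), (1,r,r,r,0),
      (r,0,1,1,r), (r,0,1,-1,r), (r,1,0,0,1), (r,1,0,0,-1), (r,1,r,r,1), (r,r,1,1,0)}"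
  proof -
    from 1 consider "a = 0" "(b, d) \<in> {(1,r), (1,-r), (r,1), (r,-1)}"
      | "a = 1" "(b, d) \<in> {(0,r), (0,-r), (r,0), (r,r)}"
      | "a = r" "(b, d) \<in> {(0,1), (0,-1), (1,0), (1,r), (r,1)}"
      by (elim insertE emptyE Pair_inject) simp_all
    then show ?thesis
    proof cases
      case 1
      then have "(c, e) \<in> {(1,r), (1,-r), (r,1), (r,-1)}" using ace r0 by simp
      then show ?thesis using 1(2) s1 unfolding 1(1)
        by (elim insertE emptyE Pair_inject; hypsubst; simp add: rr r0)
    next
      case 2
      then have "(c, e) \<in> {(0,r), (0,-r), (r,0), (r,r)}" using ace r0 by simp
      then show ?thesis using 2(2) s1 unfolding 2(1)
        by (elim insertE emptyE Pair_inject; hypsubst; simp add: rr r0)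
    next
      case 3
      then have "(c, e) \<in> {(0,1), (0,-1), (1,0), (1,r), (r,1)}" using ace r0 by simp
      then show ?thesis using 3(2) s1 unfolding 3(1)
        by (elim insertE emptyE Pair_inject; hypsubst; simp add: rr r0)
    qed
  qed
  note reps = gram_orbit_representatives[folded r_def]
  have flip: "gram_orbit 0 1 r (-r) 1 0" "gram_orbit 0 r 1 (-1) r 0"
    by (rule neg1, simp add: reps)+
  have flip2: "gram_orbit 1 0 r (-r) r (-1)" "gram_orbit r 0 1 (-1) r (-r)"
    by (rule neg2, simp add: reps)+
  have flip3: "gram_orbit 1 r 0 0 (-r) 1" "gram_orbit r 1 0 0 (-1) r"
    by (rule neg3, simp add: reps)+
  show ?thesis using 3 unfolding f
    by (elim insertE emptyE Pair_inject; hypsubst; simp add: rr reps flip flip2 flip3 algebra_simps)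
qed

lemma gram_values_minus: "x \<in> gram_values \<Longrightarrow> - x \<in> gram_values"
  by (auto simp: gram_values_def)

text \<open>The equations are invariant under negating a vector. Negating vector 0 makes
  \<open>a\<close> nonnegative; negating the vectors 2 and 3 then corrects \<open>b\<close> and
  \<open>c\<close> without touching the entries of the first row already treated.\<close>

lemma gram_solutions:
  fixes a b c d e f :: real
  assumes v: "{a, b, c, d, e} \<subseteq> gram_values"
    and t1: "a * a + b * b + d * d - a * b * d = 3" and t2: "a * a + c * c + e * e - a * c * e = 3"
    and s1: "b * c + d * e = a * c * d" and s2: "f * (3 - a * a) = a * (c * d - b * e)"
  shows "gram_orbit a b c d e f"
proof -
  have c: "gram_orbit a b c d e f"
    if "a \<ge> 0" "b \<ge> 0" "{a, b, c, d, e} \<subseteq> gram_values"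
      "a * a + b * b + d * d - a * b * d = 3" "a * a + c * c + e * e - a * c * e = 3"
      "b * c + d * e = a * c * d" "f * (3 - a * a) = a * (c * d - b * e)" for a b c d e f
  proof (cases "c \<ge> 0")
    case False
    have "gram_orbit a b (-c) d (-e) (-f)"
      using that False by (intro gram_solutions_nonneg) (auto simp: gram_values_minus algebra_simps)
    then show ?thesis by (rule neg3)
  qed (use that gram_solutions_nonneg in blast)
  have b: "gram_orbit a b c d e f"
    if "a \<ge> 0" "{a, b, c, d, e} \<subseteq> gram_values"
      "a * a + b * b + d * d - a * b * d = 3" "a * a + c * c + e * e - a * c * e = 3"
      "b * c + d * e = a * c * d" "f * (3 - a * a) = a * (c * d - b * e)" for a b c d e f
  proof (cases "b \<ge> 0")
    case False
    have "gram_orbit a (-b) c (-d) e (-f)"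
      using that False by (intro c) (auto simp: gram_values_minus algebra_simps)
    then show ?thesis by (rule neg2)
  qed (use that c in blast)
  show ?thesis
  proof (cases "a \<ge> 0")
    case False
    have "gram_orbit (-a) (-b) (-c) d e f"
      using assms False by (intro b) (auto simp: gram_values_minus algebra_simps)
    then show ?thesis by (rule neg0)
  qed (use assms b in blast)
qed

lemma real_combination_zero:
  assumes "Im lam \<noteq> 0" "complex_of_real u + lam * complex_of_real v = 0"
  shows "u = 0" "v = 0"
proof -
  have "Im (complex_of_real u + lam * complex_of_real v) = 0" "Re (complex_of_real u + lam * complex_of_real v) = 0"
    using assms(2) by simp_all
  then show "v = 0" "u = 0" using assms(1) by auto
qed

text \<open>Eliminating \<open>z\<^sub>0\<close> and \<open>z\<^sub>1\<close> leaves a \<open>2 \<times> 2\<close> system with two independent solutions, so the Schur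
  complement vanishes.\<close>

lemma gram_equations:
  fixes a b c d e f :: real and lam :: complex and z z' :: "nat \<Rightarrow> complex"
  defines "A \<equiv> complex_of_real a" and "B \<equiv> complex_of_real b" and "C \<equiv> complex_of_real c"
    and "D \<equiv> complex_of_real d" and "E \<equiv> complex_of_real e" and "F \<equiv> complex_of_real f"
  assumes lam: "lam * lam = lam - 1" "Im lam \<noteq> 0" and a3: "a * a \<noteq> 3"
    and ker: "\<And>y. y = z \<or> y = z' \<Longrightarrow>
      (1 + lam) * y 0 + A * y 1 + B * y 2 + C * y 3 = 0 \<and>
      lam * A * y 0 + (1 + lam) * y 1 + D * y 2 + E * y 3 = 0 \<and>
      lam * B * y 0 + lam * D * y 1 + (1 + lam) * y 2 + F * y 3 = 0 \<and>
      lam * C * y 0 + lam * E * y 1 + lam * F * y 2 + (1 + lam) * y 3 = 0"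
    and ind: "\<And>p q. (\<forall>l<4. p * z l + q * z' l = 0) \<Longrightarrow> p = 0 \<and> q = 0"
  shows "a * a + b * b + d * d - a * b * d = 3" "a * a + c * c + e * e - a * c * e = 3"
    "b * c + d * e = a * c * d" "f * (3 - a * a) = a * (c * d - b * e)"
proof -
  let ?s = "1 + lam"
  have ss: "?s * ?s = 3 * lam" using lam(1) by (simp add: algebra_simps)
  have lam0: "lam \<noteq> 0" using lam(2) by auto
  have s0: "?s \<noteq> 0" using lam(2) by (auto simp: complex_eq_iff)
  \<comment> \<open>The determinant \<open>(1 + lam)^2 - lam * A^2\<close> of the leading 2 x 2
    block, rewritten by \<open>ss\<close>.\<close>
  define K where "K = lam * (3 - A * A)"
  have "3 - A * A = complex_of_real (3 - a * a)" by (simp add: A_def)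
  then have K0: "K \<noteq> 0" using a3 lam0 unfolding K_def by (simp only: mult_eq_0_iff of_real_eq_0_iff) simp
  have z01: "K * y 0 = - (?s * (B * y 2 + C * y 3)) + A * (D * y 2 + E * y 3)"
    "K * y 1 = - (?s * (D * y 2 + E * y 3)) + lam * A * (B * y 2 + C * y 3)" if "y = z \<or> y = z'" for y
  proof -
    note k = ker[OF that]
    have "K * y 0 = ?s * (?s * y 0 + A * y 1 + B * y 2 + C * y 3) - A * (lam * A * y 0 + ?s * y 1 + D * y 2 + E * y 3)
       - (?s * (B * y 2 + C * y 3)) + A * (D * y 2 + E * y 3) + (3 * lam - ?s * ?s) * y 0"
      unfolding K_def by (simp add: algebra_simps)
    then show "K * y 0 = - (?s * (B * y 2 + C * y 3)) + A * (D * y 2 + E * y 3)" using k ss by simp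
    have "K * y 1 = ?s * (lam * A * y 0 + ?s * y 1 + D * y 2 + E * y 3) - lam * A * (?s * y 0 + A * y 1 + B * y 2 + C * y 3)
       - (?s * (D * y 2 + E * y 3)) + lam * A * (B * y 2 + C * y 3) + (3 * lam - ?s * ?s) * y 1"
      unfolding K_def by (simp add: algebra_simps)
    then show "K * y 1 = - (?s * (D * y 2 + E * y 3)) + lam * A * (B * y 2 + C * y 3)" using k ss by simp
  qed
  \<comment> \<open>The entries of the Schur complement of the leading block, multiplied by
    \<open>K\<close>.\<close>
  define S22 where "S22 = - (lam * B * (?s * B - A * D)) - lam * D * (?s * D - lam * A * B) + K * ?s"
  define S23 where "S23 = - (lam * B * (?s * C - A * E)) - lam * D * (?s * E - lam * A * C) + K * F"
  define S33 where "S33 = - (lam * C * (?s * C - A * E)) - lam * E * (?s * E - lam * A * C) + K * ?s"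
  define S32 where "S32 = - (lam * C * (?s * B - A * D)) - lam * E * (?s * D - lam * A * B) + K * lam * F"
  have S: "S22 * y 2 + S23 * y 3 = 0" "S32 * y 2 + S33 * y 3 = 0" if y: "y = z \<or> y = z'" for y
  proof -
    note k = ker[OF y]
    have "S22 * y 2 + S23 * y 3 = lam * B * (- (?s * (B * y 2 + C * y 3)) + A * (D * y 2 + E * y 3))
      + lam * D * (- (?s * (D * y 2 + E * y 3)) + lam * A * (B * y 2 + C * y 3)) + K * (?s * y 2 + F * y 3)"
      unfolding S22_def S23_def by (simp add: algebra_simps)
    also have "\<dots> = lam * B * (K * y 0) + lam * D * (K * y 1) + K * (?s * y 2 + F * y 3)"
      unfolding z01[OF y] ..
    also have "\<dots> = K * (lam * B * y 0 + lam * D * y 1 + ?s * y 2 + F * y 3)" by (simp add: algebra_simps)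
    finally show "S22 * y 2 + S23 * y 3 = 0" using k by simp
    have "S32 * y 2 + S33 * y 3 = lam * C * (- (?s * (B * y 2 + C * y 3)) + A * (D * y 2 + E * y 3))
      + lam * E * (- (?s * (D * y 2 + E * y 3)) + lam * A * (B * y 2 + C * y 3)) + K * (lam * F * y 2 + ?s * y 3)"
      unfolding S32_def S33_def by (simp add: algebra_simps)
    also have "\<dots> = lam * C * (K * y 0) + lam * E * (K * y 1) + K * (lam * F * y 2 + ?s * y 3)"
      unfolding z01[OF y] ..
    also have "\<dots> = K * (lam * C * y 0 + lam * E * y 1 + lam * F * y 2 + ?s * y 3)" by (simp add: algebra_simps)
    finally show "S32 * y 2 + S33 * y 3 = 0" using k by simp
  qed
  \<comment> \<open>If this vanished, a nontrivial combination of \<open>z\<close> and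
    \<open>z'\<close> would be zero in the coordinates 2 and 3, hence by \<open>z01\<close> in all
    coordinates.\<close>
  define W where "W = z 2 * z' 3 - z 3 * z' 2"
  have W0: "W \<noteq> 0"
  proof
    assume W: "W = 0"
    define p where "p = (if z 2 = 0 \<and> z 3 = 0 then 1 else if z 2 = 0 then z' 3 else z' 2)"
    define q where "q = (if z 2 = 0 \<and> z 3 = 0 then 0 else if z 2 = 0 then - z 3 else - z 2)"
    have pq: "p \<noteq> 0 \<or> q \<noteq> 0" by (auto simp: p_def q_def)
    have 2: "p * z 2 + q * z' 2 = 0" and 3: "p * z 3 + q * z' 3 = 0"
      using W unfolding W_def p_def q_def by (auto simp: algebra_simps)
    have "K * (p * z 0 + q * z' 0) = p * (K * z 0) + q * (K * z' 0)" by (simp add: algebra_simps)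
    also have "\<dots> = - (?s * (B * (p * z 2 + q * z' 2) + C * (p * z 3 + q * z' 3))) + A * (D * (p * z 2 + q * z' 2) + E * (p * z 3 + q * z' 3))"
      unfolding z01(1)[OF disjI1[OF refl]] z01(1)[OF disjI2[OF refl]] by (simp add: algebra_simps)
    finally have 0: "p * z 0 + q * z' 0 = 0" using K0 unfolding 2 3 by simp
    have "K * (p * z 1 + q * z' 1) = p * (K * z 1) + q * (K * z' 1)" by (simp add: algebra_simps)
    also have "\<dots> = - (?s * (D * (p * z 2 + q * z' 2) + E * (p * z 3 + q * z' 3))) + lam * A * (B * (p * z 2 + q * z' 2) + C * (p * z 3 + q * z' 3))"
      unfolding z01(2)[OF disjI1[OF refl]] z01(2)[OF disjI2[OF refl]] by (simp add: algebra_simps)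
    finally have 1: "p * z 1 + q * z' 1 = 0" using K0 unfolding 2 3 by simp
    have "p = 0 \<and> q = 0" by (rule ind) (use 0 1 2 3 in \<open>simp add: all_less_4\<close>)
    then show False using pq by blast
  qed
  have "S22 * W = z' 3 * (S22 * z 2 + S23 * z 3) - z 3 * (S22 * z' 2 + S23 * z' 3)"
    "S23 * W = z 2 * (S22 * z' 2 + S23 * z' 3) - z' 2 * (S22 * z 2 + S23 * z 3)"
    "S33 * W = z 2 * (S32 * z' 2 + S33 * z' 3) - z' 2 * (S32 * z 2 + S33 * z 3)"
    unfolding W_def by (simp_all add: algebra_simps)
  then have "S22 * W = 0" "S23 * W = 0" "S33 * W = 0"
    unfolding S[OF disjI1[OF refl]] S[OF disjI2[OF refl]] by simp_all
  then have z: "S22 = 0" "S23 = 0" "S33 = 0" using W0 by simp_all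
  have "S22 = lam * ?s * (3 - A * A - B * B - D * D + A * B * D)"
    unfolding S22_def K_def by (simp add: algebra_simps)
  then have "3 - A * A - B * B - D * D + A * B * D = 0" using z(1) lam0 s0 by simp
  then have "complex_of_real (3 - a * a - b * b - d * d + a * b * d) = 0"
    unfolding A_def B_def D_def by simp
  then have "3 - a * a - b * b - d * d + a * b * d = 0" by (simp only: of_real_eq_0_iff)
  then show "a * a + b * b + d * d - a * b * d = 3" by simp
  have "S33 = lam * ?s * (3 - A * A - C * C - E * E + A * C * E)"
    unfolding S33_def K_def by (simp add: algebra_simps)
  then have "3 - A * A - C * C - E * E + A * C * E = 0" using z(3) lam0 s0 by simp
  then have "complex_of_real (3 - a * a - c * c - e * e + a * c * e) = 0"
    unfolding A_def C_def E_def by simp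
  then have "3 - a * a - c * c - e * e + a * c * e = 0" by (simp only: of_real_eq_0_iff)
  then show "a * a + c * c + e * e - a * c * e = 3" by simp
  \<comment> \<open>Up to the factor \<open>lam\<close> the entry is a real number plus
    \<open>lam\<close> times a real number; as \<open>lam\<close> is not real, both vanish.\<close>
  have "S23 = lam * ((A * B * E - (B * C + D * E) + (3 - A * A) * F) + lam * (A * C * D - (B * C + D * E)))"
    unfolding S23_def K_def by (simp add: algebra_simps)
  then have "(A * B * E - (B * C + D * E) + (3 - A * A) * F) + lam * (A * C * D - (B * C + D * E)) = 0"
    using z(2) lam0 by simp
  then have "complex_of_real (a * b * e - (b * c + d * e) + (3 - a * a) * f) + lam * complex_of_real (a * c * d - (b * c + d * e)) = 0"
    unfolding A_def B_def C_def D_def E_def F_def by simp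
  from real_combination_zero[OF lam(2) this]
  have "a * b * e - (b * c + d * e) + (3 - a * a) * f = 0" and 4: "a * c * d - (b * c + d * e) = 0" .
  then show "b * c + d * e = a * c * d" "f * (3 - a * a) = a * (c * d - b * e)"
    by (simp_all add: algebra_simps)
qed

section \<open>Pairs of vectors and covectors realizing a Gram matrix\<close>

text \<open>The matrix \<open>1 - q x\<close> for a column \<open>q\<close> and a row
  \<open>x\<close>, scaled by \<open>g\<close>. The scalar is kept apart because determinant one
  will fix it only up to sign.\<close>

definition refl2 :: "complex \<Rightarrow> (nat \<Rightarrow> complex) \<Rightarrow> (nat \<Rightarrow> complex) \<Rightarrow> complex mat" where
  "refl2 g q x = mat 2 2 (\<lambda>(i,j). g * ((if i = j then 1 else 0) - q i * x j))"

lemma refl2_carrier [simp]: "refl2 g q x \<in> carrier_mat 2 2"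
  by (simp add: refl2_def)

lemma mat2_eqI:
  assumes "A \<in> carrier_mat 2 2" "B \<in> carrier_mat 2 2"
    "A $$ (0,0) = B $$ (0,0)" "A $$ (0,1) = B $$ (0,1)" "A $$ (1,0) = B $$ (1,0)" "A $$ (1,1) = B $$ (1,1)"
  shows "A = B"
proof (rule eq_matI)
  fix i j assume "i < dim_row B" "j < dim_col B"
  then have "(i = 0 \<or> i = 1) \<and> (j = 0 \<or> j = 1)" using assms by auto
  then show "A $$ (i,j) = B $$ (i,j)" using assms by auto
qed (use assms in auto)

lemma mat2_mult:
  assumes "A \<in> carrier_mat 2 2" "B \<in> carrier_mat 2 2" "i < 2" "j < 2"
  shows "(A * B) $$ (i,j) = A $$ (i,0) * B $$ (0,j) + A $$ (i,1) * B $$ (1,j)"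
  using assms by (simp add: scalar_prod_def numeral_2_eq_2)

lemma conj_refl2:
  assumes A: "A \<in> carrier_mat 2 2" and B: "B \<in> carrier_mat 2 2" and AB: "A * B = 1\<^sub>m 2"
  shows "A * refl2 g q x * B = refl2 g (\<lambda>i. A $$ (i,0) * q 0 + A $$ (i,1) * q 1)
      (\<lambda>j. x 0 * B $$ (0,j) + x 1 * B $$ (1,j))"
proof (rule eq_matI)
  fix i j assume "i < dim_row (refl2 g (\<lambda>i. A $$ (i,0) * q 0 + A $$ (i,1) * q 1) (\<lambda>j. x 0 * B $$ (0,j) + x 1 * B $$ (1,j)))"
    "j < dim_col (refl2 g (\<lambda>i. A $$ (i,0) * q 0 + A $$ (i,1) * q 1) (\<lambda>j. x 0 * B $$ (0,j) + x 1 * B $$ (1,j)))"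
  then have ij: "i < 2" "j < 2" by (auto simp: refl2_def)
  have r: "refl2 g q x $$ (k,l) = g * ((if k = l then 1 else 0) - q k * x l)" if "k < 2" "l < 2" for k l
    using that by (simp add: refl2_def)
  have AR: "A * refl2 g q x \<in> carrier_mat 2 2" using A by (auto simp: refl2_def)
  have AB': "A $$ (i,0) * B $$ (0,j) + A $$ (i,1) * B $$ (1,j) = (if i = j then 1 else 0)"
    using mat2_mult[OF A B ij] AB ij by simp
  have "(A * refl2 g q x * B) $$ (i,j) =
      (A $$ (i,0) * refl2 g q x $$ (0,0) + A $$ (i,1) * refl2 g q x $$ (1,0)) * B $$ (0,j) +
      (A $$ (i,0) * refl2 g q x $$ (0,1) + A $$ (i,1) * refl2 g q x $$ (1,1)) * B $$ (1,j)"
    using mat2_mult[OF AR B ij] mat2_mult[OF A refl2_carrier ij(1)] by simp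
  also have "\<dots> = g * ((A $$ (i,0) * B $$ (0,j) + A $$ (i,1) * B $$ (1,j)) -
      (A $$ (i,0) * q 0 + A $$ (i,1) * q 1) * (x 0 * B $$ (0,j) + x 1 * B $$ (1,j)))"
    by (simp add: r algebra_simps)
  finally show "(A * refl2 g q x * B) $$ (i,j) =
      refl2 g (\<lambda>i. A $$ (i,0) * q 0 + A $$ (i,1) * q 1) (\<lambda>j. x 0 * B $$ (0,j) + x 1 * B $$ (1,j)) $$ (i,j)"
    unfolding AB' using ij by (simp add: refl2_def)
qed (use A B in \<open>auto simp: refl2_def\<close>)

text \<open>As \<open>1 - q x\<close> has determinant \<open>1 - (1 + lam) = - lam\<close>, the
  condition on \<open>g k\<close> is the one imposed by determinant one. The fifth matrix carries no
  data of its own, since the product fixes it.\<close>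

definition realizes :: "complex \<Rightarrow> (nat \<Rightarrow> nat \<Rightarrow> complex) \<Rightarrow> complex mat list \<Rightarrow> bool" where
  "realizes lam G Ns \<longleftrightarrow> length Ns = 5 \<and> set Ns \<subseteq> SL2 \<and> tuple_prod 2 Ns = 1\<^sub>m 2 \<and>
     (\<exists>g q x. (\<forall>k<4. g k * g k = - 1 / lam \<and> Ns ! k = refl2 (g k) (q k) (x k)) \<and>
       (\<forall>k<4. \<forall>l<4. x k 0 * q l 0 + x k 1 * q l 1 = seifert lam G k l))"

section \<open>Products, conjugation and Hurwitz moves of tuples in SL2\<close>

lemma SL2_GL: "M \<in> SL2 \<Longrightarrow> M \<in> carrier (GL 2)"
proof -
  assume M: "M \<in> SL2"
  then have c: "M \<in> carrier_mat 2 2" and "det M \<noteq> 0" by (auto simp: SL2_def)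
  then have "M \<in> Units (ring_mat TYPE(complex) 2 ())" by (intro det_non_zero_imp_unit)
  then show ?thesis by (simp add: units_of_def)
qed

lemma SL2_mult: "A \<in> SL2 \<Longrightarrow> B \<in> SL2 \<Longrightarrow> A * B \<in> SL2"
  by (auto simp: SL2_def det_mult)

lemma SL2_conj:
  assumes "M \<in> SL2" "P \<in> carrier (GL 2)"
  shows "P * M * inv\<^bsub>GL 2\<^esub> P \<in> SL2"
proof -
  note P = GL_D[OF assms(2)]
  have M: "M \<in> carrier_mat 2 2" "det M = 1" using assms(1) by (auto simp: SL2_def)
  have "det P * det (inv\<^bsub>GL 2\<^esub> P) = 1" using P det_mult[OF P(1,2)] by simp
  then have "det (P * M * inv\<^bsub>GL 2\<^esub> P) = 1"
    using P M by (simp add: det_mult[of _ 2])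
  then show ?thesis using P M by (auto simp: SL2_def)
qed

lemma tuple_prod_append:
  assumes "set As \<subseteq> carrier_mat n n" "set Bs \<subseteq> carrier_mat n n"
  shows "tuple_prod n (As @ Bs) = tuple_prod n As * tuple_prod n Bs"
  using assms
proof (induction As)
  case (Cons A As)
  have c: "tuple_prod n As \<in> carrier_mat n n" "tuple_prod n Bs \<in> carrier_mat n n"
    using Cons.prems by (auto intro: tuple_prod_carrier)
  show ?case using Cons c by (simp add: tuple_prod_Cons assoc_mult_mat[of A n n _ n _ n])
next
  case Nil
  then show ?case using left_mult_one_mat[OF tuple_prod_carrier[of Bs n]] by (simp add: tuple_prod_Nil)
qed

lemma tuple_prod_conj:
  assumes P: "P \<in> carrier (GL n)" and "set As \<subseteq> carrier_mat n n"
  shows "tuple_prod n (map (\<lambda>M. P * M * inv\<^bsub>GL n\<^esub> P) As) = P * tuple_prod n As * inv\<^bsub>GL n\<^esub> P"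
  using assms(2)
proof (induction As)
  case Nil
  then show ?case using GL_D[OF P] by (simp add: tuple_prod_Nil)
next
  case (Cons A As)
  note G = GL_D[OF P]
  let ?Q = "inv\<^bsub>GL n\<^esub> P" and ?X = "tuple_prod n As"
  have c: "A \<in> carrier_mat n n" "?X \<in> carrier_mat n n"
    using Cons.prems by (auto intro: tuple_prod_carrier)
  have "?Q * (P * Z) = Z" if "Z \<in> carrier_mat n n" for Z
    using G that by (simp add: assoc_mult_mat[of _ n n _ n _ n, symmetric])
  then have "(P * A * ?Q) * (P * ?X * ?Q) = P * (A * ?X) * ?Q"
    using G c by (simp add: assoc_mult_mat[of _ n n _ n _ n])
  then show ?case using Cons by (simp add: tuple_prod_Cons)
qed

lemma tuple_prod_5:
  assumes "length Ns = 5" "set Ns \<subseteq> carrier_mat n n"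
  shows "tuple_prod n Ns = tuple_prod n (take 4 Ns) * Ns ! 4"
proof -
  have "Ns = take 4 Ns @ [Ns ! 4]" using assms(1) by (metis Suc_eq_plus1 lessI numeral_plus_one semiring_norm(5) take_Suc_conv_app_nth take_all_iff le_refl one_plus_numeral add.commute eval_nat_numeral(3))
  then have "tuple_prod n Ns = tuple_prod n (take 4 Ns @ [Ns ! 4])" by simp
  also have "\<dots> = tuple_prod n (take 4 Ns) * tuple_prod n [Ns ! 4]"
    using assms by (intro tuple_prod_append) (auto dest!: in_set_takeD)
  finally have "tuple_prod n Ns = tuple_prod n (take 4 Ns) * tuple_prod n [Ns ! 4]" .
  moreover have "Ns ! 4 \<in> carrier_mat n n" using assms by auto
  ultimately show ?thesis by (simp add: tuple_prod_Cons tuple_prod_Nil)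
qed

text \<open>The Gram matrix after the vectors \<open>v i\<close> and \<open>v (Suc i)\<close> are
  replaced by \<open>v (Suc i) - G i (Suc i) * v i\<close>, which is the reflected vector, and
  \<open>v i\<close>.\<close>

definition braid_gram :: "nat \<Rightarrow> (nat \<Rightarrow> nat \<Rightarrow> complex) \<Rightarrow> nat \<Rightarrow> nat \<Rightarrow> complex" where
  "braid_gram i G k l =
     (if k = i then (if l = i then 2 else if l = Suc i then - G i (Suc i) else G (Suc i) l - G i (Suc i) * G i l)
      else if k = Suc i then (if l = i then - G i (Suc i) else if l = Suc i then 2 else G i l)
      else if l = i then G k (Suc i) - G i (Suc i) * G k i else if l = Suc i then G k i else G k l)"

lemma braid_gen_length: "Suc i < length Ms \<Longrightarrow> length (braid_gen i Ms) = length Ms"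
  by (simp add: braid_gen_def)

lemma braid_gen_nth:
  assumes "Suc i < length Ms" "k < length Ms"
  shows "braid_gen i Ms ! k = (if k = i then Ms ! i * Ms ! Suc i * inv\<^bsub>GL 2\<^esub> (Ms ! i)
     else if k = Suc i then Ms ! i else Ms ! k)"
proof -
  have len: "length (take i Ms) = i" using assms by simp
  consider "k < i" | "k = i" | "k = Suc i" | m where "k = i + 2 + m"
    by (metis add_2_eq_Suc' le_Suc_ex not_less_eq_eq not_less order.order_iff_strict)
  then show ?thesis
  proof cases
    case (4 m)
    then have "braid_gen i Ms ! k = drop (i + 2) Ms ! m"
      unfolding braid_gen_def using len by (simp add: nth_append)
    then show ?thesis using 4 assms by simp
  qed (use len in \<open>auto simp: braid_gen_def nth_append\<close>)
qed

lemma braid_gen_SL2: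
  assumes "set Ms \<subseteq> SL2" "Suc i < length Ms"
  shows "set (braid_gen i Ms) \<subseteq> SL2"
proof -
  have "Ms ! i \<in> SL2" "Ms ! Suc i \<in> SL2" using assms by auto
  then have "Ms ! i * Ms ! Suc i * inv\<^bsub>GL 2\<^esub> (Ms ! i) \<in> SL2" by (intro SL2_conj SL2_GL)
  then show ?thesis using assms by (auto simp: braid_gen_def dest!: in_set_takeD in_set_dropD)
qed

lemma braid_gen_prod:
  assumes "set Ms \<subseteq> SL2" "Suc i < length Ms"
  shows "tuple_prod 2 (braid_gen i Ms) = tuple_prod 2 Ms"
proof -
  let ?A = "Ms ! i" and ?B = "Ms ! Suc i"
  have AB: "?A \<in> SL2" "?B \<in> SL2" using assms by auto
  note G = GL_D[OF SL2_GL[OF AB(1)]]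
  have Bc: "?B \<in> carrier_mat 2 2" using AB(2) by (simp add: SL2_def)
  have SLc: "X \<in> carrier_mat 2 2" if "X \<in> SL2" for X using that by (simp add: SL2_def)
  define X where "X = tuple_prod 2 (drop (i + 2) Ms)"
  have Xc: "X \<in> carrier_mat 2 2" unfolding X_def
    using assms(1) by (intro tuple_prod_carrier) (auto dest!: in_set_dropD SLc)
  have tc: "set (take i Ms) \<subseteq> carrier_mat 2 2" "set (drop (i + 2) Ms) \<subseteq> carrier_mat 2 2"
    using assms(1) by (auto dest!: in_set_dropD in_set_takeD SLc)
  have Ms: "Ms = take i Ms @ ?A # ?B # drop (i + 2) Ms"
    using assms(2) by (metis Cons_nth_drop_Suc Suc_lessD add_2_eq_Suc' append_take_drop_id)
  have "tuple_prod 2 (braid_gen i Ms) = tuple_prod 2 (take i Ms) * ((?A * ?B * inv\<^bsub>GL 2\<^esub> ?A) * (?A * X))"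
    unfolding braid_gen_def using tc G Bc Xc
    by (subst tuple_prod_append) (auto simp: tuple_prod_Cons X_def)
  also have "(?A * ?B * inv\<^bsub>GL 2\<^esub> ?A) * (?A * X) = ?A * (?B * X)"
  proof -
    have "inv\<^bsub>GL 2\<^esub> ?A * (?A * X) = X"
      using G Xc by (simp add: assoc_mult_mat[of _ 2 2 _ 2 _ 2, symmetric])
    then show ?thesis using G Bc Xc by (simp add: assoc_mult_mat[of _ 2 2 _ 2 _ 2])
  qed
  also have "tuple_prod 2 (take i Ms) * (?A * (?B * X)) = tuple_prod 2 (take i Ms @ ?A # ?B # drop (i + 2) Ms)"
    using tc G Bc by (subst tuple_prod_append) (auto simp: tuple_prod_Cons X_def)
  finally show ?thesis using Ms by simp
qed

text \<open>The reason is that the rank-one matrix \<open>q x\<close> squares to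
  \<open>1 + lam\<close> times itself.\<close>

lemma refl2_inverse:
  assumes g: "g * g = - 1 / lam" "lam \<noteq> 0" and xq: "x 0 * q 0 + x 1 * q 1 = 1 + lam"
  shows "refl2 g q x * refl2 (1 / g) (\<lambda>i. q i / lam) x = 1\<^sub>m 2"
proof -
  have g0: "g \<noteq> 0" using g by auto
  show ?thesis
  proof (rule eq_matI)
    fix i j assume "i < dim_row (1\<^sub>m 2 :: complex mat)" "j < dim_col (1\<^sub>m 2 :: complex mat)"
    then have ij: "i < 2" "j < 2" by auto
    define u v u' v' where "u = (if i = 0 then 1 else 0 :: complex)" and "v = (if i = 1 then 1 else 0 :: complex)"
      and "u' = (if 0 = j then 1 else 0 :: complex)" and "v' = (if 1 = j then 1 else 0 :: complex)"
    have uv: "u * q 0 + v * q 1 = q i" "x 0 * u' + x 1 * v' = x j" "u * u' + v * v' = (if i = j then 1 else 0)"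
      using ij by (auto simp: u_def v_def u'_def v'_def less_2_cases_iff)
    have "(refl2 g q x * refl2 (1 / g) (\<lambda>i. q i / lam) x) $$ (i,j) =
        g * (u - q i * x 0) * (1 / g * (u' - q 0 / lam * x j)) + g * (v - q i * x 1) * (1 / g * (v' - q 1 / lam * x j))"
      using ij by (subst mat2_mult) (auto simp: refl2_def u_def v_def u'_def v'_def)
    also have "\<dots> = (u - q i * x 0) * (u' - q 0 / lam * x j) + (v - q i * x 1) * (v' - q 1 / lam * x j)"
      using g0 by simp
    also have "\<dots> = (u * u' + v * v') - q i * (x 0 * u' + x 1 * v') - (u * q 0 + v * q 1) / lam * x j
        + q i * x j * (x 0 * q 0 + x 1 * q 1) / lam"
      using g(2) by (simp add: field_simps)
    also have "\<dots> = (if i = j then 1 else 0)"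
      unfolding uv xq using g(2) by (simp add: field_simps)
    finally show "(refl2 g q x * refl2 (1 / g) (\<lambda>i. q i / lam) x) $$ (i,j) = 1\<^sub>m 2 $$ (i,j)" using ij by simp
  qed (auto simp: refl2_def)
qed

text \<open>Conjugation by the reflection of index \<open>i\<close> leads to the column
  \<open>q (Suc i) - c * q i\<close> and the row \<open>x (Suc i) - c * x i\<close> with the same
  \<open>c\<close>: the factor \<open>lam\<close> in the pairing of \<open>x (Suc i)\<close> with
  \<open>q i\<close> cancels against the \<open>1 / lam\<close> in the inverse reflection. Hence the
  pairings keep the Seifert shape, now for the moved Gram matrix.\<close>

lemma realizes_braid:
  assumes re: "realizes lam G Ns" and i: "i < 3" and lam: "lam \<noteq> 0"
    and sym: "\<And>k l. G k l = G l k"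
  shows "realizes lam (braid_gram i G) (braid_gen i Ns)"
proof -
  from re obtain g q x where len: "length Ns = 5" and sl: "set Ns \<subseteq> SL2" and pr: "tuple_prod 2 Ns = 1\<^sub>m 2"
    and N: "\<And>k. k < 4 \<Longrightarrow> g k * g k = - 1 / lam \<and> Ns ! k = refl2 (g k) (q k) (x k)"
    and xq: "\<And>k l. k < 4 \<Longrightarrow> l < 4 \<Longrightarrow> x k 0 * q l 0 + x k 1 * q l 1 = seifert lam G k l"
    unfolding realizes_def by blast
  have i4: "i < 4" "Suc i < 4" using i by auto
  define c where "c = G i (Suc i)"
  define g' where "g' = (\<lambda>k. if k = i then g (Suc i) else if k = Suc i then g i else g k)"
  define q' where "q' = (\<lambda>k j. if k = i then q (Suc i) j - c * q i j else if k = Suc i then q i j else q k j)"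
  define x' where "x' = (\<lambda>k j. if k = i then x (Suc i) j - c * x i j else if k = Suc i then x i j else x k j)"
  have ii: "x i 0 * q i 0 + x i 1 * q i 1 = 1 + lam" using xq[OF i4(1) i4(1)] by (simp add: seifert_def)
  have gi: "g i * g i = - 1 / lam" using N[OF i4(1)] by blast
  have g0: "g i \<noteq> 0" using gi lam by auto
  define B where "B = refl2 (1 / g i) (\<lambda>j. q i j / lam) (x i)"
  have AB: "Ns ! i * B = 1\<^sub>m 2" unfolding B_def using N[OF i4(1)] refl2_inverse[OF gi lam ii] by simp
  have Ac: "Ns ! i \<in> carrier_mat 2 2" using N[OF i4(1)] by simp
  have Bc: "B \<in> carrier_mat 2 2" by (simp add: B_def)
  have inv: "inv\<^bsub>GL 2\<^esub> (Ns ! i) = B" by (rule GL_inv_eq[OF Ac Bc AB])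
  have f1: "x i 0 * q (Suc i) 0 + x i 1 * q (Suc i) 1 = c"
    using xq[OF i4] by (simp add: seifert_def c_def)
  have f2: "x (Suc i) 0 * q i 0 + x (Suc i) 1 * q i 1 = lam * c"
    using xq[OF i4(2,1)] sym by (simp add: seifert_def c_def)
  have main: "Ns ! i * Ns ! Suc i * B = refl2 (g (Suc i)) (q' i) (x' i)"
  proof -
    have "Ns ! i * Ns ! Suc i * B = refl2 (g (Suc i))
        (\<lambda>j. Ns ! i $$ (j,0) * q (Suc i) 0 + Ns ! i $$ (j,1) * q (Suc i) 1)
        (\<lambda>j. x (Suc i) 0 * B $$ (0,j) + x (Suc i) 1 * B $$ (1,j))"
      using N[OF i4(2)] conj_refl2[OF Ac Bc AB] by simp
    \<comment> \<open>Only the product of column and row matters, so the factor \<open>g i\<close>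
      and its inverse will cancel.\<close>
    also have "\<dots> = refl2 (g (Suc i)) (\<lambda>j. g i * q' i j) (\<lambda>j. x' i j / g i)"
    proof -
      have a: "Ns ! i $$ (j,0) * q (Suc i) 0 + Ns ! i $$ (j,1) * q (Suc i) 1 = g i * q' i j" if "j < 2" for j
      proof -
        have "Ns ! i $$ (j,0) * q (Suc i) 0 + Ns ! i $$ (j,1) * q (Suc i) 1 =
          g i * ((if j = 0 then q (Suc i) 0 else q (Suc i) 1) - q i j * (x i 0 * q (Suc i) 0 + x i 1 * q (Suc i) 1))"
          using N[OF i4(1)] that by (auto simp: refl2_def algebra_simps)
        also have "\<dots> = g i * q' i j" using that unfolding f1 by (auto simp: q'_def less_2_cases_iff mult.commute)
        finally show ?thesis .
      qed
      have b: "x (Suc i) 0 * B $$ (0,j) + x (Suc i) 1 * B $$ (1,j) = x' i j / g i" if "j < 2" for j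
      proof -
        have "x (Suc i) 0 * B $$ (0,j) + x (Suc i) 1 * B $$ (1,j) =
          1 / g i * ((if j = 0 then x (Suc i) 0 else x (Suc i) 1) - (x (Suc i) 0 * q i 0 + x (Suc i) 1 * q i 1) / lam * x i j)"
          using that g0 lam by (auto simp: B_def refl2_def field_simps)
        also have "\<dots> = x' i j / g i" using that lam unfolding f2 by (auto simp: x'_def less_2_cases_iff)
        finally show ?thesis .
      qed
      show ?thesis unfolding refl2_def by (rule cong_mat) (simp_all only: a b prod.case refl)
    qed
    also have "\<dots> = refl2 (g (Suc i)) (q' i) (x' i)"
      unfolding refl2_def using g0 by (intro cong_mat) auto
    finally show ?thesis .
  qed
  have si: "Suc i < length Ns" using i len by simp
  show ?thesis
    unfolding realizes_def
  proof (intro conjI exI allI impI)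
    show "length (braid_gen i Ns) = 5" using braid_gen_length[OF si] len by simp
    show "set (braid_gen i Ns) \<subseteq> SL2" by (rule braid_gen_SL2[OF sl si])
    show "tuple_prod 2 (braid_gen i Ns) = 1\<^sub>m 2" using braid_gen_prod[OF sl si] pr by simp
    fix k :: nat assume k: "k < 4"
    show "g' k * g' k = - 1 / lam" using N k i4 by (simp add: g'_def)
    show "braid_gen i Ns ! k = refl2 (g' k) (q' k) (x' k)"
    proof -
      have e: "q' (Suc i) = q i" "x' (Suc i) = x i" by (auto simp: q'_def x'_def)
      have e': "q' k = q k" "x' k = x k" if "k \<noteq> i" "k \<noteq> Suc i" using that by (auto simp: q'_def x'_def)
      show ?thesis using braid_gen_nth[OF si, of k] k len main inv N i4 e e' by (simp add: g'_def)
    qed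
    fix l :: nat assume l: "l < 4"
    have FF: "seifert lam G i i = 1 + lam" "seifert lam G (Suc i) (Suc i) = 1 + lam" "seifert lam G i (Suc i) = c" "seifert lam G (Suc i) i = lam * c"
      using sym by (simp_all add: seifert_def c_def)
    show "x' k 0 * q' l 0 + x' k 1 * q' l 1 = seifert lam (braid_gram i G) k l"
    proof -
      let ?f = "\<lambda>k l. x k 0 * q l 0 + x k 1 * q l 1"
      consider "k = i" | "k = Suc i" | "k \<noteq> i" "k \<noteq> Suc i" by blast
      then show ?thesis
      proof cases
        case 1
        consider "l = i" | "l = Suc i" | "l \<noteq> i" "l \<noteq> Suc i" by blast
        then show ?thesis
        proof cases
          case 1
          have "x' k 0 * q' l 0 + x' k 1 * q' l 1 = ?f (Suc i) (Suc i) - c * ?f (Suc i) i - c * ?f i (Suc i) + c * c * ?f i i"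
            using 1 \<open>k = i\<close> by (simp add: x'_def q'_def algebra_simps)
          also have "\<dots> = 1 + lam" unfolding xq[OF i4(2) i4(2)] xq[OF i4(2) i4(1)] xq[OF i4(1) i4(2)] xq[OF i4(1) i4(1)] FF
            by (simp add: algebra_simps)
          finally show ?thesis using 1 \<open>k = i\<close> by (simp add: seifert_def)
        next
          case 2
          have "x' k 0 * q' l 0 + x' k 1 * q' l 1 = ?f (Suc i) i - c * ?f i i"
            using 2 \<open>k = i\<close> by (simp add: x'_def q'_def algebra_simps)
          also have "\<dots> = - c" unfolding xq[OF i4(2) i4(1)] xq[OF i4(1) i4(1)] FF by (simp add: algebra_simps)
          finally show ?thesis using 2 \<open>k = i\<close> by (simp add: seifert_def braid_gram_def c_def)
        next
          case 3
          have "x' k 0 * q' l 0 + x' k 1 * q' l 1 = ?f (Suc i) l - c * ?f i l"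
            using 3 \<open>k = i\<close> by (simp add: x'_def q'_def algebra_simps)
          also have "\<dots> = seifert lam G (Suc i) l - c * seifert lam G i l" unfolding xq[OF i4(2) l] xq[OF i4(1) l] ..
          also have "\<dots> = seifert lam (braid_gram i G) k l"
            using 3 \<open>k = i\<close> by (auto simp: seifert_def braid_gram_def c_def algebra_simps)
          finally show ?thesis .
        qed
      next
        case 2
        consider "l = i" | "l = Suc i" | "l \<noteq> i" "l \<noteq> Suc i" by blast
        then show ?thesis
        proof cases
          case 1
          have "x' k 0 * q' l 0 + x' k 1 * q' l 1 = ?f i (Suc i) - c * ?f i i"
            using 1 \<open>k = Suc i\<close> by (simp add: x'_def q'_def algebra_simps)
          also have "\<dots> = - (lam * c)" unfolding xq[OF i4(1) i4(2)] xq[OF i4(1) i4(1)] FF by (simp add: algebra_simps)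
          finally show ?thesis using 1 \<open>k = Suc i\<close> by (simp add: seifert_def braid_gram_def c_def)
        next
          case 2
          then show ?thesis using \<open>k = Suc i\<close> xq[OF i4(1) i4(1)] by (simp add: x'_def q'_def seifert_def)
        next
          case 3
          have "x' k 0 * q' l 0 + x' k 1 * q' l 1 = seifert lam G i l"
            using 3 \<open>k = Suc i\<close> xq[OF i4(1) l] by (simp add: x'_def q'_def)
          also have "\<dots> = seifert lam (braid_gram i G) k l"
            using 3 \<open>k = Suc i\<close> by (auto simp: seifert_def braid_gram_def)
          finally show ?thesis .
        qed
      next
        case 3
        consider "l = i" | "l = Suc i" | "l \<noteq> i" "l \<noteq> Suc i" by blast
        then show ?thesis
        proof cases
          case 1
          have "x' k 0 * q' l 0 + x' k 1 * q' l 1 = ?f k (Suc i) - c * ?f k i"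
            using 1 3 by (simp add: x'_def q'_def algebra_simps)
          also have "\<dots> = seifert lam G k (Suc i) - c * seifert lam G k i" unfolding xq[OF k i4(2)] xq[OF k i4(1)] ..
          also have "\<dots> = seifert lam (braid_gram i G) k l"
            using 1 3 by (auto simp: seifert_def braid_gram_def c_def algebra_simps)
          finally show ?thesis .
        next
          case 2
          then show ?thesis using 3 xq[OF k i4(1)] by (auto simp: x'_def q'_def seifert_def braid_gram_def)
        next
          case l3: 3
          then show ?thesis using 3 xq[OF k l] by (auto simp: x'_def q'_def seifert_def braid_gram_def)
        qed
      qed
    qed
  qed
qed

text \<open>Negating a column together with its row does not change the matrix, so the tuple itself
  stays the same.\<close>

lemma realizes_sign:
  assumes re: "realizes lam G Ns" and e: "\<And>k. e k = 1 \<or> e k = (-1 :: complex)"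
  shows "realizes lam (\<lambda>k l. e k * e l * G k l) Ns"
proof -
  from re obtain g q x where len: "length Ns = 5" and sl: "set Ns \<subseteq> SL2" and pr: "tuple_prod 2 Ns = 1\<^sub>m 2"
    and N: "\<And>k. k < 4 \<Longrightarrow> g k * g k = - 1 / lam \<and> Ns ! k = refl2 (g k) (q k) (x k)"
    and xq: "\<And>k l. k < 4 \<Longrightarrow> l < 4 \<Longrightarrow> x k 0 * q l 0 + x k 1 * q l 1 = seifert lam G k l"
    unfolding realizes_def by blast
  have ee: "e k * e k = 1" for k using e[of k] by auto
  show ?thesis
    unfolding realizes_def
  proof (intro conjI exI allI impI)
    fix k l :: nat assume k: "k < 4"
    show "g k * g k = - 1 / lam" using N k by blast
    show "Ns ! k = refl2 (g k) (\<lambda>j. e k * q k j) (\<lambda>j. e k * x k j)"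
      using N[OF k] ee[of k] by (simp add: refl2_def mult.left_commute mult.assoc[symmetric])
    assume l: "l < 4"
    have "e k * x k 0 * (e l * q l 0) + e k * x k 1 * (e l * q l 1) = e k * e l * (x k 0 * q l 0 + x k 1 * q l 1)"
      by (simp add: algebra_simps)
    also have "\<dots> = e k * e l * seifert lam G k l" unfolding xq[OF k l] ..
    finally have "e k * x k 0 * (e l * q l 0) + e k * x k 1 * (e l * q l 1) = e k * e l * seifert lam G k l" .
    then show "e k * x k 0 * (e l * q l 0) + e k * x k 1 * (e l * q l 1) = seifert lam (\<lambda>k l. e k * e l * G k l) k l"
      using ee by (auto simp: seifert_def algebra_simps)
  qed (use len sl pr in auto)
qed

section \<open>Equivalence of realizations\<close>

text \<open>On SL2 conjugation by \<open>J\<close> is the inverse transpose. Transposing exchanges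
  columns and rows, and since the inverse of \<open>g * (1 - q x)\<close> is
  \<open>(1 / g) * (1 - q x / lam)\<close>, the parameter \<open>lam\<close> turns into its
  inverse.\<close>

lemma realizes_dual:
  assumes re: "realizes lam G Ns" and lam: "lam \<noteq> 0" and sym: "\<And>k l. G k l = G l k"
  obtains Ns' where "(Ns, Ns') \<in> simult_conj" "realizes (1 / lam) G Ns'"
proof -
  from re obtain g q x where len: "length Ns = 5" and sl: "set Ns \<subseteq> SL2" and pr: "tuple_prod 2 Ns = 1\<^sub>m 2"
    and N: "\<And>k. k < 4 \<Longrightarrow> g k * g k = - 1 / lam \<and> Ns ! k = refl2 (g k) (q k) (x k)"
    and xq: "\<And>k l. k < 4 \<Longrightarrow> l < 4 \<Longrightarrow> x k 0 * q l 0 + x k 1 * q l 1 = seifert lam G k l"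
    unfolding realizes_def by blast
  define J where "J = mat 2 2 (\<lambda>(i,j). if i = j then 0 else if i = 0 then 1 else -1 :: complex)"
  define J' where "J' = mat 2 2 (\<lambda>(i,j). if i = j then 0 else if i = 0 then -1 else 1 :: complex)"
  have Jc: "J \<in> carrier_mat 2 2" "J' \<in> carrier_mat 2 2" by (auto simp: J_def J'_def)
  have JJ: "J * J' = 1\<^sub>m 2"
    by (rule mat2_eqI) (auto simp: J_def J'_def scalar_prod_def numeral_2_eq_2)
  have J: "J \<in> carrier (GL 2)" by (rule GL_I[OF Jc JJ])
  have Ji: "inv\<^bsub>GL 2\<^esub> J = J'" by (rule GL_inv_eq[OF Jc JJ])
  define Ns' where "Ns' = map (\<lambda>M. J * M * inv\<^bsub>GL 2\<^esub> J) Ns"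
  have conj: "(Ns, Ns') \<in> simult_conj" unfolding simult_conj_def Ns'_def using sl J by blast
  have main: "J * refl2 (g k) (q k) (x k) * J' = refl2 (1 / g k) (\<lambda>j. x k j / lam) (q k)" if k: "k < 4" for k
  proof -
    have gg: "g k * g k = - 1 / lam" using N[OF k] by blast
    have g0: "g k \<noteq> 0" using gg lam by auto
    have S: "x k 0 * q k 0 + x k 1 * q k 1 = 1 + lam" using xq[OF k k] by (simp add: seifert_def)
    have gl: "g k * g k * lam = - 1" using gg lam by simp
    have "J * refl2 (g k) (q k) (x k) * J' = refl2 (g k) (\<lambda>i. J $$ (i,0) * q k 0 + J $$ (i,1) * q k 1)
      (\<lambda>j. x k 0 * J' $$ (0,j) + x k 1 * J' $$ (1,j))" by (rule conj_refl2[OF Jc JJ])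
    also have "\<dots> = refl2 (1 / g k) (\<lambda>j. x k j / lam) (q k)"
    proof -
      have a: "g k * (1 - u) = 1 / g k * (1 - v / lam)" if "u + v = 1 + lam" for u v
      proof -
        have "u = 1 + lam - v" using that by (simp add: algebra_simps)
        then have "g k * g k * lam * (1 - u) = lam - v" unfolding gl by (simp add: algebra_simps)
        then show ?thesis using g0 lam by (simp add: field_simps)
      qed
      have b: "g k * u = - (1 / g k * (u / lam))" for u
      proof -
        have "g k * g k * lam * u = - u" unfolding gl by simp
        then show ?thesis using g0 lam by (simp add: field_simps)
      qed
      show ?thesis
        using a[of "q k 1 * x k 1" "q k 0 * x k 0"] a[of "q k 0 * x k 0" "q k 1 * x k 1"] S
          b[of "q k 1 * x k 0"] b[of "q k 0 * x k 1"]
        by (intro mat2_eqI) (simp_all add: refl2_def J_def J'_def algebra_simps)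
    qed
    finally show ?thesis .
  qed
  have "realizes (1 / lam) G Ns'"
    unfolding realizes_def
  proof (intro conjI exI allI impI)
    show "length Ns' = 5" using len by (simp add: Ns'_def)
    show "set Ns' \<subseteq> SL2" using sl J SL2_conj by (auto simp: Ns'_def)
    have "set Ns \<subseteq> carrier_mat 2 2" using sl by (auto simp: SL2_def)
    then show "tuple_prod 2 Ns' = 1\<^sub>m 2"
      unfolding Ns'_def using tuple_prod_conj[OF J] pr GL_D[OF J] by simp
    fix k l :: nat assume k: "k < 4"
    have "g k * g k = - 1 / lam" using N[OF k] by blast
    moreover have "1 / g k * (1 / g k) = 1 / (g k * g k)" by simp
    ultimately show "1 / g k * (1 / g k) = - 1 / (1 / lam)" using lam by simp
    show "Ns' ! k = refl2 (1 / g k) (\<lambda>j. x k j / lam) (q k)"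
      using N[OF k] main[OF k] k len Ji by (simp add: Ns'_def)
    assume l: "l < 4"
    have "q k 0 * (x l 0 / lam) + q k 1 * (x l 1 / lam) = (x l 0 * q k 0 + x l 1 * q k 1) / lam"
      by (simp add: add_divide_distrib mult.commute)
    also have "\<dots> = seifert lam G l k / lam" unfolding xq[OF l k] ..
    also have "\<dots> = seifert (1 / lam) G k l" using lam sym by (auto simp: seifert_def field_simps)
    finally show "q k 0 * (x l 0 / lam) + q k 1 * (x l 1 / lam) = seifert (1 / lam) G k l" .
  qed
  then show thesis using conj that by blast
qed

lemma smult_smult_mat: "a \<cdot>\<^sub>m (b \<cdot>\<^sub>m M) = (a * b) \<cdot>\<^sub>m (M :: complex mat)"
  by (intro eq_matI) auto

lemma tuple_prod_smult:
  assumes "length cs = length Ms" "set Ms \<subseteq> carrier_mat n n"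
  shows "tuple_prod n (map2 (\<cdot>\<^sub>m) cs Ms) = prod_list cs \<cdot>\<^sub>m tuple_prod n Ms"
  using assms
proof (induction cs Ms rule: list_induct2)
  case Nil
  then show ?case by (auto simp: tuple_prod_Nil)
next
  case (Cons c cs M Ms)
  have X: "tuple_prod n Ms \<in> carrier_mat n n" "M \<in> carrier_mat n n"
    using Cons.prems by (auto intro: tuple_prod_carrier)
  then show ?case using Cons
    by (simp add: tuple_prod_Cons mult_smult_assoc_mat[of _ n n _ n] mult_smult_distrib[of _ n n _ n] smult_smult_mat mult.commute)
qed

text \<open>By \<open>nd\<close> the leading block \<open>B\<close> of pairings is invertible, so
  the first two columns form a basis on which the first two rows are coordinates up to
  \<open>B\<close>. The pairings then determine all columns and rows up to one change of basis, and
  the scalars are determined up to signs.\<close>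

lemma realizes_unique:
  assumes re: "realizes lam G Ns" and re': "realizes lam G Ns'"
    and nd: "(1 + lam) * (1 + lam) - lam * G 0 1 * G 1 0 \<noteq> 0" and lam: "lam \<noteq> 0"
  shows "tuple_equivalent Ns Ns'"
proof -
  from re obtain g q x where len: "length Ns = 5" and sl: "set Ns \<subseteq> SL2" and pr: "tuple_prod 2 Ns = 1\<^sub>m 2"
    and N: "\<And>k. k < 4 \<Longrightarrow> g k * g k = - 1 / lam \<and> Ns ! k = refl2 (g k) (q k) (x k)"
    and xq: "\<And>k l. k < 4 \<Longrightarrow> l < 4 \<Longrightarrow> x k 0 * q l 0 + x k 1 * q l 1 = seifert lam G k l"
    unfolding realizes_def by blast
  from re' obtain g' q' x' where len': "length Ns' = 5" and sl': "set Ns' \<subseteq> SL2" and pr': "tuple_prod 2 Ns' = 1\<^sub>m 2"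
    and N': "\<And>k. k < 4 \<Longrightarrow> g' k * g' k = - 1 / lam \<and> Ns' ! k = refl2 (g' k) (q' k) (x' k)"
    and xq': "\<And>k l. k < 4 \<Longrightarrow> l < 4 \<Longrightarrow> x' k 0 * q' l 0 + x' k 1 * q' l 1 = seifert lam G k l"
    unfolding realizes_def by blast
  define X where "X = mat 2 2 (\<lambda>(i,j). q j i)"
  define X' where "X' = mat 2 2 (\<lambda>(i,j). q' j i)"
  define Y where "Y = mat 2 2 (\<lambda>(i,j). x i j)"
  define Y' where "Y' = mat 2 2 (\<lambda>(i,j). x' i j)"
  define B where "B = mat 2 2 (\<lambda>(i,j). seifert lam G i j)"
  define D where "D = (1 + lam) * (1 + lam) - lam * G 0 1 * G 1 0"
  define Bi where "Bi = mat 2 2 (\<lambda>(i,j). (if i = j then 1 + lam else - seifert lam G i j) / D)"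
  have c: "X \<in> carrier_mat 2 2" "X' \<in> carrier_mat 2 2" "Y \<in> carrier_mat 2 2" "Y' \<in> carrier_mat 2 2"
    "B \<in> carrier_mat 2 2" "Bi \<in> carrier_mat 2 2"
    by (auto simp: X_def X'_def Y_def Y'_def B_def Bi_def)
  have D0: "D \<noteq> 0" using nd by (simp add: D_def)
  have YX: "Y * X = B" "Y' * X' = B"
    using xq xq' by (auto intro!: mat2_eqI simp: X_def X'_def Y_def Y'_def B_def scalar_prod_def numeral_2_eq_2)
  have BiB: "Bi * B = 1\<^sub>m 2"
  proof (rule mat2_eqI)
    show "Bi * B \<in> carrier_mat 2 2" using c by auto
    have d: "((1 + lam) * (1 + lam) - lam * G 0 1 * G 1 0) / D = 1" using D0 by (simp add: D_def)
    have f: "seifert lam G 0 1 = G 0 1" "seifert lam G 1 0 = lam * G 1 0" "seifert lam G 0 0 = 1 + lam" "seifert lam G 1 1 = 1 + lam"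
      by (simp_all add: seifert_def)
    have "(Bi * B) $$ (0,0) = ((1 + lam) * (1 + lam) - lam * G 0 1 * G 1 0) / D"
      "(Bi * B) $$ (1,1) = ((1 + lam) * (1 + lam) - lam * G 0 1 * G 1 0) / D"
      using f by (simp_all add: Bi_def B_def scalar_prod_def numeral_2_eq_2 diff_divide_distrib add_divide_distrib algebra_simps)
    then show "(Bi * B) $$ (0,0) = 1\<^sub>m 2 $$ (0,0)" "(Bi * B) $$ (1,1) = 1\<^sub>m 2 $$ (1,1)" using d by simp_all
    show "(Bi * B) $$ (0,1) = 1\<^sub>m 2 $$ (0,1)" "(Bi * B) $$ (1,0) = 1\<^sub>m 2 $$ (1,0)"
      using f by (simp_all add: Bi_def B_def scalar_prod_def numeral_2_eq_2)
  qed simp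
  note as = assoc_mult_mat[of _ 2 2 _ 2 _ 2]
  \<comment> \<open>Because of \<open>Y * X = B\<close>, the matrix \<open>Bi * Y\<close> computes
    coordinates in the basis of the first two columns; thus \<open>A\<close> carries the columns of
    the first tuple to those of the second.\<close>
  define A where "A = X' * (Bi * Y)"
  define A' where "A' = X * (Bi * Y')"
  have Ac: "A \<in> carrier_mat 2 2" "A' \<in> carrier_mat 2 2" using c by (auto simp: A_def A'_def)
  have one': "X' * (Bi * Y') = 1\<^sub>m 2"
  proof (rule mat_mult_left_right_inverse[of "Bi * Y'" 2 X'])
    show "(Bi * Y') * X' = 1\<^sub>m 2" using c YX BiB by (simp add: as)
  qed (use c in auto)
  have "A * A' = X' * (Bi * (Y * X) * (Bi * Y'))" using c by (simp add: A_def A'_def as)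
  also have "\<dots> = X' * (Bi * Y')" unfolding YX BiB using c by simp
  finally have AA: "A * A' = 1\<^sub>m 2" using one' by simp
  have A: "A \<in> carrier (GL 2)" by (rule GL_I[OF Ac AA])
  have Ai: "inv\<^bsub>GL 2\<^esub> A = A'" by (rule GL_inv_eq[OF Ac AA])
  have Aq: "A $$ (i,0) * q k 0 + A $$ (i,1) * q k 1 = q' k i" if k: "k < 4" and i: "i < 2" for k i
  proof -
    define v where "v = vec 2 (q k)"
    define v' where "v' = vec 2 (q' k)"
    have vc: "v \<in> carrier_vec 2" "v' \<in> carrier_vec 2" by (auto simp: v_def v'_def)
    have YY: "Y *\<^sub>v v = Y' *\<^sub>v v'"
    proof (rule eq_vecI)
      fix j assume "j < dim_vec (Y' *\<^sub>v v')"
      then have j: "j < 2" by (simp add: Y'_def)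
      then have j4: "j < 4" by simp
      show "(Y *\<^sub>v v) $ j = (Y' *\<^sub>v v') $ j"
        using j xq[OF j4 k] xq'[OF j4 k] by (simp add: Y_def Y'_def v_def v'_def scalar_prod_def numeral_2_eq_2)
    qed (simp add: Y_def Y'_def)
    have "A *\<^sub>v v = X' *\<^sub>v (Bi *\<^sub>v (Y *\<^sub>v v))"
      using c vc unfolding A_def by (simp add: assoc_mult_mat_vec[of _ 2 2 _ 2])
    also have "\<dots> = (X' * (Bi * Y')) *\<^sub>v v'"
      unfolding YY using c vc by (simp add: assoc_mult_mat_vec[of _ 2 2 _ 2])
    finally have "A *\<^sub>v v = v'" using one' vc by simp
    then have "(A *\<^sub>v v) $ i = v' $ i" by simp
    then show ?thesis using Ac i by (simp add: v_def v'_def scalar_prod_def numeral_2_eq_2)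
  qed
  have xA: "x k 0 * A' $$ (0,j) + x k 1 * A' $$ (1,j) = x' k j" if k: "k < 4" and j: "j < 2" for k j
  proof -
    define u where "u = mat 1 2 (\<lambda>(i,j). x k j)"
    define u' where "u' = mat 1 2 (\<lambda>(i,j). x' k j)"
    have uc: "u \<in> carrier_mat 1 2" "u' \<in> carrier_mat 1 2" by (auto simp: u_def u'_def)
    have UX: "u * X = u' * X'"
    proof (rule eq_matI)
      fix i j assume "i < dim_row (u' * X')" "j < dim_col (u' * X')"
      then have ij: "i = 0" "j < 2" using c uc by auto
      then have j4: "j < 4" by simp
      show "(u * X) $$ (i,j) = (u' * X') $$ (i,j)"
        using ij xq[OF k j4] xq'[OF k j4] by (simp add: X_def X'_def u_def u'_def scalar_prod_def numeral_2_eq_2)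
    qed (use c uc in auto)
    have "u * A' = (u * X) * (Bi * Y')" using c uc unfolding A'_def by (simp add: assoc_mult_mat[of u 1 2 _ 2 _ 2])
    also have "\<dots> = u' * (X' * (Bi * Y'))" unfolding UX using c uc by (simp add: assoc_mult_mat[of u' 1 2 _ 2 _ 2])
    finally have "u * A' = u'" using one' uc by simp
    then have "(u * A') $$ (0,j) = u' $$ (0,j)" by simp
    then show ?thesis using Ac j by (simp add: u_def u'_def scalar_prod_def numeral_2_eq_2)
  qed
  define Ms where "Ms = map (\<lambda>M. A * M * inv\<^bsub>GL 2\<^esub> A) Ns"
  have conj: "(Ns, Ms) \<in> simult_conj" unfolding simult_conj_def Ms_def using sl A by blast
  have lenM: "length Ms = 5" using len by (simp add: Ms_def)
  have slM: "set Ms \<subseteq> SL2" using sl A SL2_conj by (auto simp: Ms_def)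
  have carr: "set Ns \<subseteq> carrier_mat 2 2" "set Ms \<subseteq> carrier_mat 2 2" "set Ns' \<subseteq> carrier_mat 2 2"
    using sl slM sl' by (auto simp: SL2_def)
  have prM: "tuple_prod 2 Ms = 1\<^sub>m 2" unfolding Ms_def using tuple_prod_conj[OF A carr(1)] pr GL_D[OF A] by simp
  define e where "e = (\<lambda>k. g' k / g k)"
  have g0: "g k \<noteq> 0" if "k < 4" for k using N[OF that] lam by auto
  have e1: "e k = 1 \<or> e k = -1" if "k < 4" for k
  proof -
    have "e k * e k = (g' k * g' k) / (g k * g k)" by (simp add: e_def)
    also have "\<dots> = (- 1 / lam) / (- 1 / lam)" using N[OF that] N'[OF that] by simp
    finally have "e k * e k = 1" using lam by simp
    then show ?thesis by (simp add: square_eq_1_iff)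
  qed
  have Mk: "Ns' ! k = e k \<cdot>\<^sub>m Ms ! k" if k: "k < 4" for k
  proof -
    have "Ms ! k = A * refl2 (g k) (q k) (x k) * A'" using k len N[OF k] Ai by (simp add: Ms_def)
    also have "\<dots> = refl2 (g k) (q' k) (x' k)"
      unfolding conj_refl2[OF Ac AA] unfolding refl2_def
      by (rule cong_mat) (simp_all only: Aq[OF k] xA[OF k] prod.case refl)
    finally show ?thesis using N'[OF k] g0[OF k] by (intro eq_matI) (auto simp: refl2_def e_def)
  qed
  \<comment> \<open>Both tuples have product 1, so the sign of the fifth entry is the product of the
    other four signs. This makes the number of minus signs even.\<close>
  define p where "p = e 0 * e 1 * e 2 * e 3"
  have p1: "p = 1 \<or> p = -1" using e1[of 0] e1[of 1] e1[of 2] e1[of 3] by (auto simp: p_def)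
  define ss where "ss = [e 0, e 1, e 2, e 3, p]"
  have take4: "take 4 Ns' = map2 (\<cdot>\<^sub>m) [e 0, e 1, e 2, e 3] (take 4 Ms)"
    using len' lenM Mk by (intro nth_equalityI) (auto simp: nth_Cons' dest!: less_4_cases)
  have M4: "Ns' ! 4 = p \<cdot>\<^sub>m Ms ! 4"
  proof -
    let ?T = "tuple_prod 2 (take 4 Ms)"
    have tc: "set (take 4 Ms) \<subseteq> carrier_mat 2 2" using carr by (auto dest!: in_set_takeD)
    have T: "?T \<in> carrier_mat 2 2" by (rule tuple_prod_carrier[OF tc])
    have m: "Ms ! 4 \<in> carrier_mat 2 2" "Ns' ! 4 \<in> carrier_mat 2 2" using carr lenM len' by auto
    have TM: "?T * Ms ! 4 = 1\<^sub>m 2" using tuple_prod_5[OF lenM carr(2)] prM by simp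
    have "tuple_prod 2 (take 4 Ns') = p \<cdot>\<^sub>m ?T"
      unfolding take4 using lenM tc by (subst tuple_prod_smult) (auto simp: p_def mult.assoc)
    then have TN: "p \<cdot>\<^sub>m ?T * Ns' ! 4 = 1\<^sub>m 2" using tuple_prod_5[OF len' carr(3)] pr' by simp
    have MT: "Ms ! 4 * ?T = 1\<^sub>m 2" by (rule mat_mult_left_right_inverse[OF T m(1) TM])
    have "p \<cdot>\<^sub>m Ms ! 4 = (p \<cdot>\<^sub>m Ms ! 4) * (p \<cdot>\<^sub>m ?T * Ns' ! 4)" unfolding TN using m by simp
    also have "\<dots> = (p * p) \<cdot>\<^sub>m ((Ms ! 4 * ?T) * Ns' ! 4)"
      using T m by (simp add: mult_smult_assoc_mat[of _ 2 2 _ 2] mult_smult_distrib[of _ 2 2 _ 2] smult_smult_mat as)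
    also have "\<dots> = Ns' ! 4" unfolding MT using p1 m by auto
    finally show ?thesis by simp
  qed
  have "Ns' = map2 (\<cdot>\<^sub>m) ss Ms"
  proof (rule nth_equalityI)
    show "length Ns' = length (map2 (\<cdot>\<^sub>m) ss Ms)" using len' lenM by (simp add: ss_def)
    fix k assume "k < length Ns'"
    then have "k < 5" using len' by simp
    then have "k = 0 \<or> k = 1 \<or> k = 2 \<or> k = 3 \<or> k = 4" by linarith
    then show "Ns' ! k = map2 (\<cdot>\<^sub>m) ss Ms ! k" using Mk M4 lenM by (auto simp: ss_def)
  qed
  moreover have "length ss = length Ms" "set ss \<subseteq> {1, -1}" "prod_list ss = 1"
    using lenM e1[of 0] e1[of 1] e1[of 2] e1[of 3] p1 by (auto simp: ss_def p_def)
  ultimately have "(Ms, Ns') \<in> sign_change" unfolding sign_change_def using slM by blast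
  with conj show ?thesis unfolding tuple_equivalent_def by (meson UnI1 UnI2 converse_rtrancl_into_rtrancl r_into_rtrancl)
qed

section \<open>Equivalence of tuples is symmetric and transitive\<close>

lemma simult_conj_sym:
  assumes "(Ms, Ns) \<in> simult_conj" shows "(Ns, Ms) \<in> simult_conj"
proof -
  obtain P where sl: "set Ms \<subseteq> SL2" and P: "P \<in> carrier (GL 2)"
    and Ns: "Ns = map (\<lambda>M. P * M * inv\<^bsub>GL 2\<^esub> P) Ms"
    using assms unfolding simult_conj_def by blast
  note G = GL_D[OF P]
  let ?Q = "inv\<^bsub>GL 2\<^esub> P"
  have Q: "?Q \<in> carrier (GL 2)" by (rule GL_I[OF G(2,1,4)])
  have QQ: "inv\<^bsub>GL 2\<^esub> ?Q = P" by (rule GL_inv_eq[OF G(2,1,4)])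
  have "?Q * (P * M * ?Q) * P = M" if M: "M \<in> carrier_mat 2 2" for M
  proof -
    have "?Q * (P * Z) = Z" if "Z \<in> carrier_mat 2 2" for Z
      using G that by (simp add: assoc_mult_mat[of _ 2 2 _ 2 _ 2, symmetric])
    then show ?thesis using G M by (simp add: assoc_mult_mat[of _ 2 2 _ 2 _ 2])
  qed
  then have "Ms = map (\<lambda>M. ?Q * M * inv\<^bsub>GL 2\<^esub> ?Q) Ns"
    using sl unfolding Ns QQ by (intro nth_equalityI) (auto simp: SL2_def subset_iff)
  moreover have "set Ns \<subseteq> SL2" using sl P SL2_conj unfolding Ns by auto
  ultimately show ?thesis unfolding simult_conj_def using Q by blast
qed

lemma sign_change_sym:
  assumes "(Ms, Ns) \<in> sign_change" shows "(Ns, Ms) \<in> sign_change"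
proof -
  obtain ss where sl: "set Ms \<subseteq> SL2" and ss: "length ss = length Ms" "set ss \<subseteq> {1, -1}" "prod_list ss = 1"
    and Ns: "Ns = map2 (\<cdot>\<^sub>m) ss Ms"
    using assms unfolding sign_change_def by blast
  have s: "ss ! k = 1 \<or> ss ! k = -1" if "k < length Ms" for k
  proof -
    have "ss ! k \<in> set ss" using ss(1) that by simp
    then show ?thesis using ss(2) by blast
  qed
  have "set Ns \<subseteq> SL2"
  proof
    fix M assume "M \<in> set Ns"
    then obtain k where k: "k < length Ms" "M = ss ! k \<cdot>\<^sub>m Ms ! k"
      using ss(1) unfolding Ns by (auto simp: in_set_conv_nth)
    then have "Ms ! k \<in> SL2" using sl by auto
    then show "M \<in> SL2" using s[OF k(1)] unfolding k(2) by (auto simp: SL2_def)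
  qed
  moreover have "Ms = map2 (\<cdot>\<^sub>m) ss Ns"
  proof (rule nth_equalityI)
    fix k assume k: "k < length Ms"
    then show "Ms ! k = map2 (\<cdot>\<^sub>m) ss Ns ! k"
      using s[OF k] ss(1) unfolding Ns by (auto simp: smult_smult_mat)
  qed (use ss in \<open>simp add: Ns\<close>)
  moreover have "length ss = length Ns" using ss by (simp add: Ns)
  ultimately show ?thesis unfolding sign_change_def using ss by blast
qed

lemma tuple_equivalent_sym: "tuple_equivalent Ms Ns \<Longrightarrow> tuple_equivalent Ns Ms"
proof -
  let ?R = "simult_conj \<union> braid_step \<union> braid_step\<inverse> \<union> sign_change"
  have "sym ?R" by (rule symI) (auto intro: simult_conj_sym sign_change_sym)
  then have "sym (?R\<^sup>*)" by (rule sym_rtrancl)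
  then show "tuple_equivalent Ms Ns \<Longrightarrow> tuple_equivalent Ns Ms"
    unfolding tuple_equivalent_def by (rule symD)
qed

lemma tuple_equivalent_trans: "tuple_equivalent Ms Ns \<Longrightarrow> tuple_equivalent Ns Ks \<Longrightarrow> tuple_equivalent Ms Ks"
  unfolding tuple_equivalent_def by (rule rtrancl_trans)

section \<open>Following Gram matrices along Hurwitz moves\<close>

definition gram6 :: "real \<Rightarrow> real \<Rightarrow> real \<Rightarrow> real \<Rightarrow> real \<Rightarrow> real \<Rightarrow> nat \<Rightarrow> nat \<Rightarrow> complex" where
  "gram6 a b c d e f k l = complex_of_real
     (if k = l then 2 else
      if k + l = 1 then a else if {k, l} = {0, 2} then b else if {k, l} = {0, 3} then c else
      if {k, l} = {1, 2} then d else if {k, l} = {1, 3} then e else if {k, l} = {2, 3} then f else 0)"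

lemma gram6_sym: "gram6 a b c d e f k l = gram6 a b c d e f l k"
  by (simp add: gram6_def insert_commute add.commute)

lemma gram6_simps:
  "gram6 a b c d e f 0 1 = of_real a" "gram6 a b c d e f 0 2 = of_real b" "gram6 a b c d e f 0 3 = of_real c"
  "gram6 a b c d e f 1 2 = of_real d" "gram6 a b c d e f 1 3 = of_real e" "gram6 a b c d e f 2 3 = of_real f"
  "gram6 a b c d e f 1 0 = of_real a" "gram6 a b c d e f 2 0 = of_real b" "gram6 a b c d e f 3 0 = of_real c"
  "gram6 a b c d e f 2 1 = of_real d" "gram6 a b c d e f 3 1 = of_real e" "gram6 a b c d e f 3 2 = of_real f"
  by (simp_all add: gram6_def doubleton_eq_iff)

lemma realizes_cong:
  assumes "realizes lam G Ns" "\<And>k l. k < 4 \<Longrightarrow> l < 4 \<Longrightarrow> k \<noteq> l \<Longrightarrow> G k l = G' k l"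
  shows "realizes lam G' Ns"
proof -
  have "seifert lam G k l = seifert lam G' k l" if "k < 4" "l < 4" for k l
    using assms(2) that by (auto simp: seifert_def)
  then show ?thesis using assms(1) unfolding realizes_def by auto
qed

lemma braid_equivalent:
  assumes "realizes lam G Ns" "i < 3"
  shows "tuple_equivalent Ns (braid_gen i Ns)"
proof -
  have "(Ns, braid_gen i Ns) \<in> braid_step"
    using assms unfolding realizes_def braid_step_def by auto
  then show ?thesis unfolding tuple_equivalent_def by auto
qed

lemma realizes_gram6I:
  assumes "realizes lam G Ns" and sym: "\<And>k l. G k l = G l k"
    and "G 0 1 = of_real a" "G 0 2 = of_real b" "G 0 3 = of_real c"
      "G 1 2 = of_real d" "G 1 3 = of_real e" "G 2 3 = of_real f"
  shows "realizes lam (gram6 a b c d e f) Ns"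
proof (rule realizes_cong[OF assms(1)])
  fix k l :: nat assume kl: "k < 4" "l < 4" "k \<noteq> l"
  have "G 1 0 = of_real a" "G 2 0 = of_real b" "G 3 0 = of_real c"
      "G 2 1 = of_real d" "G 3 1 = of_real e" "G 3 2 = of_real f"
    using assms(3-8) sym[of 0 1] sym[of 0 2] sym[of 0 3] sym[of 1 2] sym[of 1 3] sym[of 2 3] by simp_all
  note eqs = this assms(3-8)
  show "G k l = gram6 a b c d e f k l"
    using less_4_cases[OF kl(1)] less_4_cases[OF kl(2)] kl(3)
    by (elim disjE; hypsubst; (simp only: eqs gram6_simps)?; simp)
qed

lemma braid_gram_sym:
  assumes "\<And>k l. G k l = G l k"
  shows "braid_gram i G k l = braid_gram i G l k"
  unfolding braid_gram_def by (simp add: assms)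

lemma braid_gram_0:
  "braid_gram 0 G 0 1 = - G 0 1" "braid_gram 0 G 0 2 = G 1 2 - G 0 1 * G 0 2"
  "braid_gram 0 G 0 3 = G 1 3 - G 0 1 * G 0 3" "braid_gram 0 G 1 2 = G 0 2"
  "braid_gram 0 G 1 3 = G 0 3" "braid_gram 0 G 2 3 = G 2 3"
  by (simp_all add: braid_gram_def)

lemma braid_gram_1:
  "braid_gram 1 G 0 1 = G 0 2 - G 1 2 * G 0 1" "braid_gram 1 G 0 2 = G 0 1"
  "braid_gram 1 G 0 3 = G 0 3" "braid_gram 1 G 1 2 = - G 1 2"
  "braid_gram 1 G 1 3 = G 2 3 - G 1 2 * G 1 3" "braid_gram 1 G 2 3 = G 1 3"
  by (simp_all add: braid_gram_def numeral_2_eq_2 numeral_3_eq_3)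

text \<open>Hurwitz moves of Gram matrices lift to braid generators, while sign changes leave the
  tuple as it is. At the end of the path uniqueness applies, because the leading block of the base
  matrix has determinant \<open>(1 + lam)^2 - lam = 2 * lam\<close>.\<close>

lemma gram_orbit_equivalent:
  assumes orb: "gram_orbit a b c d e f" and re: "realizes lam (gram6 a b c d e f) Ns"
    and lam: "lam * lam = lam - 1" "lam \<noteq> 0"
    and Ms: "realizes lam (gram6 1 (sqrt 2) 0 0 (sqrt 2) (-1)) Ms"
  shows "tuple_equivalent Ns Ms"
  using orb re
proof (induction arbitrary: Ns)
  case base
  have "(1 + lam) * (1 + lam) - lam * 1 * 1 = 2 * lam" using lam(1) by (simp add: algebra_simps)
  then show ?case
    using lam(2) by (intro realizes_unique[OF base Ms]) (simp_all add: gram6_simps[simplified])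
next
  case (braid0 a d b e c f)
  have "realizes lam (braid_gram 0 (gram6 a b c d e f)) (braid_gen 0 Ns)"
    by (rule realizes_braid[OF braid0.prems _ lam(2) gram6_sym]) simp
  then have "realizes lam (gram6 (-a) (d - a * b) (e - a * c) b c f) (braid_gen 0 Ns)"
    by (rule realizes_gram6I[OF _ braid_gram_sym[OF gram6_sym]], unfold braid_gram_0 braid_gram_1 gram6_simps)
      simp_all
  then have "tuple_equivalent (braid_gen 0 Ns) Ms" by (rule braid0.IH)
  moreover have "tuple_equivalent Ns (braid_gen 0 Ns)" by (rule braid_equivalent[OF braid0.prems]) simp
  ultimately show ?case using tuple_equivalent_trans by blast
next
  case (braid1 b d a c f e)
  have "realizes lam (braid_gram 1 (gram6 a b c d e f)) (braid_gen 1 Ns)"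
    by (rule realizes_braid[OF braid1.prems _ lam(2) gram6_sym]) simp
  then have "realizes lam (gram6 (b - d * a) a c (-d) (f - d * e) e) (braid_gen 1 Ns)"
    by (rule realizes_gram6I[OF _ braid_gram_sym[OF gram6_sym]], unfold braid_gram_0 braid_gram_1 gram6_simps)
      simp_all
  then have "tuple_equivalent (braid_gen 1 Ns) Ms" by (rule braid1.IH)
  moreover have "tuple_equivalent Ns (braid_gen 1 Ns)" by (rule braid_equivalent[OF braid1.prems]) simp
  ultimately show ?case using tuple_equivalent_trans by blast
next
  case (neg0 a b c d e f)
  have "realizes lam (gram6 (-a) (-b) (-c) d e f) Ns"
    by (rule realizes_gram6I[OF realizes_sign[OF neg0.prems, of "\<lambda>k. if k = 0 then -1 else 1"]],
        simp, subst gram6_sym, simp, unfold gram6_simps) simp_all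
  then show ?case by (rule neg0.IH)
next
  case (neg1 a b c d e f)
  have "realizes lam (gram6 (-a) b c (-d) (-e) f) Ns"
    by (rule realizes_gram6I[OF realizes_sign[OF neg1.prems, of "\<lambda>k. if k = 1 then -1 else 1"]],
        simp, subst gram6_sym, simp, unfold gram6_simps) simp_all
  then show ?case by (rule neg1.IH)
next
  case (neg2 a b c d e f)
  have "realizes lam (gram6 a (-b) c (-d) e (-f)) Ns"
    by (rule realizes_gram6I[OF realizes_sign[OF neg2.prems, of "\<lambda>k. if k = 2 then -1 else 1"]],
        simp, subst gram6_sym, simp, unfold gram6_simps) simp_all
  then show ?case by (rule neg2.IH)
next
  case (neg3 a b c d e f)
  have "realizes lam (gram6 a b (-c) d (-e) (-f)) Ns"
    by (rule realizes_gram6I[OF realizes_sign[OF neg3.prems, of "\<lambda>k. if k = 3 then -1 else 1"]],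
        simp, subst gram6_sym, simp, unfold gram6_simps) simp_all
  then show ?case by (rule neg3.IH)
qed

section \<open>Finiteness of orbits\<close>

text \<open>Closure under negation is demanded because equivalence of tuples allows sign
  changes.\<close>

definition finite_SL2_group :: "complex mat set \<Rightarrow> bool" where
  "finite_SL2_group G \<longleftrightarrow> finite G \<and> G \<subseteq> SL2 \<and> (\<forall>A\<in>G. \<forall>B\<in>G. A * B \<in> G) \<and>
     (\<forall>A\<in>G. inv\<^bsub>GL 2\<^esub> A \<in> G) \<and> (\<forall>A\<in>G. - A \<in> G)"

lemma finite_SL2_groupD:
  assumes "finite_SL2_group G"
  shows "finite G" "G \<subseteq> SL2" "\<And>A B. A \<in> G \<Longrightarrow> B \<in> G \<Longrightarrow> A * B \<in> G"
     "\<And>A. A \<in> G \<Longrightarrow> inv\<^bsub>GL 2\<^esub> A \<in> G" "\<And>A. A \<in> G \<Longrightarrow> - A \<in> G"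
  using assms by (auto simp: finite_SL2_group_def)

definition finite_type :: "complex mat list \<Rightarrow> bool" where
  "finite_type Ns \<longleftrightarrow> (\<exists>G. finite_SL2_group G \<and> set Ns \<subseteq> G)"

lemma GL_inv_conj:
  assumes P: "P \<in> carrier (GL n)" and A: "A \<in> carrier (GL n)"
  shows "inv\<^bsub>GL n\<^esub> (P * A * inv\<^bsub>GL n\<^esub> P) = P * inv\<^bsub>GL n\<^esub> A * inv\<^bsub>GL n\<^esub> P"
proof (rule GL_inv_eq)
  note p = GL_D[OF P] and a = GL_D[OF A]
  show "P * A * inv\<^bsub>GL n\<^esub> P \<in> carrier_mat n n" "P * inv\<^bsub>GL n\<^esub> A * inv\<^bsub>GL n\<^esub> P \<in> carrier_mat n n"
    using p a by auto
  have 1: "inv\<^bsub>GL n\<^esub> P * (P * Z) = Z" "A * (inv\<^bsub>GL n\<^esub> A * Z) = Z" if "Z \<in> carrier_mat n n" for Z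
    using p a that by (simp_all add: assoc_mult_mat[of _ n n _ n _ n, symmetric])
  show "P * A * inv\<^bsub>GL n\<^esub> P * (P * inv\<^bsub>GL n\<^esub> A * inv\<^bsub>GL n\<^esub> P) = 1\<^sub>m n"
    using p a 1 by (simp add: assoc_mult_mat[of _ n n _ n _ n])
qed

lemma finite_type_conj:
  assumes "(Ms, Ns) \<in> simult_conj" and ft: "finite_type Ms"
  shows "finite_type Ns"
proof -
  obtain P where P: "P \<in> carrier (GL 2)" and Ns: "Ns = map (\<lambda>M. P * M * inv\<^bsub>GL 2\<^esub> P) Ms"
    using assms(1) unfolding simult_conj_def by blast
  obtain G where gr: "finite_SL2_group G" and Ms: "set Ms \<subseteq> G"
    using ft unfolding finite_type_def by blast
  note G = finite_SL2_groupD[OF gr]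
  note p = GL_D[OF P]
  let ?c = "\<lambda>M. P * M * inv\<^bsub>GL 2\<^esub> P"
  have c: "M \<in> carrier_mat 2 2" if "M \<in> G" for M using G(2) that by (auto simp: SL2_def)
  have "?c A * ?c B = ?c (A * B)" if "A \<in> G" "B \<in> G" for A B
  proof -
    have 1: "inv\<^bsub>GL 2\<^esub> P * (P * Z) = Z" if "Z \<in> carrier_mat 2 2" for Z
      using p that by (simp add: assoc_mult_mat[of _ 2 2 _ 2 _ 2, symmetric])
    show ?thesis using p c[OF that(1)] c[OF that(2)] 1 by (simp add: assoc_mult_mat[of _ 2 2 _ 2 _ 2])
  qed
  moreover have "inv\<^bsub>GL 2\<^esub> (?c A) = ?c (inv\<^bsub>GL 2\<^esub> A)" if "A \<in> G" for A
    using GL_inv_conj[OF P] SL2_GL G(2) that by blast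
  moreover have "- ?c A = ?c (- A)" if "A \<in> G" for A
    using p c[OF that] by simp
  ultimately have "finite_SL2_group (?c ` G)"
    unfolding finite_SL2_group_def using G SL2_conj[OF _ P] by auto
  moreover have "set Ns \<subseteq> ?c ` G" using Ms unfolding Ns by auto
  ultimately show ?thesis unfolding finite_type_def by blast
qed

lemma braid_gen_subset:
  assumes "set Ms \<subseteq> G" "Suc i < length Ms" "\<And>A B. A \<in> G \<Longrightarrow> B \<in> G \<Longrightarrow> A * B \<in> G"
    "\<And>A. A \<in> G \<Longrightarrow> inv\<^bsub>GL 2\<^esub> A \<in> G"
  shows "set (braid_gen i Ms) \<subseteq> G"
proof -
  have "Ms ! i \<in> G" "Ms ! Suc i \<in> G" using assms by auto
  then have "Ms ! i * Ms ! Suc i * inv\<^bsub>GL 2\<^esub> (Ms ! i) \<in> G" using assms(3,4) by blast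
  then show ?thesis using assms by (auto simp: braid_gen_def dest!: in_set_takeD in_set_dropD)
qed

text \<open>The move keeps the old entry of index \<open>i\<close> in the next position; conjugating
  back by it recovers the other one.\<close>

lemma braid_gen_subset_converse:
  assumes sub: "set (braid_gen i Ms) \<subseteq> G" and i: "Suc i < length Ms" and sl: "set Ms \<subseteq> SL2"
    and G: "\<And>A B. A \<in> G \<Longrightarrow> B \<in> G \<Longrightarrow> A * B \<in> G" "\<And>A. A \<in> G \<Longrightarrow> inv\<^bsub>GL 2\<^esub> A \<in> G"
  shows "set Ms \<subseteq> G"
proof
  fix M assume "M \<in> set Ms"
  then obtain k where k: "k < length Ms" "M = Ms ! k" by (auto simp: in_set_conv_nth)
  let ?A = "Ms ! i" and ?B = "Ms ! Suc i"
  have mem: "braid_gen i Ms ! k \<in> G" if "k < length Ms" for k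
    using sub braid_gen_length[OF i] that by auto
  have A: "?A \<in> G" using mem[OF i] braid_gen_nth[OF i i] by simp
  have C: "?A * ?B * inv\<^bsub>GL 2\<^esub> ?A \<in> G" using mem[of i] braid_gen_nth[OF i, of i] i by simp
  have "?A \<in> SL2" "?B \<in> SL2" using sl i by auto
  note a = GL_D[OF SL2_GL[OF this(1)]] and b = GL_D(1)[OF SL2_GL[OF this(2)]]
  have 1: "inv\<^bsub>GL 2\<^esub> ?A * (?A * Z) = Z" if "Z \<in> carrier_mat 2 2" for Z
    using a that by (simp add: assoc_mult_mat[of _ 2 2 _ 2 _ 2, symmetric])
  have "inv\<^bsub>GL 2\<^esub> ?A * (?A * ?B * inv\<^bsub>GL 2\<^esub> ?A) * ?A = ?B"
    using a b 1 by (simp add: assoc_mult_mat[of _ 2 2 _ 2 _ 2])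
  moreover have "inv\<^bsub>GL 2\<^esub> ?A * (?A * ?B * inv\<^bsub>GL 2\<^esub> ?A) * ?A \<in> G" using A C G by blast
  ultimately have B: "?B \<in> G" by simp
  show "M \<in> G"
    using A B mem[OF k(1)] braid_gen_nth[OF i k(1)] k(2) by (cases "k = i"; cases "k = Suc i") auto
qed

lemma finite_type_sign:
  assumes "(Ms, Ns) \<in> sign_change" and ft: "finite_type Ms"
  shows "finite_type Ns"
proof -
  obtain ss where ss: "length ss = length Ms" "set ss \<subseteq> {1, -1}" and Ns: "Ns = map2 (\<cdot>\<^sub>m) ss Ms"
    using assms(1) unfolding sign_change_def by blast
  obtain G where gr: "finite_SL2_group G" and Ms: "set Ms \<subseteq> G"
    using ft unfolding finite_type_def by blast
  note G = finite_SL2_groupD[OF gr]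
  have "set Ns \<subseteq> G"
  proof
    fix M assume "M \<in> set Ns"
    then obtain k where k: "k < length Ms" "M = ss ! k \<cdot>\<^sub>m Ms ! k"
      using ss(1) unfolding Ns by (auto simp: in_set_conv_nth)
    then have M: "Ms ! k \<in> G" using Ms by auto
    have "ss ! k \<in> set ss" using k ss(1) by simp
    then have "ss ! k = 1 \<or> ss ! k = -1" using ss(2) by blast
    moreover have "1 \<cdot>\<^sub>m A = A" "(-1) \<cdot>\<^sub>m A = - A" for A :: "complex mat" by (auto intro!: eq_matI)
    ultimately show "M \<in> G" unfolding k(2) using M G(5)[OF M] by auto
  qed
  then show ?thesis unfolding finite_type_def using gr by blast
qed

lemma finite_type_braid:
  assumes "(Ms, Ns) \<in> braid_step"
  shows "finite_type Ms \<longleftrightarrow> finite_type Ns"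
proof -
  obtain i where i: "Suc i < length Ms" "set Ms \<subseteq> SL2" "Ns = braid_gen i Ms"
    using assms unfolding braid_step_def by blast
  have "set Ms \<subseteq> G \<longleftrightarrow> set Ns \<subseteq> G" if gr: "finite_SL2_group G" for G
    unfolding i(3)
  proof
    show "set (braid_gen i Ms) \<subseteq> G" if "set Ms \<subseteq> G"
      by (rule braid_gen_subset[OF that i(1)]) (use finite_SL2_groupD(3,4)[OF gr] in blast)+
    show "set Ms \<subseteq> G" if "set (braid_gen i Ms) \<subseteq> G"
      by (rule braid_gen_subset_converse[OF that i(1,2)]) (use finite_SL2_groupD(3,4)[OF gr] in blast)+
  qed
  then show ?thesis unfolding finite_type_def by blast
qed

text \<open>Conjugation replaces the finite group by a conjugate one; braid moves, their inverses
  and sign changes stay inside the same group.\<close>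

lemma finite_type_equivalent:
  assumes "tuple_equivalent Ms Ns" "finite_type Ms"
  shows "finite_type Ns"
  using assms(1) unfolding tuple_equivalent_def
proof (induction rule: rtrancl_induct)
  case (step Ks Ls)
  then show ?case using finite_type_conj finite_type_sign finite_type_braid by blast
qed (rule assms(2))

text \<open>The braid orbit consists of lists of fixed length over one finite group, so it is finite
  even before conjugacy classes are formed.\<close>

lemma finite_type_MCG_finite:
  assumes ft: "finite_type Ns" and pr: "tuple_prod 2 Ns = 1\<^sub>m 2"
  shows "MCG_finite Ns"
proof -
  obtain G where gr: "finite_SL2_group G" and Ns: "set Ns \<subseteq> G"
    using ft unfolding finite_type_def by blast
  note G = finite_SL2_groupD[OF gr]
  have "Ms \<in> {Ms. set Ms \<subseteq> G \<and> length Ms = length Ns}" if "Ms \<in> braid_orbit Ns" for Ms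
  proof -
    have "(Ns, Ms) \<in> (braid_step \<union> braid_step\<inverse>)\<^sup>*" using that by (simp add: braid_orbit_def)
    then have "set Ms \<subseteq> G \<and> length Ms = length Ns"
    proof (induction rule: rtrancl_induct)
      case (step Ks Ls)
      from step.hyps(2) consider i where "Suc i < length Ks" "set Ks \<subseteq> SL2" "Ls = braid_gen i Ks"
        | i where "Suc i < length Ls" "set Ls \<subseteq> SL2" "Ks = braid_gen i Ls"
        unfolding braid_step_def by blast
      then show ?case
      proof cases
        case (1 i)
        have "set (braid_gen i Ks) \<subseteq> G"
          by (rule braid_gen_subset[OF conjunct1[OF step.IH] 1(1)]) (use G in blast)+
        then show ?thesis using step.IH braid_gen_length[OF 1(1)] 1(3) by simp
      next
        case (2 i)
        have "set (braid_gen i Ls) \<subseteq> G" using step.IH 2(3) by simp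
        then have "set Ls \<subseteq> G"
          by (rule braid_gen_subset_converse[OF _ 2(1,2)]) (use G in blast)+
        then show ?thesis using step.IH braid_gen_length[OF 2(1)] 2(3) by simp
      qed
    qed (use Ns in simp)
    then show ?thesis by simp
  qed
  then have "braid_orbit Ns \<subseteq> {Ms. set Ms \<subseteq> G \<and> length Ms = length Ns}" by blast
  then have "finite (braid_orbit Ns)" using finite_lists_length_eq[OF G(1)] by (rule finite_subset)
  then show ?thesis using pr unfolding MCG_finite_def by simp
qed

section \<open>A finite group containing the reference tuple\<close>

definition mat22 :: "complex \<Rightarrow> complex \<Rightarrow> complex \<Rightarrow> complex \<Rightarrow> complex mat" where
  "mat22 a b c d = mat 2 2 (\<lambda>(i,j). if i = 0 then if j = 0 then a else b else if j = 0 then c else d)"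

lemma mat22_carrier [simp]: "mat22 a b c d \<in> carrier_mat 2 2"
  by (simp add: mat22_def)

lemma mat22_mult: "mat22 a b c d * mat22 a' b' c' d' =
    mat22 (a * a' + b * c') (a * b' + b * d') (c * a' + d * c') (c * b' + d * d')"
  by (rule mat2_eqI) (auto simp: mat22_def scalar_prod_def numeral_2_eq_2)

lemma mat22_one: "1\<^sub>m 2 = mat22 1 0 0 1"
  by (rule mat2_eqI) (auto simp: mat22_def)

lemma mat22_eq: "mat22 a b c d = mat22 a' b' c' d' \<longleftrightarrow> a = a' \<and> b = b' \<and> c = c' \<and> d = d'"
proof
  assume eq: "mat22 a b c d = mat22 a' b' c' d'"
  then have "mat22 a b c d $$ (i,j) = mat22 a' b' c' d' $$ (i,j)" for i j by simp
  from this[of 0 0] this[of 0 1] this[of 1 0] this[of 1 1]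
  show "a = a' \<and> b = b' \<and> c = c' \<and> d = d'" by (simp_all add: mat22_def)
qed simp

lemma det_mat22: "det (mat22 a b c d) = a * d - b * c"
proof -
  have 1: "mat_delete (mat22 a b c d) i 0 \<in> carrier_mat 1 1" if "i < 2" for i
    using that mat_delete_carrier[OF mat22_carrier, of a b c d] by simp
  have "det (mat22 a b c d) = (\<Sum>i<2. mat22 a b c d $$ (i,0) * cofactor (mat22 a b c d) i 0)"
    by (rule laplace_expansion_column[OF mat22_carrier]) simp
  also have "\<dots> = a * d - b * c"
    using det_single[OF 1[of 0]] det_single[OF 1[of 1]]
    by (simp add: numeral_2_eq_2 cofactor_def) (simp add: mat22_def mat_delete_def)
  finally show ?thesis .
qed

text \<open>Vectors in \<open>\<complex>\<^sup>2\<close> are encoded as pairs.\<close>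

definition stab :: "(complex \<times> complex) set \<Rightarrow> complex mat set" where
  "stab S = {mat22 a b c d | a b c d. a * d - b * c = 1 \<and> (\<forall>(u,v)\<in>S. (a * u + b * v, c * u + d * v) \<in> S)}"

text \<open>A matrix is determined by its two columns, the images of (1, 0) and (0, 1), which lie in
  \<open>S\<close>. Inverses remain in the stabilizer because an injective map of a finite set into
  itself is onto.\<close>

lemma stab_finite_group:
  assumes S: "finite S" "(1,0) \<in> S" "(0,1) \<in> S" and sym: "\<And>u v. (u,v) \<in> S \<Longrightarrow> (-u,-v) \<in> S"
    and Ns: "set Ns \<subseteq> stab S"
  shows "finite_type Ns"
proof -
  have fin: "finite (stab S)"
  proof (rule finite_subset)
    show "stab S \<subseteq> (\<lambda>((a,c),(b,d)). mat22 a b c d) ` (S \<times> S)"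
    proof
      fix M assume "M \<in> stab S"
      then obtain a b c d where M: "M = mat22 a b c d" and inv: "\<forall>(u,v)\<in>S. (a * u + b * v, c * u + d * v) \<in> S"
        unfolding stab_def by blast
      have "(a, c) \<in> S" "(b, d) \<in> S" using inv S(2,3) by force+
      then show "M \<in> (\<lambda>((a,c),(b,d)). mat22 a b c d) ` (S \<times> S)"
        unfolding M by (intro image_eqI[of _ _ "((a,c),(b,d))"]) auto
    qed
    show "finite ((\<lambda>((a,c),(b,d)). mat22 a b c d) ` (S \<times> S))" using S(1) by auto
  qed
  have SL: "stab S \<subseteq> SL2" unfolding stab_def SL2_def by (auto simp: det_mat22)
  have mult: "A * B \<in> stab S" if A: "A \<in> stab S" and B: "B \<in> stab S" for A B
  proof -
    obtain a b c d where A: "A = mat22 a b c d" "a * d - b * c = 1" "\<forall>(u,v)\<in>S. (a * u + b * v, c * u + d * v) \<in> S"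
      using A unfolding stab_def by blast
    obtain a' b' c' d' where B: "B = mat22 a' b' c' d'" "a' * d' - b' * c' = 1"
      "\<forall>(u,v)\<in>S. (a' * u + b' * v, c' * u + d' * v) \<in> S" using B unfolding stab_def by blast
    have "(a * a' + b * c') * (c * b' + d * d') - (a * b' + b * d') * (c * a' + d * c') =
        (a * d - b * c) * (a' * d' - b' * c')" by (simp add: algebra_simps)
    then have det: "(a * a' + b * c') * (c * b' + d * d') - (a * b' + b * d') * (c * a' + d * c') = 1"
      using A(2) B(2) by simp
    have "((a * a' + b * c') * u + (a * b' + b * d') * v, (c * a' + d * c') * u + (c * b' + d * d') * v) \<in> S"
      if "(u,v) \<in> S" for u v
    proof -
      have "(a' * u + b' * v, c' * u + d' * v) \<in> S" using B(3) that by blast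
      then have "(a * (a' * u + b' * v) + b * (c' * u + d' * v), c * (a' * u + b' * v) + d * (c' * u + d' * v)) \<in> S"
        using A(3) by blast
      then show ?thesis by (simp add: algebra_simps)
    qed
    then show ?thesis unfolding A(1) B(1) mat22_mult stab_def using det by blast
  qed
  have inv: "inv\<^bsub>GL 2\<^esub> A \<in> stab S" if A: "A \<in> stab S" for A
  proof -
    obtain a b c d where A: "A = mat22 a b c d" "a * d - b * c = 1" "\<forall>(u,v)\<in>S. (a * u + b * v, c * u + d * v) \<in> S"
      using A unfolding stab_def by blast
    define f where "f = (\<lambda>(u,v). (a * u + b * v, c * u + d * v))"
    define f' where "f' = (\<lambda>(u,v). (d * u - b * v, a * v - c * u))"
    have f'f: "f' (f p) = p" for p
    proof -
      obtain u v where p: "p = (u,v)" by force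
      have "d * (a * u + b * v) - b * (c * u + d * v) = (a * d - b * c) * u"
        "a * (c * u + d * v) - c * (a * u + b * v) = (a * d - b * c) * v" by (simp_all add: algebra_simps)
      then show ?thesis unfolding p f_def f'_def using A(2) by simp
    qed
    have fS: "f ` S \<subseteq> S" using A(3) by (auto simp: f_def)
    moreover have "inj_on f S" by (metis f'f inj_onI)
    ultimately have "f ` S = S" using S(1) by (intro endo_inj_surj)
    then have "f' p \<in> S" if "p \<in> S" for p using that f'f by (metis imageE)
    then have "\<forall>(u,v)\<in>S. (d * u + (-b) * v, (-c) * u + a * v) \<in> S" by (force simp: f'_def)
    moreover have "d * a - (-b) * (-c) = 1" using A(2) by (simp add: mult.commute)
    ultimately have "mat22 d (-b) (-c) a \<in> stab S" unfolding stab_def by blast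
    moreover have "inv\<^bsub>GL 2\<^esub> A = mat22 d (-b) (-c) a"
      by (rule GL_inv_eq) (use A(2) in \<open>auto simp: A(1) mat22_mult mat22_one mat22_eq algebra_simps\<close>)
    ultimately show ?thesis by simp
  qed
  have neg: "- A \<in> stab S" if A: "A \<in> stab S" for A
  proof -
    obtain a b c d where A: "A = mat22 a b c d" "a * d - b * c = 1" "\<forall>(u,v)\<in>S. (a * u + b * v, c * u + d * v) \<in> S"
      using A unfolding stab_def by blast
    have "- A = mat22 (-a) (-b) (-c) (-d)" unfolding A(1) by (rule mat2_eqI) (auto simp: mat22_def)
    moreover have "(-a) * (-d) - (-b) * (-c) = 1" using A(2) by simp
    moreover have "(- a * u + - b * v, - c * u + - d * v) \<in> S" if "(u,v) \<in> S" for u v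
    proof -
      have "(a * u + b * v, c * u + d * v) \<in> S" using A(3) that by blast
      from sym[OF this] show ?thesis by simp
    qed
    ultimately show ?thesis unfolding stab_def by blast
  qed
  have "finite_SL2_group (stab S)" unfolding finite_SL2_group_def using fin SL mult inv neg by simp
  then show ?thesis unfolding finite_type_def using Ns by blast
qed

text \<open>The entries generate the binary tetrahedral group, which permutes 24 vectors of \<open>\<complex>\<^sup>2\<close>.\<close>

definition base_tuple :: "complex \<Rightarrow> complex mat list" where
  "base_tuple lam = [mat22 (- (lam * lam)) 0 (- (lam * lam)) lam, mat22 lam (- lam) 0 (- (lam * lam)),
     mat22 (- (lam * lam)) lam 0 lam, mat22 lam 0 (lam * lam) (- (lam * lam)), 1\<^sub>m 2]"

text \<open>Coordinates are chosen so that the first two rows \<open>x\<close> are the standard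
  ones. The columns \<open>q k\<close> can then be read off from the first two rows of
  \<open>F\<close>, and the other rows are solved from the pairings. As \<open>lam^3 = -1\<close>,
  the scalar \<open>lam\<close> is a square root of \<open>- 1 / lam\<close>. The four reflections
  happen to have product 1, which explains the fifth entry.\<close>

lemma base_tuple_realizes:
  assumes lam: "lam * lam = lam - 1" "lam \<noteq> 0"
  shows "realizes lam (gram6 1 (sqrt 2) 0 0 (sqrt 2) (-1)) (base_tuple lam)"
proof -
  have "lam * (lam * lam) = lam * (lam - 1)" by (simp only: lam(1))
  moreover have "lam * (lam - 1) = lam * lam - lam" by (simp add: algebra_simps)
  moreover have "lam * lam - lam = -1" by (simp only: lam(1)) simp
  ultimately have l3: "lam * (lam * lam) = -1" by simp
  have lx: "lam * (lam * x) = lam * x - x" for x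
    using lam(1) by (metis left_diff_distrib mult.assoc mult_1)
  have il: "- 1 / lam = lam * lam" using l3 lam(2) by (simp add: field_simps)
  define r where "r = complex_of_real (sqrt 2)"
  have rr: "r * r = 2" unfolding r_def by (metis of_real_mult of_real_numeral real_sqrt_mult_self abs_numeral)
  have r0: "r \<noteq> 0" using rr by auto
  define s where "s = 1 + lam"
  define q where "q = (\<lambda>k i. if k = (0::nat) then if i = 0 then s else lam else if k = 1 then if i = 0 then 1 else s
      else if k = 2 then if i = 0 then r else 0 else if i = (0::nat) then 0 else r :: complex)"
  define x where "x = (\<lambda>k i. if k = (0::nat) then if i = 0 then 1 else 0 else if k = 1 then if i = 0 then 0 else 1
      else if k = 2 then if i = 0 then s / r else - 1 / r else if i = (0::nat) then - lam / r else s / r :: complex)"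
  have ent: "r2 g q x = mat22 (g * (1 - q 0 * x 0)) (- (g * (q 0 * x 1))) (- (g * (q 1 * x 0))) (g * (1 - q 1 * x 1))"
    if "r2 = refl2" for r2 g q x
    unfolding that by (rule mat2_eqI) (auto simp: refl2_def mat22_def)
  note ent = ent[OF refl]
  have main: "length (base_tuple lam) = 5 \<and> set (base_tuple lam) \<subseteq> SL2 \<and> tuple_prod 2 (base_tuple lam) = 1\<^sub>m 2 \<and>
      (\<forall>k<4. lam * lam = - 1 / lam \<and> base_tuple lam ! k = refl2 lam (q k) (x k)) \<and>
      (\<forall>k<4. \<forall>l<4. x k 0 * q l 0 + x k 1 * q l 1 = seifert lam (gram6 1 (sqrt 2) 0 0 (sqrt 2) (-1)) k l)"
  proof (intro conjI allI impI)
    show "length (base_tuple lam) = 5" by (simp add: base_tuple_def)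
    show "set (base_tuple lam) \<subseteq> SL2"
      by (auto simp: base_tuple_def SL2_def det_mat22) (simp_all add: l3 algebra_simps)
    show "tuple_prod 2 (base_tuple lam) = 1\<^sub>m 2"
      by (simp add: base_tuple_def tuple_prod_Cons tuple_prod_Nil mat22_one mat22_mult mat22_eq)
        (simp add: lam(1) lx algebra_simps)
    show "lam * lam = - 1 / lam" using il by simp
    fix k l :: nat assume k: "k < 4"
    have rr1: "r * (z / r) = z" for z using r0 by simp
    have e0: "lam * (1 - s) = - (lam * lam)" unfolding s_def by (simp add: algebra_simps)
    have "refl2 lam (q 0) (x 0) = mat22 (lam * (1 - s)) 0 (- (lam * lam)) lam"
      "refl2 lam (q 1) (x 1) = mat22 lam (- lam) 0 (lam * (1 - s))"
      "refl2 lam (q 2) (x 2) = mat22 (lam * (1 - r * (s / r))) (- (lam * (r * (- 1 / r)))) 0 lam"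
      "refl2 lam (q 3) (x 3) = mat22 lam 0 (- (lam * (r * (- lam / r)))) (lam * (1 - r * (s / r)))"
      unfolding ent mat22_eq q_def x_def by simp_all
    note this[unfolded rr1 e0]
    then show "base_tuple lam ! k = refl2 lam (q k) (x k)"
      using less_4_cases[OF k] by (elim disjE; hypsubst; simp add: base_tuple_def)
    assume l: "l < 4"
    have rq: "z / r * r = z" "r * (z / r) = z" for z using r0 by simp_all
    have half: "2 / r = r" using rr r0 by (simp add: field_simps)
    have ss: "s * s = 3 * lam" unfolding s_def using lam(1) by (simp add: algebra_simps)
    have e: "s / r * s - lam / r = lam * r"
    proof -
      have "s / r * s - lam / r = (s * s - lam) / r" by (simp add: diff_divide_distrib)
      also have "\<dots> = lam * (2 / r)" unfolding ss by simp
      finally show ?thesis unfolding half .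
    qed
    show "x k 0 * q l 0 + x k 1 * q l 1 = seifert lam (gram6 1 (sqrt 2) 0 0 (sqrt 2) (-1)) k l"
      using less_4_cases[OF k] less_4_cases[OF l] r0 e
      by (elim disjE; hypsubst; simp add: seifert_def gram6_simps[simplified] q_def x_def r_def[symmetric] s_def[symmetric])
  qed
  show ?thesis unfolding realizes_def
    by (intro conjI, use main in blast, use main in blast, use main in blast,
        rule exI[of _ "\<lambda>_. lam"], rule exI[of _ q], rule exI[of _ x]) (use main in blast)
qed

text \<open>\<open>U\<close> is the group of sixth roots of unity, with \<open>lam - 1\<close> as
  the square of \<open>lam\<close>, and \<open>V\<close> has one vector from each of four lines. The
  generators permute these lines, and \<open>S\<close> collects the multiples that they permute as
  vectors.\<close>

lemma base_tuple_finite_type: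
  assumes lam: "lam * lam = lam - 1"
  shows "finite_type (base_tuple lam)"
proof -
  define U where "U = {1, -1, lam, - lam, lam - 1, 1 - lam}"
  define V :: "(complex \<times> complex) set" where "V = {(1,0), (0,1), (1,1), (1,lam)}"
  define S where "S = (\<lambda>(t,(u,v)). (t * u, t * v)) ` (U \<times> V)"
  have U: "lam * t \<in> U" "- t \<in> U" if "t \<in> U" for t
    using that unfolding U_def by (elim insertE emptyE; hypsubst; simp add: lam algebra_simps)+
  have Sfin: "finite S" unfolding S_def U_def V_def by auto
  have SI: "(t * u, t * v) \<in> S" if "t \<in> U" "(u,v) \<in> V" for t u v using that unfolding S_def by force
  have I: "a * d - b * c = 1 \<Longrightarrow> (\<And>t. t \<in> U \<Longrightarrow> (a * t, c * t) \<in> S \<and> (b * t, d * t) \<in> S \<and> ((a + b) * t, (c + d) * t) \<in> S \<and>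
      ((a + b * lam) * t, (c + d * lam) * t) \<in> S) \<Longrightarrow> mat22 a b c d \<in> stab S" for a b c d
  proof -
    assume det: "a * d - b * c = 1" and *: "\<And>t. t \<in> U \<Longrightarrow> (a * t, c * t) \<in> S \<and> (b * t, d * t) \<in> S \<and> ((a + b) * t, (c + d) * t) \<in> S \<and>
      ((a + b * lam) * t, (c + d * lam) * t) \<in> S"
    have "(a * u + b * v, c * u + d * v) \<in> S" if uv: "(u,v) \<in> S" for u v
    proof -
      obtain t w z where t: "t \<in> U" "(w,z) \<in> V" "u = t * w" "v = t * z" using uv unfolding S_def by auto
      show ?thesis using t(2) *[OF t(1)] unfolding t(3,4) V_def by (auto simp: algebra_simps)
    qed
    then show "mat22 a b c d \<in> stab S" unfolding stab_def using det by blast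
  qed
  have S1: "(t, 0) \<in> S" "(0, t) \<in> S" "(t, t) \<in> S" "(t, t * lam) \<in> S" if "t \<in> U" for t
    using SI[OF that, of 1 0] SI[OF that, of 0 1] SI[OF that, of 1 1] SI[OF that, of 1 lam] by (simp_all add: V_def)
  have lx: "lam * (lam * x) = lam * x - x" for x
    using lam by (metis left_diff_distrib mult.assoc mult_1)
  have L: "lam * t \<in> U" "- (lam * t) \<in> U" "- t \<in> U" "lam * t - t \<in> U" "t - lam * t \<in> U" if "t \<in> U" for t
    using U(1)[OF that] U(2)[OF U(1)[OF that]] U(2)[OF that] U(1)[OF U(1)[OF that]] U(2)[OF U(1)[OF U(1)[OF that]]]
    by (simp_all add: lx)
  have S2: "(t - lam * t, t) \<in> S" "(lam * t - t, - t) \<in> S" "(lam * t, lam * t - t) \<in> S"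
    "(- (lam * t), t - lam * t) \<in> S" if "t \<in> U" for t
    using S1(4)[OF L(5)[OF that]] S1(4)[OF L(4)[OF that]] S1(4)[OF L(1)[OF that]] S1(4)[OF L(2)[OF that]]
    by (simp_all add: algebra_simps lx lam)
  note S1 = S1 S2
  have "set (base_tuple lam) \<subseteq> stab S"
  proof -
    have "mat22 (- (lam * lam)) 0 (- (lam * lam)) lam \<in> stab S"
      by (rule I, simp add: lx lam algebra_simps) (use L S1 in \<open>simp add: lx lam algebra_simps\<close>)
    moreover have "mat22 lam (- lam) 0 (- (lam * lam)) \<in> stab S"
      by (rule I, simp add: lx lam algebra_simps) (use L S1 in \<open>simp add: lx lam algebra_simps\<close>)
    moreover have "mat22 (- (lam * lam)) lam 0 lam \<in> stab S"
      by (rule I, simp add: lx lam algebra_simps) (use L S1 in \<open>simp add: lx lam algebra_simps\<close>)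
    moreover have "mat22 lam 0 (lam * lam) (- (lam * lam)) \<in> stab S"
      by (rule I, simp add: lx lam algebra_simps) (use L S1 in \<open>simp add: lx lam algebra_simps\<close>)
    moreover have "1\<^sub>m 2 \<in> stab S" unfolding mat22_one by (rule I, simp) (use S1 in \<open>simp add: mult.commute\<close>)
    ultimately show ?thesis by (simp add: base_tuple_def)
  qed
  moreover have "(1, 0) \<in> S" "(0, 1) \<in> S" using S1[of 1] by (auto simp: U_def)
  moreover have "(- u, - v) \<in> S" if uv: "(u, v) \<in> S" for u v
  proof -
    obtain t w z where t: "t \<in> U" "(w,z) \<in> V" "u = t * w" "v = t * z" using uv unfolding S_def by auto
    show ?thesis using SI[OF U(2)[OF t(1)] t(2)] t by simp
  qed
  ultimately show ?thesis using stab_finite_group[OF Sfin] by blast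
qed

section \<open>Middle convolution\<close>

lemma sum_blocks: "(\<Sum>m<16. f m) = (\<Sum>l<4. \<Sum>i<4. f (l * 4 + i :: nat))"
proof -
  have "(\<Sum>m<4 * 4. f m) = (\<Sum>l<4. sum f {l * 4..<l * 4 + 4})" by (rule sum.nat_group[symmetric])
  also have "\<dots> = (\<Sum>l<4. \<Sum>i<4. f (l * 4 + i))"
  proof (rule sum.cong[OF refl])
    show "sum f {l * 4..<l * 4 + 4} = (\<Sum>i<4. f (l * 4 + i))" for l
      using sum.shift_bounds_nat_ivl[of f 0 "l * 4" 4] by (simp add: atLeast0LessThan add.commute)
  qed
  finally show ?thesis by simp
qed

text \<open>Here \<open>rank2\<close> expresses the rows of \<open>F\<close> by the first two, and
  \<open>nondeg\<close> says that the leading block is invertible; together they state that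
  \<open>F\<close> has rank two with its first two rows as a basis of the row space.\<close>

locale root_tuple =
  fixes \<alpha> :: "nat \<Rightarrow> complex vec" and lam :: complex and x :: "nat \<Rightarrow> nat \<Rightarrow> complex"
  assumes roots: "\<And>k. k < 4 \<Longrightarrow> \<alpha> k \<in> F4_roots"
    and lam: "lam * lam = lam - 1"
    and rank2: "\<And>k l. k < 4 \<Longrightarrow> l < 4 \<Longrightarrow>
      seifert lam (cartan \<alpha>) k l = x k 0 * seifert lam (cartan \<alpha>) 0 l + x k 1 * seifert lam (cartan \<alpha>) 1 l"
    and nondeg: "(1 + lam) * (1 + lam) - lam * cartan \<alpha> 0 1 * cartan \<alpha> 1 0 \<noteq> 0"
begin

abbreviation As :: "complex mat list" where
  "As \<equiv> map (\<lambda>k. root_reflection (\<alpha> k)) [0..<4]"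

abbreviation F :: "nat \<Rightarrow> nat \<Rightarrow> complex" where
  "F \<equiv> seifert lam (cartan \<alpha>)"

text \<open>A reflection minus the identity sees the component of index \<open>k\<close> only
  through its pairing with the coroot, so these numbers are coordinates of \<open>v\<close> modulo
  \<open>conv_K\<close>.\<close>

definition yc :: "nat \<Rightarrow> complex vec \<Rightarrow> complex" where
  "yc k v = (\<Sum>i<4. coroot (\<alpha> k) $ i * v $ (k * 4 + i))"

definition Fy :: "complex vec \<Rightarrow> nat \<Rightarrow> complex" where
  "Fy v k = (\<Sum>l<4. F k l * yc l v)"

lemma lam0: "lam \<noteq> 0" and lam1: "lam \<noteq> 1"
  using lam by auto

lemma ac: "k < 4 \<Longrightarrow> \<alpha> k \<in> carrier_vec 4"
  using F4_root_carrier[OF roots] .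

lemma coroot_index: "k < 4 \<Longrightarrow> i < 4 \<Longrightarrow> coroot (\<alpha> k) $ i = 2 / (\<alpha> k \<bullet> \<alpha> k) * \<alpha> k $ i"
  using carrier_vecD[OF ac[of k]] by (simp add: coroot_def)

lemma cartan_sum: "k < 4 \<Longrightarrow> l < 4 \<Longrightarrow> cartan \<alpha> k l = (\<Sum>i<4. coroot (\<alpha> k) $ i * \<alpha> l $ i)"
  using carrier_vecD[OF ac[of l]] by (simp add: cartan_def scalar_prod_def atLeast0LessThan)

lemma diag2: "k < 4 \<Longrightarrow> cartan \<alpha> k k = 2"
  using cartan_diag roots by blast

lemma yc_component:
  assumes "k < 4" shows "yc k v = coroot (\<alpha> k) \<bullet> component 4 k v"
  using assms by (simp add: yc_def component_def scalar_prod_def atLeast0LessThan)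

lemma yc_add: "v \<in> carrier_vec 16 \<Longrightarrow> w \<in> carrier_vec 16 \<Longrightarrow> k < 4 \<Longrightarrow> yc k (v + w) = yc k v + yc k w"
  by (simp add: yc_def sum.distrib distrib_left)

lemma yc_minus: "v \<in> carrier_vec 16 \<Longrightarrow> w \<in> carrier_vec 16 \<Longrightarrow> k < 4 \<Longrightarrow> yc k (v - w) = yc k v - yc k w"
  by (simp add: yc_def sum_subtractf right_diff_distrib)

text \<open>For a root reflection \<open>A - 1\<close> has rank one, so each block contributes a
  multiple of a root with factor \<open>yc\<close>. The diagonal block \<open>lam * A\<close>
  contributes \<open>lam * v\<close> in addition, and its root term has the weight
  \<open>lam\<close> like the blocks before it.\<close>

lemma conv_mat_mult:
  assumes v: "v \<in> carrier_vec 16" and k: "k < 4" and j: "j < 16"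
  shows "(conv_mat 4 lam As k *\<^sub>v v) $ j = (if j div 4 = k then
      lam * v $ j - (\<Sum>l<4. (if l \<le> k then lam else 1) * yc l v * \<alpha> l $ (j mod 4)) else v $ j)"
proof (cases "j div 4 = k")
  case False
  have "(conv_mat 4 lam As k *\<^sub>v v) $ j = (\<Sum>m<16. conv_mat 4 lam As k $$ (j,m) * v $ m)"
    using v j by (simp add: conv_mat_def scalar_prod_def atLeast0LessThan)
  also have "\<dots> = (\<Sum>m<16. if m = j then v $ j else 0)"
    using False j by (intro sum.cong) (auto simp: conv_mat_def)
  finally show ?thesis using False j by simp
next
  case True
  define a where "a = j mod 4"
  have a: "a < 4" and ja: "j = k * 4 + a" using True by (auto simp: a_def)
  have entry: "conv_mat 4 lam As k $$ (j, l * 4 + i) =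
      (if l = k then if i = a then lam else 0 else 0) - (if l \<le> k then lam else 1) * \<alpha> l $ a * coroot (\<alpha> l) $ i"
    if l: "l < 4" and i: "i < 4" for l i
  proof -
    have li: "l * 4 + i < 16" "(l * 4 + i) div 4 = l" "(l * 4 + i) mod 4 = i" using l i by auto
    have rr: "root_reflection (\<alpha> l) $$ (a,i) = (if i = a then 1 else 0) - \<alpha> l $ a * coroot (\<alpha> l) $ i"
      using a i coroot_index[OF l i] by (simp add: root_reflection_def)
    have "conv_mat 4 lam As k $$ (j, l * 4 + i) =
      (if l < k then lam \<cdot>\<^sub>m (root_reflection (\<alpha> l) - 1\<^sub>m 4) else if l = k then lam \<cdot>\<^sub>m root_reflection (\<alpha> k)
        else root_reflection (\<alpha> l) - 1\<^sub>m 4) $$ (a, i)"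
      using True j li l k a_def by (simp add: conv_mat_def Let_def)
    also have "\<dots> = (if l = k then if i = a then lam else 0 else 0) - (if l \<le> k then lam else 1) * \<alpha> l $ a * coroot (\<alpha> l) $ i"
      using a i rr carrier_matD[OF root_reflection_carrier[of "\<alpha> l"]] carrier_matD[OF root_reflection_carrier[of "\<alpha> k"]]
      by (auto simp: right_diff_distrib mult.assoc)
    finally show ?thesis .
  qed
  have "(conv_mat 4 lam As k *\<^sub>v v) $ j = (\<Sum>m<16. conv_mat 4 lam As k $$ (j,m) * v $ m)"
    using v j by (simp add: conv_mat_def scalar_prod_def atLeast0LessThan)
  also have "\<dots> = (\<Sum>l<4. \<Sum>i<4. conv_mat 4 lam As k $$ (j, l * 4 + i) * v $ (l * 4 + i))"
    by (rule sum_blocks)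
  also have "\<dots> = (\<Sum>l<4. (if l = k then lam * v $ j else 0) - (if l \<le> k then lam else 1) * yc l v * \<alpha> l $ a)"
  proof (rule sum.cong[OF refl])
    fix l assume "l \<in> {..<4::nat}"
    then have l: "l < 4" by simp
    have "(\<Sum>i<4. conv_mat 4 lam As k $$ (j, l * 4 + i) * v $ (l * 4 + i)) =
      (\<Sum>i<4. (if i = a then if l = k then lam * v $ (l * 4 + a) else 0 else 0) -
        (if l \<le> k then lam else 1) * \<alpha> l $ a * (coroot (\<alpha> l) $ i * v $ (l * 4 + i)))"
      by (intro sum.cong refl, subst entry[OF l]) (auto simp: left_diff_distrib)
    also have "\<dots> = (if l = k then lam * v $ (l * 4 + a) else 0) - (if l \<le> k then lam else 1) * \<alpha> l $ a * yc l v"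
      using a by (simp add: sum_subtractf sum_distrib_left[symmetric] yc_def)
    finally show "(\<Sum>i<4. conv_mat 4 lam As k $$ (j, l * 4 + i) * v $ (l * 4 + i)) =
      (if l = k then lam * v $ j else 0) - (if l \<le> k then lam else 1) * yc l v * \<alpha> l $ a"
      by (simp add: ja mult_ac)
  qed
  also have "\<dots> = lam * v $ j - (\<Sum>l<4. (if l \<le> k then lam else 1) * yc l v * \<alpha> l $ a)"
    using k by (simp add: sum_subtractf)
  finally show ?thesis using True by (simp add: a_def)
qed

lemma conv_mat_carrier: "conv_mat 4 lam As k \<in> carrier_mat 16 16"
  by (simp add: conv_mat_def)

lemma weighted_sum:
  assumes k: "k < 4"
  shows "(\<Sum>l<4. (if l \<le> k then lam else 1) * cartan \<alpha> k l * yc l v) = Fy v k + (lam - 1) * yc k v"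
proof -
  have "Fy v k + (lam - 1) * yc k v = (\<Sum>l<4. F k l * yc l v + (if l = k then (lam - 1) * yc k v else 0))"
    using k by (simp add: Fy_def sum.distrib)
  also have "\<dots> = (\<Sum>l<4. (if l \<le> k then lam else 1) * cartan \<alpha> k l * yc l v)"
    using diag2[OF k] by (intro sum.cong) (auto simp: seifert_def algebra_simps)
  finally show ?thesis by simp
qed

text \<open>In the coordinates \<open>yc\<close> the weighted Cartan sum is \<open>F y\<close> plus
  \<open>(lam - 1) * y\<close> in row \<open>k\<close>; the second term turns the factor
  \<open>lam\<close> on the diagonal block back into 1.\<close>

lemma yc_conv_mat:
  assumes v: "v \<in> carrier_vec 16" and k: "k < 4" and l: "l < 4"
  shows "yc l (conv_mat 4 lam As k *\<^sub>v v) = yc l v - (if l = k then Fy v k else 0)"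
proof (cases "l = k")
  case False
  have "yc l (conv_mat 4 lam As k *\<^sub>v v) = yc l v"
    unfolding yc_def
  proof (intro sum.cong refl)
    fix i assume "i \<in> {..<4::nat}"
    then have i: "l * 4 + i < 16" "(l * 4 + i) div 4 = l" using l by auto
    show "coroot (\<alpha> l) $ i * (conv_mat 4 lam As k *\<^sub>v v) $ (l * 4 + i) = coroot (\<alpha> l) $ i * v $ (l * 4 + i)"
      using conv_mat_mult[OF v k i(1)] i(2) False by simp
  qed
  then show ?thesis using False by simp
next
  case True
  have "yc k (conv_mat 4 lam As k *\<^sub>v v) =
      (\<Sum>i<4. coroot (\<alpha> k) $ i * (lam * v $ (k * 4 + i) - (\<Sum>l<4. (if l \<le> k then lam else 1) * yc l v * \<alpha> l $ i)))"
    unfolding yc_def[of k "conv_mat 4 lam As k *\<^sub>v v"]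
  proof (intro sum.cong refl)
    fix i assume "i \<in> {..<4::nat}"
    then have i: "k * 4 + i < 16" "(k * 4 + i) div 4 = k" "(k * 4 + i) mod 4 = i" using k by auto
    show "coroot (\<alpha> k) $ i * (conv_mat 4 lam As k *\<^sub>v v) $ (k * 4 + i) =
       coroot (\<alpha> k) $ i * (lam * v $ (k * 4 + i) - (\<Sum>l<4. (if l \<le> k then lam else 1) * yc l v * \<alpha> l $ i))"
      using conv_mat_mult[OF v k i(1)] i(2,3) by simp
  qed
  also have "\<dots> = lam * yc k v - (\<Sum>i<4. \<Sum>l<4. (if l \<le> k then lam else 1) * (coroot (\<alpha> k) $ i * \<alpha> l $ i) * yc l v)"
    by (simp add: yc_def[of k v] right_diff_distrib sum_subtractf sum_distrib_left mult_ac)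
  also have "(\<Sum>i<4. \<Sum>l<4. (if l \<le> k then lam else 1) * (coroot (\<alpha> k) $ i * \<alpha> l $ i) * yc l v) =
      (\<Sum>l<4. \<Sum>i<4. (if l \<le> k then lam else 1) * (coroot (\<alpha> k) $ i * \<alpha> l $ i) * yc l v)"
    by (rule sum.swap)
  also have "\<dots> = (\<Sum>l<4. (if l \<le> k then lam else 1) * cartan \<alpha> k l * yc l v)"
    using cartan_sum[OF k] by (intro sum.cong refl) (simp add: sum_distrib_left sum_distrib_right)
  also have "\<dots> = Fy v k + (lam - 1) * yc k v" by (rule weighted_sum[OF k])
  finally show ?thesis using True by (simp add: algebra_simps)
qed

lemma mat_kernel_reflection:
  assumes k: "k < 4" and v: "v \<in> carrier_vec 4"
  shows "v \<in> mat_kernel (root_reflection (\<alpha> k) - 1\<^sub>m 4) \<longleftrightarrow> coroot (\<alpha> k) \<bullet> v = 0"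
proof -
  have c: "root_reflection (\<alpha> k) - 1\<^sub>m 4 \<in> carrier_mat 4 4"
    by (rule minus_carrier_mat) simp
  have "(root_reflection (\<alpha> k) - 1\<^sub>m 4) *\<^sub>v v = root_reflection (\<alpha> k) *\<^sub>v v - v"
    using v minus_mult_distrib_mat_vec[OF root_reflection_carrier one_carrier_mat v] by simp
  also have "\<dots> = - (coroot (\<alpha> k) \<bullet> v) \<cdot>\<^sub>v \<alpha> k"
    using root_reflection_mult_vec[OF ac[OF k] v] v ac[OF k] by (intro eq_vecI) auto
  finally have eq: "(root_reflection (\<alpha> k) - 1\<^sub>m 4) *\<^sub>v v = - (coroot (\<alpha> k) \<bullet> v) \<cdot>\<^sub>v \<alpha> k" .
  have "t \<cdot>\<^sub>v \<alpha> k = 0\<^sub>v 4 \<longleftrightarrow> t = 0" for t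
  proof
    assume "t \<cdot>\<^sub>v \<alpha> k = 0\<^sub>v 4"
    then have "(t \<cdot>\<^sub>v \<alpha> k) \<bullet> \<alpha> k = 0" using ac[OF k] by simp
    then show "t = 0" using ac[OF k] F4_root_nonzero[OF roots[OF k]] by simp
  qed (use ac[OF k] in \<open>auto intro!: eq_vecI\<close>)
  then show ?thesis using v c eq by (auto simp: mat_kernel[OF c])
qed

lemma conv_K: "conv_K 4 As = {v \<in> carrier_vec 16. \<forall>k<4. yc k v = 0}"
  unfolding conv_K_def
  using mat_kernel_reflection by (auto simp: yc_component component_def)

lemma mat_kernel_minus_one:
  assumes "B \<in> carrier_mat n n" "v \<in> carrier_vec n"
  shows "v \<in> mat_kernel (B - 1\<^sub>m n) \<longleftrightarrow> B *\<^sub>v v = (v :: complex vec)"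
proof -
  have c: "B - 1\<^sub>m n \<in> carrier_mat n n" by (rule minus_carrier_mat) simp
  have "(B - 1\<^sub>m n) *\<^sub>v v = B *\<^sub>v v - v"
    using minus_mult_distrib_mat_vec[OF assms(1) one_carrier_mat assms(2)] assms by simp
  moreover have "B *\<^sub>v v - v = 0\<^sub>v n \<longleftrightarrow> B *\<^sub>v v = v"
  proof
    assume "B *\<^sub>v v - v = 0\<^sub>v n"
    then have *: "(B *\<^sub>v v - v) $ i = 0" if "i < n" for i using that by simp
    show "B *\<^sub>v v = v"
    proof (rule eq_vecI)
      show "(B *\<^sub>v v) $ i = v $ i" if "i < dim_vec v" for i using *[of i] that assms by simp
    qed (use assms in auto)
  qed (use assms in simp)
  ultimately show ?thesis using assms(2) by (simp add: mat_kernel[OF c])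
qed

lemma conv_L:
  "v \<in> conv_L 4 lam As \<longleftrightarrow> v \<in> carrier_vec 16 \<and> (\<forall>k<4. conv_mat 4 lam As k *\<^sub>v v = v)"
  unfolding conv_L_def using mat_kernel_minus_one[OF conv_mat_carrier] by auto

text \<open>A vector fixed by all convolution matrices satisfies \<open>F y = 0\<close> by
  \<open>yc_conv_mat\<close>. Conversely, for coordinates with \<open>F y = 0\<close> the
  fixed-point equations have a solution with these coordinates, and its difference to the given
  vector lies in \<open>conv_K\<close>.\<close>

lemma conv_KL: "{u + w | u w. u \<in> conv_K 4 As \<and> w \<in> conv_L 4 lam As} = {v \<in> carrier_vec 16. \<forall>k<4. Fy v k = 0}"
proof (intro equalityI subsetI)
  fix v assume "v \<in> {u + w | u w. u \<in> conv_K 4 As \<and> w \<in> conv_L 4 lam As}"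
  then obtain u w where v: "v = u + w" and u: "u \<in> carrier_vec 16" "\<forall>k<4. yc k u = 0"
    and w: "w \<in> carrier_vec 16" "\<forall>k<4. conv_mat 4 lam As k *\<^sub>v w = w"
    using conv_K conv_L by auto
  have "Fy w k = 0" if k: "k < 4" for k
    using yc_conv_mat[OF w(1) k k] w(2) k by simp
  moreover have "Fy v k = Fy w k" if "k < 4" for k
    unfolding Fy_def v using yc_add[OF u(1) w(1)] u(2) by (intro sum.cong) auto
  ultimately show "v \<in> {v \<in> carrier_vec 16. \<forall>k<4. Fy v k = 0}" using u w v by simp
next
  fix v assume "v \<in> {v \<in> carrier_vec 16. \<forall>k<4. Fy v k = 0}"
  then have v: "v \<in> carrier_vec 16" and Fv: "\<And>k. k < 4 \<Longrightarrow> Fy v k = 0" by auto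
  \<comment> \<open>The fixed-point equations solved for \<open>w\<close>, with the coordinates of
    \<open>v\<close> in place of those of \<open>w\<close>; \<open>yw\<close> shows that the two
    agree.\<close>
  define w where "w = vec 16 (\<lambda>j. (\<Sum>l<4. (if l \<le> j div 4 then lam else 1) * yc l v * \<alpha> l $ (j mod 4)) / (lam - 1))"
  have wc: "w \<in> carrier_vec 16" by (simp add: w_def)
  have yw: "yc k w = yc k v" if k: "k < 4" for k
  proof -
    have "(lam - 1) * yc k w = (\<Sum>i<4. coroot (\<alpha> k) $ i * ((lam - 1) * w $ (k * 4 + i)))"
      by (simp add: yc_def sum_distrib_left mult.left_commute)
    also have "\<dots> = (\<Sum>i<4. \<Sum>l<4. (if l \<le> k then lam else 1) * (coroot (\<alpha> k) $ i * \<alpha> l $ i) * yc l v)"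
    proof (intro sum.cong refl)
      fix i assume "i \<in> {..<4::nat}"
      then have i: "k * 4 + i < 16" "(k * 4 + i) div 4 = k" "(k * 4 + i) mod 4 = i" using k by auto
      have "(lam - 1) * w $ (k * 4 + i) = (\<Sum>l<4. (if l \<le> k then lam else 1) * yc l v * \<alpha> l $ i)"
        using i lam1 by (simp add: w_def)
      then show "coroot (\<alpha> k) $ i * ((lam - 1) * w $ (k * 4 + i)) =
          (\<Sum>l<4. (if l \<le> k then lam else 1) * (coroot (\<alpha> k) $ i * \<alpha> l $ i) * yc l v)"
        by (simp add: sum_distrib_left mult_ac)
    qed
    also have "\<dots> = (\<Sum>l<4. \<Sum>i<4. (if l \<le> k then lam else 1) * (coroot (\<alpha> k) $ i * \<alpha> l $ i) * yc l v)"
      by (rule sum.swap)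
    also have "\<dots> = (\<Sum>l<4. (if l \<le> k then lam else 1) * cartan \<alpha> k l * yc l v)"
      using cartan_sum[OF k] by (intro sum.cong refl) (simp add: sum_distrib_left sum_distrib_right)
    also have "\<dots> = (lam - 1) * yc k v" using weighted_sum[OF k] Fv[OF k] by simp
    finally show ?thesis using lam1 by simp
  qed
  have "conv_mat 4 lam As k *\<^sub>v w = w" if k: "k < 4" for k
  proof (rule eq_vecI)
    fix j assume "j < dim_vec w"
    then have j: "j < 16" by (simp add: w_def)
    show "(conv_mat 4 lam As k *\<^sub>v w) $ j = w $ j"
    proof (cases "j div 4 = k")
      case True
      have "(lam - 1) * w $ j = (\<Sum>l<4. (if l \<le> k then lam else 1) * yc l v * \<alpha> l $ (j mod 4))"
        using j lam1 True by (simp add: w_def)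
      then show ?thesis using conv_mat_mult[OF wc k j] True yw by (simp add: algebra_simps)
    qed (use conv_mat_mult[OF wc k j] in simp)
  qed (use wc conv_mat_carrier in \<open>simp add: conv_mat_def\<close>)
  then have "w \<in> conv_L 4 lam As" using wc conv_L by blast
  moreover have "v - w \<in> conv_K 4 As" using v wc yw yc_minus[OF v wc] by (simp add: conv_K)
  moreover have "v = (v - w) + w" using v wc by (intro eq_vecI) auto
  ultimately show "v \<in> {u + w | u w. u \<in> conv_K 4 As \<and> w \<in> conv_L 4 lam As}" by blast
qed

lemma Fy_rank2:
  assumes "k < 4" shows "Fy v k = x k 0 * Fy v 0 + x k 1 * Fy v 1"
proof -
  have "Fy v k = (\<Sum>l<4. x k 0 * (F 0 l * yc l v) + x k 1 * (F 1 l * yc l v))"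
    unfolding Fy_def
  proof (intro sum.cong refl)
    fix l assume "l \<in> {..<4::nat}"
    then have "F k l = x k 0 * F 0 l + x k 1 * F 1 l" using rank2[OF assms] by simp
    then show "F k l * yc l v = x k 0 * (F 0 l * yc l v) + x k 1 * (F 1 l * yc l v)"
      by (simp only: distrib_right mult.assoc)
  qed
  also have "\<dots> = x k 0 * Fy v 0 + x k 1 * Fy v 1"
    unfolding Fy_def by (simp only: sum.distrib sum_distrib_left)
  finally show ?thesis .
qed

text \<open>The matrix of the map from \<open>v\<close> to the first two entries of
  \<open>F y\<close>. By \<open>rank2\<close> the other entries are combinations of these, so this
  is a quotient map with kernel K + L.\<close>

definition P0 :: "complex mat" where
  "P0 = mat 2 16 (\<lambda>(i,j). F i (j div 4) * coroot (\<alpha> (j div 4)) $ (j mod 4))"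

lemma P0_carrier: "P0 \<in> carrier_mat 2 16" by (simp add: P0_def)

lemma P0_mult:
  assumes v: "v \<in> carrier_vec 16" and i: "i < 2"
  shows "(P0 *\<^sub>v v) $ i = Fy v i"
proof -
  have "(P0 *\<^sub>v v) $ i = (\<Sum>m<16. P0 $$ (i,m) * v $ m)"
    using v i by (simp add: P0_def scalar_prod_def atLeast0LessThan)
  also have "\<dots> = (\<Sum>l<4. \<Sum>a<4. P0 $$ (i, l * 4 + a) * v $ (l * 4 + a))" by (rule sum_blocks)
  also have "\<dots> = (\<Sum>l<4. \<Sum>a<4. F i l * (coroot (\<alpha> l) $ a * v $ (l * 4 + a)))"
    using i by (intro sum.cong refl) (auto simp: P0_def)
  also have "\<dots> = Fy v i" by (simp add: Fy_def yc_def sum_distrib_left)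
  finally show ?thesis .
qed

lemma yc_solution:
  obtains v where "v \<in> carrier_vec 16" "\<And>k. k < 4 \<Longrightarrow> yc k v = t k"
proof -
  define v where "v = vec 16 (\<lambda>j. t (j div 4) / 2 * \<alpha> (j div 4) $ (j mod 4))"
  have "yc k v = t k" if k: "k < 4" for k
  proof -
    have "yc k v = (\<Sum>i<4. coroot (\<alpha> k) $ i * (t k / 2 * \<alpha> k $ i))"
      unfolding yc_def using k by (intro sum.cong refl) (auto simp: v_def)
    also have "\<dots> = t k / 2 * cartan \<alpha> k k"
      unfolding cartan_sum[OF k k] by (simp add: sum_distrib_left sum_divide_distrib mult_ac)
    finally show ?thesis using diag2[OF k] by simp
  qed
  moreover have "v \<in> carrier_vec 16" by (simp add: v_def)
  ultimately show thesis using that by blast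
qed

lemma P0_surj: "(\<lambda>v. P0 *\<^sub>v v) ` carrier_vec 16 = carrier_vec 2"
proof (intro equalityI subsetI)
  fix w :: "complex vec" assume w: "w \<in> carrier_vec 2"
  define D where "D = (1 + lam) * (1 + lam) - lam * cartan \<alpha> 0 1 * cartan \<alpha> 1 0"
  \<comment> \<open>Cramer's rule for the leading 2 x 2 block, with the coordinates 2 and 3 set to
    zero.\<close>
  define t where "t = (\<lambda>k. if k = 0 then ((1 + lam) * w $ 0 - cartan \<alpha> 0 1 * w $ 1) / D
      else if k = (1::nat) then ((1 + lam) * w $ 1 - lam * cartan \<alpha> 1 0 * w $ 0) / D else 0)"
  obtain v where v: "v \<in> carrier_vec 16" "\<And>k. k < 4 \<Longrightarrow> yc k v = t k" by (rule yc_solution[of t]) blast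
  have D0: "D \<noteq> 0" using nondeg by (simp add: D_def)
  have f: "Fy v k = F k 0 * t 0 + F k 1 * t 1" for k
    using v(2)[of 0] v(2)[of 1] v(2)[of 2] v(2)[of 3] by (simp add: Fy_def sum_less_4) (simp add: t_def)
  have "Fy v 0 = ((1 + lam) * ((1 + lam) * w $ 0 - cartan \<alpha> 0 1 * w $ 1) + cartan \<alpha> 0 1 * ((1 + lam) * w $ 1 - lam * cartan \<alpha> 1 0 * w $ 0)) / D"
    unfolding f by (simp add: t_def seifert_def add_divide_distrib)
  also have "\<dots> = D * w $ 0 / D" unfolding D_def by (simp add: algebra_simps)
  finally have 0: "Fy v 0 = w $ 0" using D0 by simp
  have "Fy v 1 = (lam * cartan \<alpha> 1 0 * ((1 + lam) * w $ 0 - cartan \<alpha> 0 1 * w $ 1) + (1 + lam) * ((1 + lam) * w $ 1 - lam * cartan \<alpha> 1 0 * w $ 0)) / D"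
    unfolding f by (simp add: t_def seifert_def add_divide_distrib)
  also have "\<dots> = D * w $ 1 / D" unfolding D_def by (simp add: algebra_simps)
  finally have 1: "Fy v 1 = w $ 1" using D0 by simp
  have "P0 *\<^sub>v v = w"
  proof (rule eq_vecI)
    fix i assume "i < dim_vec w"
    then have "i < 2" using w by simp
    then show "(P0 *\<^sub>v v) $ i = w $ i" using P0_mult[OF v(1)] 0 1 by (auto simp: less_2_cases_iff)
  qed (use w in \<open>simp add: P0_def\<close>)
  then show "w \<in> (\<lambda>v. P0 *\<^sub>v v) ` carrier_vec 16" using v(1) by blast
qed (use P0_carrier in auto)

lemma P0_kernel: "mat_kernel P0 = {u + w | u w. u \<in> conv_K 4 As \<and> w \<in> conv_L 4 lam As}"
proof -
  have "P0 *\<^sub>v v = 0\<^sub>v 2 \<longleftrightarrow> (\<forall>k<4. Fy v k = 0)" if v: "v \<in> carrier_vec 16" for v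
  proof
    assume "P0 *\<^sub>v v = 0\<^sub>v 2"
    then have 0: "Fy v 0 = 0" "Fy v 1 = 0" using P0_mult[OF v, of 0] P0_mult[OF v, of 1] by simp_all
    show "\<forall>k<4. Fy v k = 0"
    proof (intro allI impI)
      fix k :: nat assume "k < 4"
      then show "Fy v k = 0" by (subst Fy_rank2) (simp_all only: 0 mult_zero_right add_0_right)
    qed
  next
    assume "\<forall>k<4. Fy v k = 0"
    then show "P0 *\<^sub>v v = 0\<^sub>v 2"
      using P0_mult[OF v] by (intro eq_vecI) (auto simp: P0_def)
  qed
  then show ?thesis unfolding conv_KL mat_kernel[OF P0_carrier] by auto
qed

text \<open>Subtracting \<open>Fy v k\<close> from coordinate \<open>k\<close> lowers
  \<open>Fy v i\<close> by \<open>F i k * Fy v k\<close>, and \<open>Fy v k\<close> is the row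
  \<open>x k\<close> applied to the first two entries.\<close>

lemma P0_conv:
  assumes k: "k < 4"
  shows "refl2 1 (\<lambda>i. F i k) (x k) * P0 = P0 * conv_mat 4 lam As k"
proof (rule mat_eq_vecI[of _ 2 16])
  show "refl2 1 (\<lambda>i. F i k) (x k) * P0 \<in> carrier_mat 2 16"
    using P0_carrier by (auto simp: refl2_def)
  show "P0 * conv_mat 4 lam As k \<in> carrier_mat 2 16"
    using P0_carrier conv_mat_carrier by auto
  fix v :: "complex vec" assume v: "v \<in> carrier_vec 16"
  have Bv: "conv_mat 4 lam As k *\<^sub>v v \<in> carrier_vec 16" by (rule mult_mat_vec_carrier[OF conv_mat_carrier v])
  show "refl2 1 (\<lambda>i. F i k) (x k) * P0 *\<^sub>v v = P0 * conv_mat 4 lam As k *\<^sub>v v"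
  proof (rule eq_vecI)
    fix i assume "i < dim_vec (P0 * conv_mat 4 lam As k *\<^sub>v v)"
    then have i: "i < 2" by (simp add: P0_def)
    have "(P0 * conv_mat 4 lam As k *\<^sub>v v) $ i = Fy (conv_mat 4 lam As k *\<^sub>v v) i"
      using P0_mult[OF Bv i] assoc_mult_mat_vec[OF P0_carrier conv_mat_carrier v] by simp
    also have "\<dots> = (\<Sum>l<4. F i l * (yc l v - (if l = k then Fy v k else 0)))"
      unfolding Fy_def[of "conv_mat 4 lam As k *\<^sub>v v"] using yc_conv_mat[OF v k] by (intro sum.cong refl) auto
    also have "\<dots> = Fy v i - F i k * Fy v k"
      using k by (simp add: right_diff_distrib sum_subtractf Fy_def[of v i] if_distrib[of "\<lambda>z. _ * z"] cong: if_cong)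
    finally have r: "(P0 * conv_mat 4 lam As k *\<^sub>v v) $ i = Fy v i - F i k * Fy v k" .
    have "(refl2 1 (\<lambda>i. F i k) (x k) * P0 *\<^sub>v v) $ i = (refl2 1 (\<lambda>i. F i k) (x k) *\<^sub>v (P0 *\<^sub>v v)) $ i"
      using assoc_mult_mat_vec[OF refl2_carrier P0_carrier v] by simp
    also have "\<dots> = Fy v i - F i k * (x k 0 * Fy v 0 + x k 1 * Fy v 1)"
      using i P0_mult[OF v, of 0] P0_mult[OF v, of 1]
      by (auto simp: refl2_def scalar_prod_def numeral_2_eq_2 P0_def less_Suc_eq algebra_simps)
    finally show "(refl2 1 (\<lambda>i. F i k) (x k) * P0 *\<^sub>v v) $ i = (P0 * conv_mat 4 lam As k *\<^sub>v v) $ i"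
      unfolding r Fy_rank2[OF k, of v] .
  qed (auto simp: refl2_def P0_def)
qed

lemma middle_convolution_exists:
  "middle_convolution 4 lam As (map (\<lambda>k. refl2 1 (\<lambda>i. F i k) (x k)) [0..<4])"
  unfolding middle_convolution_def
proof (intro conjI exI bexI)
  show "P0 \<in> carrier_mat 2 (length As * 4)" using P0_carrier by simp
qed (use P0_surj P0_kernel P0_conv in \<open>simp_all\<close>)

end

section \<open>Independence of the chosen quotient map\<close>

lemma surjective_section:
  fixes P :: "complex mat"
  assumes P: "P \<in> carrier_mat m n" and surj: "(\<lambda>v. P *\<^sub>v v) ` carrier_vec n = carrier_vec m"
  obtains E where "E \<in> carrier_mat n m" "P * E = 1\<^sub>m m"
proof -
  have "\<exists>v. v \<in> carrier_vec n \<and> P *\<^sub>v v = unit_vec m j" for j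
  proof -
    have "unit_vec m j \<in> (\<lambda>v. P *\<^sub>v v) ` carrier_vec n" unfolding surj by simp
    then show ?thesis by force
  qed
  then obtain f where f: "\<And>j. f j \<in> carrier_vec n" "\<And>j. P *\<^sub>v f j = unit_vec m j" by metis
  define E where "E = mat n m (\<lambda>(i,j). f j $ i)"
  have E: "E \<in> carrier_mat n m" by (simp add: E_def)
  have "P * E = 1\<^sub>m m"
  proof (rule eq_matI)
    fix i j assume "i < dim_row (1\<^sub>m m :: complex mat)" "j < dim_col (1\<^sub>m m :: complex mat)"
    then have ij: "i < m" "j < m" by auto
    have "col E j = f j" using ij f(1)[of j] by (intro eq_vecI) (auto simp: E_def)
    then have "(P * E) $$ (i,j) = (P *\<^sub>v f j) $ i" using P E ij by simp
    then show "(P * E) $$ (i,j) = 1\<^sub>m m $$ (i,j)" using f(2) ij by simp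
  qed (use P E in auto)
  then show thesis using E that by blast
qed

text \<open>The vector \<open>v - E P0 v\<close> lies in the kernel of \<open>P0\<close>, hence in
  that of \<open>P\<close>.\<close>

lemma same_kernel_factor:
  fixes P P0 :: "complex mat"
  assumes P: "P \<in> carrier_mat m n" and P0: "P0 \<in> carrier_mat r n"
    and E: "E \<in> carrier_mat n r" "P0 * E = 1\<^sub>m r" and ker: "mat_kernel P0 \<subseteq> mat_kernel P"
  shows "P * E * P0 = P"
proof (rule mat_eq_vecI[of _ m n])
  fix v :: "complex vec" assume v: "v \<in> carrier_vec n"
  let ?w = "E *\<^sub>v (P0 *\<^sub>v v)"
  have w: "?w \<in> carrier_vec n" using E P0 v by simp
  have "P0 *\<^sub>v ?w = (P0 * E) *\<^sub>v (P0 *\<^sub>v v)"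
    by (rule assoc_mult_mat_vec[OF P0 E(1) mult_mat_vec_carrier[OF P0 v], symmetric])
  also have "\<dots> = P0 *\<^sub>v v" unfolding E(2) using P0 v by simp
  finally have "P0 *\<^sub>v (v - ?w) = 0\<^sub>v r" using P0 v w by (simp add: mult_minus_distrib_mat_vec[OF P0])
  then have "v - ?w \<in> mat_kernel P0" using v w by (simp add: mat_kernel[OF P0])
  then have "P *\<^sub>v (v - ?w) = 0\<^sub>v m" using ker mat_kernel[OF P] by blast
  then have eq: "P *\<^sub>v v - P *\<^sub>v ?w = 0\<^sub>v m" using P v w by (simp add: mult_minus_distrib_mat_vec[OF P])
  have "P *\<^sub>v v = P *\<^sub>v ?w"
  proof (rule eq_vecI)
    fix i assume "i < dim_vec (P *\<^sub>v ?w)"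
    then have i: "i < m" using P by simp
    have "(P *\<^sub>v v - P *\<^sub>v ?w) $ i = 0" unfolding eq using i by simp
    then show "(P *\<^sub>v v) $ i = (P *\<^sub>v ?w) $ i" using i P by simp
  qed simp
  moreover have "P * E * P0 *\<^sub>v v = P *\<^sub>v ?w"
    unfolding assoc_mult_mat_vec[OF mult_carrier_mat[OF P E(1)] P0 v]
    by (rule assoc_mult_mat_vec[OF P E(1) mult_mat_vec_carrier[OF P0 v]])
  ultimately show "P * E * P0 *\<^sub>v v = P *\<^sub>v v" by simp
qed (use P E P0 in auto)

text \<open>The traces of the two products agree.\<close>

lemma left_right_inverse_dim:
  fixes S S' :: "complex mat"
  assumes S: "S \<in> carrier_mat m r" and S': "S' \<in> carrier_mat r m" and 1: "S * S' = 1\<^sub>m m" "S' * S = 1\<^sub>m r"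
  shows "m = r"
proof -
  have "of_nat m = (\<Sum>i<m. (S * S') $$ (i,i))" using 1 by simp
  also have "\<dots> = (\<Sum>i<m. \<Sum>j<r. S $$ (i,j) * S' $$ (j,i))"
    using S S' by (intro sum.cong refl) (simp add: scalar_prod_def atLeast0LessThan)
  also have "\<dots> = (\<Sum>j<r. \<Sum>i<m. S $$ (i,j) * S' $$ (j,i))" by (rule sum.swap)
  also have "\<dots> = (\<Sum>j<r. (S' * S) $$ (j,j))"
    using S S' by (intro sum.cong refl) (simp add: scalar_prod_def atLeast0LessThan mult.commute)
  also have "\<dots> = of_nat r" using 1 by simp
  finally have "of_nat m = (of_nat r :: complex)" .
  then show ?thesis by simp
qed

lemma det_refl2: "det (refl2 g q x) = g * g * (1 - (x 0 * q 0 + x 1 * q 1))"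
proof -
  have "refl2 g q x = mat22 (g * (1 - q 0 * x 0)) (- (g * (q 0 * x 1))) (- (g * (q 1 * x 0))) (g * (1 - q 1 * x 1))"
    by (rule mat2_eqI) (auto simp: refl2_def mat22_def)
  then show ?thesis by (simp add: det_mat22 algebra_simps)
qed

lemma smult_refl2: "c \<cdot>\<^sub>m refl2 g q x = refl2 (c * g) q x"
  by (intro eq_matI) (auto simp: refl2_def)

lemma tuple_prod_SL2:
  assumes "set Ms \<subseteq> SL2" shows "tuple_prod 2 Ms \<in> SL2"
  using assms by (induction Ms) (auto simp: tuple_prod_Nil tuple_prod_Cons SL2_mult, simp add: SL2_def)

context root_tuple
begin

text \<open>Quotient maps with the same kernel differ by an invertible matrix \<open>S\<close>.
  Hence the dimension is two for every choice and the reflections are conjugated by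
  \<open>S\<close>, which preserves the pairings of rows with columns.\<close>

lemma middle_convolution_refl2:
  assumes "middle_convolution 4 lam As Ms"
  obtains q y where "\<And>k. k < 4 \<Longrightarrow> Ms ! k = refl2 1 (q k) (y k)" "length Ms = 4"
    "\<And>k l. k < 4 \<Longrightarrow> l < 4 \<Longrightarrow> y k 0 * q l 0 + y k 1 * q l 1 = F k l"
proof -
  from assms obtain m P where len: "length Ms = 4" and P: "P \<in> carrier_mat m 16"
    and surj: "(\<lambda>v. P *\<^sub>v v) ` carrier_vec 16 = carrier_vec m"
    and ker: "mat_kernel P = {u + w | u w. u \<in> conv_K 4 As \<and> w \<in> conv_L 4 lam As}"
    and Ms: "\<And>k. k < 4 \<Longrightarrow> Ms ! k \<in> carrier_mat m m \<and> Ms ! k * P = P * conv_mat 4 lam As k"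
    unfolding middle_convolution_def by auto
  obtain E where E: "E \<in> carrier_mat 16 2" "P0 * E = 1\<^sub>m 2" by (rule surjective_section[OF P0_carrier P0_surj])
  obtain E' where E': "E' \<in> carrier_mat 16 m" "P * E' = 1\<^sub>m m" by (rule surjective_section[OF P surj])
  define S where "S = P * E"
  define S' where "S' = P0 * E'"
  have Sc: "S \<in> carrier_mat m 2" "S' \<in> carrier_mat 2 m" using P P0_carrier E E' by (auto simp: S_def S'_def)
  have SP: "S * P0 = P" unfolding S_def by (rule same_kernel_factor[OF P P0_carrier E]) (simp add: ker P0_kernel)
  have SP': "S' * P = P0" unfolding S'_def by (rule same_kernel_factor[OF P0_carrier P E']) (simp add: ker P0_kernel)
  have "S * S' = S * P0 * E'" unfolding S'_def using Sc P0_carrier E' by (simp add: assoc_mult_mat[of _ m 2 _ 16 _ m])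
  then have SS: "S * S' = 1\<^sub>m m" unfolding SP E'(2) .
  have "S' * S = S' * P * E" unfolding S_def using Sc P E by (simp add: assoc_mult_mat[of _ 2 m _ 16 _ 2])
  then have S'S: "S' * S = 1\<^sub>m 2" unfolding SP' E(2) .
  have m2: "m = 2" by (rule left_right_inverse_dim[OF Sc SS S'S])
  note Sc = Sc[unfolded m2] and SS = SS[unfolded m2]
  have Mk: "Ms ! k = S * refl2 1 (\<lambda>i. F i k) (x k) * S'" if k: "k < 4" for k
  proof -
    let ?M0 = "refl2 1 (\<lambda>i. F i k) (x k)"
    have M: "Ms ! k \<in> carrier_mat 2 2" "Ms ! k * P = P * conv_mat 4 lam As k" using Ms[OF k] m2 by auto
    note P = P[unfolded m2]
    have M0: "?M0 \<in> carrier_mat 2 2" by simp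
    have B: "conv_mat 4 lam As k \<in> carrier_mat 16 16" by (rule conv_mat_carrier)
    have "Ms ! k * S = Ms ! k * P * E"
      unfolding S_def by (rule assoc_mult_mat[OF M(1) P E(1), symmetric])
    also have "\<dots> = S * P0 * conv_mat 4 lam As k * E" unfolding M(2) SP ..
    also have "\<dots> = S * (P0 * conv_mat 4 lam As k) * E"
      using assoc_mult_mat[OF Sc(1) P0_carrier B] by simp
    also have "\<dots> = S * (?M0 * P0) * E" unfolding P0_conv[OF k] ..
    also have "\<dots> = S * ((?M0 * P0) * E)" by (rule assoc_mult_mat[OF Sc(1) mult_carrier_mat[OF M0 P0_carrier] E(1)])
    also have "(?M0 * P0) * E = ?M0 * (P0 * E)" by (rule assoc_mult_mat[OF M0 P0_carrier E(1)])
    also have "\<dots> = ?M0" unfolding E(2) by (rule right_mult_one_mat[OF M0])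
    finally have MS: "Ms ! k * S = S * ?M0" .
    have "Ms ! k = Ms ! k * (S * S')" unfolding SS using M by simp
    also have "\<dots> = Ms ! k * S * S'" using M Sc by (simp add: assoc_mult_mat[of _ 2 2 _ 2 _ 2])
    finally show ?thesis unfolding MS .
  qed
  define q where "q = (\<lambda>k i. S $$ (i,0) * F 0 k + S $$ (i,1) * F 1 k)"
  define y where "y = (\<lambda>k j. x k 0 * S' $$ (0,j) + x k 1 * S' $$ (1,j))"
  show thesis
  proof (rule that[of q y])
    show "Ms ! k = refl2 1 (q k) (y k)" if "k < 4" for k
      unfolding Mk[OF that] conj_refl2[OF Sc SS] q_def y_def ..
    show "length Ms = 4" by (rule len)
    fix k l :: nat assume kl: "k < 4" "l < 4"
    have e: "S' $$ (i,0) * S $$ (0,j) + S' $$ (i,1) * S $$ (1,j) = (if i = j then 1 else 0)" if "i < 2" "j < 2" for i j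
      using mat2_mult[OF Sc(2,1) that] S'S that by simp
    have "y k 0 * q l 0 + y k 1 * q l 1 =
      x k 0 * (S' $$ (0,0) * S $$ (0,0) + S' $$ (0,1) * S $$ (1,0)) * F 0 l
      + x k 0 * (S' $$ (0,0) * S $$ (0,1) + S' $$ (0,1) * S $$ (1,1)) * F 1 l
      + x k 1 * (S' $$ (1,0) * S $$ (0,0) + S' $$ (1,1) * S $$ (1,0)) * F 0 l
      + x k 1 * (S' $$ (1,0) * S $$ (0,1) + S' $$ (1,1) * S $$ (1,1)) * F 1 l"
      by (simp add: q_def y_def algebra_simps)
    also have "\<dots> = x k 0 * F 0 l + x k 1 * F 1 l"
      by (subst (1 2 3 4) e) simp_all
    finally show "y k 0 * q l 0 + y k 1 * q l 1 = F k l" using rank2[OF kl] by simp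
  qed
qed

text \<open>The scalars of an induced tuple are forced up to signs by the determinants, and the passage from the
  Cartan matrix to a symmetric Gram matrix rescales the vectors and covectors.\<close>

lemma induced_realizes:
  assumes ind: "induced_tuple 4 lam As Ns"
    and n: "\<And>k. k < 4 \<Longrightarrow> n k \<noteq> 0" and G: "\<And>k l. k < 4 \<Longrightarrow> l < 4 \<Longrightarrow> G k l * n l = n k * cartan \<alpha> k l"
  shows "realizes lam G Ns"
proof -
  obtain Ms cs where mc: "middle_convolution 4 lam As Ms" and cs: "length cs = 5" "0 \<notin> set cs" "prod_list cs = 1"
    and Ns: "Ns = map2 (\<cdot>\<^sub>m) cs (Ms @ [inv_prod 2 Ms])" and sl: "set Ns \<subseteq> SL2"
    using ind unfolding induced_tuple_def by auto
  obtain q y where M: "\<And>k. k < 4 \<Longrightarrow> Ms ! k = refl2 1 (q k) (y k)" and len: "length Ms = 4"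
    and yq: "\<And>k l. k < 4 \<Longrightarrow> l < 4 \<Longrightarrow> y k 0 * q l 0 + y k 1 * q l 1 = F k l"
    by (rule middle_convolution_refl2[OF mc]) blast
  have lenN: "length Ns = 5" using cs len by (simp add: Ns)
  have Nk: "Ns ! k = refl2 (cs ! k) (q k) (y k)" if k: "k < 4" for k
    using k cs len M[OF k] by (simp add: Ns nth_append smult_refl2)
  \<comment> \<open>Determinant one reads \<open>c^2 * (1 - (1 + lam)) = 1\<close> for the scalar
    \<open>c\<close>.\<close>
  have ck: "cs ! k * cs ! k = - 1 / lam" if k: "k < 4" for k
  proof -
    have "Ns ! k \<in> SL2" using sl lenN k by auto
    then have "cs ! k * cs ! k * (1 - (1 + lam)) = 1"
      unfolding Nk[OF k] SL2_def using yq[OF k k] by (simp add: det_refl2 seifert_def)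
    then have "lam * (cs ! k * cs ! k) = -1" by (simp add: minus_equation_iff mult.commute)
    then show ?thesis using lam0 by (metis nonzero_eq_divide_eq mult.commute)
  qed
  have Mc: "set Ms \<subseteq> carrier (GL 2)"
  proof
    fix A assume "A \<in> set Ms"
    then obtain k where k: "k < 4" "A = Ms ! k" using len by (auto simp: in_set_conv_nth)
    have "refl2 1 (q k) (y k) \<in> carrier_mat 2 2" by simp
    moreover have "det (refl2 1 (q k) (y k)) \<noteq> 0"
      using yq[OF k(1) k(1)] lam0 by (simp add: det_refl2 seifert_def)
    ultimately have "refl2 1 (q k) (y k) \<in> Units (ring_mat TYPE(complex) 2 ())" by (rule det_non_zero_imp_unit)
    then show "A \<in> carrier (GL 2)" using M[OF k(1)] k(2) by (simp add: units_of_def)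
  qed
  have Mcc: "set Ms \<subseteq> carrier_mat 2 2" using Mc GL_D(1) by blast
  note T = GL_D[OF tuple_prod_GL[OF Mc]]
  have "tuple_prod 2 (Ms @ [inv_prod 2 Ms]) = tuple_prod 2 Ms * inv_prod 2 Ms"
    using Mcc T by (subst tuple_prod_append) (auto simp: tuple_prod_Cons tuple_prod_Nil inv_prod_def)
  then have pr1: "tuple_prod 2 (Ms @ [inv_prod 2 Ms]) = 1\<^sub>m 2" using T by (simp add: inv_prod_def)
  have "tuple_prod 2 Ns = prod_list cs \<cdot>\<^sub>m tuple_prod 2 (Ms @ [inv_prod 2 Ms])"
    unfolding Ns using cs len Mcc T by (intro tuple_prod_smult) (auto simp: inv_prod_def)
  then have pr: "tuple_prod 2 Ns = 1\<^sub>m 2" unfolding pr1 cs(3) by auto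
  \<comment> \<open>Dividing columns and multiplying rows by \<open>n\<close> leaves the reflections
    unchanged and conjugates the matrix of pairings by a diagonal matrix.\<close>
  have main: "(\<forall>k<4. cs ! k * cs ! k = - 1 / lam \<and> Ns ! k = refl2 (cs ! k) (\<lambda>i. q k i / n k) (\<lambda>j. n k * y k j)) \<and>
      (\<forall>k<4. \<forall>l<4. n k * y k 0 * (q l 0 / n l) + n k * y k 1 * (q l 1 / n l) = seifert lam G k l)"
  proof (intro conjI allI impI)
    fix k :: nat assume k: "k < 4"
    show "cs ! k * cs ! k = - 1 / lam" by (rule ck[OF k])
    show "Ns ! k = refl2 (cs ! k) (\<lambda>i. q k i / n k) (\<lambda>j. n k * y k j)"
      using Nk[OF k] n[OF k] by (simp add: refl2_def)
  next
    fix k l :: nat assume kl: "k < 4" "l < 4"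
    have "n k * y k 0 * (q l 0 / n l) + n k * y k 1 * (q l 1 / n l) = n k * (y k 0 * q l 0 + y k 1 * q l 1) / n l"
      by (simp add: add_divide_distrib distrib_left mult.assoc)
    also have "\<dots> = n k * F k l / n l" unfolding yq[OF kl] ..
    also have "\<dots> = seifert lam G k l"
    proof -
      have "n k * cartan \<alpha> k l / n l = G k l" using G[OF kl] n[OF kl(2)] by (simp add: field_simps)
      moreover have "n k * (lam * cartan \<alpha> k l) / n l = lam * (n k * cartan \<alpha> k l / n l)" by simp
      ultimately show ?thesis using n[OF kl(2)] n[OF kl(1)] by (simp add: seifert_def)
    qed
    finally show "n k * y k 0 * (q l 0 / n l) + n k * y k 1 * (q l 1 / n l) = seifert lam G k l" .
  qed
  show ?thesis unfolding realizes_def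
    by (intro conjI, rule lenN, rule sl, rule pr, rule exI[of _ "(!) cs"], rule exI[of _ "\<lambda>k i. q k i / n k"],
        rule exI[of _ "\<lambda>k j. n k * y k j"], rule main)
qed

lemma induced_exists: "\<exists>Ns. induced_tuple 4 lam As Ns"
proof -
  define Ms where "Ms = map (\<lambda>k. refl2 1 (\<lambda>i. F i k) (x k)) [0..<4]"
  have mc: "middle_convolution 4 lam As Ms" unfolding Ms_def by (rule middle_convolution_exists)
  have lenM: "length Ms = 4" by (simp add: Ms_def)
  define c where "c = 1 / (lam * lam * lam * lam)"
  \<comment> \<open>The reflections have determinant \<open>- lam\<close>, and
    \<open>lam^3 = -1\<close>, so the scalar \<open>lam\<close> brings each of them into SL2; the
    fifth scalar makes the product of the scalars 1.\<close>
  define cs where "cs = [lam, lam, lam, lam, c]"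
  have l3: "lam * lam * lam = -1"
  proof -
    have "lam * lam * lam = (lam - 1) * lam" unfolding lam ..
    also have "\<dots> = lam * lam - lam" by (simp add: algebra_simps)
    finally show ?thesis unfolding lam by simp
  qed
  have dM: "lam \<cdot>\<^sub>m M \<in> SL2" "M \<in> carrier_mat 2 2" if "M \<in> set Ms" for M
  proof -
    obtain k where k: "k < 4" "M = refl2 1 (\<lambda>i. F i k) (x k)" using \<open>M \<in> set Ms\<close> by (auto simp: Ms_def)
    show "M \<in> carrier_mat 2 2" using k by simp
    have "x k 0 * F 0 k + x k 1 * F 1 k = 1 + lam" using rank2[OF k(1) k(1)] by (simp add: seifert_def)
    then have "det (lam \<cdot>\<^sub>m M) = lam * lam * (- lam)" unfolding k(2) smult_refl2 by (simp add: det_refl2)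
    then show "lam \<cdot>\<^sub>m M \<in> SL2" using l3 k(2) by (simp add: SL2_def)
  qed
  define T where "T = tuple_prod 2 Ms"
  have Tc: "T \<in> carrier_mat 2 2" unfolding T_def by (rule tuple_prod_carrier) (use dM(2) in blast)
  have LT_eq: "tuple_prod 2 (map2 (\<cdot>\<^sub>m) [lam, lam, lam, lam] Ms) = prod_list [lam, lam, lam, lam] \<cdot>\<^sub>m T"
    unfolding T_def using lenM dM(2) by (intro tuple_prod_smult) auto
  have scalars_SL2: "set (map2 (\<cdot>\<^sub>m) [lam, lam, lam, lam] Ms) \<subseteq> SL2"
  proof
    fix A assume "A \<in> set (map2 (\<cdot>\<^sub>m) [lam, lam, lam, lam] Ms)"
    then obtain e M where eM: "(e, M) \<in> set (zip [lam, lam, lam, lam] Ms)" "A = e \<cdot>\<^sub>m M" by auto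
    have "e = lam" using set_zip_leftD[OF eM(1)] by simp
    then show "A \<in> SL2" using dM(1) set_zip_rightD[OF eM(1)] eM(2) by simp
  qed
  have LT: "(lam * lam * lam * lam) \<cdot>\<^sub>m T \<in> SL2"
    using tuple_prod_SL2[OF scalars_SL2] unfolding LT_eq by (simp add: mult.assoc)
  note L = GL_D[OF SL2_GL[OF LT]]
  let ?L = "lam * lam * lam * lam"
  have L0: "?L \<noteq> 0" using lam0 by simp
  define I where "I = inv\<^bsub>GL 2\<^esub> (?L \<cdot>\<^sub>m T)"
  have Ic: "I \<in> carrier_mat 2 2" using L(2) by (simp add: I_def)
  have "T * (?L \<cdot>\<^sub>m I) = 1\<^sub>m 2"
    using L(3) Tc Ic unfolding I_def[symmetric]
    by (simp add: mult_smult_distrib[of T 2 2] mult_smult_assoc_mat[of T 2 2])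
  then have inv: "inv_prod 2 Ms = ?L \<cdot>\<^sub>m I"
    unfolding inv_prod_def T_def[symmetric] using Tc Ic by (intro GL_inv_eq) auto
  have "det (?L \<cdot>\<^sub>m T) * det I = 1"
    using L(3) det_mult[OF L(1) Ic] unfolding I_def[symmetric] by simp
  then have "det I = 1" using LT by (simp add: SL2_def)
  then have IS: "I \<in> SL2" using Ic by (simp add: SL2_def)
  define Ns where "Ns = map2 (\<cdot>\<^sub>m) cs (Ms @ [inv_prod 2 Ms])"
  have "c \<cdot>\<^sub>m inv_prod 2 Ms = I" unfolding inv c_def using L0 by (auto simp: smult_smult_mat)
  moreover have "Ns = map2 (\<cdot>\<^sub>m) [lam, lam, lam, lam] Ms @ [c \<cdot>\<^sub>m inv_prod 2 Ms]"
  proof -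
    have "Ns = map2 (\<cdot>\<^sub>m) ([lam, lam, lam, lam] @ [c]) (Ms @ [inv_prod 2 Ms])" by (simp add: Ns_def cs_def)
    then show ?thesis using lenM by (simp del: append.simps)
  qed
  moreover have "set (map2 (\<cdot>\<^sub>m) [lam, lam, lam, lam] Ms) \<subseteq> SL2" by (rule scalars_SL2)
  ultimately have "set Ns \<subseteq> SL2" using IS by simp
  moreover have "length cs = length As + 1" "0 \<notin> set cs" "prod_list cs = 1"
    using lam0 by (auto simp: cs_def c_def mult.assoc)
  ultimately have "induced_tuple 4 lam As Ns"
    unfolding induced_tuple_def using mc Ns_def by blast
  then show ?thesis by blast
qed

end

section \<open>Gram matrices of nice tuples\<close>

definition root_norm :: "complex vec \<Rightarrow> real" where
  "root_norm \<alpha> = (if \<alpha> \<bullet> \<alpha> = 1 then 1 else sqrt 2)"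

text \<open>On roots this is 2 (\<alpha>, \<beta>) / (|\<alpha>| |\<beta>|). The form with the
  Cartan integer exhibits it as a diagonal conjugate of the Cartan matrix.\<close>

definition gram :: "complex vec \<Rightarrow> complex vec \<Rightarrow> real" where
  "gram \<alpha> \<beta> = root_norm \<alpha> / root_norm \<beta> * Re (coroot \<alpha> \<bullet> \<beta>)"

lemma root_norm_pos: "root_norm \<alpha> > 0"
  by (simp add: root_norm_def)

lemma root_norm_square: "\<alpha> \<in> F4_roots \<Longrightarrow> \<alpha> \<bullet> \<alpha> = of_real (root_norm \<alpha> * root_norm \<alpha>)"
  using F4_root_lattice(2)[of \<alpha>] by (auto simp: root_norm_def simp flip: of_real_mult)

lemma F4_root_real:
  assumes "\<alpha> \<in> F4_roots" "i < 4"
  shows "\<alpha> $ i = of_real (Re (\<alpha> $ i))"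
proof -
  have "\<alpha> $ i \<in> \<int> \<or> \<alpha> $ i - 1/2 \<in> \<int>"
    using F4_root_lattice(1)[OF assms(1)] assms(2) by (auto simp: Q_lattice_def)
  then obtain m :: int where "\<alpha> $ i = of_int m \<or> \<alpha> $ i - 1/2 = of_int m" by (auto elim: Ints_cases)
  then have "\<alpha> $ i = of_real (of_int m) \<or> \<alpha> $ i = of_real (of_int m + 1/2)" by (auto simp: algebra_simps)
  then show ?thesis by (metis Re_complex_of_real)
qed

lemma F4_root_scalar_prod_real:
  assumes "\<alpha> \<in> F4_roots" "\<beta> \<in> F4_roots"
  shows "\<alpha> \<bullet> \<beta> = of_real (\<Sum>i<4. Re (\<alpha> $ i) * Re (\<beta> $ i))"
proof -
  have "\<alpha> \<bullet> \<beta> = (\<Sum>i<4. \<alpha> $ i * \<beta> $ i)"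
    using carrier_vecD[OF F4_root_carrier[OF assms(2)]] by (simp add: scalar_prod_def atLeast0LessThan)
  also have "\<dots> = (\<Sum>i<4. of_real (Re (\<alpha> $ i) * Re (\<beta> $ i)))"
    using F4_root_real assms by (intro sum.cong refl) (metis lessThan_iff of_real_mult)
  finally show ?thesis by simp
qed

text \<open>By Lagrange's identity the difference of the two sides is a sum of six squares.\<close>

lemma Cauchy_Schwarz_4:
  fixes a b :: "nat \<Rightarrow> real"
  shows "(\<Sum>i<4. a i * b i) * (\<Sum>i<4. a i * b i) \<le> (\<Sum>i<4. a i * a i) * (\<Sum>i<4. b i * b i)"
proof -
  have "(\<Sum>i<4. a i * a i) * (\<Sum>i<4. b i * b i) - (\<Sum>i<4. a i * b i) * (\<Sum>i<4. a i * b i) =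
    (a 0 * b 1 - a 1 * b 0)\<^sup>2 + (a 0 * b 2 - a 2 * b 0)\<^sup>2 + (a 0 * b 3 - a 3 * b 0)\<^sup>2 +
    (a 1 * b 2 - a 2 * b 1)\<^sup>2 + (a 1 * b 3 - a 3 * b 1)\<^sup>2 + (a 2 * b 3 - a 3 * b 2)\<^sup>2"
    unfolding sum_less_4 power2_eq_square by (simp add: algebra_simps)
  also have "\<dots> \<ge> 0" by (intro add_nonneg_nonneg zero_le_power2)
  finally show ?thesis by simp
qed

lemma coroot_scalar_prod:
  assumes "\<alpha> \<in> F4_roots" "\<beta> \<in> F4_roots"
  shows "(\<alpha> \<bullet> \<alpha>) * (coroot \<alpha> \<bullet> \<beta>) = 2 * (\<alpha> \<bullet> \<beta>)"
  using F4_root_nonzero[OF assms(1)] F4_root_carrier[OF assms(1)] F4_root_carrier[OF assms(2)]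
  by (simp add: coroot_def)

lemma gram_cartan:
  assumes "\<alpha> \<in> F4_roots" "\<beta> \<in> F4_roots"
  shows "of_real (gram \<alpha> \<beta>) * of_real (root_norm \<beta>) = of_real (root_norm \<alpha>) * (coroot \<alpha> \<bullet> \<beta>)"
proof -
  have "coroot \<alpha> \<bullet> \<beta> \<in> \<int>" using assms by (intro D_Q_int F4_root_lattice)
  then obtain m :: int where "coroot \<alpha> \<bullet> \<beta> = of_int m" by (rule Ints_cases)
  then show ?thesis using root_norm_pos[of \<beta>] by (simp add: gram_def)
qed

lemma gram_scalar_prod:
  assumes "\<alpha> \<in> F4_roots" "\<beta> \<in> F4_roots"
  shows "of_real (gram \<alpha> \<beta> * root_norm \<alpha> * root_norm \<beta>) = 2 * (\<alpha> \<bullet> \<beta>)"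
proof -
  have "of_real (gram \<alpha> \<beta> * root_norm \<alpha> * root_norm \<beta>) =
      of_real (root_norm \<alpha>) * (of_real (gram \<alpha> \<beta>) * complex_of_real (root_norm \<beta>))"
    by (simp add: mult_ac)
  also have "\<dots> = of_real (root_norm \<alpha> * root_norm \<alpha>) * (coroot \<alpha> \<bullet> \<beta>)"
    unfolding gram_cartan[OF assms] by (simp add: mult.assoc)
  also have "\<dots> = 2 * (\<alpha> \<bullet> \<beta>)"
    unfolding root_norm_square[OF assms(1), symmetric] by (rule coroot_scalar_prod[OF assms])
  finally show ?thesis .
qed

lemma gram_sym:
  assumes "\<alpha> \<in> F4_roots" "\<beta> \<in> F4_roots"
  shows "gram \<alpha> \<beta> = gram \<beta> \<alpha>"
proof -
  have c: "\<alpha> \<bullet> \<beta> = \<beta> \<bullet> \<alpha>"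
    using F4_root_carrier[OF assms(1)] F4_root_carrier[OF assms(2)] by (rule comm_scalar_prod)
  have "complex_of_real (gram \<alpha> \<beta> * root_norm \<alpha> * root_norm \<beta>) = of_real (gram \<beta> \<alpha> * root_norm \<beta> * root_norm \<alpha>)"
    unfolding gram_scalar_prod[OF assms] gram_scalar_prod[OF assms(2,1)] c ..
  then have "gram \<alpha> \<beta> * root_norm \<alpha> * root_norm \<beta> = gram \<beta> \<alpha> * root_norm \<beta> * root_norm \<alpha>"
    unfolding of_real_eq_iff .
  then show ?thesis using root_norm_pos[of \<alpha>] root_norm_pos[of \<beta>] by simp
qed

text \<open>The Cauchy-Schwarz inequality bounds the absolute value by 2. For roots of equal length
  the value is the Cartan integer; for different lengths it is the square root of 2 times the Cartan
  integer taken in the suitable order.\<close>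

lemma gram_in_gram_values:
  assumes "\<alpha> \<in> F4_roots" "\<beta> \<in> F4_roots"
  shows "gram \<alpha> \<beta> \<in> gram_values"
proof -
  obtain m :: int where m: "coroot \<alpha> \<bullet> \<beta> = of_int m"
    using D_Q_int[OF F4_root_lattice(3)[OF assms(1)] F4_root_lattice(1)[OF assms(2)]] by (rule Ints_cases)
  obtain m' :: int where m': "coroot \<beta> \<bullet> \<alpha> = of_int m'"
    using D_Q_int[OF F4_root_lattice(3)[OF assms(2)] F4_root_lattice(1)[OF assms(1)]] by (rule Ints_cases)
  define g where "g = gram \<alpha> \<beta>"
  have g: "g = root_norm \<alpha> / root_norm \<beta> * of_int m" by (simp add: g_def gram_def m)
  have g': "g = root_norm \<beta> / root_norm \<alpha> * of_int m'" unfolding g_def gram_sym[OF assms] by (simp add: gram_def m')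
  have "g * g \<le> 4"
  proof -
    let ?s = "\<lambda>x y. \<Sum>i<4. Re (x $ i) * Re (y $ i)"
    have s: "g * root_norm \<alpha> * root_norm \<beta> = 2 * ?s \<alpha> \<beta>"
    proof -
      have "complex_of_real (g * root_norm \<alpha> * root_norm \<beta>) = of_real (2 * ?s \<alpha> \<beta>)"
        using gram_scalar_prod[OF assms] F4_root_scalar_prod_real[OF assms] by (simp add: g_def)
      then show ?thesis unfolding of_real_eq_iff .
    qed
    have n: "root_norm x * root_norm x = ?s x x" if "x \<in> F4_roots" for x
      using root_norm_square[OF that] F4_root_scalar_prod_real[OF that that] by (metis of_real_eq_iff)
    let ?p = "root_norm \<alpha> * root_norm \<alpha> * (root_norm \<beta> * root_norm \<beta>)"
    have "(g * g) * ?p = (g * root_norm \<alpha> * root_norm \<beta>) * (g * root_norm \<alpha> * root_norm \<beta>)" by (simp add: mult_ac)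
    also have "\<dots> = 4 * (?s \<alpha> \<beta> * ?s \<alpha> \<beta>)" unfolding s by simp
    also have "\<dots> \<le> 4 * ?p" unfolding n[OF assms(1)] n[OF assms(2)] using Cauchy_Schwarz_4 by simp
    finally show ?thesis using root_norm_pos[of \<alpha>] root_norm_pos[of \<beta>] by (simp add: mult_le_cancel_right)
  qed
  have small: "k \<in> {-2,-1,0,1,2}" if "k * k \<le> 4" for k :: int
  proof -
    have "\<bar>k\<bar> \<le> 2" using that abs_le_square_iff[of k 2] by (simp add: power2_eq_square)
    then show ?thesis by auto
  qed
  have tiny: "k \<in> {-1,0,1}" if "k * k \<le> 2" for k :: int
  proof -
    have "k \<noteq> 2" "k \<noteq> -2" using that by auto
    then show ?thesis using small[of k] that by auto
  qed
  have r2: "sqrt 2 * sqrt 2 = 2" "\<And>x. sqrt 2 * (sqrt 2 * x) = 2 * x" by (simp_all add: mult.assoc[symmetric])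
  consider (same) "root_norm \<alpha> = root_norm \<beta>" | (short) "root_norm \<alpha> = 1" "root_norm \<beta> = sqrt 2"
    | (long) "root_norm \<alpha> = sqrt 2" "root_norm \<beta> = 1"
    by (cases "\<alpha> \<bullet> \<alpha> = 1"; cases "\<beta> \<bullet> \<beta> = 1") (simp_all add: root_norm_def)
  then have "g \<in> gram_values"
  proof cases
    case same
    then have "g = of_int m" using g root_norm_pos[of \<beta>] by simp
    moreover from this have "m * m \<le> 4" using \<open>g * g \<le> 4\<close> by (simp flip: of_int_mult)
    ultimately show ?thesis using small[of m] by (auto simp: gram_values_def)
  next
    case short
    then have e: "g = sqrt 2 * of_int m'" using g' by simp
    then have "of_int m' * of_int m' \<le> (2 :: real)" using \<open>g * g \<le> 4\<close> r2 by (simp add: mult_ac)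
    then have "m' * m' \<le> 2" by (simp flip: of_int_mult)
    then show ?thesis using tiny[of m'] e by (auto simp: gram_values_def)
  next
    case long
    then have e: "g = sqrt 2 * of_int m" using g by simp
    then have "of_int m * of_int m \<le> (2 :: real)" using \<open>g * g \<le> 4\<close> r2 by (simp add: mult_ac)
    then have "m * m \<le> 2" by (simp flip: of_int_mult)
    then show ?thesis using tiny[of m] e by (auto simp: gram_values_def)
  qed
  then show ?thesis by (simp add: g_def)
qed

text \<open>Row \<open>k\<close> minus the combination of the first two rows given by Cramer's rule
  vanishes in the columns 0 and 1. It still annihilates both kernel vectors, whose parts in the
  coordinates 2 and 3 are independent, so it vanishes altogether.\<close>

lemma rank_two_rows:
  fixes F :: "nat \<Rightarrow> nat \<Rightarrow> complex"
  assumes D: "F 0 0 * F 1 1 - F 0 1 * F 1 0 \<noteq> 0"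
    and z: "\<And>k. k < 4 \<Longrightarrow> (\<Sum>l<4. F k l * z l) = 0" and z': "\<And>k. k < 4 \<Longrightarrow> (\<Sum>l<4. F k l * z' l) = 0"
    and ind: "\<And>p q. (\<forall>l<4. p * z l + q * z' l = 0) \<Longrightarrow> p = 0 \<and> q = 0"
  obtains x where "\<forall>k<4. \<forall>l<4. F k l = x k 0 * F 0 l + x k (1::nat) * F 1 l"
proof -
  define \<Delta> where "\<Delta> = z 2 * z' 3 - z 3 * z' 2"
  have dep: "p = 0 \<and> q = 0" if pq: "p * z 2 + q * z' 2 = 0" "p * z 3 + q * z' 3 = 0" for p q
  proof (rule ind)
    define w where "w = (\<lambda>l. p * z l + q * z' l)"
    have "F k 0 * w 0 + F k 1 * w 1 = 0" if "k < 4" for k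
    proof -
      have "F k 0 * w 0 + F k 1 * w 1 = p * (\<Sum>l<4. F k l * z l) + q * (\<Sum>l<4. F k l * z' l)
          - F k 2 * (p * z 2 + q * z' 2) - F k 3 * (p * z 3 + q * z' 3)"
        unfolding w_def sum_less_4 by (simp add: algebra_simps)
      then show ?thesis unfolding z[OF that] z'[OF that] pq by simp
    qed
    from this[of 0] this[of 1] have e: "F 0 0 * w 0 + F 0 1 * w 1 = 0" "F 1 0 * w 0 + F 1 1 * w 1 = 0" by simp_all
    have "(F 0 0 * F 1 1 - F 0 1 * F 1 0) * w 0 = F 1 1 * (F 0 0 * w 0 + F 0 1 * w 1) - F 0 1 * (F 1 0 * w 0 + F 1 1 * w 1)"
      "(F 0 0 * F 1 1 - F 0 1 * F 1 0) * w 1 = F 0 0 * (F 1 0 * w 0 + F 1 1 * w 1) - F 1 0 * (F 0 0 * w 0 + F 0 1 * w 1)"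
      by (simp_all add: algebra_simps)
    then have "w 0 = 0" "w 1 = 0" using D unfolding e by simp_all
    then show "\<forall>l<4. p * z l + q * z' l = 0" using pq by (simp add: all_less_4 w_def)
  qed
  have \<Delta>: "\<Delta> \<noteq> 0"
  proof
    assume "\<Delta> = 0"
    then have e: "z 2 * z' 3 = z 3 * z' 2" by (simp add: \<Delta>_def)
    have "z' 2 = 0 \<and> - z 2 = 0" by (rule dep) (use e in \<open>simp_all add: mult.commute\<close>)
    moreover have "z' 3 = 0 \<and> - z 3 = 0" by (rule dep) (use e in \<open>simp_all add: mult.commute\<close>)
    ultimately have "(1::complex) = 0 \<and> (0::complex) = 0" by (intro dep) auto
    then show False by simp
  qed
  define D where "D = F 0 0 * F 1 1 - F 0 1 * F 1 0"
  define x where "x = (\<lambda>k i. if i = (0::nat) then (F k 0 * F 1 1 - F k 1 * F 1 0) / D else (F 0 0 * F k 1 - F 0 1 * F k 0) / D)"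
  have "F k l = x k 0 * F 0 l + x k 1 * F 1 l" if k: "k < 4" and l: "l < 4" for k l
  proof -
    define u where "u = (\<lambda>l. F k l - x k 0 * F 0 l - x k 1 * F 1 l)"
    have D0: "D \<noteq> 0" using D by (simp add: D_def)
    have x: "x k 0 * D = F k 0 * F 1 1 - F k 1 * F 1 0" "x k 1 * D = F 0 0 * F k 1 - F 0 1 * F k 0"
      using D0 by (simp_all add: x_def)
    have "u 0 * D = F k 0 * D - (x k 0 * D) * F 0 0 - (x k 1 * D) * F 1 0" by (simp add: u_def algebra_simps)
    also have "\<dots> = 0" unfolding x unfolding D_def by (simp add: algebra_simps)
    finally have u0: "u 0 = 0" using D0 by simp
    have "u 1 * D = F k 1 * D - (x k 0 * D) * F 0 1 - (x k 1 * D) * F 1 1" by (simp add: u_def algebra_simps)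
    also have "\<dots> = 0" unfolding x unfolding D_def by (simp add: algebra_simps)
    finally have u1: "u 1 = 0" using D0 by simp
    have uz: "u 2 * y 2 + u 3 * y 3 = 0" if y: "\<And>k. k < 4 \<Longrightarrow> (\<Sum>l<4. F k l * y l) = 0" for y
    proof -
      have "u 2 * y 2 + u 3 * y 3 = (\<Sum>l<4. u l * y l)" unfolding sum_less_4 u0 u1 by simp
      also have "\<dots> = (\<Sum>l<4. F k l * y l) - x k 0 * (\<Sum>l<4. F 0 l * y l) - x k 1 * (\<Sum>l<4. F 1 l * y l)"
        unfolding sum_less_4 u_def by (simp add: algebra_simps)
      finally show ?thesis using y[OF k] y[of 0] y[of 1] by simp
    qed
    have uzz: "u 2 * z 2 + u 3 * z 3 = 0" "u 2 * z' 2 + u 3 * z' 3 = 0"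
      by (rule uz, rule z, assumption) (rule uz, rule z')
    have "u 2 * \<Delta> = (u 2 * z 2 + u 3 * z 3) * z' 3 - (u 2 * z' 2 + u 3 * z' 3) * z 3"
      "u 3 * \<Delta> = (u 2 * z' 2 + u 3 * z' 3) * z 2 - (u 2 * z 2 + u 3 * z 3) * z' 2"
      unfolding \<Delta>_def by (simp_all add: algebra_simps)
    then have "u 2 * \<Delta> = 0" "u 3 * \<Delta> = 0" unfolding uzz by simp_all
    then have "u 2 = 0" "u 3 = 0" using \<Delta> by simp_all
    then have "u l = 0" using u0 u1 less_4_cases[OF l] by auto
    then show ?thesis by (simp add: u_def algebra_simps)
  qed
  then show thesis using that by blast
qed

lemma gram_values_square: "a \<in> gram_values \<Longrightarrow> a * a \<noteq> 3"
  by (auto simp: gram_values_def)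

text \<open>Conjugation by the diagonal matrix of root lengths turns the Cartan matrix into the Gram
  matrix and scales the kernel vectors, so the Gram equations apply. The same scaling carries the
  pairings of the middle convolution over to the Gram matrix.\<close>

lemma nice_4_tuple_realizes:
  assumes len: "length As = 4" and nice: "nice_tuple 4 G28 As" and ev: "nice_eigenvalue 4 As lam"
  obtains a b c d e f where "lam * lam = lam - 1" "gram_orbit a b c d e f"
    "\<forall>Ns. induced_tuple 4 lam As Ns \<longrightarrow> realizes lam (gram6 a b c d e f) Ns"
    "\<exists>Ns. induced_tuple 4 lam As Ns"
proof -
  obtain \<alpha> y y' where As: "As = map (\<lambda>k. root_reflection (\<alpha> k)) [0..<4]" and rts: "\<forall>k<4. \<alpha> k \<in> F4_roots"
    and lam: "lam * lam = lam - 1" "cnj lam \<noteq> lam"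
    and y: "\<forall>k<4. (\<Sum>l<4. seifert lam (cartan \<alpha>) k l * y l) = 0"
    and y': "\<forall>k<4. (\<Sum>l<4. seifert lam (cartan \<alpha>) k l * y' l) = 0"
    and ind: "\<forall>a b. (\<forall>l<4. a * y l + b * y' l = 0) \<longrightarrow> a = 0 \<and> b = 0"
    by (rule nice_4_tuple_eigenvalue[OF assms]) (rule that)
  have rt: "\<And>k. k < 4 \<Longrightarrow> \<alpha> k \<in> F4_roots" using rts by blast
  define n where "n = (\<lambda>k. complex_of_real (root_norm (\<alpha> k)))"
  have n0: "n k \<noteq> 0" for k using root_norm_pos[of "\<alpha> k"] by (simp add: n_def)
  define g where "g = (\<lambda>k l. gram (\<alpha> k) (\<alpha> l))"
  have gs: "g k l = g l k" if "k < 4" "l < 4" for k l unfolding g_def by (rule gram_sym[OF rt[OF that(1)] rt[OF that(2)]])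
  have gv: "g k l \<in> gram_values" if "k < 4" "l < 4" for k l
    unfolding g_def by (rule gram_in_gram_values[OF rt[OF that(1)] rt[OF that(2)]])
  have gn: "of_real (g k l) * n l = n k * cartan \<alpha> k l" if "k < 4" "l < 4" for k l
    unfolding g_def n_def cartan_def by (rule gram_cartan[OF rt[OF that(1)] rt[OF that(2)]])
  define G where "G = (\<lambda>k l. if k < 4 \<and> l < (4::nat) then complex_of_real (g k l) else 0)"
  have Gs: "G k l = G l k" for k l unfolding G_def using gs by auto
  have FG: "seifert lam G k l * n l = n k * seifert lam (cartan \<alpha>) k l" if "k < 4" "l < 4" for k l
    using gn[OF that] that by (auto simp: seifert_def G_def mult.assoc mult.left_commute)
  have row: "(\<Sum>l<4. seifert lam G k l * (n l * w l)) = 0"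
    if k: "k < 4" and w: "(\<Sum>l<4. seifert lam (cartan \<alpha>) k l * w l) = 0" for k w
  proof -
    have "(\<Sum>l<4. seifert lam G k l * (n l * w l)) = (\<Sum>l<4. n k * (seifert lam (cartan \<alpha>) k l * w l))"
    proof (rule sum.cong[OF refl])
      fix l assume "l \<in> {..<4::nat}"
      then have "seifert lam G k l * n l = n k * seifert lam (cartan \<alpha>) k l" using FG k by simp
      then show "seifert lam G k l * (n l * w l) = n k * (seifert lam (cartan \<alpha>) k l * w l)"
        by (simp only: mult.assoc[symmetric])
    qed
    then show ?thesis using w by (simp add: sum_distrib_left[symmetric])
  qed
  have Im: "Im lam \<noteq> 0" using lam(2) by (auto simp: complex_eq_iff)
  define a b c d e f where "a = g 0 1" "b = g 0 2" "c = g 0 3" "d = g 1 2" "e = g 1 3" "f = g 2 3"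
  note abc = this
  have vals: "{a, b, c, d, e} \<subseteq> gram_values" unfolding abc using gv by simp
  have a3: "a * a \<noteq> 3" using vals by (intro gram_values_square) simp
  have GE: "G 0 1 = of_real a" "G 0 2 = of_real b" "G 0 3 = of_real c"
      "G 1 2 = of_real d" "G 1 3 = of_real e" "G 2 3 = of_real f"
    by (simp_all add: G_def abc)
  have GE': "G 1 0 = of_real a" "G 2 0 = of_real b" "G 3 0 = of_real c"
      "G 2 1 = of_real d" "G 3 1 = of_real e" "G 3 2 = of_real f"
    using GE Gs by metis+
  let ?z = "\<lambda>l. n l * y l" and ?z' = "\<lambda>l. n l * y' l"
  have ker: "(1 + lam) * w 0 + of_real a * w 1 + of_real b * w 2 + of_real c * w 3 = 0 \<and>
      lam * of_real a * w 0 + (1 + lam) * w 1 + of_real d * w 2 + of_real e * w 3 = 0 \<and>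
      lam * of_real b * w 0 + lam * of_real d * w 1 + (1 + lam) * w 2 + of_real f * w 3 = 0 \<and>
      lam * of_real c * w 0 + lam * of_real e * w 1 + lam * of_real f * w 2 + (1 + lam) * w 3 = 0"
    if w: "w = ?z \<or> w = ?z'" for w
  proof -
    have k: "(\<Sum>l<4. seifert lam G k l * w l) = 0" if "k < 4" for k
      using w row[OF that] y y' that by auto
    have "(\<Sum>l<4. seifert lam G 0 l * w l) = 0" "(\<Sum>l<4. seifert lam G 1 l * w l) = 0"
      "(\<Sum>l<4. seifert lam G 2 l * w l) = 0" "(\<Sum>l<4. seifert lam G 3 l * w l) = 0"
      by (rule k; simp)+
    then show ?thesis unfolding sum_less_4 seifert_def
      by (simp add: GE[simplified] GE'[simplified])
  qed
  have indz: "p = 0 \<and> q = 0" if pq: "\<forall>l<4. p * ?z l + q * ?z' l = 0" for p q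
  proof -
    have "p * y l + q * y' l = 0" if "l < 4" for l
    proof -
      have "n l * (p * y l + q * y' l) = 0" using pq that by (simp add: algebra_simps)
      then show ?thesis using n0 by simp
    qed
    then show ?thesis using ind by blast
  qed
  note eqs = gram_equations[OF lam(1) Im a3 ker indz]
  have orb: "gram_orbit a b c d e f" by (rule gram_solutions[OF vals eqs])
  have nondeg: "(1 + lam) * (1 + lam) - lam * cartan \<alpha> 0 1 * cartan \<alpha> 1 0 \<noteq> 0"
  proof -
    have "n 1 * (n 0 * (cartan \<alpha> 0 1 * cartan \<alpha> 1 0)) = (n 0 * cartan \<alpha> 0 1) * (n 1 * cartan \<alpha> 1 0)"
      by (simp add: mult_ac)
    also have "\<dots> = (of_real (g 0 1) * n 1) * (of_real (g 1 0) * n 0)"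
      using gn[of 0 1] gn[of 1 0] by simp
    also have "\<dots> = n 1 * (n 0 * of_real (a * a))" using gs[of 0 1] by (simp add: abc)
    finally have "cartan \<alpha> 0 1 * cartan \<alpha> 1 0 = of_real (a * a)" using n0 by simp
    then have "(1 + lam) * (1 + lam) - lam * cartan \<alpha> 0 1 * cartan \<alpha> 1 0 = lam * of_real (3 - a * a) + (lam * lam - (lam - 1))"
      by (simp add: algebra_simps)
    moreover have "lam * complex_of_real (3 - a * a) \<noteq> 0"
    proof -
      have "lam \<noteq> 0" using Im by auto
      moreover have "3 - a * a \<noteq> 0" using a3 by simp
      ultimately show ?thesis by (simp only: mult_eq_0_iff of_real_eq_0_iff) simp
    qed
    ultimately show ?thesis using lam(1) by simp
  qed
  obtain x where x: "\<forall>k<4. \<forall>l<4. seifert lam (cartan \<alpha>) k l =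
      x k 0 * seifert lam (cartan \<alpha>) 0 l + x k (1::nat) * seifert lam (cartan \<alpha>) 1 l"
  proof (rule rank_two_rows[of "seifert lam (cartan \<alpha>)" y y'])
    show "seifert lam (cartan \<alpha>) 0 0 * seifert lam (cartan \<alpha>) 1 1 - seifert lam (cartan \<alpha>) 0 1 * seifert lam (cartan \<alpha>) 1 0 \<noteq> 0"
      using nondeg by (simp add: seifert_def mult_ac)
  qed (use y y' ind in blast)+
  interpret root_tuple \<alpha> lam x
    by unfold_locales (use rt lam(1) x nondeg in blast)+
  have "realizes lam (gram6 a b c d e f) Ns" if "induced_tuple 4 lam As Ns" for Ns
  proof (rule realizes_gram6I[OF _ Gs GE])
    show "realizes lam G Ns"
      by (rule induced_realizes[of Ns n]) (use that As n0 gn in \<open>auto simp: G_def\<close>)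
  qed
  moreover have "\<exists>Ns. induced_tuple 4 lam As Ns" using induced_exists As by simp
  ultimately show thesis using that lam(1) orb by blast
qed

lemma induced_tuples_MCG_finite:
  assumes "length As = 4" "nice_tuple 4 G28 As" "nice_eigenvalue 4 As lam" and ind: "induced_tuple 4 lam As Ns"
  shows "lam * lam = lam - 1" "tuple_equivalent Ns (base_tuple lam)" "MCG_finite Ns"
proof -
  obtain a b c d e f where lam: "lam * lam = lam - 1" and orb: "gram_orbit a b c d e f"
    and re: "\<forall>Ns. induced_tuple 4 lam As Ns \<longrightarrow> realizes lam (gram6 a b c d e f) Ns"
    using nice_4_tuple_realizes[OF assms(1-3)] by metis
  show "lam * lam = lam - 1" by (rule lam)
  have lam0: "lam \<noteq> 0" using lam by auto
  have r: "realizes lam (gram6 a b c d e f) Ns" using re ind by blast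
  show e: "tuple_equivalent Ns (base_tuple lam)"
    by (rule gram_orbit_equivalent[OF orb r lam lam0 base_tuple_realizes[OF lam lam0]])
  show "MCG_finite Ns"
  proof (rule finite_type_MCG_finite)
    show "finite_type Ns" by (rule finite_type_equivalent[OF tuple_equivalent_sym[OF e] base_tuple_finite_type[OF lam]])
    show "tuple_prod 2 Ns = 1\<^sub>m 2" using r by (simp add: realizes_def)
  qed
qed

text \<open>The two roots of the quadratic equation are inverse to each other, and dualizing passes
  from one to the other.\<close>

lemma base_tuple_equivalent:
  assumes lam: "lam * lam = lam - 1" and mu: "mu * mu = mu - 1"
  shows "tuple_equivalent (base_tuple lam) (base_tuple mu)"
proof -
  have lam0: "lam \<noteq> 0" and mu0: "mu \<noteq> 0" using lam mu by auto
  have "(mu - lam) * (mu - (1 - lam)) = (mu * mu - (mu - 1)) - (lam * lam - (lam - 1))" by (simp add: algebra_simps)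
  then have "mu = lam \<or> mu = 1 - lam" using lam mu by simp
  moreover have "1 - lam = 1 / lam" using lam lam0 by (simp add: field_simps)
  ultimately consider "mu = lam" | "mu = 1 / lam" by auto
  then show ?thesis
  proof cases
    case 1
    then show ?thesis by (simp add: tuple_equivalent_def)
  next
    case 2
    obtain Ns' where c: "(base_tuple lam, Ns') \<in> simult_conj" and re: "realizes (1 / lam) (gram6 1 (sqrt 2) 0 0 (sqrt 2) (-1)) Ns'"
      using realizes_dual[OF base_tuple_realizes[OF lam lam0] lam0 gram6_sym] by metis
    have "tuple_equivalent (base_tuple lam) Ns'" using c by (auto simp: tuple_equivalent_def)
    moreover have "tuple_equivalent Ns' (base_tuple mu)"
      by (rule gram_orbit_equivalent[OF gram_orbit.base re[folded 2] mu mu0 base_tuple_realizes[OF mu mu0]])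
    ultimately show ?thesis by (rule tuple_equivalent_trans)
  qed
qed

section \<open>A nice tuple\<close>

lemma root_reflection_selfadjoint:
  assumes "\<alpha> \<in> carrier_vec 4" "v \<in> carrier_vec 4" "w \<in> carrier_vec 4"
  shows "(root_reflection \<alpha> *\<^sub>v v) \<bullet> w = v \<bullet> (root_reflection \<alpha> *\<^sub>v w)"
proof -
  have c: "coroot \<alpha> \<bullet> u = 2 / (\<alpha> \<bullet> \<alpha>) * (\<alpha> \<bullet> u)" if "u \<in> carrier_vec 4" for u
    using assms that by (simp add: coroot_def)
  have "(root_reflection \<alpha> *\<^sub>v v) \<bullet> w = v \<bullet> w - (coroot \<alpha> \<bullet> v) * (\<alpha> \<bullet> w)"
    using assms by (simp add: root_reflection_mult_vec minus_scalar_prod_distrib[of _ 4])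
  moreover have "v \<bullet> (root_reflection \<alpha> *\<^sub>v w) = v \<bullet> w - (coroot \<alpha> \<bullet> w) * (v \<bullet> \<alpha>)"
    using assms by (simp add: root_reflection_mult_vec scalar_prod_minus_distrib[of _ 4])
  moreover have "v \<bullet> \<alpha> = \<alpha> \<bullet> v" using assms by (intro comm_scalar_prod)
  ultimately show ?thesis using c assms by simp
qed

lemma root_reflection_conj:
  assumes a: "\<alpha> \<in> carrier_vec 4" "\<alpha> \<bullet> \<alpha> \<noteq> 0" and b: "\<beta> \<in> carrier_vec 4"
  shows "root_reflection \<alpha> * root_reflection \<beta> * root_reflection \<alpha> = root_reflection (root_reflection \<alpha> *\<^sub>v \<beta>)"
proof (rule mat_eq_vecI[of _ 4 4])
  let ?s = "root_reflection \<alpha>" and ?t = "root_reflection \<beta>"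
  note cs = root_reflection_carrier
  show "?s * ?t * ?s \<in> carrier_mat 4 4" using mult_carrier_mat[OF mult_carrier_mat[OF cs cs] cs] .
  fix v :: "complex vec" assume v: "v \<in> carrier_vec 4"
  have sc: "?s *\<^sub>v u \<in> carrier_vec 4" for u :: "complex vec" by (rule carrier_vecI) (simp add: root_reflection_def)
  have inv: "?s *\<^sub>v (?s *\<^sub>v u) = u" if "u \<in> carrier_vec 4" for u
    using assoc_mult_mat_vec[OF cs cs that, of \<alpha> \<alpha>] root_reflection_involution[OF a] that by simp
  have "?s * ?t * ?s *\<^sub>v v = ?s *\<^sub>v (?t *\<^sub>v (?s *\<^sub>v v))"
    unfolding assoc_mult_mat_vec[OF mult_carrier_mat[OF cs cs] cs v] by (rule assoc_mult_mat_vec[OF cs cs sc])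
  also have "\<dots> = ?s *\<^sub>v (?s *\<^sub>v v - (coroot \<beta> \<bullet> (?s *\<^sub>v v)) \<cdot>\<^sub>v \<beta>)"
    unfolding root_reflection_mult_vec[OF b sc] ..
  also have "\<dots> = v - (coroot \<beta> \<bullet> (?s *\<^sub>v v)) \<cdot>\<^sub>v (?s *\<^sub>v \<beta>)"
    using b sc inv[OF v] by (simp add: mult_minus_distrib_mat_vec[OF cs] mult_mat_vec[OF cs])
  also have "coroot \<beta> \<bullet> (?s *\<^sub>v v) = coroot (?s *\<^sub>v \<beta>) \<bullet> v"
  proof -
    have "(?s *\<^sub>v \<beta>) \<bullet> (?s *\<^sub>v \<beta>) = \<beta> \<bullet> \<beta>"
      unfolding root_reflection_selfadjoint[OF a(1) b sc] inv[OF b] ..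
    then show ?thesis
      using root_reflection_selfadjoint[OF a(1) b v] b v sc
      by (simp add: coroot_def smult_scalar_prod_distrib[OF sc v])
  qed
  also have "v - (coroot (?s *\<^sub>v \<beta>) \<bullet> v) \<cdot>\<^sub>v (?s *\<^sub>v \<beta>) = root_reflection (?s *\<^sub>v \<beta>) *\<^sub>v v"
    by (rule root_reflection_mult_vec[OF sc v, symmetric])
  finally show "?s * ?t * ?s *\<^sub>v v = root_reflection (?s *\<^sub>v \<beta>) *\<^sub>v v" .
qed (rule root_reflection_carrier)

lemma eigenvalue_quadratic:
  assumes A: "A \<in> carrier_mat n n" and ev: "eigenvalue A x"
    and quad: "\<And>v. v \<in> carrier_vec n \<Longrightarrow> A *\<^sub>v (A *\<^sub>v v) = p \<cdot>\<^sub>v (A *\<^sub>v v) + q \<cdot>\<^sub>v v"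
  shows "x * x = p * x + (q :: complex)"
proof -
  obtain v where v: "v \<in> carrier_vec n" "v \<noteq> 0\<^sub>v n" "A *\<^sub>v v = x \<cdot>\<^sub>v v"
    using ev A unfolding eigenvalue_def eigenvector_def by auto
  obtain i where i: "i < n" "v $ i \<noteq> 0" using v(1,2) by (rule nonzero_vec_index)
  have "A *\<^sub>v (A *\<^sub>v v) = x \<cdot>\<^sub>v (x \<cdot>\<^sub>v v)" unfolding v(3) mult_mat_vec[OF A v(1)] ..
  then have "(x \<cdot>\<^sub>v (x \<cdot>\<^sub>v v)) $ i = (p \<cdot>\<^sub>v (x \<cdot>\<^sub>v v) + q \<cdot>\<^sub>v v) $ i" using quad[OF v(1)] v(3) by simp
  then have "(x * x) * v $ i = (p * x + q) * v $ i" using i v(1) by (simp add: algebra_simps)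
  then show ?thesis using i by simp
qed

text \<open>The eigenvalues of an involution are 1 and -1, and trace 2 in dimension four leaves
  exactly one eigenvalue -1.\<close>

lemma reflection_root_reflection:
  assumes a: "\<alpha> \<in> F4_roots"
  shows "reflection 4 (root_reflection \<alpha>)"
proof -
  let ?A = "root_reflection \<alpha>"
  note ac = F4_root_carrier[OF a] and a0 = F4_root_nonzero[OF a]
  have A: "?A \<in> carrier_mat 4 4" by (rule root_reflection_carrier)
  have AA: "?A * ?A = 1\<^sub>m 4" by (rule root_reflection_involution[OF ac a0])
  have pow: "?A ^\<^sub>m 2 = 1\<^sub>m 4" using AA A by (simp add: numeral_2_eq_2)
  obtain P R d where P: "P \<in> carrier_mat 4 4" "R \<in> carrier_mat 4 4" and RP: "R * P = 1\<^sub>m 4"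
    and AP: "?A = P * mat_diag 4 d * R" and cp: "char_poly ?A = (\<Prod>i<4. [:- d i, 1:])"
    using finite_order_diagonalizable[OF A zero_less_numeral pow] by metis
  have ev1: "x = 1 \<or> x = -1" if "eigenvalue ?A x" for x
  proof -
    have "?A *\<^sub>v (?A *\<^sub>v v) = 0 \<cdot>\<^sub>v (?A *\<^sub>v v) + 1 \<cdot>\<^sub>v v" if v: "v \<in> carrier_vec 4" for v
    proof -
      have "?A *\<^sub>v (?A *\<^sub>v v) = v" using assoc_mult_mat_vec[OF A A v] v unfolding AA by simp
      then show ?thesis using v A by (intro eq_vecI) auto
    qed
    then have "x * x = 0 * x + 1" by (rule eigenvalue_quadratic[OF A that])
    then show ?thesis by (simp add: square_eq_1_iff)
  qed
  have d: "d i = 1 \<or> d i = -1" if "i < 4" for i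
    by (rule ev1, rule eigenvalue_of_linear_factors[OF A cp that])
  have "(\<Sum>i<4. ?A $$ (i,i)) = (\<Sum>i<4. \<Sum>l<4. P $$ (i,l) * d l * R $$ (l,i))"
    unfolding AP using P by (intro sum.cong refl mat_diag_sandwich_index) auto
  also have "\<dots> = (\<Sum>l<4. \<Sum>i<4. P $$ (i,l) * d l * R $$ (l,i))" by (rule sum.swap)
  also have "\<dots> = (\<Sum>l<4. d l * (R * P) $$ (l,l))"
    using P by (intro sum.cong refl) (simp add: scalar_prod_def atLeast0LessThan sum_distrib_left mult_ac)
  also have "\<dots> = (\<Sum>l<4. d l)" unfolding RP by simp
  also have "\<dots> = (\<Sum>l<4. 1 - 2 * (if d l = -1 then 1 else 0))"
    using d by (intro sum.cong) auto
  also have "\<dots> = 4 - 2 * of_nat (card {i. i < 4 \<and> d i = -1})"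
    by (simp add: sum_subtractf sum.If_cases Int_def flip: sum_distrib_left)
  finally have tr: "(\<Sum>i<4. ?A $$ (i,i)) = 4 - 2 * of_nat (card {i. i < 4 \<and> d i = -1})" .
  have "(\<Sum>i<4. ?A $$ (i,i)) = (\<Sum>i<4. 1 - 2 / (\<alpha> \<bullet> \<alpha>) * (\<alpha> $ i * \<alpha> $ i))"
    by (intro sum.cong refl) (simp add: root_reflection_def)
  also have "\<dots> = 4 - 2 / (\<alpha> \<bullet> \<alpha>) * (\<Sum>i<4. \<alpha> $ i * \<alpha> $ i)"
    by (simp add: sum_subtractf sum_distrib_left)
  also have "(\<Sum>i<4. \<alpha> $ i * \<alpha> $ i) = \<alpha> \<bullet> \<alpha>"
    using carrier_vecD[OF ac] by (simp add: scalar_prod_def atLeast0LessThan)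
  finally have "(\<Sum>i<4. ?A $$ (i,i)) = 2" using a0 by simp
  then have "of_nat (card {i. i < 4 \<and> d i = -1}) = (of_nat 1 :: complex)" using tr by simp
  then have c1: "card {i. i < 4 \<and> d i = -1} = 1" unfolding of_nat_eq_iff .
  have ord: "Polynomial.order (-1) (char_poly ?A) = 1" unfolding cp order_prod_linear c1 ..
  have "{i. i < 4 \<and> d i = -1} \<noteq> {}" using c1 by (metis card.empty zero_neq_one)
  then obtain i where "i < 4" "d i = -1" by blast
  then have "eigenvalue ?A (-1)" using eigenvalue_of_linear_factors[OF A cp, of i] by simp
  then have "{\<nu>. eigenvalue ?A \<nu> \<and> \<nu> \<noteq> 1} = {-1}" using ev1 by auto
  moreover have "?A \<in> carrier (GL 4)" by (rule GL_I[OF A A AA])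
  moreover have "\<exists>k>0. ?A ^\<^sub>m k = 1\<^sub>m 4" using pow by (intro exI[of _ 2]) simp
  ultimately show ?thesis unfolding reflection_def using ord by blast
qed

text \<open>The normalized Gram matrix of these roots is the one in the rule \<open>base\<close> of
  \<open>gram_orbit\<close>.\<close>

definition nice_roots :: "complex vec list" where
  "nice_roots = [vec_of_list [1,1,0,0], vec_of_list [0,1,1,0], vec_of_list [1,0,0,0], vec_of_list [-1/2,1/2,1/2,1/2]]"

lemma nice_roots_F4: "set nice_roots \<subseteq> F4_roots"
proof -
  have "vec_of_list [1,1,0,0] \<in> F4_roots"
    by (rule F4_rootsI[OF vec_of_list_4(1)], rule disjI2, rule disjI2, rule exI[of _ 0], rule conjI, simp,
        rule exI[of _ 1], unfold all_less_4 vec_of_list_4, simp)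
  moreover have "vec_of_list [0,1,1,0] \<in> F4_roots"
    by (rule F4_rootsI[OF vec_of_list_4(1)], rule disjI2, rule disjI2, rule exI[of _ 1], rule conjI, simp,
        rule exI[of _ 2], unfold all_less_4 vec_of_list_4, simp)
  moreover have "vec_of_list [1,0,0,0] \<in> F4_roots"
    by (rule F4_rootsI[OF vec_of_list_4(1)], rule disjI2, rule disjI1, rule exI[of _ 0],
        unfold all_less_4 vec_of_list_4, simp)
  moreover have "vec_of_list [-1/2,1/2,1/2,1/2] \<in> F4_roots"
    unfolding F4_roots_def by (rule UnI2) blast
  ultimately show ?thesis by (simp add: nice_roots_def)
qed

text \<open>The caller supplies the pairing \<open>t\<close> with the coroot, which keeps explicit
  computations free of divisions by the squared length.\<close>

lemma root_reflection_4:
  fixes a b c d x y z w :: complex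
  assumes "2 * (a * x + b * y + c * z + d * w) = t * (a * a + b * b + c * c + d * d)"
    and "a * a + b * b + c * c + d * d \<noteq> 0"
  shows "root_reflection (vec_of_list [a,b,c,d]) *\<^sub>v vec_of_list [x,y,z,w] =
    vec_of_list [x - t * a, y - t * b, z - t * c, w - t * d]"
proof -
  let ?a = "vec_of_list [a,b,c,d]" and ?v = "vec_of_list [x,y,z,w]"
  note ca = vec_of_list_4(1)[of a b c d] and cv = vec_of_list_4(1)[of x y z w]
  have "coroot ?a \<bullet> ?v = 2 * (a * x + b * y + c * z + d * w) / (a * a + b * b + c * c + d * d)"
    unfolding coroot_def smult_scalar_prod_distrib[OF ca cv] scalar_prod_4[OF ca cv] scalar_prod_4[OF ca ca] vec_of_list_4
    by simp
  then have t: "coroot ?a \<bullet> ?v = t" using assms by simp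
  show ?thesis
    unfolding root_reflection_mult_vec[OF ca cv] t
  proof (rule vec_of_list_4_eqI)
    have "t \<cdot>\<^sub>v ?a \<in> carrier_vec 4" unfolding smult_carrier_vec by (rule ca)
    then show "?v - t \<cdot>\<^sub>v ?a \<in> carrier_vec 4" by (rule minus_carrier_vec[OF cv])
    have i: "(?v - t \<cdot>\<^sub>v ?a) $ i = ?v $ i - t * ?a $ i" if "i < 4" for i
      using that carrier_vecD[OF ca] by (simp only: index_minus_vec index_smult_vec)
    have i4: "0 < (4::nat)" "1 < (4::nat)" "2 < (4::nat)" "3 < (4::nat)" by simp_all
    show "(?v - t \<cdot>\<^sub>v ?a) $ 0 = x - t * a" "(?v - t \<cdot>\<^sub>v ?a) $ 1 = y - t * b"
      "(?v - t \<cdot>\<^sub>v ?a) $ 2 = z - t * c" "(?v - t \<cdot>\<^sub>v ?a) $ 3 = w - t * d"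
      unfolding i[OF i4(1)] i[OF i4(2)] i[OF i4(3)] i[OF i4(4)] vec_of_list_4 by (rule HOL.refl)+
  qed
qed

text \<open>Conjugating one reflection by another reflects its root, so the roots whose reflections
  are generated are closed under reflecting in each other. From the four given roots every root is
  reached.\<close>

lemma nice_roots_generate: "generate (GL 4) (root_reflection ` set nice_roots) = G28"
proof
  interpret group "GL 4" by (rule GL_group)
  let ?S = "generate (GL 4) (root_reflection ` set nice_roots)"
  show "?S \<subseteq> G28"
    unfolding G28_def using nice_roots_F4 by (intro mono_generate image_mono)
  define P where "P = (\<lambda>a b c d. root_reflection (vec_of_list [a,b,c,d]) \<in> ?S)"
  have step: "P a'' b'' c'' d''"
    if P: "P a b c d" "P a' b' c' d'" and n: "a * a + b * b + c * c + d * d \<noteq> 0"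
      and t: "2 * (a * a' + b * b' + c * c' + d * d') = t * (a * a + b * b + c * c + d * d)"
      and e: "a'' = a' - t * a" "b'' = b' - t * b" "c'' = c' - t * c" "d'' = d' - t * d"
    for a b c d a' b' c' d' a'' b'' c'' d'' t
  proof -
    let ?a = "vec_of_list [a,b,c,d]" and ?b = "vec_of_list [a',b',c',d']"
    have "?a \<bullet> ?a \<noteq> 0" using n unfolding scalar_prod_4[OF vec_of_list_4(1) vec_of_list_4(1)] vec_of_list_4 .
    then have "root_reflection (vec_of_list [a'',b'',c'',d'']) = root_reflection ?a * root_reflection ?b * root_reflection ?a"
      unfolding e root_reflection_4[OF t n, symmetric] by (intro root_reflection_conj[symmetric] vec_of_list_4(1))
    moreover have "root_reflection ?a * root_reflection ?b * root_reflection ?a \<in> ?S"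
      using generate.eng[OF generate.eng[OF P[unfolded P_def]] P(1)[unfolded P_def]] by (simp add: GL_simps)
    ultimately show ?thesis by (simp add: P_def)
  qed
  have r0: "P 1 1 0 0" and r1: "P 0 1 1 0" and r2: "P 1 0 0 0" and r3: "P (-1/2) (1/2) (1/2) (1/2)"
    unfolding P_def by (intro generate.incl imageI; simp add: nice_roots_def)+
  \<comment> \<open>Up to \<open>r23\<close> this produces one root from each of the 24 pairs of
    opposite roots; \<open>t\<close> is the pairing of the second root with the coroot of the
    first.\<close>
  have r4: "P (-1) 0 1 0" by (rule step[OF r0 r1, where t = "1"]) simp_all
  have r5: "P 0 (-1) 0 0" by (rule step[OF r0 r2, where t = "1"]) simp_all
  have r6: "P (-1/2) (-1/2) (-1/2) (1/2)" by (rule step[OF r1 r3, where t = "1"]) simp_all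
  have r7: "P 0 0 1 0" by (rule step[OF r1 r5, where t = "-1"]) simp_all
  have r8: "P (-1) 1 0 0" by (rule step[OF r2 r0, where t = "2"]) simp_all
  have r9: "P (1/2) (1/2) (1/2) (1/2)" by (rule step[OF r2 r3, where t = "-1"]) simp_all
  have r10: "P 1 0 1 0" by (rule step[OF r2 r4, where t = "-2"]) simp_all
  have r11: "P (1/2) (-1/2) (-1/2) (1/2)" by (rule step[OF r2 r6, where t = "-1"]) simp_all
  have r12: "P 1 0 0 (-1)" by (rule step[OF r3 r1, where t = "2"]) simp_all
  have r13: "P 0 (-1) 0 (-1)" by (rule step[OF r3 r4, where t = "2"]) simp_all
  have r14: "P (-1/2) (-1/2) (1/2) (1/2)" by (rule step[OF r3 r5, where t = "-1"]) simp_all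
  have r15: "P (1/2) (-1/2) (1/2) (-1/2)" by (rule step[OF r3 r7, where t = "1"]) simp_all
  have r16: "P 0 0 (-1) (-1)" by (rule step[OF r3 r8, where t = "2"]) simp_all
  have r17: "P 0 0 0 1" by (rule step[OF r3 r11, where t = "-1"]) simp_all
  have r18: "P (1/2) (1/2) (-1/2) (1/2)" by (rule step[OF r0 r6, where t = "-1"]) simp_all
  have r19: "P 0 (-1) 1 0" by (rule step[OF r0 r10, where t = "1"]) simp_all
  have r20: "P 0 0 1 (-1)" by (rule step[OF r1 r13, where t = "-1"]) simp_all
  have r21: "P 0 1 0 (-1)" by (rule step[OF r1 r16, where t = "-1"]) simp_all
  have r22: "P (-1) 0 0 (-1)" by (rule step[OF r2 r12, where t = "2"]) simp_all
  have r23: "P (1/2) (-1/2) (1/2) (1/2)" by (rule step[OF r2 r14, where t = "-1"]) simp_all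
  \<comment> \<open>Reflecting a root in itself gives its negative.\<close>
  have n0: "P (-1) (-1) 0 0" by (rule step[OF r0 r0, where t = "2"]) simp_all
  have n1: "P 0 (-1) (-1) 0" by (rule step[OF r1 r1, where t = "2"]) simp_all
  have n2: "P (-1) 0 0 0" by (rule step[OF r2 r2, where t = "2"]) simp_all
  have n3: "P (1/2) (-1/2) (-1/2) (-1/2)" by (rule step[OF r3 r3, where t = "2"]) simp_all
  have n4: "P 1 0 (-1) 0" by (rule step[OF r4 r4, where t = "2"]) simp_all
  have n5: "P 0 1 0 0" by (rule step[OF r5 r5, where t = "2"]) simp_all
  have n6: "P (1/2) (1/2) (1/2) (-1/2)" by (rule step[OF r6 r6, where t = "2"]) simp_all
  have n7: "P 0 0 (-1) 0" by (rule step[OF r7 r7, where t = "2"]) simp_all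
  have n8: "P 1 (-1) 0 0" by (rule step[OF r8 r8, where t = "2"]) simp_all
  have n9: "P (-1/2) (-1/2) (-1/2) (-1/2)" by (rule step[OF r9 r9, where t = "2"]) simp_all
  have n10: "P (-1) 0 (-1) 0" by (rule step[OF r10 r10, where t = "2"]) simp_all
  have n11: "P (-1/2) (1/2) (1/2) (-1/2)" by (rule step[OF r11 r11, where t = "2"]) simp_all
  have n12: "P (-1) 0 0 1" by (rule step[OF r12 r12, where t = "2"]) simp_all
  have n13: "P 0 1 0 1" by (rule step[OF r13 r13, where t = "2"]) simp_all
  have n14: "P (1/2) (1/2) (-1/2) (-1/2)" by (rule step[OF r14 r14, where t = "2"]) simp_all
  have n15: "P (-1/2) (1/2) (-1/2) (1/2)" by (rule step[OF r15 r15, where t = "2"]) simp_all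
  have n16: "P 0 0 1 1" by (rule step[OF r16 r16, where t = "2"]) simp_all
  have n17: "P 0 0 0 (-1)" by (rule step[OF r17 r17, where t = "2"]) simp_all
  have n18: "P (-1/2) (-1/2) (1/2) (-1/2)" by (rule step[OF r18 r18, where t = "2"]) simp_all
  have n19: "P 0 1 (-1) 0" by (rule step[OF r19 r19, where t = "2"]) simp_all
  have n20: "P 0 0 (-1) 1" by (rule step[OF r20 r20, where t = "2"]) simp_all
  have n21: "P 0 (-1) 0 1" by (rule step[OF r21 r21, where t = "2"]) simp_all
  have n22: "P 1 0 0 1" by (rule step[OF r22 r22, where t = "2"]) simp_all
  have n23: "P (-1/2) (1/2) (-1/2) (-1/2)" by (rule step[OF r23 r23, where t = "2"]) simp_all
  note all_roots = r0 r1 r2 r3 r4 r5 r6 r7 r8 r9 r10 r11 r12 r13 r14 r15 r16 r17 r18 r19 r20 r21 r22 r23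
    n0 n1 n2 n3 n4 n5 n6 n7 n8 n9 n10 n11 n12 n13 n14 n15 n16 n17 n18 n19 n20 n21 n22 n23
  have "root_reflection \<alpha> \<in> ?S" if "\<alpha> \<in> F4_roots" for \<alpha>
  proof -
    have "\<alpha> = vec_of_list [\<alpha> $ 0, \<alpha> $ 1, \<alpha> $ 2, \<alpha> $ 3]"
      by (rule vec_of_list_4_eqI[OF F4_root_carrier[OF that]]) (rule refl)+
    moreover have "P (\<alpha> $ 0) (\<alpha> $ 1) (\<alpha> $ 2) (\<alpha> $ 3)"
      using that
    proof (cases rule: F4_rootsE)
      case (axis s i)
      have "s = 1 \<or> s = -1" using axis(1) by simp
      then show ?thesis using less_4_cases[OF axis(2)] unfolding axis(3)
        by (elim disjE; hypsubst; simp add: all_roots)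
    next
      case (long s t i j)
      have st: "s = 1 \<or> s = -1" "t = 1 \<or> t = -1" using long by simp_all
      have "i = 0 \<and> j = 1 \<or> i = 0 \<and> j = 2 \<or> i = 0 \<and> j = 3 \<or> i = 1 \<and> j = 2 \<or> i = 1 \<and> j = 3 \<or> i = 2 \<and> j = 3"
        using long(3,4) by auto
      then show ?thesis using st unfolding long(5)
        by (elim disjE conjE; hypsubst; simp add: all_roots all_roots[simplified])
    next
      case (half a b c d)
      have "a = 1/2 \<or> a = -1/2" "b = 1/2 \<or> b = -1/2" "c = 1/2 \<or> c = -1/2" "d = 1/2 \<or> d = -1/2"
        using half(1) by auto
      then show ?thesis unfolding half(2) vec_of_list_4
        by (elim disjE; hypsubst; intro all_roots)
    qed
    ultimately show ?thesis unfolding P_def by simp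
  qed
  moreover have "root_reflection ` set nice_roots \<subseteq> carrier (GL 4)"
    using nice_roots_F4 G28_sub_GL(1) generate.incl[of _ "root_reflection ` F4_roots" "GL 4"] unfolding G28_def by blast
  ultimately show "G28 \<subseteq> ?S" unfolding G28_def by (intro generate_subgroup_incl generate_is_subgroup) auto
qed

text \<open>The product \<open>A\<close> of the four reflections satisfies
  \<open>A^2 = A - 1\<close>, and so does its inverse. All eigenvalues are therefore primitive sixth
  roots of unity, and conjugation symmetry makes each of the two occur twice.\<close>

lemma nice_4_tuple_exists: "\<exists>As. length As = 4 \<and> nice_tuple 4 G28 As"
proof (intro exI conjI)
  let ?As = "map root_reflection nice_roots"
  show len: "length ?As = 4" by (simp add: nice_roots_def)
  have G: "root_reflection \<alpha> \<in> G28" if "\<alpha> \<in> F4_roots" for \<alpha>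
    using that unfolding G28_def by (intro generate.incl imageI)
  have As_refl: "\<forall>A\<in>set ?As. A \<in> G28 \<and> reflection 4 A"
    using nice_roots_F4 G reflection_root_reflection by auto
  define A where "A = tuple_prod 4 ?As"
  have AG: "A \<in> G28" unfolding A_def using As_refl by (intro tuple_prod_G28) auto
  have A: "A \<in> carrier_mat 4 4" using G28_props(1)[OF AG] .
  have Av: "A *\<^sub>v vec_of_list [x,y,z,w] = vec_of_list [(x-y+z-w)/2, (x+y+z+w)/2, -(x+y-z-w)/2, (x-y-z+w)/2]"
    for x y z w
  proof -
    let ?t = "- x + y + z + w"
    note cs = root_reflection_carrier
    have "A *\<^sub>v vec_of_list [x,y,z,w] = root_reflection (vec_of_list [1,1,0,0]) *\<^sub>v (root_reflection (vec_of_list [0,1,1,0]) *\<^sub>v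
      (root_reflection (vec_of_list [1,0,0,0]) *\<^sub>v (root_reflection (vec_of_list [-1/2,1/2,1/2,1/2]) *\<^sub>v vec_of_list [x,y,z,w])))"
      unfolding A_def nice_roots_def list.map tuple_prod_Cons tuple_prod_Nil right_mult_one_mat[OF cs]
      by (simp only: assoc_mult_mat_vec[OF cs mult_carrier_mat[OF cs mult_carrier_mat[OF cs cs]] vec_of_list_4(1)]
          assoc_mult_mat_vec[OF cs mult_carrier_mat[OF cs cs] vec_of_list_4(1)] assoc_mult_mat_vec[OF cs cs vec_of_list_4(1)])
    also have "root_reflection (vec_of_list [-1/2,1/2,1/2,1/2]) *\<^sub>v vec_of_list [x,y,z,w] =
        vec_of_list [x - ?t * (-1/2), y - ?t * (1/2), z - ?t * (1/2), w - ?t * (1/2)]"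
      by (rule root_reflection_4) (simp_all add: field_simps)
    also have "root_reflection (vec_of_list [1,0,0,0]) *\<^sub>v \<dots> =
        vec_of_list [x - ?t * (-1/2) - 2 * (x - ?t * (-1/2)) * 1, y - ?t * (1/2) - 2 * (x - ?t * (-1/2)) * 0,
          z - ?t * (1/2) - 2 * (x - ?t * (-1/2)) * 0, w - ?t * (1/2) - 2 * (x - ?t * (-1/2)) * 0]"
      by (rule root_reflection_4) (simp_all add: field_simps)
    also have "\<dots> = vec_of_list [-(x+y+z+w)/2, (x+y-z-w)/2, (x-y+z-w)/2, (x-y-z+w)/2]"
      by (simp add: field_simps)
    also have "root_reflection (vec_of_list [0,1,1,0]) *\<^sub>v \<dots> =
        vec_of_list [-(x+y+z+w)/2 - (x-w) * 0, (x+y-z-w)/2 - (x-w) * 1, (x-y+z-w)/2 - (x-w) * 1, (x-y-z+w)/2 - (x-w) * 0]"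
      by (rule root_reflection_4) (simp_all add: field_simps)
    also have "\<dots> = vec_of_list [-(x+y+z+w)/2, -(x-y+z-w)/2, -(x+y-z-w)/2, (x-y-z+w)/2]"
      by (simp add: field_simps)
    also have "root_reflection (vec_of_list [1,1,0,0]) *\<^sub>v \<dots> =
        vec_of_list [-(x+y+z+w)/2 - (-(x+z)) * 1, -(x-y+z-w)/2 - (-(x+z)) * 1, -(x+y-z-w)/2 - (-(x+z)) * 0, (x-y-z+w)/2 - (-(x+z)) * 0]"
      by (rule root_reflection_4) (simp_all add: field_simps)
    also have "\<dots> = vec_of_list [(x-y+z-w)/2, (x+y+z+w)/2, -(x+y-z-w)/2, (x-y-z+w)/2]"
      by (simp add: field_simps)
    finally show ?thesis .
  qed
  have vl: "\<exists>x y z w. v = vec_of_list [x,y,z,w]" if "v \<in> carrier_vec 4" for v :: "complex vec"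
    using vec_of_list_4_eqI[OF that HOL.refl HOL.refl HOL.refl HOL.refl] by blast
  have AAv: "A *\<^sub>v (A *\<^sub>v v) = A *\<^sub>v v - v" if v: "v \<in> carrier_vec 4" for v
  proof -
    obtain x y z w where xyzw: "v = vec_of_list [x,y,z,w]" using vl[OF v] by blast
    show ?thesis unfolding xyzw Av
      by (rule vec_of_list_4_eqI[symmetric]) (simp_all add: vec_of_list_4 vec_of_list_4[simplified] field_simps)
  qed
  define h where "h = inv_prod 4 ?As"
  have hG: "h \<in> G28" unfolding h_def using As_refl by (intro inv_prod_G28) auto
  have h: "h \<in> carrier_mat 4 4" using G28_props(1)[OF hG] .
  have "A \<in> carrier (GL 4)" using AG G28_sub_GL by blast
  note D = GL_D[OF this]
  have hA: "h * A = 1\<^sub>m 4" using D(4) by (simp add: h_def inv_prod_def A_def)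
  have hv: "h *\<^sub>v (h *\<^sub>v v) = h *\<^sub>v v - v" if v: "v \<in> carrier_vec 4" for v
  proof -
    have inv: "h *\<^sub>v (A *\<^sub>v u) = u" if "u \<in> carrier_vec 4" for u
      using assoc_mult_mat_vec[OF h A that] hA that by simp
    have Av: "A *\<^sub>v v \<in> carrier_vec 4" by (rule mult_mat_vec_carrier[OF A v])
    have hv: "h *\<^sub>v v \<in> carrier_vec 4" by (rule mult_mat_vec_carrier[OF h v])
    have "A *\<^sub>v v = h *\<^sub>v (A *\<^sub>v (A *\<^sub>v v))" by (rule inv[OF Av, symmetric])
    also have "\<dots> = v - h *\<^sub>v v" unfolding AAv[OF v] mult_minus_distrib_mat_vec[OF h Av v] inv[OF v] ..
    finally have e: "A *\<^sub>v v = v - h *\<^sub>v v" .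
    have "v = h *\<^sub>v v - h *\<^sub>v (h *\<^sub>v v)" using inv[OF v] unfolding e mult_minus_distrib_mat_vec[OF h v hv] by simp
    then have "v $ i = (h *\<^sub>v v) $ i - (h *\<^sub>v (h *\<^sub>v v)) $ i" if "i < 4" for i
      using that h by (metis carrier_matD(1) dim_mult_mat_vec index_minus_vec(1))
    then show ?thesis using v h by (intro eq_vecI) (auto simp: algebra_simps)
  qed
  obtain P R d where cp: "char_poly h = (\<Prod>i<4. [:- d i, 1:])"
    and cnj: "\<forall>x. card {i. i < 4 \<and> d i = cnj x} = card {i. i < (4::nat) \<and> d i = x}"
    by (rule G28_spectrum[OF hG]) (rule that)
  \<comment> \<open>The primitive sixth root of unity with positive imaginary part.\<close>
  define lam where "lam = Complex (1/2) (sqrt 3 / 2)"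
  have lam: "lam * lam = lam - 1" "cnj lam = 1 - lam" "lam \<noteq> cnj lam" "lam \<noteq> 1"
    by (auto simp: lam_def complex_eq_iff)
  have d: "d i = lam \<or> d i = cnj lam" if "i < 4" for i
  proof -
    have "d i * d i = 1 * d i + (-1)"
    proof (rule eigenvalue_quadratic[OF h eigenvalue_of_linear_factors[OF h cp that]])
      show "h *\<^sub>v (h *\<^sub>v v) = 1 \<cdot>\<^sub>v (h *\<^sub>v v) + (-1) \<cdot>\<^sub>v v" if "v \<in> carrier_vec 4" for v
        unfolding hv[OF that] using that h by (intro eq_vecI) auto
    qed
    moreover have "(d i - lam) * (d i - (1 - lam)) = (d i * d i - (d i - 1)) - (lam * lam - (lam - 1))"
      by (simp add: algebra_simps)
    ultimately have "(d i - lam) * (d i - (1 - lam)) = 0" using lam(1) by simp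
    then show ?thesis unfolding lam(2) by simp
  qed
  have "card ({i. i < 4 \<and> d i = lam} \<union> {i. i < 4 \<and> d i = cnj lam}) = card {i. i < 4 \<and> d i = lam} + card {i. i < 4 \<and> d i = cnj lam}"
    using lam(3) by (intro card_Un_disjoint) auto
  moreover have "{i. i < 4 \<and> d i = lam} \<union> {i. i < 4 \<and> d i = cnj lam} = {..<4}" using d by auto
  ultimately have c2: "card {i. i < 4 \<and> d i = lam} = 2" using cnj by simp
  then have "{i. i < 4 \<and> d i = lam} \<noteq> {}" by (metis card.empty zero_neq_numeral)
  then obtain i where "i < 4" "d i = lam" by blast
  then have "eigenvalue h lam" using eigenvalue_of_linear_factors[OF h cp, of i] by simp
  moreover have "Polynomial.order lam (char_poly h) = 2" unfolding cp order_prod_linear c2 ..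
  ultimately have "nice_eigenvalue 4 ?As lam"
    unfolding nice_eigenvalue_def h_def[symmetric] using lam(4) len by simp
  then show "nice_tuple 4 G28 ?As"
    unfolding nice_tuple_def using As_refl nice_roots_generate by auto
qed

theorem theorem1p9:
  shows
    "(\<exists>As. length As = 4 \<and> nice_tuple 4 G28 As) \<and>
     (\<forall>As Bs. length As = 4 \<and> nice_tuple 4 G28 As \<and> length Bs = 4 \<and> nice_tuple 4 G28 Bs \<longrightarrow>
        type_equivalent 4 As Bs \<and> tuple_type 4 As = tuple_type 4 Bs) \<and>
     (\<forall>As lam. length As = 4 \<and> nice_tuple 4 G28 As \<and> nice_eigenvalue 4 As lam \<longrightarrow>
        (\<exists>Ns. induced_tuple 4 lam As Ns) \<and>
        (\<forall>Ns. induced_tuple 4 lam As Ns \<longrightarrow> MCG_finite Ns)) \<and>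
     (\<forall>As lam Ns As' lam' Ns'.
        length As = 4 \<and> nice_tuple 4 G28 As \<and> nice_eigenvalue 4 As lam \<and> induced_tuple 4 lam As Ns \<and>
        length As' = 4 \<and> nice_tuple 4 G28 As' \<and> nice_eigenvalue 4 As' lam' \<and> induced_tuple 4 lam' As' Ns' \<longrightarrow>
        tuple_equivalent Ns Ns') \<and>
     \<not> (\<exists>As. length As = 5 \<and> nice_tuple 4 G28 As)"
proof (intro conjI allI impI; (elim conjE)?)
  fix As Bs assume a: "length As = 4" "nice_tuple 4 G28 As" "length Bs = 4" "nice_tuple 4 G28 Bs"
  show "tuple_type 4 As = tuple_type 4 Bs" by (rule nice_4_tuple_types[OF a])
  then show "type_equivalent 4 As Bs" by (simp add: type_equivalent_def)
next
  fix As lam assume a: "length As = 4" "nice_tuple 4 G28 As" "nice_eigenvalue 4 As lam"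
  show "\<exists>Ns. induced_tuple 4 lam As Ns" by (rule nice_4_tuple_realizes[OF a])
  show "MCG_finite Ns" if "induced_tuple 4 lam As Ns" for Ns
    by (rule induced_tuples_MCG_finite(3)[OF a that])
next
  fix As lam Ns As' lam' Ns'
  assume a: "length As = 4" "nice_tuple 4 G28 As" "nice_eigenvalue 4 As lam" "induced_tuple 4 lam As Ns"
    and a': "length As' = 4" "nice_tuple 4 G28 As'" "nice_eigenvalue 4 As' lam'" "induced_tuple 4 lam' As' Ns'"
  note E = induced_tuples_MCG_finite[OF a] and E' = induced_tuples_MCG_finite[OF a']
  \<comment> \<open>Each induced tuple is led to the reference tuple of its own eigenvalue, and the
    two reference tuples are compared with each other.\<close>
  show "tuple_equivalent Ns Ns'"
    by (rule tuple_equivalent_trans[OF tuple_equivalent_trans[OF E(2) base_tuple_equivalent[OF E(1) E'(1)]]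
        tuple_equivalent_sym[OF E'(2)]])
qed (use nice_4_tuple_exists no_nice_5_tuple in blast)+

end
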